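(* Let $n\geq 2$, $0<p,q<\infty$ and $s\in\mathbb{R}$. Then the trace operator $$\mathbb{T}: f(x)\mapsto f(\bar{x},0),\qquad \bar{x}=(x_1,\dots,x_{n-1}),$$ is a trace-retraction from $W^{p,q,1\wedge q}_s(\mathbb{R}^n)$ to $W^{p,q}_s(\mathbb{R}^{n-1})$.
   Context: Notation: $a\wedge b=\min(a,b)$; $\langle k\rangle=(1+|k|^2)^{1/2}$; $\mathcal{S}$ denotes the Schwartz space and $\mathcal{S}'$ the tempered distributions; $\hat f(\xi)=\mathcal{F}f(\xi)=\int e^{-2\pi i x\cdot\xi}f(x)\,dx$. For $k\in\mathbb{Z}^n$ write $k=(\bar{k},k_n)$ with $\bar{k}=(k_1,\dots,k_{n-1})\in\mathbb{Z}^{n-1}$. Frequency-uniform decomposition: let $\eta:\mathbb{R}\to[0,1]$ be a smooth function with $\eta(\xi)=1$ for $|\xi|\le 1$ and $\eta(\xi)=0$ for $|\xi|\ge 2$. In dimension $d$, for $k\in\mathbb{Z}^d$ and $\xi\in\mathbb{R}^d$ put $\phi_{k_i}(\xi_i)=\eta(2(\xi_i-k_i))$, $$\varphi_k(\xi)=\frac{\phi_{k_1}(\xi_1)\cdots\phi_{k_d}(\xi_d)}{\sum_{m\in\mathbb{Z}^d}\phi_{m_1}(\xi_1)\cdots\phi_{m_d}(\xi_d)},\qquad \square_k f=\mathcal{F}^{-1}(\varphi_k\hat f).$$ Wiener amalgam spaces: for $0<p,q\le\infty$ and $s\in\mathbb{R}$, $W^{p,q}_s(\mathbb{R}^d)$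 is the space of all $f\in\mathcal{S}'(\mathbb{R}^d)$ with $$\|f\|_{W^{p,q}_s}=\Big\|\,\big\|\{\langle k\rangle^s\square_k f\}_{k\in\mathbb{Z}^d}\big\|_{\ell^q}\Big\|_{L^p(\mathbb{R}^d)}<\infty.$$ Anisotropic Wiener amalgam spaces: for $0<p,q,r\le\infty$ and $s\in\mathbb{R}$, $W^{p,q,r}_s(\mathbb{R}^n)$ is the space of all $f\in\mathcal{S}'(\mathbb{R}^n)$ with $$\|f\|_{W^{p,q,r}_s(\mathbb{R}^n)}=\Big\|\Big(\sum_{k_n\in\mathbb{Z}}\Big(\sum_{\bar{k}\in\mathbb{Z}^{n-1}}\langle\bar{k}\rangle^{sq}|\square_k f|^q\Big)^{r/q}\Big)^{1/r}\Big\|_{L^p(\mathbb{R}^n)}<\infty$$ (usual modification with suprema if $q$ or $r$ is $\infty$). The Schwartz space is dense in $W^{p,q,r}_s(\mathbb{R}^n)$ when $p,q,r<\infty$. Trace and trace-retraction: let $X$ and $Y$ be quasi-Banach function spaces on $\mathbb{R}^n$ and $\mathbb{R}^{n-1}$ respectively, with $\mathcal{S}(\mathbb{R}^n)$ dense in $X$. For $f\in\mathcal{S}(\mathbb{R}^n)$ let $\mathbb{T}f(\bar{x})=f(\bar{x},0)$. If there is a constant $C>0$ with $\|\mathbb{T}f\|_Y\le C\|f\|_X$ for all $f\in\mathcal{S}(\mathbb{R}^n)$, then $\mathbb{T}$ extends by density to $\mathbb{T}:X\to Y$, and $f(\bar{x},0)=\mathbb{T}f$ is called the trace of $f\in X$.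 If moreover there is a continuous linear operator $\mathbb{T}^{-1}:Y\to X$ such that $\mathbb{T}\mathbb{T}^{-1}$ is the identity operator on $Y$, then $\mathbb{T}$ is called a trace-retraction from $X$ onto $Y$. *)

theory Defs
  imports "HOL-Analysis.Analysis"
begin

section \<open>Schwartz functions\<close>

definition dir_deriv :: "'a::real_normed_vector \<Rightarrow> ('a \<Rightarrow> 'b::real_normed_vector) \<Rightarrow> 'a \<Rightarrow> 'b" where
  "dir_deriv v f x = frechet_derivative f (at x) v"

text \<open>Multi-indices are lists of basis vectors: \<open>iter_deriv [b\<^sub>1, \<dots>, b\<^sub>j] f\<close> is the
  iterated partial derivative along \<open>b\<^sub>1, \<dots>, b\<^sub>j\<close>.\<close>

definition iter_deriv :: "'a list \<Rightarrow> ('a::real_normed_vector \<Rightarrow> 'b::real_normed_vector) \<Rightarrow> 'a \<Rightarrow> 'b" where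
  "iter_deriv bs f = foldr dir_deriv bs f"

definition smooth :: "('a::euclidean_space \<Rightarrow> 'b::real_normed_vector) \<Rightarrow> bool" where
  "smooth f \<longleftrightarrow> (\<forall>bs. set bs \<subseteq> Basis \<longrightarrow> (\<forall>x. iter_deriv bs f differentiable (at x)))"

definition schwartz :: "('a::euclidean_space \<Rightarrow> complex) set" where
  "schwartz = {f. smooth f \<and>
     (\<forall>bs N. set bs \<subseteq> Basis \<longrightarrow> (\<exists>C. \<forall>x. (1 + norm x) ^ N * norm (iter_deriv bs f x) \<le> C))}"

definition schwartz_seminorm :: "nat \<Rightarrow> ('a::euclidean_space \<Rightarrow> complex) \<Rightarrow> real" where
  "schwartz_seminorm N f =
     (SUP (bs, x) \<in> {bs. set bs \<subseteq> Basis \<and> length bs \<le> N} \<times> UNIV.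
        (1 + norm x) ^ N * norm (iter_deriv bs f x))"

definition fourier :: "('a::euclidean_space \<Rightarrow> complex) \<Rightarrow> 'a \<Rightarrow> complex" where
  "fourier f \<xi> = (\<integral>x. exp (- 2 * of_real pi * \<i> * of_real (x \<bullet> \<xi>)) * f x \<partial>lborel)"

definition inv_fourier :: "('a::euclidean_space \<Rightarrow> complex) \<Rightarrow> 'a \<Rightarrow> complex" where
  "inv_fourier f x = (\<integral>\<xi>. exp (2 * of_real pi * \<i> * of_real (x \<bullet> \<xi>)) * f \<xi> \<partial>lborel)"

section \<open>Tempered distributions\<close>

text \<open>A tempered distribution is a continuous complex-linear functional on the Schwartz space.
  It is represented by a functional on all functions that vanishes off the Schwartz space, so that
  HOL equality is equality of distributions.\<close>

type_synonym 'a distr = "('a \<Rightarrow> complex) \<Rightarrow> complex"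

definition on_schwartz :: "'a::euclidean_space distr \<Rightarrow> 'a distr" where
  "on_schwartz L = (\<lambda>\<phi>. if \<phi> \<in> schwartz then L \<phi> else 0)"

definition tempered :: "'a::euclidean_space distr set" where
  "tempered = {L.
     (\<forall>\<phi>\<in>schwartz. \<forall>\<psi>\<in>schwartz. \<forall>a b. L (\<lambda>x. a * \<phi> x + b * \<psi> x) = a * L \<phi> + b * L \<psi>) \<and>
     (\<exists>N C. \<forall>\<phi>\<in>schwartz. norm (L \<phi>) \<le> C * schwartz_seminorm N \<phi>) \<and>
     (\<forall>\<phi>. \<phi> \<notin> schwartz \<longrightarrow> L \<phi> = 0)}"

definition distr_of :: "('a::euclidean_space \<Rightarrow> complex) \<Rightarrow> 'a distr" where
  "distr_of f = on_schwartz (\<lambda>\<phi>. \<integral>x. f x * \<phi> x \<partial>lborel)"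

definition distr_comb :: "complex \<Rightarrow> 'a distr \<Rightarrow> complex \<Rightarrow> 'a distr \<Rightarrow> 'a distr" where
  "distr_comb a L b M = (\<lambda>\<phi>. a * L \<phi> + b * M \<phi>)"

definition distr_diff :: "'a distr \<Rightarrow> 'a distr \<Rightarrow> 'a distr" where
  "distr_diff L M = (\<lambda>\<phi>. L \<phi> - M \<phi>)"

definition fourier_distr :: "'a::euclidean_space distr \<Rightarrow> 'a distr" where
  "fourier_distr L = on_schwartz (\<lambda>\<phi>. L (fourier \<phi>))"

definition inv_fourier_distr :: "'a::euclidean_space distr \<Rightarrow> 'a distr" where
  "inv_fourier_distr L = on_schwartz (\<lambda>\<phi>. L (inv_fourier \<phi>))"

definition mult_distr :: "('a::euclidean_space \<Rightarrow> real) \<Rightarrow> 'a distr \<Rightarrow> 'a distr" where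
  "mult_distr m L = on_schwartz (\<lambda>\<phi>. L (\<lambda>x. of_real (m x) * \<phi> x))"

text \<open>The continuous function inducing a given distribution. Only meaningful if there is one, in
  which case it is unique; distributions with compactly supported Fourier transform have one.\<close>

definition fun_of_distr :: "'a::euclidean_space distr \<Rightarrow> 'a \<Rightarrow> complex" where
  "fun_of_distr L = (THE g. continuous_on UNIV g \<and>
     (\<forall>\<phi>\<in>schwartz. integrable lborel (\<lambda>x. g x * \<phi> x) \<and> L \<phi> = (\<integral>x. g x * \<phi> x \<partial>lborel)))"

section \<open>Frequency-uniform decomposition\<close>

definition int_lattice :: "'a::euclidean_space set" where
  "int_lattice = {k. \<forall>b\<in>Basis. k \<bullet> b \<in> \<int>}"

definition bump :: "(real \<Rightarrow> real) \<Rightarrow> 'a::euclidean_space \<Rightarrow> 'a \<Rightarrow> real" where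
  "bump \<eta> k \<xi> = (\<Prod>b\<in>Basis. \<eta> (2 * (\<xi> \<bullet> b - k \<bullet> b)))"

definition unif_part :: "(real \<Rightarrow> real) \<Rightarrow> 'a::euclidean_space \<Rightarrow> 'a \<Rightarrow> real" where
  "unif_part \<eta> k \<xi> = bump \<eta> k \<xi> / (\<Sum>\<^sub>\<infinity>m\<in>int_lattice. bump \<eta> m \<xi>)"

definition box_op :: "(real \<Rightarrow> real) \<Rightarrow> 'a::euclidean_space \<Rightarrow> 'a distr \<Rightarrow> 'a \<Rightarrow> complex" where
  "box_op \<eta> k f = fun_of_distr (inv_fourier_distr (mult_distr (unif_part \<eta> k) (fourier_distr f)))"

section \<open>Wiener amalgam spaces\<close>

text \<open>Powers on \<open>[0,\<infinity>]\<close>, intended for exponents \<open>a > 0\<close>.\<close>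

definition epowr :: "ennreal \<Rightarrow> real \<Rightarrow> ennreal" where
  "epowr x a = (if x = top then top else ennreal (enn2real x powr a))"

text \<open>The \<open>L\<^sup>p\<close> quasi-norm of a nonnegative function, for \<open>0 < p < \<infinity>\<close>; with a counting
  measure it is the \<open>\<ell>\<^sup>p\<close> quasi-norm.\<close>

definition Lp_norm :: "real \<Rightarrow> 'b measure \<Rightarrow> ('b \<Rightarrow> ennreal) \<Rightarrow> ennreal" where
  "Lp_norm p M F = epowr (\<integral>\<^sup>+x. epowr (F x) p \<partial>M) (1 / p)"

definition jbracket :: "'a::euclidean_space \<Rightarrow> real" where
  "jbracket k = sqrt (1 + (norm k)\<^sup>2)"

definition wiener_norm ::
  "(real \<Rightarrow> real) \<Rightarrow> real \<Rightarrow> real \<Rightarrow> real \<Rightarrow> 'a::euclidean_space distr \<Rightarrow> ennreal" where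
  "wiener_norm \<eta> p q s f =
     Lp_norm p lborel (\<lambda>x.
       Lp_norm q (count_space int_lattice) (\<lambda>k.
         ennreal (jbracket k powr s * norm (box_op \<eta> k f x))))"

definition wiener_space ::
  "(real \<Rightarrow> real) \<Rightarrow> real \<Rightarrow> real \<Rightarrow> real \<Rightarrow> 'a::euclidean_space distr set" where
  "wiener_space \<eta> p q s = {f \<in> tempered. wiener_norm \<eta> p q s f < \<infinity>}"

text \<open>\<open>\<real>\<^sup>n = \<real>\<^sup>n\<^sup>-\<^sup>1 \<times> \<real>\<close> is modelled by the product type \<open>'a \<times> real\<close>, where \<open>'a\<close> has dimension
  \<open>n - 1\<close>; a frequency is a pair of \<open>kb\<close> in the lattice of \<open>'a\<close> and a last coordinate \<open>kn\<close>.\<close>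

definition aniso_wiener_norm ::
  "(real \<Rightarrow> real) \<Rightarrow> real \<Rightarrow> real \<Rightarrow> real \<Rightarrow> real \<Rightarrow> ('a::euclidean_space \<times> real) distr \<Rightarrow> ennreal" where
  "aniso_wiener_norm \<eta> p q r s f =
     Lp_norm p lborel (\<lambda>x.
       Lp_norm r (count_space (\<int> :: real set)) (\<lambda>kn.
         Lp_norm q (count_space int_lattice) (\<lambda>kb.
           ennreal (jbracket kb powr s * norm (box_op \<eta> (kb, kn) f x)))))"

definition aniso_wiener_space ::
  "(real \<Rightarrow> real) \<Rightarrow> real \<Rightarrow> real \<Rightarrow> real \<Rightarrow> real \<Rightarrow> ('a::euclidean_space \<times> real) distr set" where
  "aniso_wiener_space \<eta> p q r s = {f \<in> tempered. aniso_wiener_norm \<eta> p q r s f < \<infinity>}"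

section \<open>Traces\<close>

definition trace_fun :: "('a \<times> real \<Rightarrow> complex) \<Rightarrow> 'a \<Rightarrow> complex" where
  "trace_fun f = (\<lambda>x. f (x, 0))"

text \<open>Below, a quasi-normed space of distributions is given by its carrier \<open>X\<close> and its
  quasi-norm \<open>NX\<close>.\<close>

definition schwartz_dense :: "'a::euclidean_space distr set \<Rightarrow> ('a distr \<Rightarrow> ennreal) \<Rightarrow> bool" where
  "schwartz_dense X NX \<longleftrightarrow>
     distr_of ` schwartz \<subseteq> X \<and>
     (\<forall>f\<in>X. \<forall>\<epsilon>>0. \<exists>g\<in>schwartz. NX (distr_diff f (distr_of g)) < ennreal \<epsilon>)"

definition continuous_linear_op ::
  "'a distr set \<Rightarrow> ('a distr \<Rightarrow> ennreal) \<Rightarrow> 'b distr set \<Rightarrow> ('b distr \<Rightarrow> ennreal) \<Rightarrow>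
   ('a distr \<Rightarrow> 'b distr) \<Rightarrow> bool" where
  "continuous_linear_op X NX Y NY T \<longleftrightarrow>
     (\<forall>f\<in>X. T f \<in> Y) \<and>
     (\<forall>f\<in>X. \<forall>g\<in>X. \<forall>a b. T (distr_comb a f b g) = distr_comb a (T f) b (T g)) \<and>
     (\<forall>f\<in>X. \<forall>\<epsilon>>0. \<exists>\<delta>>0. \<forall>g\<in>X.
        NX (distr_diff g f) < ennreal \<delta> \<longrightarrow> NY (distr_diff (T g) (T f)) < ennreal \<epsilon>)"

text \<open>The continuous linear extension \<open>T\<close> of \<open>trace_fun\<close> is determined on \<open>X\<close> by the density of
  the Schwartz functions.\<close>

definition trace_retraction ::
  "('a::euclidean_space \<times> real) distr set \<Rightarrow> (('a \<times> real) distr \<Rightarrow> ennreal) \<Rightarrow>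
   'a distr set \<Rightarrow> ('a distr \<Rightarrow> ennreal) \<Rightarrow> bool" where
  "trace_retraction X NX Y NY \<longleftrightarrow>
     schwartz_dense X NX \<and>
     (\<exists>C>0. \<forall>f\<in>schwartz. NY (distr_of (trace_fun f)) \<le> ennreal C * NX (distr_of f)) \<and>
     (\<exists>T. continuous_linear_op X NX Y NY T \<and>
          (\<forall>f\<in>schwartz. T (distr_of f) = distr_of (trace_fun f)) \<and>
          (\<exists>R. continuous_linear_op Y NY X NX R \<and> (\<forall>g\<in>Y. T (R g) = g)))"

end

theory Submission
  imports Defs "HOL-Probability.Probability"
begin

text \<open>The blocks of a tempered distribution are point evaluations of that distribution: if \<open>ker k\<close> denotes
the Fourier transform of the \<open>k\<close>-th multiplier, then block \<open>k\<close> of \<open>L\<close> has the value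
\<open>L (\<lambda>y. ker k (y - x))\<close> at \<open>x\<close> (\<open>box_op_eq\<close>). On a product the multipliers factor, so
\<open>ker (kb, kn)\<close> is the tensor product of \<open>ker kb\<close> and \<open>ker kn\<close>. The multipliers add up to \<open>1\<close>; hence, by
Fourier inversion, integrating a function \<open>a\<close> against \<open>ker kn\<close> and summing over \<open>kn\<close> gives \<open>a 0\<close>
(\<open>sum_integral_ker\<close>). The trace is therefore \<open>T f \<phi> = (\<Sum>kn. f (\<phi> \<otimes> ker kn))\<close>, and its blocks are
\<open>box kb (T f) x = (\<Sum>kn. box (kb, kn) f (x, 0))\<close> (\<open>box_op_trace_op\<close>).

Boundedness of \<open>T\<close> rests on two facts about this formula. First, a block is band-limited to a cube of
fixed size, so it is controlled at a point by averages of a small power of itself, with constants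
independent of the block (\<open>sub_mean_value_inequality\<close>). Values at \<open>(x, 0)\<close> may thus be replaced by averages
around \<open>(x, t)\<close> with \<open>0 \<le> t \<le> 1\<close> and integrated in \<open>t\<close>; as the power may be taken below all exponents
involved, Minkowski's integral inequality bounds the averages in the anisotropic norm
(\<open>mixed_norm_maxblock\<close>), even for exponents below \<open>1\<close>. Second, the \<open>\<ell>\<^sup>q\<close> norm of a sum over \<open>kn\<close> is at most the
\<open>\<ell>\<^sup>r\<close> sum of the \<open>\<ell>\<^sup>q\<close> norms for \<open>r = min 1 q\<close>: this is the triangle inequality for \<open>q \<ge> 1\<close>, and
\<open>\<ell>\<^sup>q \<subseteq> \<ell>\<^sup>1\<close> for \<open>q \<le> 1\<close> (\<open>Lp_norm_sum_le_seq_norm\<close>).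

That the sum defining \<open>T f\<close> is again a tempered distribution follows from a synthesis estimate: a
distribution is bounded on test functions by a weighted sum of integrals of its blocks
(\<open>tempered_le_blocks\<close>), and the blocks of \<open>f\<close> are bounded uniformly in space (\<open>seq_norm_wblock_bounded\<close>).

A right inverse of \<open>T\<close> is \<open>R g = g \<otimes> chi\<close> with a cutoff function \<open>chi\<close> such that \<open>chi 0 = 1\<close>. The blocks
of \<open>R g\<close> are products, so its norm is the norm of \<open>g\<close> times a constant
(\<open>aniso_wiener_norm_extension_op\<close>).

Schwartz functions are dense because the blocks of \<open>f\<close> can be truncated to finitely many frequencies and
to balls. A block of the error is bounded by discarded parts of neighbouring blocks; these tend to
zero pointwise and are dominated by the averages above, so that dominated convergence in the three
nested quasi-norms applies (\<open>schwartz_approximation\<close>).\<close>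

section \<open>Calculus of iterated partial derivatives\<close>

lemma iter_deriv_Nil [simp]: "iter_deriv [] f = f"
  by (simp add: iter_deriv_def)

lemma iter_deriv_Cons: "iter_deriv (b # bs) f = dir_deriv b (iter_deriv bs f)"
  by (simp add: iter_deriv_def)

lemma iter_deriv_snoc: "iter_deriv (bs @ [b]) f = iter_deriv bs (dir_deriv b f)"
  by (simp add: iter_deriv_def)

lemma dir_deriv_eqI: "(f has_derivative f') (at x) \<Longrightarrow> dir_deriv v f x = f' v"
  using frechet_derivative_at by (fastforce simp: dir_deriv_def)

lemma smoothD: "smooth f \<Longrightarrow> f differentiable at x"
  unfolding smooth_def by (metis iter_deriv_Nil empty_set empty_subsetI)

lemma smooth_dir_deriv: "smooth f \<Longrightarrow> b \<in> Basis \<Longrightarrow> smooth (dir_deriv b f)"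
  unfolding smooth_def iter_deriv_snoc[symmetric] by auto

lemma smooth_iter_deriv: "smooth f \<Longrightarrow> set bs \<subseteq> Basis \<Longrightarrow> smooth (iter_deriv bs f)"
  by (induction bs) (auto simp: iter_deriv_Cons intro: smooth_dir_deriv)

text \<open>Used for functions whose derivatives are all of the same form, such as Fourier transforms.\<close>

lemma smooth_coinduct [consumes 1, case_names differentiable deriv]:
  assumes "P f"
    and d: "\<And>f x. P f \<Longrightarrow> f differentiable at x"
    and P: "\<And>f b. P f \<Longrightarrow> b \<in> Basis \<Longrightarrow> P (dir_deriv b f)"
  shows "smooth f"
proof -
  have "P (iter_deriv bs f)" if "set bs \<subseteq> Basis" for bs
    using that by (induction bs) (auto simp: iter_deriv_Cons \<open>P f\<close> intro: P)
  then show ?thesis unfolding smooth_def using d by blast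
qed

text \<open>Smoothness of finite order is the induction parameter in the closure properties below: the derivative
  of a product or of an inverse is an expression in the functions themselves and their derivatives, which
  are smooth to one order less.\<close>

definition smooth_upto :: "nat \<Rightarrow> ('a::euclidean_space \<Rightarrow> 'b::real_normed_vector) \<Rightarrow> bool" where
  "smooth_upto n f \<longleftrightarrow>
     (\<forall>bs. set bs \<subseteq> Basis \<and> length bs \<le> n \<longrightarrow> (\<forall>x. iter_deriv bs f differentiable at x))"

lemma smooth_iff_upto: "smooth f \<longleftrightarrow> (\<forall>n. smooth_upto n f)"
  unfolding smooth_def smooth_upto_def by auto

lemma smooth_upto_0: "smooth_upto 0 f \<longleftrightarrow> (\<forall>x. f differentiable at x)"
  unfolding smooth_upto_def by auto

lemma smooth_upto_Suc:
  "smooth_upto (Suc n) f \<longleftrightarrow>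
     (\<forall>x. f differentiable at x) \<and> (\<forall>b\<in>Basis. smooth_upto n (dir_deriv b f))"
proof safe
  assume f: "smooth_upto (Suc n) f"
  show "f differentiable at x" for x
    using f[unfolded smooth_upto_def, rule_format, of "[]"] by simp
  show "smooth_upto n (dir_deriv b f)" if "b \<in> Basis" for b
    unfolding smooth_upto_def
  proof (intro allI impI, elim conjE)
    fix bs x assume "set bs \<subseteq> (Basis :: 'a set)" "length bs \<le> n"
    then show "iter_deriv bs (dir_deriv b f) differentiable at x"
      using f[unfolded smooth_upto_def, rule_format, of "bs @ [b]" x] that
      by (simp add: iter_deriv_snoc)
  qed
next
  assume d: "\<forall>x. f differentiable at x" and *: "\<forall>b\<in>Basis. smooth_upto n (dir_deriv b f)"
  show "smooth_upto (Suc n) f"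
    unfolding smooth_upto_def
  proof (intro allI impI, elim conjE)
    fix bs x assume "set bs \<subseteq> (Basis :: 'a set)" "length bs \<le> Suc n"
    then show "iter_deriv bs f differentiable at x"
      by (cases bs rule: rev_cases)
        (use d *[unfolded smooth_upto_def] in \<open>auto simp: iter_deriv_snoc\<close>)
  qed
qed

lemma smooth_upto_mono: "smooth_upto (Suc n) f \<Longrightarrow> smooth_upto n f"
  unfolding smooth_upto_def by auto

lemma dir_deriv_add:
  assumes "\<And>x. f differentiable at x" "\<And>x. g differentiable at x"
  shows "dir_deriv v (\<lambda>x. f x + g x) = (\<lambda>x. dir_deriv v f x + dir_deriv v g x)"
proof
  fix x
  have "((\<lambda>x. f x + g x) has_derivative
      (\<lambda>v. frechet_derivative f (at x) v + frechet_derivative g (at x) v)) (at x)"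
    using assms by (intro has_derivative_add) (auto simp: frechet_derivative_works)
  from dir_deriv_eqI[OF this, of v] show "dir_deriv v (\<lambda>x. f x + g x) x = dir_deriv v f x + dir_deriv v g x"
    by (simp add: dir_deriv_def)
qed

lemma dir_deriv_mult:
  fixes f g :: "'a::real_normed_vector \<Rightarrow> 'b::real_normed_algebra"
  assumes "\<And>x. f differentiable at x" "\<And>x. g differentiable at x"
  shows "dir_deriv v (\<lambda>x. f x * g x) = (\<lambda>x. f x * dir_deriv v g x + dir_deriv v f x * g x)"
proof
  fix x
  have "((\<lambda>x. f x * g x) has_derivative
      (\<lambda>v. f x * frechet_derivative g (at x) v + frechet_derivative f (at x) v * g x)) (at x)"
    using assms by (intro has_derivative_mult) (auto simp: frechet_derivative_works)
  from dir_deriv_eqI[OF this, of v] show "dir_deriv v (\<lambda>x. f x * g x) x = f x * dir_deriv v g x + dir_deriv v f x * g x"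
    by (simp add: dir_deriv_def)
qed

lemma dir_deriv_bounded_linear:
  assumes "bounded_linear h" "\<And>x. f differentiable at x"
  shows "dir_deriv v (\<lambda>x. h (f x)) = (\<lambda>x. h (dir_deriv v f x))"
proof
  fix x
  have "((\<lambda>x. h (f x)) has_derivative (\<lambda>v. h (frechet_derivative f (at x) v))) (at x)"
    using assms by (intro bounded_linear.has_derivative[OF assms(1)])
      (auto simp: frechet_derivative_works)
  from dir_deriv_eqI[OF this, of v] show "dir_deriv v (\<lambda>x. h (f x)) x = h (dir_deriv v f x)"
    by (simp add: dir_deriv_def)
qed

lemma dir_deriv_const [simp]: "dir_deriv v (\<lambda>x. c) = (\<lambda>x. 0)"
  by (rule ext, rule dir_deriv_eqI) (rule has_derivative_const)

lemma dir_deriv_compose_affine: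
  assumes "bounded_linear A" "\<And>x. f differentiable at x"
  shows "dir_deriv v (\<lambda>x. f (A x + a)) = (\<lambda>x. dir_deriv (A v) f (A x + a))"
proof
  fix x
  have *: "((\<lambda>x. A x + a) has_derivative A) (at x)"
    using bounded_linear.has_derivative[OF assms(1) has_derivative_ident]
    by (auto intro!: derivative_eq_intros)
  have "(f has_derivative frechet_derivative f (at (A x + a))) (at (A x + a))"
    using assms(2) by (simp add: frechet_derivative_works[symmetric])
  from diff_chain_at[OF * this]
  have "((\<lambda>x. f (A x + a)) has_derivative (\<lambda>v. frechet_derivative f (at (A x + a)) (A v))) (at x)"
    by (simp add: o_def)
  from dir_deriv_eqI[OF this, of v] show "dir_deriv v (\<lambda>x. f (A x + a)) x = dir_deriv (A v) f (A x + a)"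
    by (simp add: dir_deriv_def)
qed

lemma differentiable_compose_affine:
  assumes "bounded_linear A" "\<And>x. f differentiable at x"
  shows "(\<lambda>x. f (A x + a)) differentiable at x"
proof -
  have "(\<lambda>x. A x + a) differentiable at x"
    using bounded_linear_imp_differentiable[OF assms(1)] by simp
  from differentiable_chain_at[OF this assms(2)] show ?thesis by (simp add: o_def)
qed

lemma bounded_linear_differentiable:
  assumes "bounded_linear h" "f differentiable at x"
  shows "(\<lambda>x. h (f x)) differentiable at x"
  using bounded_linear.has_derivative[OF assms(1)] assms(2) unfolding differentiable_def by blast

lemma smooth_upto_const: "smooth_upto n (\<lambda>x. c)"
  by (induction n arbitrary: c) (auto simp: smooth_upto_0 smooth_upto_Suc)

lemma smooth_upto_add: "smooth_upto n f \<Longrightarrow> smooth_upto n g \<Longrightarrow> smooth_upto n (\<lambda>x. f x + g x)"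
  by (induction n arbitrary: f g) (auto simp: smooth_upto_0 smooth_upto_Suc dir_deriv_add)

lemma smooth_upto_mult:
  fixes f g :: "'a::euclidean_space \<Rightarrow> 'b::real_normed_algebra"
  shows "smooth_upto n f \<Longrightarrow> smooth_upto n g \<Longrightarrow> smooth_upto n (\<lambda>x. f x * g x)"
proof (induction n arbitrary: f g)
  case 0
  then show ?case by (simp add: smooth_upto_0)
next
  case (Suc n)
  have "smooth_upto n f" "smooth_upto n g"
    using Suc.prems by (auto intro: smooth_upto_mono)
  with Suc show ?case
    unfolding smooth_upto_Suc by (auto simp: dir_deriv_mult intro!: smooth_upto_add)
qed

lemma smooth_upto_bounded_linear:
  assumes "bounded_linear h"
  shows "smooth_upto n f \<Longrightarrow> smooth_upto n (\<lambda>x. h (f x))"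
proof (induction n arbitrary: f)
  case 0
  then have "(\<lambda>x. h (f x)) differentiable at x" for x
    unfolding smooth_upto_0 using bounded_linear_differentiable[OF assms, of f x] by fast
  then show ?case unfolding smooth_upto_0 by fast
next
  case (Suc n)
  then have f: "\<And>x. f differentiable at x" by (simp add: smooth_upto_Suc)
  have "(\<lambda>x. h (f x)) differentiable at x" for x
    using bounded_linear_differentiable[OF assms, of f x] f by fast
  moreover have "smooth_upto n (\<lambda>x. h (dir_deriv b f x))" if "b \<in> Basis" for b
    using Suc that by (simp add: smooth_upto_Suc)
  ultimately show ?case
    unfolding smooth_upto_Suc dir_deriv_bounded_linear[OF assms f] by fast
qed

lemma dir_deriv_inverse:
  fixes f :: "'a::real_normed_vector \<Rightarrow> real"
  assumes "\<And>x. f differentiable at x" "\<And>x. f x \<noteq> 0"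
  shows "dir_deriv v (\<lambda>x. inverse (f x)) = (\<lambda>x. - 1 * (dir_deriv v f x * (inverse (f x) * inverse (f x))))"
proof
  fix x
  have "((\<lambda>x. inverse (f x)) has_derivative
      (\<lambda>v. - (inverse (f x) * frechet_derivative f (at x) v * inverse (f x)))) (at x)"
    using assms by (intro Deriv.has_derivative_inverse) (auto simp: frechet_derivative_works)
  from dir_deriv_eqI[OF this, of v] show "dir_deriv v (\<lambda>x. inverse (f x)) x = - 1 * (dir_deriv v f x * (inverse (f x) * inverse (f x)))"
    by (simp add: dir_deriv_def)
qed

lemma smooth_upto_inverse:
  fixes f :: "'a::euclidean_space \<Rightarrow> real"
  assumes "\<And>x. f x \<noteq> 0"
  shows "smooth_upto n f \<Longrightarrow> smooth_upto n (\<lambda>x. inverse (f x))"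
proof (induction n)
  case 0
  then show ?case using assms by (auto simp: smooth_upto_0)
next
  case (Suc n)
  have f: "\<And>x. f differentiable at x" and "smooth_upto n f"
    using Suc.prems by (auto simp: smooth_upto_Suc intro: smooth_upto_mono)
  then have "smooth_upto n (\<lambda>x. inverse (f x))" using Suc.IH by simp
  then have "smooth_upto n (dir_deriv b (\<lambda>x. inverse (f x)))" if "b \<in> Basis" for b
    unfolding dir_deriv_inverse[OF f assms]
    using that Suc.prems by (intro smooth_upto_mult smooth_upto_const) (auto simp: smooth_upto_Suc)
  then show ?case using assms f by (auto simp: smooth_upto_Suc)
qed

lemma smooth_const: "smooth (\<lambda>x. c)"
  by (simp add: smooth_iff_upto smooth_upto_const)

lemma smooth_add: "smooth f \<Longrightarrow> smooth g \<Longrightarrow> smooth (\<lambda>x. f x + g x)"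
  by (simp add: smooth_iff_upto smooth_upto_add)

lemma smooth_mult:
  fixes f g :: "'a::euclidean_space \<Rightarrow> 'b::real_normed_algebra"
  shows "smooth f \<Longrightarrow> smooth g \<Longrightarrow> smooth (\<lambda>x. f x * g x)"
  by (simp add: smooth_iff_upto smooth_upto_mult)

lemma smooth_bounded_linear: "bounded_linear h \<Longrightarrow> smooth f \<Longrightarrow> smooth (\<lambda>x. h (f x))"
  by (simp add: smooth_iff_upto smooth_upto_bounded_linear)

lemma smooth_inverse:
  fixes f :: "'a::euclidean_space \<Rightarrow> real"
  shows "smooth f \<Longrightarrow> (\<And>x. f x \<noteq> 0) \<Longrightarrow> smooth (\<lambda>x. inverse (f x))"
  by (simp add: smooth_iff_upto smooth_upto_inverse)

lemma smooth_sum: "(\<And>i. i \<in> I \<Longrightarrow> smooth (f i)) \<Longrightarrow> smooth (\<lambda>x. \<Sum>i\<in>I. f i x)"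
  by (induction I rule: infinite_finite_induct) (auto intro: smooth_const smooth_add)

lemma smooth_prod:
  fixes f :: "'i \<Rightarrow> 'a::euclidean_space \<Rightarrow> 'b::real_normed_field"
  shows "(\<And>i. i \<in> I \<Longrightarrow> smooth (f i)) \<Longrightarrow> smooth (\<lambda>x. \<Prod>i\<in>I. f i x)"
  by (induction I rule: infinite_finite_induct) (auto intro: smooth_const smooth_mult)

lemma smooth_of_real: "smooth f \<Longrightarrow> smooth (\<lambda>x. complex_of_real (f x))"
  by (rule smooth_bounded_linear[OF bounded_linear_of_real])

lemma smooth_inner: "smooth (\<lambda>x. x \<bullet> c)"
proof -
  have "dir_deriv b (\<lambda>x. x \<bullet> c) = (\<lambda>x. b \<bullet> c)" for b :: 'a
    by (rule ext, rule dir_deriv_eqI) (auto intro!: derivative_eq_intros)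
  moreover have "(\<lambda>x. x \<bullet> c) differentiable at x" for x
    by (intro differentiableI[where f'="\<lambda>v. v \<bullet> c"]) (auto intro!: derivative_eq_intros)
  ultimately have "smooth_upto n (\<lambda>x. x \<bullet> c)" for n
    by (cases n) (auto simp: smooth_upto_0 smooth_upto_Suc smooth_upto_const)
  then show ?thesis by (simp add: smooth_iff_upto)
qed

lemma smooth_iter_deriv_add:
  assumes "smooth f" "smooth g" "set bs \<subseteq> Basis"
  shows "iter_deriv bs (\<lambda>x. f x + g x) = (\<lambda>x. iter_deriv bs f x + iter_deriv bs g x)"
  using assms(3)
  by (induction bs)
    (auto simp: iter_deriv_Cons dir_deriv_add[OF smoothD smoothD] smooth_iter_deriv assms(1,2))

lemma smooth_iter_deriv_sum:
  assumes "\<And>i. i \<in> I \<Longrightarrow> smooth (f i)" "set bs \<subseteq> Basis"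
  shows "iter_deriv bs (\<lambda>x. \<Sum>i\<in>I. f i x) = (\<lambda>x. \<Sum>i\<in>I. iter_deriv bs (f i) x)"
proof -
  have 0: "iter_deriv bs (\<lambda>x. 0) = (\<lambda>x. 0)"
    by (induction bs) (auto simp: iter_deriv_Cons)
  show ?thesis
    using assms(1)
    by (induction I rule: infinite_finite_induct)
      (auto simp: 0 smooth_iter_deriv_add smooth_sum assms(2))
qed

lemma smooth_iter_deriv_bounded_linear:
  assumes "bounded_linear h" "smooth f" "set bs \<subseteq> Basis"
  shows "iter_deriv bs (\<lambda>x. h (f x)) = (\<lambda>x. h (iter_deriv bs f x))"
  using assms(3)
  by (induction bs)
    (auto simp: iter_deriv_Cons dir_deriv_bounded_linear[OF assms(1) smoothD] smooth_iter_deriv assms(2))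

lemma smooth_iter_deriv_cmult:
  fixes c :: complex
  assumes "smooth f" "set bs \<subseteq> Basis"
  shows "iter_deriv bs (\<lambda>x. c * f x) = (\<lambda>x. c * iter_deriv bs f x)"
  by (rule smooth_iter_deriv_bounded_linear[OF bounded_linear_mult_right assms])

lemma dir_deriv_scaleR:
  assumes "f differentiable at x"
  shows "dir_deriv (c *\<^sub>R v) f x = c *\<^sub>R dir_deriv v f x"
  using linear_scale[OF linear_frechet_derivative[OF assms]] by (simp add: dir_deriv_def)

lemma iter_deriv_dilate_translate:
  assumes "smooth f"
  shows "set bs \<subseteq> Basis \<Longrightarrow>
     iter_deriv bs (\<lambda>x. f (c *\<^sub>R x + a)) = (\<lambda>x. c ^ length bs *\<^sub>R iter_deriv bs f (c *\<^sub>R x + a))"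
proof (induction bs)
  case (Cons b bs)
  let ?g = "iter_deriv bs f"
  have g: "\<And>x. ?g differentiable at x" using Cons assms by (auto intro: smoothD smooth_iter_deriv)
  have A: "bounded_linear (\<lambda>x::'a. c *\<^sub>R x)" by (rule bounded_linear_scaleR_right)
  have "iter_deriv (b # bs) (\<lambda>x. f (c *\<^sub>R x + a))
      = dir_deriv b (\<lambda>x. c ^ length bs *\<^sub>R ?g (c *\<^sub>R x + a))"
    using Cons by (simp add: iter_deriv_Cons)
  also have "\<dots> = (\<lambda>x. c ^ length bs *\<^sub>R dir_deriv b (\<lambda>x. ?g (c *\<^sub>R x + a)) x)"
    by (rule dir_deriv_bounded_linear[OF bounded_linear_scaleR_right])
      (rule differentiable_compose_affine[OF A g])
  also have "\<dots> = (\<lambda>x. c ^ length bs *\<^sub>R c *\<^sub>R dir_deriv b ?g (c *\<^sub>R x + a))"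
    unfolding dir_deriv_compose_affine[OF A g] dir_deriv_scaleR[OF g] by simp
  finally show ?case by (simp add: iter_deriv_Cons mult.commute)
qed simp

lemma smooth_dilate_translate:
  assumes "smooth f"
  shows "smooth (\<lambda>x. f (c *\<^sub>R x + a))"
proof -
  have A: "bounded_linear (\<lambda>x::'a. c *\<^sub>R x)" by (rule bounded_linear_scaleR_right)
  have "(\<lambda>x. c ^ length bs *\<^sub>R iter_deriv bs f (c *\<^sub>R x + a)) differentiable at x"
    if "set bs \<subseteq> Basis" for bs x
    by (rule bounded_linear_differentiable[OF bounded_linear_scaleR_right])
      (intro differentiable_compose_affine A smoothD smooth_iter_deriv assms that)
  then show ?thesis unfolding smooth_def by (simp add: iter_deriv_dilate_translate assms)
qed

lemma iter_deriv_compose_linear: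
  assumes "bounded_linear A" "A ` Basis \<subseteq> Basis" "smooth f"
  shows "set bs \<subseteq> Basis \<Longrightarrow> iter_deriv bs (\<lambda>x. f (A x)) = (\<lambda>x. iter_deriv (map A bs) f (A x))"
proof (induction bs)
  case (Cons b bs)
  have "\<And>x. iter_deriv (map A bs) f differentiable at x"
    using Cons.prems assms by (intro smoothD smooth_iter_deriv) auto
  from dir_deriv_compose_affine[OF assms(1) this, of b 0] Cons show ?case
    by (simp add: iter_deriv_Cons)
qed simp

lemma smooth_compose_linear:
  assumes "bounded_linear A" "A ` Basis \<subseteq> Basis" "smooth f"
  shows "smooth (\<lambda>x. f (A x))"
proof -
  have "(\<lambda>x. iter_deriv (map A bs) f (A x)) differentiable at x"
    if "set bs \<subseteq> Basis" for bs x
  proof -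
    have "\<And>x. iter_deriv (map A bs) f differentiable at x"
      using that assms by (intro smoothD smooth_iter_deriv) auto
    from differentiable_compose_affine[OF assms(1) this, of 0] show ?thesis by simp
  qed
  then show ?thesis unfolding smooth_def by (simp add: iter_deriv_compose_linear assms)
qed

text \<open>Smoothness is local: a function that agrees near each point with some smooth function is
  smooth, because iterated derivatives of functions that agree on an open set agree there.\<close>

lemma dir_deriv_cong_open:
  assumes "open U" "x \<in> U" "\<And>y. y \<in> U \<Longrightarrow> f y = g y" "g differentiable at x"
  shows "dir_deriv v f x = dir_deriv v g x" "f differentiable at x"
proof -
  have "(g has_derivative frechet_derivative g (at x)) (at x)"
    using assms(4) by (simp add: frechet_derivative_works)
  then have *: "(f has_derivative frechet_derivative g (at x)) (at x)"
    by (rule has_derivative_transform_within_open[OF _ assms(1,2)]) (simp add: assms(3))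
  show "f differentiable at x" using * by (rule differentiableI)
  show "dir_deriv v f x = dir_deriv v g x" using dir_deriv_eqI[OF *] by (simp add: dir_deriv_def)
qed

lemma iter_deriv_cong_open:
  assumes "open U" "\<And>y. y \<in> U \<Longrightarrow> f y = g y" "smooth g"
  shows "set bs \<subseteq> Basis \<Longrightarrow> x \<in> U \<Longrightarrow> iter_deriv bs f x = iter_deriv bs g x"
proof (induction bs arbitrary: x)
  case (Cons b bs)
  show ?case unfolding iter_deriv_Cons
    by (rule dir_deriv_cong_open(1)[OF assms(1)])
      (use Cons assms in \<open>auto intro!: smoothD smooth_iter_deriv\<close>)
qed (simp add: assms)

lemma smooth_local:
  assumes "\<And>x. \<exists>U g. open U \<and> x \<in> U \<and> smooth g \<and> (\<forall>y\<in>U. f y = g y)"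
  shows "smooth f"
  unfolding smooth_def
proof (intro allI impI)
  fix bs :: "'a list" and x assume bs: "set bs \<subseteq> Basis"
  from assms[of x] obtain U g where *: "open U \<and> x \<in> U \<and> smooth g \<and> (\<forall>y\<in>U. f y = g y)"
    by (elim exE)
  then have U: "open U" "x \<in> U" "smooth g" "\<And>y. y \<in> U \<Longrightarrow> f y = g y" by simp_all
  show "iter_deriv bs f differentiable at x"
  proof (rule dir_deriv_cong_open(2)[OF U(1,2)])
    show "iter_deriv bs f y = iter_deriv bs g y" if "y \<in> U" for y
      using iter_deriv_cong_open[OF U(1,4,3) bs that] .
    show "iter_deriv bs g differentiable at x" by (intro smoothD smooth_iter_deriv U bs)
  qed
qed

text \<open>Leibniz' rule: the derivative of the product is a sum of \<open>2 ^ length bs\<close> terms.\<close>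

lemma norm_iter_deriv_mult_le:
  fixes f g :: "'a::euclidean_space \<Rightarrow> 'b::real_normed_algebra"
  assumes "smooth f" "smooth g" "set bs \<subseteq> Basis"
    and "\<And>cs. set cs \<subseteq> Basis \<Longrightarrow> length cs \<le> length bs \<Longrightarrow> norm (iter_deriv cs f x) \<le> A"
    and "\<And>cs. set cs \<subseteq> Basis \<Longrightarrow> length cs \<le> length bs \<Longrightarrow> norm (iter_deriv cs g x) \<le> B"
  shows "norm (iter_deriv bs (\<lambda>x. f x * g x) x) \<le> 2 ^ length bs * (A * B)"
  using assms
proof (induction bs arbitrary: f g rule: rev_induct)
  case Nil
  have "norm (f x) \<le> A" "norm (g x) \<le> B" using Nil(4,5)[of "[]"] by auto
  then show ?case
    by (auto intro!: order_trans[OF norm_mult_ineq] mult_mono intro: order_trans[OF norm_ge_zero])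
next
  case (snoc b bs)
  have b: "b \<in> Basis" "set bs \<subseteq> Basis" using snoc.prems by auto
  have sm: "smooth (dir_deriv b f)" "smooth (dir_deriv b g)"
    using snoc.prems b by (auto intro: smooth_dir_deriv)
  have f: "norm (iter_deriv cs f x) \<le> A" "norm (iter_deriv cs (dir_deriv b f) x) \<le> A"
    if "set cs \<subseteq> Basis" "length cs \<le> length bs" for cs
    using snoc.prems(4)[of cs] snoc.prems(4)[of "cs @ [b]"] that b by (auto simp: iter_deriv_snoc)
  have g: "norm (iter_deriv cs g x) \<le> B" "norm (iter_deriv cs (dir_deriv b g) x) \<le> B"
    if "set cs \<subseteq> Basis" "length cs \<le> length bs" for cs
    using snoc.prems(5)[of cs] snoc.prems(5)[of "cs @ [b]"] that b by (auto simp: iter_deriv_snoc)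
  have "iter_deriv (bs @ [b]) (\<lambda>x. f x * g x) x =
      iter_deriv bs (\<lambda>x. f x * dir_deriv b g x) x + iter_deriv bs (\<lambda>x. dir_deriv b f x * g x) x"
    using snoc.prems sm b
    by (simp add: iter_deriv_snoc dir_deriv_mult[OF smoothD smoothD] smooth_iter_deriv_add smooth_mult)
  also have "norm \<dots> \<le> 2 ^ length bs * (A * B) + 2 ^ length bs * (A * B)"
    using snoc.prems(1,2) sm b f g
    by (intro order_trans[OF norm_triangle_ineq] add_mono snoc.IH) auto
  finally show ?case by (simp add: algebra_simps)
qed

lemma has_derivative_dir_deriv:
  fixes f :: "'a::euclidean_space \<Rightarrow> 'b::real_normed_vector"
  assumes "f differentiable at x"
  shows "(f has_derivative (\<lambda>v. \<Sum>b\<in>Basis. (v \<bullet> b) *\<^sub>R dir_deriv b f x)) (at x)"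
proof -
  have lin: "linear (frechet_derivative f (at x))" using assms by (rule linear_frechet_derivative)
  have "frechet_derivative f (at x) v = (\<Sum>b\<in>Basis. (v \<bullet> b) *\<^sub>R dir_deriv b f x)" for v
  proof -
    have "frechet_derivative f (at x) v = frechet_derivative f (at x) (\<Sum>b\<in>Basis. (v \<bullet> b) *\<^sub>R b)"
      by (simp add: euclidean_representation)
    also have "\<dots> = (\<Sum>b\<in>Basis. (v \<bullet> b) *\<^sub>R dir_deriv b f x)"
      by (simp add: linear_sum[OF lin] linear_scale[OF lin] dir_deriv_def)
    finally show ?thesis .
  qed
  then have "frechet_derivative f (at x) = (\<lambda>v. \<Sum>b\<in>Basis. (v \<bullet> b) *\<^sub>R dir_deriv b f x)" by blast
  then show ?thesis using assms by (simp add: frechet_derivative_works)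
qed

lemma norm_diff_le_dir_deriv_bound:
  fixes f :: "'a::euclidean_space \<Rightarrow> 'b::real_normed_vector" and B :: real
  assumes "\<And>x. f differentiable at x"
    and "\<And>z b. z \<in> closed_segment x y \<Longrightarrow> b \<in> Basis \<Longrightarrow> norm (dir_deriv b f z) \<le> B"
  shows "norm (f y - f x) \<le> DIM('a) * B * norm (y - x)"
proof (rule differentiable_bound[of "closed_segment x y" f
      "\<lambda>z v. \<Sum>b\<in>Basis. (v \<bullet> b) *\<^sub>R dir_deriv b f z"])
  show "(f has_derivative (\<lambda>v. \<Sum>b\<in>Basis. (v \<bullet> b) *\<^sub>R dir_deriv b f z)) (at z within closed_segment x y)" for z
    by (rule has_derivative_at_withinI[OF has_derivative_dir_deriv[OF assms(1)]])
  show "onorm (\<lambda>v. \<Sum>b\<in>Basis. (v \<bullet> b) *\<^sub>R dir_deriv b f z) \<le> DIM('a) * B"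
    if z: "z \<in> closed_segment x y" for z
  proof (rule onorm_le)
    fix v :: 'a
    have "norm (\<Sum>b\<in>Basis. (v \<bullet> b) *\<^sub>R dir_deriv b f z) \<le> (\<Sum>b\<in>(Basis :: 'a set). norm v * B)"
    proof (rule sum_norm_le)
      fix b :: 'a assume b: "b \<in> Basis"
      show "norm ((v \<bullet> b) *\<^sub>R dir_deriv b f z) \<le> norm v * B"
        unfolding norm_scaleR
        by (rule mult_mono[OF Basis_le_norm[OF b] assms(2)[OF z b]]) auto
    qed
    also have "\<dots> = DIM('a) * B * norm v" by simp
    finally show "norm (\<Sum>b\<in>Basis. (v \<bullet> b) *\<^sub>R dir_deriv b f z) \<le> DIM('a) * B * norm v" .
  qed
qed (rule convex_closed_segment ends_in_segment)+

lemma taylor_quadratic_remainder: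
  fixes f :: "'a::euclidean_space \<Rightarrow> 'b::real_normed_vector" and B :: real
  assumes "smooth f"
    and B: "\<And>z b c. z \<in> closed_segment x y \<Longrightarrow> b \<in> Basis \<Longrightarrow> c \<in> Basis \<Longrightarrow>
      norm (dir_deriv c (dir_deriv b f) z) \<le> B"
  shows "norm (f y - f x - (\<Sum>b\<in>Basis. ((y - x) \<bullet> b) *\<^sub>R dir_deriv b f x))
    \<le> (DIM('a))\<^sup>2 * B * (norm (y - x))\<^sup>2"
proof -
  let ?l = "\<lambda>z. \<Sum>b\<in>Basis. ((z - x) \<bullet> b) *\<^sub>R dir_deriv b f x"
  let ?g = "\<lambda>z. f z - ?l z"
  have der: "(?g has_derivative (\<lambda>v. (\<Sum>b\<in>Basis. (v \<bullet> b) *\<^sub>R dir_deriv b f z)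
      - (\<Sum>b\<in>Basis. (v \<bullet> b) *\<^sub>R dir_deriv b f x))) (at z)" for z
    by (intro has_derivative_diff has_derivative_dir_deriv smoothD assms(1))
      (auto intro!: derivative_eq_intros)
  have dg: "dir_deriv b ?g z = dir_deriv b f z - dir_deriv b f x" if "b \<in> Basis" for b z
    using that by (subst dir_deriv_eqI[OF der]) (simp add: inner_Basis if_distrib if_distribR cong: if_cong)
  have "norm (?g y - ?g x) \<le> DIM('a) * (DIM('a) * B * norm (y - x)) * norm (y - x)"
  proof (rule norm_diff_le_dir_deriv_bound)
    show "?g differentiable at z" for z using der by (rule differentiableI)
    fix z b assume z: "z \<in> closed_segment x y" and b: "(b::'a) \<in> Basis"
    have B0: "0 \<le> B" using B[OF z b b] norm_ge_zero order_trans by blast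
    have sub: "closed_segment x z \<subseteq> closed_segment x y" using z by (simp add: subset_closed_segment)
    have "norm (dir_deriv b f z - dir_deriv b f x) \<le> DIM('a) * B * norm (z - x)"
      by (rule norm_diff_le_dir_deriv_bound)
        (use B b assms(1) sub in \<open>auto intro!: smoothD smooth_dir_deriv\<close>)
    also have "\<dots> \<le> DIM('a) * B * norm (y - x)"
      using segment_bound1[OF z] B0 by (intro mult_left_mono) (auto simp: norm_minus_commute)
    finally show "norm (dir_deriv b ?g z) \<le> DIM('a) * B * norm (y - x)" using dg[OF b] by simp
  qed
  moreover have eq: "f y - f x - ?l y = ?g y - ?g x" by simp
  ultimately show ?thesis unfolding eq by (simp add: power2_eq_square mult_ac)
qed

section \<open>Integration on Euclidean space\<close>

lemma lborel_nn_integral_affine: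
  fixes f :: "'a::euclidean_space \<Rightarrow> ennreal"
  assumes [measurable]: "f \<in> borel_measurable borel" and c: "c \<noteq> 0"
  shows "(\<integral>\<^sup>+x. f x \<partial>lborel) = \<bar>c\<bar> ^ DIM('a) * (\<integral>\<^sup>+x. f (t + c *\<^sub>R x) \<partial>lborel)"
  by (subst lborel_affine[OF c, of t])
    (simp add: nn_integral_density nn_integral_distr nn_integral_cmult ennreal_power)

lemma lborel_integrable_affine:
  fixes f :: "'a::euclidean_space \<Rightarrow> 'b::{banach, second_countable_topology}"
  assumes f: "integrable lborel f" and c: "c \<noteq> 0"
  shows "integrable lborel (\<lambda>x. f (t + c *\<^sub>R x))"
proof -
  have [measurable]: "f \<in> borel_measurable borel" using f by (auto dest: borel_measurable_integrable)
  have "(\<integral>\<^sup>+x. norm (f x) \<partial>lborel) < \<infinity>" using f by (simp add: integrable_iff_bounded)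
  then have "(\<integral>\<^sup>+x. norm (f (t + c *\<^sub>R x)) \<partial>lborel) < \<infinity>"
    using c by (subst (asm) lborel_nn_integral_affine[OF _ c, where t=t])
      (auto simp: ennreal_mult_less_top ennreal_mult_eq_top_iff)
  then show ?thesis by (simp add: integrable_iff_bounded)
qed

lemma lborel_integral_affine:
  fixes f :: "'a::euclidean_space \<Rightarrow> 'b::{banach, second_countable_topology}"
  assumes [measurable]: "f \<in> borel_measurable borel" and c: "c \<noteq> 0"
  shows "(\<integral>x. f x \<partial>lborel) = \<bar>c\<bar> ^ DIM('a) *\<^sub>R (\<integral>x. f (t + c *\<^sub>R x) \<partial>lborel)"
  by (subst lborel_affine[OF c, of t])
    (simp add: integral_density integral_distr)

lemma lborel_nn_integral_translate:
  fixes f :: "'a::euclidean_space \<Rightarrow> ennreal"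
  assumes "f \<in> borel_measurable borel"
  shows "(\<integral>\<^sup>+x. f (x + a) \<partial>lborel) = (\<integral>\<^sup>+x. f x \<partial>lborel)"
  using lborel_nn_integral_affine[OF assms, of 1 a] by (simp add: add.commute)

lemma lborel_nn_integral_reflect:
  fixes f :: "'a::euclidean_space \<Rightarrow> ennreal"
  assumes "f \<in> borel_measurable borel"
  shows "(\<integral>\<^sup>+x. f (a - x) \<partial>lborel) = (\<integral>\<^sup>+x. f x \<partial>lborel)"
  using lborel_nn_integral_affine[OF assms, of "-1" a] by simp

lemma lborel_integral_translate:
  fixes f :: "'a::euclidean_space \<Rightarrow> 'b::{banach, second_countable_topology}"
  assumes "f \<in> borel_measurable borel"
  shows "(\<integral>x. f (x + a) \<partial>lborel) = (\<integral>x. f x \<partial>lborel)"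
  using lborel_integral_affine[OF assms, of 1 a] by (simp add: add.commute)

lemma lborel_integral_reflect:
  fixes f :: "'a::euclidean_space \<Rightarrow> 'b::{banach, second_countable_topology}"
  assumes "f \<in> borel_measurable borel"
  shows "(\<integral>x. f (a - x) \<partial>lborel) = (\<integral>x. f x \<partial>lborel)"
  using lborel_integral_affine[OF assms, of "-1" a] by simp

lemma lborel_integrable_translate:
  fixes f :: "'a::euclidean_space \<Rightarrow> 'b::{banach, second_countable_topology}"
  shows "integrable lborel f \<Longrightarrow> integrable lborel (\<lambda>x. f (x + a))"
  using lborel_integrable_affine[of f 1 a] by (simp add: add.commute)

lemma lborel_integrable_reflect:
  fixes f :: "'a::euclidean_space \<Rightarrow> 'b::{banach, second_countable_topology}"
  shows "integrable lborel f \<Longrightarrow> integrable lborel (\<lambda>x. f (a - x))"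
  using lborel_integrable_affine[of f "-1" a] by simp

lemma nn_integral_inverse_square_real_finite:
  "(\<integral>\<^sup>+t. ennreal (1 / (1 + \<bar>t\<bar>)\<^sup>2) \<partial>(lborel :: real measure)) < \<infinity>"
proof -
  let ?g = "\<lambda>t::real. ennreal (1 / (1 + \<bar>t\<bar>)\<^sup>2) * indicator {0..} t"
  have "?g = (\<lambda>t. ennreal (1 / (1 + t)\<^sup>2) * indicator {0..} t)"
    by (auto split: split_indicator)
  moreover have "(\<integral>\<^sup>+t. ennreal (1 / (1 + t)\<^sup>2) * indicator {0..} t \<partial>lborel) = ennreal (0 - (- 1 / (1 + 0::real)))"
  proof (rule nn_integral_FTC_atLeast)
    show "((\<lambda>t::real. - 1 / (1 + t)) has_real_derivative 1 / (1 + x)\<^sup>2) (at x)" if "0 \<le> x" for x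
      using that by (auto intro!: derivative_eq_intros simp: power2_eq_square field_simps)
    show "((\<lambda>t::real. - 1 / (1 + t)) \<longlongrightarrow> 0) at_top" by real_asymp
  qed auto
  ultimately have g: "(\<integral>\<^sup>+t. ?g t \<partial>lborel) < \<infinity>" by simp
  have "(\<integral>\<^sup>+t. ennreal (1 / (1 + \<bar>t\<bar>)\<^sup>2) \<partial>(lborel :: real measure)) \<le> (\<integral>\<^sup>+t. ?g t + ?g (0 - t) \<partial>lborel)"
    by (intro nn_integral_mono) (auto split: split_indicator)
  also have "\<dots> = (\<integral>\<^sup>+t. ?g t \<partial>lborel) + (\<integral>\<^sup>+t. ?g (0 - t) \<partial>lborel)"
    by (rule nn_integral_add) auto
  also have "(\<integral>\<^sup>+t. ?g (0 - t) \<partial>lborel) = (\<integral>\<^sup>+t. ?g t \<partial>lborel)"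
    by (rule lborel_nn_integral_reflect) auto
  finally show ?thesis using g by (auto intro: le_less_trans)
qed

lemma one_plus_norm_pos [simp]: "0 < 1 + norm x" and one_plus_norm_neq_0 [simp]: "1 + norm x \<noteq> 0"
  using norm_ge_zero[of x] by linarith+

definition weight :: "nat \<Rightarrow> 'a::euclidean_space \<Rightarrow> real" where
  "weight N x = 1 / (1 + norm x) ^ N"

lemma weight_pos [simp]: "0 < weight N x" and weight_nonneg [simp]: "0 \<le> weight N x"
  and weight_le_1: "weight N x \<le> 1"
  by (auto simp: weight_def add_pos_nonneg intro!: divide_le_eq_1_pos[THEN iffD2] one_le_power)

lemma weight_mult: "weight (M + N) x = weight M x * weight N x"
  by (simp add: weight_def power_add)

lemma weight_antimono: "M \<le> N \<Longrightarrow> weight N x \<le> weight M x"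
  by (auto simp: weight_def intro!: divide_left_mono power_increasing mult_pos_pos zero_less_power add_pos_nonneg)

lemma weight_minus [simp]: "weight N (- x) = weight N x"
  by (simp add: weight_def)

lemma weight_measurable [measurable]: "weight N \<in> borel_measurable borel"
  unfolding weight_def by measurable

lemma one_plus_norm_add_le: "1 + norm (x + y) \<le> (1 + norm x) * (1 + norm y)"
  using norm_triangle_ineq[of x y] by (auto simp: algebra_simps intro: order_trans)

lemma weight_submult: "weight N x * weight N y \<le> weight N (x + y)"
proof -
  have "(1 + norm (x + y)) ^ N \<le> ((1 + norm x) * (1 + norm y)) ^ N"
    by (intro power_mono one_plus_norm_add_le) auto
  then show ?thesis
    by (auto simp: weight_def power_mult_distrib add_pos_nonneg
        intro!: divide_left_mono mult_pos_pos zero_less_power)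
qed

lemma weight_shift_le: "weight N x \<le> (1 + norm y) ^ N * weight N (x + y)"
proof -
  have p: "0 < (1 + norm y) ^ N" by (simp add: add_pos_nonneg)
  have "weight N x * weight N y \<le> weight N (x + y)" by (rule weight_submult)
  then have "weight N x / (1 + norm y) ^ N \<le> weight N (x + y)" by (simp add: weight_def)
  with p show ?thesis by (simp add: pos_divide_le_eq mult.commute)
qed

text \<open>The weight is dominated by the product over the coordinates of \<open>1 / (1 + \<bar>t\<bar>)\<^sup>2\<close>, one square
  for each dimension.\<close>

lemma nn_integral_weight_finite:
  "(\<integral>\<^sup>+x. ennreal (weight (2 * DIM('a)) x) \<partial>(lborel :: 'a::euclidean_space measure)) < \<infinity>"
proof -
  have "weight (2 * DIM('a)) x \<le> (\<Prod>b\<in>Basis. 1 / (1 + \<bar>x \<bullet> b\<bar>)\<^sup>2)" for x :: 'a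
  proof -
    have "weight (2 * DIM('a)) x = (\<Prod>b\<in>(Basis :: 'a set). 1 / (1 + norm x)\<^sup>2)"
      by (simp add: weight_def power_mult power_one_over)
    also have "\<dots> \<le> (\<Prod>b\<in>Basis. 1 / (1 + \<bar>x \<bullet> b\<bar>)\<^sup>2)"
      by (intro prod_mono) (auto simp: Basis_le_norm add_pos_nonneg intro!: divide_left_mono power_mono mult_pos_pos)
    finally show ?thesis .
  qed
  then have "(\<integral>\<^sup>+x. ennreal (weight (2 * DIM('a)) x) \<partial>(lborel :: 'a measure))
      \<le> (\<integral>\<^sup>+x. (\<Prod>b\<in>Basis. ennreal (1 / (1 + \<bar>x \<bullet> b\<bar>)\<^sup>2)) \<partial>(lborel :: 'a measure))"
    by (intro nn_integral_mono) (simp add: prod_ennreal ennreal_leI)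
  also have "\<dots> = (\<Prod>b\<in>(Basis :: 'a set). \<integral>\<^sup>+t. ennreal (1 / (1 + \<bar>t\<bar>)\<^sup>2) \<partial>lborel)"
    by (rule nn_integral_lborel_prod) auto
  also have "\<dots> < \<infinity>"
    using nn_integral_inverse_square_real_finite
    by (simp add: power_less_top_ennreal)
  finally show ?thesis .
qed

lemma integrable_weight:
  assumes "2 * DIM('a) \<le> N"
  shows "integrable lborel (weight N :: 'a::euclidean_space \<Rightarrow> real)"
proof (rule Bochner_Integration.integrable_bound[where f="weight (2 * DIM('a))"])
  show "integrable lborel (weight (2 * DIM('a)) :: 'a \<Rightarrow> real)"
    using nn_integral_weight_finite[where 'a='a] by (simp add: integrable_iff_bounded)
  show "AE x in lborel. norm (weight N x :: real) \<le> norm (weight (2 * DIM('a)) (x :: 'a))"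
    using assms by (auto intro: weight_antimono)
qed simp

text \<open>Functions all of whose moments exist; this class contains the Schwartz functions and the
  bounded measurable functions of compact support, and the Fourier transform maps it to smooth
  functions.\<close>

definition moments :: "('a::euclidean_space \<Rightarrow> complex) \<Rightarrow> bool" where
  "moments f \<longleftrightarrow> f \<in> borel_measurable borel \<and>
     (\<forall>N. integrable lborel (\<lambda>x. (1 + norm x) ^ N * norm (f x)))"

lemma moments_measurable: "moments f \<Longrightarrow> f \<in> borel_measurable borel"
  by (simp add: moments_def)

lemma moments_integrable_power: "moments f \<Longrightarrow> integrable lborel (\<lambda>x. (1 + norm x) ^ N * norm (f x))"
  by (simp add: moments_def)

lemma moments_integrable: "moments f \<Longrightarrow> integrable lborel f"
  using moments_integrable_power[of f 0] by (auto simp: moments_def integrable_iff_bounded)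

lemma integrable_moments_bound:
  fixes g :: "'a::euclidean_space \<Rightarrow> 'b::{banach, second_countable_topology}"
  assumes "moments f" "g \<in> borel_measurable borel"
    and "\<And>x. norm (g x) \<le> C * (1 + norm x) ^ N * norm (f x)"
  shows "integrable lborel g"
proof (rule Bochner_Integration.integrable_bound)
  show "integrable lborel (\<lambda>x. C * ((1 + norm x) ^ N * norm (f x)))"
    using assms(1) by (intro integrable_mult_right moments_integrable_power)
  show "AE x in lborel. norm (g x) \<le> norm (C * ((1 + norm x) ^ N * norm (f x)))"
    using assms(3) by (auto intro!: AE_I2 order_trans[OF assms(3)] simp: mult.assoc)
qed (use assms in simp)

lemma moments_mult_bound:
  assumes "moments f" "m \<in> borel_measurable borel" "\<And>x. norm (m x) \<le> C * (1 + norm x) ^ N"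
  shows "moments (\<lambda>x. m x * f x)"
  unfolding moments_def
proof (intro conjI allI)
  have [measurable]: "f \<in> borel_measurable borel" "m \<in> borel_measurable borel"
    using assms by (auto simp: moments_def)
  show "(\<lambda>x. m x * f x) \<in> borel_measurable borel" by simp
  show "integrable lborel (\<lambda>x. (1 + norm x) ^ K * norm (m x * f x))" for K
  proof (rule integrable_moments_bound[OF assms(1), where C=C and N="K + N"])
    fix x
    have "(1 + norm x) ^ K * (norm (m x) * norm (f x))
        \<le> (1 + norm x) ^ K * (C * (1 + norm x) ^ N * norm (f x))"
      by (intro mult_left_mono mult_right_mono assms) auto
    then show "norm ((1 + norm x) ^ K * norm (m x * f x)) \<le> C * (1 + norm x) ^ (K + N) * norm (f x)"
      by (simp add: norm_mult power_add mult_ac abs_mult)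
  qed simp
qed

section \<open>The Schwartz space\<close>

lemma schwartz_smooth: "f \<in> schwartz \<Longrightarrow> smooth f"
  by (simp add: schwartz_def)

lemma schwartz_iter_deriv_bdd:
  "f \<in> schwartz \<Longrightarrow> set bs \<subseteq> Basis \<Longrightarrow> \<exists>C. \<forall>x. (1 + norm x) ^ N * norm (iter_deriv bs f x) \<le> C"
  by (auto simp: schwartz_def)

lemma schwartz_iter_deriv: "f \<in> schwartz \<Longrightarrow> set bs \<subseteq> Basis \<Longrightarrow> iter_deriv bs f \<in> schwartz"
proof -
  assume f: "f \<in> schwartz" and bs: "set bs \<subseteq> Basis"
  have "iter_deriv cs (iter_deriv bs f) = iter_deriv (cs @ bs) f" for cs
    by (simp add: iter_deriv_def)
  then show ?thesis
    using f bs by (auto simp: schwartz_def smooth_iter_deriv intro!: schwartz_iter_deriv_bdd[OF f])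
qed

lemma schwartz_dir_deriv: "f \<in> schwartz \<Longrightarrow> b \<in> Basis \<Longrightarrow> dir_deriv b f \<in> schwartz"
  using schwartz_iter_deriv[of f "[b]"] by (simp add: iter_deriv_Cons)

lemma schwartz_seminorm_ge:
  assumes "f \<in> schwartz" "set bs \<subseteq> Basis" "length bs \<le> N"
  shows "(1 + norm x) ^ N * norm (iter_deriv bs f x) \<le> schwartz_seminorm N f"
proof -
  let ?L = "{bs. set bs \<subseteq> (Basis :: 'a set) \<and> length bs \<le> N}"
  have fin: "finite ?L" by (rule finite_lists_length_le) simp
  have "\<forall>bs\<in>?L. \<exists>C. \<forall>x. (1 + norm x) ^ N * norm (iter_deriv bs f x) \<le> C"
    using schwartz_iter_deriv_bdd[OF assms(1)] by auto
  then obtain C where C: "\<And>bs x. bs \<in> ?L \<Longrightarrow> (1 + norm x) ^ N * norm (iter_deriv bs f x) \<le> C bs"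
    by metis
  have "C bs \<le> Max (C ` ?L)" if "bs \<in> ?L" for bs using that fin by auto
  then have "bdd_above ((\<lambda>(bs, x). (1 + norm x) ^ N * norm (iter_deriv bs f x)) ` (?L \<times> UNIV))"
    by (intro bdd_aboveI2[where M="Max (C ` ?L)"]) (use C in \<open>fastforce intro: order_trans\<close>)
  then show ?thesis
    unfolding schwartz_seminorm_def
    using cSUP_upper[of "(bs, x)" "?L \<times> UNIV" "\<lambda>(bs, x). (1 + norm x) ^ N * norm (iter_deriv bs f x)"]
      assms(2,3) by auto
qed

lemma schwartz_seminorm_ge_weight:
  assumes "f \<in> schwartz" "set bs \<subseteq> Basis" "length bs \<le> N"
  shows "norm (iter_deriv bs f x) \<le> schwartz_seminorm N f * weight N x"
  using schwartz_seminorm_ge[OF assms, of x]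
  by (simp add: weight_def pos_le_divide_eq add_pos_nonneg mult.commute)

lemma schwartz_norm_le: "f \<in> schwartz \<Longrightarrow> norm (f x) \<le> schwartz_seminorm N f * weight N x"
  using schwartz_seminorm_ge_weight[of f "[]" N x] by simp

lemma schwartz_seminorm_le:
  assumes "\<And>bs x. set bs \<subseteq> Basis \<Longrightarrow> length bs \<le> N \<Longrightarrow> (1 + norm x) ^ N * norm (iter_deriv bs f x) \<le> C"
  shows "schwartz_seminorm N f \<le> C"
  unfolding schwartz_seminorm_def
proof (rule cSUP_least)
  have "([], 0) \<in> {bs. set bs \<subseteq> (Basis :: 'a set) \<and> length bs \<le> N} \<times> UNIV" by simp
  then show "{bs. set bs \<subseteq> (Basis :: 'a set) \<and> length bs \<le> N} \<times> (UNIV :: 'a set) \<noteq> {}" by blast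
qed (use assms in auto)

lemma schwartz_seminorm_nonneg: "f \<in> schwartz \<Longrightarrow> 0 \<le> schwartz_seminorm N f"
  using order_trans[OF _ schwartz_seminorm_ge[of f "[]" N 0]] by simp

lemma schwartz_seminorm_mono:
  assumes "f \<in> schwartz" "M \<le> N"
  shows "schwartz_seminorm M f \<le> schwartz_seminorm N f"
proof (rule schwartz_seminorm_le)
  fix bs x assume bs: "set bs \<subseteq> (Basis :: 'a set)" "length bs \<le> M"
  have "(1 + norm x) ^ M * norm (iter_deriv bs f x) \<le> (1 + norm x) ^ N * norm (iter_deriv bs f x)"
    using assms by (intro mult_right_mono power_increasing) auto
  also have "\<dots> \<le> schwartz_seminorm N f" using bs assms by (intro schwartz_seminorm_ge) auto
  finally show "(1 + norm x) ^ M * norm (iter_deriv bs f x) \<le> schwartz_seminorm N f" .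
qed

lemma schwartz_seminorm_dir_deriv:
  assumes "f \<in> schwartz" "b \<in> Basis"
  shows "schwartz_seminorm N (dir_deriv b f) \<le> schwartz_seminorm (Suc N) f"
proof (rule schwartz_seminorm_le)
  fix bs x assume bs: "set bs \<subseteq> (Basis :: 'a set)" "length bs \<le> N"
  have "(1 + norm x) ^ N * norm (iter_deriv bs (dir_deriv b f) x)
      \<le> (1 + norm x) ^ Suc N * norm (iter_deriv (bs @ [b]) f x)"
    unfolding iter_deriv_snoc by (intro mult_right_mono power_increasing) auto
  also have "\<dots> \<le> schwartz_seminorm (Suc N) f" using bs assms by (intro schwartz_seminorm_ge) auto
  finally show "(1 + norm x) ^ N * norm (iter_deriv bs (dir_deriv b f) x) \<le> schwartz_seminorm (Suc N) f" .
qed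

lemma schwartzI:
  assumes "smooth f" "\<And>bs N. set bs \<subseteq> Basis \<Longrightarrow> \<exists>C. \<forall>x. (1 + norm x) ^ N * norm (iter_deriv bs f x) \<le> C"
  shows "f \<in> schwartz"
  using assms by (auto simp: schwartz_def)

lemma schwartz_cmult: "f \<in> schwartz \<Longrightarrow> (\<lambda>x. c * f x) \<in> schwartz"
proof (rule schwartzI)
  assume f: "f \<in> schwartz"
  then show "smooth (\<lambda>x. c * f x)" by (intro smooth_mult smooth_const schwartz_smooth)
  fix bs :: "'a list" and N assume bs: "set bs \<subseteq> Basis"
  obtain C where C: "\<And>x. (1 + norm x) ^ N * norm (iter_deriv bs f x) \<le> C"
    using schwartz_iter_deriv_bdd[OF f bs] by blast
  have "(1 + norm x) ^ N * norm (iter_deriv bs (\<lambda>x. c * f x) x) \<le> norm c * C" for x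
    using mult_left_mono[OF C[of x], of "norm c"]
    by (simp add: smooth_iter_deriv_cmult schwartz_smooth f bs norm_mult mult_ac)
  then show "\<exists>C. \<forall>x. (1 + norm x) ^ N * norm (iter_deriv bs (\<lambda>x. c * f x) x) \<le> C" by blast
qed

lemma schwartz_add: "f \<in> schwartz \<Longrightarrow> g \<in> schwartz \<Longrightarrow> (\<lambda>x. f x + g x) \<in> schwartz"
proof (rule schwartzI)
  assume f: "f \<in> schwartz" and g: "g \<in> schwartz"
  then show "smooth (\<lambda>x. f x + g x)" by (intro smooth_add schwartz_smooth)
  fix bs :: "'a list" and N assume bs: "set bs \<subseteq> Basis"
  obtain C D where C: "\<And>x. (1 + norm x) ^ N * norm (iter_deriv bs f x) \<le> C"
    and D: "\<And>x. (1 + norm x) ^ N * norm (iter_deriv bs g x) \<le> D"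
    using schwartz_iter_deriv_bdd[OF f bs] schwartz_iter_deriv_bdd[OF g bs] by metis
  have "(1 + norm x) ^ N * norm (iter_deriv bs f x + iter_deriv bs g x)
      \<le> (1 + norm x) ^ N * (norm (iter_deriv bs f x) + norm (iter_deriv bs g x))" for x
    by (intro mult_left_mono norm_triangle_ineq) auto
  then have "(1 + norm x) ^ N * norm (iter_deriv bs (\<lambda>x. f x + g x) x) \<le> C + D" for x
    using C[of x] D[of x] unfolding smooth_iter_deriv_add[OF schwartz_smooth[OF f] schwartz_smooth[OF g] bs]
    by (smt (verit) distrib_left)
  then show "\<exists>C. \<forall>x. (1 + norm x) ^ N * norm (iter_deriv bs (\<lambda>x. f x + g x) x) \<le> C" by blast
qed

lemma schwartz_zero: "(\<lambda>x. 0) \<in> schwartz"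
proof -
  have "iter_deriv bs (\<lambda>x. 0 :: complex) = (\<lambda>x. 0)" for bs :: "'a list"
    by (induction bs) (auto simp: iter_deriv_Cons)
  then show ?thesis by (intro schwartzI) (auto intro: smooth_const)
qed

lemma schwartz_sum: "(\<And>i. i \<in> I \<Longrightarrow> f i \<in> schwartz) \<Longrightarrow> (\<lambda>x. \<Sum>i\<in>I. f i x) \<in> schwartz"
  by (induction I rule: infinite_finite_induct) (auto intro: schwartz_zero schwartz_add)

lemma schwartz_diff: "f \<in> schwartz \<Longrightarrow> g \<in> schwartz \<Longrightarrow> (\<lambda>x. f x - g x) \<in> schwartz"
  using schwartz_add[of f "\<lambda>x. (-1) * g x"] schwartz_cmult[of g "-1"] by simp

lemma schwartz_iter_deriv_diff:
  assumes "f \<in> schwartz" "g \<in> schwartz" "set bs \<subseteq> Basis"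
  shows "iter_deriv bs (\<lambda>x. f x - g x) x = iter_deriv bs f x - iter_deriv bs g x"
proof -
  have "smooth (\<lambda>x. (-1) * g x)" by (intro schwartz_smooth schwartz_cmult assms)
  from smooth_iter_deriv_add[OF schwartz_smooth[OF assms(1)] this assms(3)]
  show ?thesis
    unfolding smooth_iter_deriv_cmult[OF schwartz_smooth[OF assms(2)] assms(3)] by simp
qed

lemma schwartz_dilate_translate:
  assumes "f \<in> schwartz" "c \<noteq> 0"
  shows "(\<lambda>x. f (c *\<^sub>R x + a)) \<in> schwartz"
proof (rule schwartzI)
  let ?y = "\<lambda>x. c *\<^sub>R x + a"
  show "smooth (\<lambda>x. f (?y x))"
    by (intro smooth_dilate_translate schwartz_smooth assms)
  fix bs :: "'a list" and N assume bs: "set bs \<subseteq> Basis"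
  obtain C where C: "\<And>x. (1 + norm x) ^ N * norm (iter_deriv bs f x) \<le> C"
    using schwartz_iter_deriv_bdd[OF assms(1) bs] by blast
  let ?K = "(1 + 1 / \<bar>c\<bar>) ^ N * (1 + norm a) ^ N"
  have "(1 + norm x) ^ N * norm (iter_deriv bs (\<lambda>x. f (?y x)) x) \<le> ?K * (\<bar>c\<bar> ^ length bs * C)" for x
  proof -
    have nx: "norm x = norm ((?y x) - a) / \<bar>c\<bar>" using assms(2) by simp
    also have "\<dots> \<le> (norm (?y x) + norm a) / \<bar>c\<bar>"
      by (intro divide_right_mono norm_triangle_ineq4) auto
    finally have "1 + norm x \<le> 1 + 1 / \<bar>c\<bar> * (norm (?y x) + norm a)" by simp
    also have "\<dots> \<le> (1 + 1 / \<bar>c\<bar>) * ((1 + norm a) * (1 + norm (?y x)))"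
      by (simp add: algebra_simps add_nonneg_nonneg)
    finally have "(1 + norm x) ^ N \<le> ((1 + 1 / \<bar>c\<bar>) * ((1 + norm a) * (1 + norm (?y x)))) ^ N"
      by (intro power_mono) auto
    then have "(1 + norm x) ^ N \<le> ?K * (1 + norm (?y x)) ^ N"
      by (simp add: power_mult_distrib mult_ac)
    then have "(1 + norm x) ^ N * (\<bar>c\<bar> ^ length bs * norm (iter_deriv bs f (?y x)))
      \<le> ?K * (1 + norm (?y x)) ^ N * (\<bar>c\<bar> ^ length bs * norm (iter_deriv bs f (?y x)))"
      by (intro mult_right_mono) auto
    also have "\<dots> = ?K * \<bar>c\<bar> ^ length bs * ((1 + norm (?y x)) ^ N * norm (iter_deriv bs f (?y x)))"
      by (simp add: mult_ac)
    also have "\<dots> \<le> ?K * \<bar>c\<bar> ^ length bs * C" by (intro mult_left_mono C) auto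
    finally show ?thesis
      by (simp add: iter_deriv_dilate_translate[OF schwartz_smooth[OF assms(1)] bs] power_abs mult_ac)
  qed
  then show "\<exists>C. \<forall>x. (1 + norm x) ^ N * norm (iter_deriv bs (\<lambda>x. f (?y x)) x) \<le> C" by blast
qed

lemma schwartz_translate: "f \<in> schwartz \<Longrightarrow> (\<lambda>x. f (x - a)) \<in> schwartz"
  using schwartz_dilate_translate[of f 1 "- a"] by simp

lemma schwartz_reflect: "f \<in> schwartz \<Longrightarrow> (\<lambda>x. f (- x)) \<in> schwartz"
  using schwartz_dilate_translate[of f "-1" 0] by simp

lemma iter_deriv_translate:
  "smooth f \<Longrightarrow> set bs \<subseteq> Basis \<Longrightarrow> iter_deriv bs (\<lambda>x. f (x - a)) = (\<lambda>x. iter_deriv bs f (x - a))"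
  using iter_deriv_dilate_translate[of f bs 1 "- a"] by simp

lemma smooth_translate: "smooth f \<Longrightarrow> smooth (\<lambda>x. f (x - a))"
  using smooth_dilate_translate[of f 1 "- a"] by simp

lemma schwartz_seminorm_reflect:
  assumes "f \<in> schwartz"
  shows "schwartz_seminorm N (\<lambda>x. f (- x)) \<le> schwartz_seminorm N f"
proof (rule schwartz_seminorm_le)
  fix bs :: "'a list" and x assume bs: "set bs \<subseteq> Basis" "length bs \<le> N"
  show "(1 + norm x) ^ N * norm (iter_deriv bs (\<lambda>x. f (- x)) x) \<le> schwartz_seminorm N f"
    using schwartz_seminorm_ge[OF assms bs, of "- x"]
      iter_deriv_dilate_translate[OF schwartz_smooth[OF assms] bs(1), of "-1" 0]
    by (simp add: power_abs)
qed

lemma schwartz_seminorm_translate: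
  assumes "f \<in> schwartz"
  shows "schwartz_seminorm N (\<lambda>x. f (x - a)) \<le> (1 + norm a) ^ N * schwartz_seminorm N f"
proof (rule schwartz_seminorm_le)
  fix bs :: "'a list" and x assume bs: "set bs \<subseteq> Basis" "length bs \<le> N"
  have "1 + norm x \<le> (1 + norm a) * (1 + norm (x - a))"
    using one_plus_norm_add_le[of a "x - a"] by simp
  then have "(1 + norm x) ^ N \<le> ((1 + norm a) * (1 + norm (x - a))) ^ N" by (intro power_mono) auto
  then have "(1 + norm x) ^ N * norm (iter_deriv bs f (x - a)) \<le>
      (1 + norm a) ^ N * ((1 + norm (x - a)) ^ N * norm (iter_deriv bs f (x - a)))"
    unfolding power_mult_distrib mult.assoc[symmetric] by (intro mult_right_mono) auto
  also have "\<dots> \<le> (1 + norm a) ^ N * schwartz_seminorm N f"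
    by (intro mult_left_mono schwartz_seminorm_ge assms bs) auto
  finally show "(1 + norm x) ^ N * norm (iter_deriv bs (\<lambda>x. f (x - a)) x)
      \<le> (1 + norm a) ^ N * schwartz_seminorm N f"
    by (simp add: iter_deriv_translate schwartz_smooth assms bs)
qed

lemma schwartz_compose_isometry:
  assumes "bounded_linear A" "A ` Basis \<subseteq> Basis" "\<And>x. norm (A x) = norm x" "f \<in> schwartz"
  shows "(\<lambda>x. f (A x)) \<in> schwartz"
proof (rule schwartzI)
  show "smooth (\<lambda>x. f (A x))" by (rule smooth_compose_linear[OF assms(1,2) schwartz_smooth[OF assms(4)]])
  fix bs :: "'a list" and N assume bs: "set bs \<subseteq> Basis"
  then have "set (map A bs) \<subseteq> Basis" using assms(2) by auto
  then obtain C where C: "\<And>x. (1 + norm x) ^ N * norm (iter_deriv (map A bs) f x) \<le> C"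
    using schwartz_iter_deriv_bdd[OF assms(4)] by blast
  show "\<exists>C. \<forall>x. (1 + norm x) ^ N * norm (iter_deriv bs (\<lambda>x. f (A x)) x) \<le> C"
    using C[of "A _"] bs by (intro exI[of _ C])
      (simp add: iter_deriv_compose_linear[OF assms(1,2) schwartz_smooth[OF assms(4)]] assms(3))
qed

text \<open>The quantitative form of the fact that Schwartz functions may be multiplied by smooth
  functions of polynomial growth. A multiplier concentrated near a point \<open>k\<close> fits it too: its
  derivatives are bounded by \<open>C / (1 + norm (x - k)) ^ M \<le> C / (1 + norm k) ^ M * (1 + norm x) ^ M\<close>,
  so that the product has seminorms that decay in \<open>k\<close>.\<close>

lemma schwartz_seminorm_mult:
  assumes h: "h \<in> schwartz" and m: "smooth m"
    and B: "\<And>cs x. set cs \<subseteq> Basis \<Longrightarrow> length cs \<le> N \<Longrightarrow> norm (iter_deriv cs m x) \<le> B * (1 + norm x) ^ M"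
    and bs: "set bs \<subseteq> Basis" "length bs \<le> N"
  shows "(1 + norm x) ^ N * norm (iter_deriv bs (\<lambda>x. m x * h x) x) \<le> 2 ^ N * B * schwartz_seminorm (N + M) h"
proof -
  have B0: "0 \<le> B" using order_trans[OF norm_ge_zero B[of "[]" 0]] by simp
  let ?S = "schwartz_seminorm (N + M) h"
  have S0: "0 \<le> ?S" by (rule schwartz_seminorm_nonneg[OF h])
  have "norm (iter_deriv bs (\<lambda>x. m x * h x) x) \<le> 2 ^ length bs * ((B * (1 + norm x) ^ M) * (?S * weight (N + M) x))"
    using bs by (intro norm_iter_deriv_mult_le m schwartz_smooth h B schwartz_seminorm_ge_weight) auto
  also have "\<dots> \<le> 2 ^ N * ((B * (1 + norm x) ^ M) * (?S * weight (N + M) x))"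
    using bs B0 S0 by (intro mult_right_mono power_increasing mult_nonneg_nonneg) auto
  finally have "(1 + norm x) ^ N * norm (iter_deriv bs (\<lambda>x. m x * h x) x)
      \<le> (1 + norm x) ^ N * (2 ^ N * ((B * (1 + norm x) ^ M) * (?S * weight (N + M) x)))"
    by (rule mult_left_mono) auto
  also have "\<dots> = 2 ^ N * B * ?S * ((1 + norm x) ^ (N + M) * weight (N + M) x)"
    by (simp add: power_add mult_ac)
  also have "(1 + norm x) ^ (N + M) * weight (N + M) x = 1"
    by (simp add: weight_def add_pos_nonneg less_imp_neq[symmetric])
  finally show ?thesis by simp
qed

text \<open>The multipliers of the Schwartz space.\<close>

definition slow :: "('a::euclidean_space \<Rightarrow> complex) \<Rightarrow> bool" where
  "slow m \<longleftrightarrow> smooth m \<and>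
     (\<forall>bs. set bs \<subseteq> Basis \<longrightarrow> (\<exists>C N. \<forall>x. norm (iter_deriv bs m x) \<le> C * (1 + norm x) ^ N))"

lemma slow_uniform:
  assumes "slow m"
  obtains C M where "\<And>cs x. set cs \<subseteq> Basis \<Longrightarrow> length cs \<le> N \<Longrightarrow>
    norm (iter_deriv cs m x) \<le> C * (1 + norm x) ^ M"
proof -
  let ?L = "{bs. set bs \<subseteq> (Basis :: 'a set) \<and> length bs \<le> N}"
  have fin: "finite ?L" by (rule finite_lists_length_le) simp
  have "\<forall>bs\<in>?L. \<exists>C N. \<forall>x. norm (iter_deriv bs m x) \<le> C * (1 + norm x) ^ N"
    using assms by (auto simp: slow_def)
  then obtain C D where C: "\<And>bs x. bs \<in> ?L \<Longrightarrow> norm (iter_deriv bs m x) \<le> C bs * (1 + norm x) ^ D bs"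
    by metis
  have "norm (iter_deriv cs m x) \<le> Max (C ` ?L) * (1 + norm x) ^ Max (D ` ?L)" if "cs \<in> ?L" for cs x
  proof -
    have C0: "0 \<le> C cs" using order_trans[OF norm_ge_zero C[OF that, of 0]] by simp
    have m: "C cs \<le> Max (C ` ?L)" "D cs \<le> Max (D ` ?L)" using that fin by auto
    show ?thesis
      by (rule order_trans[OF C[OF that]]) (use m C0 in \<open>intro mult_mono power_increasing; simp\<close>)
  qed
  then show ?thesis using that by blast
qed

lemma schwartz_mult_slow:
  assumes "slow m" "h \<in> schwartz"
  shows "(\<lambda>x. m x * h x) \<in> schwartz"
proof (rule schwartzI)
  show "smooth (\<lambda>x. m x * h x)" using assms(1) by (intro smooth_mult schwartz_smooth[OF assms(2)]) (simp add: slow_def)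
  fix bs :: "'a list" and N assume bs: "set bs \<subseteq> Basis"
  obtain C M where C: "\<And>cs x. set cs \<subseteq> Basis \<Longrightarrow> length cs \<le> max N (length bs) \<Longrightarrow>
    norm (iter_deriv cs m x) \<le> C * (1 + norm x) ^ M"
    using slow_uniform[OF assms(1)] by blast
  have "(1 + norm x) ^ N * norm (iter_deriv bs (\<lambda>x. m x * h x) x)
      \<le> (1 + norm x) ^ max N (length bs) * norm (iter_deriv bs (\<lambda>x. m x * h x) x)" for x
    by (intro mult_right_mono power_increasing) auto
  also have "(1 + norm x) ^ max N (length bs) * norm (iter_deriv bs (\<lambda>x. m x * h x) x)
      \<le> 2 ^ max N (length bs) * C * schwartz_seminorm (max N (length bs) + M) h" for x
    using assms(1) bs by (intro schwartz_seminorm_mult[OF assms(2)] C) (auto simp: slow_def)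
  finally show "\<exists>C. \<forall>x. (1 + norm x) ^ N * norm (iter_deriv bs (\<lambda>x. m x * h x) x) \<le> C" by blast
qed

lemma slow_schwartz:
  assumes "f \<in> schwartz"
  shows "slow f"
  unfolding slow_def
proof (intro conjI allI impI)
  fix bs :: "'a list" assume "set bs \<subseteq> Basis"
  then obtain C where "\<And>x. norm (iter_deriv bs f x) \<le> C"
    using schwartz_iter_deriv_bdd[OF assms, of bs 0] by auto
  then have "\<forall>x. norm (iter_deriv bs f x) \<le> C * (1 + norm x) ^ 0" by simp
  then show "\<exists>C N. \<forall>x. norm (iter_deriv bs f x) \<le> C * (1 + norm x) ^ N" by (intro exI)
qed (rule schwartz_smooth[OF assms])

lemma schwartz_continuous: "f \<in> schwartz \<Longrightarrow> continuous_on UNIV f"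
  by (meson differentiable_imp_continuous_on differentiable_on_def differentiable_at_withinI
      smoothD schwartz_smooth)

lemma schwartz_measurable: "f \<in> schwartz \<Longrightarrow> f \<in> borel_measurable borel"
  by (intro borel_measurable_continuous_onI schwartz_continuous)

lemma moments_of_decay:
  fixes f :: "'a::euclidean_space \<Rightarrow> complex"
  assumes "f \<in> borel_measurable borel" "\<And>N. \<exists>C. \<forall>x. norm (f x) \<le> C * weight N x"
  shows "moments f"
  unfolding moments_def
proof (intro conjI allI assms(1))
  fix N
  obtain C where C: "\<And>x. norm (f x) \<le> C * weight (N + 2 * DIM('a)) x" using assms(2) by blast
  show "integrable lborel (\<lambda>x. (1 + norm x) ^ N * norm (f x))"
  proof (rule Bochner_Integration.integrable_bound)
    show "integrable lborel (\<lambda>x::'a. C * weight (2 * DIM('a)) x)"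
      by (intro integrable_mult_right integrable_weight) simp
    show "AE x in lborel. norm ((1 + norm x) ^ N * norm (f x)) \<le> norm (C * weight (2 * DIM('a)) x)"
    proof (rule AE_I2)
      fix x
      have "(1 + norm x) ^ N * norm (f x) \<le> (1 + norm x) ^ N * (C * weight (N + 2 * DIM('a)) x)"
        by (intro mult_left_mono C) auto
      also have "\<dots> = C * weight (2 * DIM('a)) x"
        by (simp add: weight_mult) (simp add: weight_def add_pos_nonneg less_imp_neq[symmetric])
      finally show "norm ((1 + norm x) ^ N * norm (f x)) \<le> norm (C * weight (2 * DIM('a)) x)" by simp
    qed
  qed (use assms(1) in simp)
qed

lemma schwartz_moments:
  assumes "f \<in> schwartz"
  shows "moments f"
proof (rule moments_of_decay)
  show "\<exists>C. \<forall>x. norm (f x) \<le> C * weight N x" for N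
    using schwartz_norm_le[OF assms, of _ N] by (intro exI allI)
qed (rule schwartz_measurable[OF assms])

lemma schwartz_integrable: "f \<in> schwartz \<Longrightarrow> integrable lborel f"
  by (intro moments_integrable schwartz_moments)

lemma schwartz_integral_norm_le:
  fixes f :: "'a::euclidean_space \<Rightarrow> complex"
  assumes "f \<in> schwartz"
  shows "(\<integral>x. norm (f x) \<partial>lborel) \<le> schwartz_seminorm (2 * DIM('a)) f * (\<integral>x. weight (2 * DIM('a)) (x::'a) \<partial>lborel)"
proof -
  have "(\<integral>x. norm (f x) \<partial>lborel) \<le> (\<integral>x. schwartz_seminorm (2 * DIM('a)) f * weight (2 * DIM('a)) (x::'a) \<partial>lborel)"
    by (intro integral_mono integrable_norm integrable_mult_right integrable_weight schwartz_integrable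
        schwartz_norm_le assms) simp
  then show ?thesis by simp
qed

section \<open>The Fourier transform on Schwartz functions\<close>

lemma fourier_cis: "fourier f \<xi> = (\<integral>x. cis (- 2 * pi * (x \<bullet> \<xi>)) * f x \<partial>lborel)"
  unfolding fourier_def by (simp add: cis_conv_exp mult_ac)

lemma inv_fourier_cis: "inv_fourier f x = (\<integral>\<xi>. cis (2 * pi * (x \<bullet> \<xi>)) * f \<xi> \<partial>lborel)"
  unfolding inv_fourier_def by (simp add: cis_conv_exp mult_ac)

lemma inv_fourier_eq: "inv_fourier f x = fourier f (- x)"
  unfolding fourier_cis inv_fourier_cis by (simp add: inner_commute)

lemma measurable_cis [measurable]: "cis \<in> borel_measurable borel"
  by (intro borel_measurable_continuous_onI continuous_on_cis continuous_on_id)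

lemma integrable_cis_mult:
  assumes "integrable M f" "g \<in> borel_measurable M"
  shows "integrable M (\<lambda>x. cis (g x) * f x)"
proof (rule Bochner_Integration.integrable_bound[OF assms(1)])
  have "f \<in> borel_measurable M" using assms(1) by (rule borel_measurable_integrable)
  with assms(2) show "(\<lambda>x. cis (g x) * f x) \<in> borel_measurable M" by measurable
qed (simp add: norm_mult)

lemma norm_fourier_le: "norm (fourier f \<xi>) \<le> (\<integral>x. norm (f x) \<partial>lborel)"
  unfolding fourier_cis using integral_norm_bound[of lborel "\<lambda>x. cis (- 2 * pi * (x \<bullet> \<xi>)) * f x"]
  by (simp add: norm_mult)

lemma has_derivative_quadratic:
  fixes f :: "'a::real_normed_vector \<Rightarrow> 'b::real_normed_vector"
  assumes "bounded_linear f'" "\<And>h. norm h \<le> 1 \<Longrightarrow> norm (f (x + h) - f x - f' h) \<le> C * (norm h)\<^sup>2"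
  shows "(f has_derivative f') (at x)"
  unfolding has_derivative_at
proof (intro conjI assms(1))
  have C: "\<forall>\<^sub>F h in at 0. norm (norm (f (x + h) - f x - f' h) / norm h) \<le> C * norm h"
    unfolding eventually_at
  proof (intro exI[of _ 1] conjI ballI impI)
    fix h :: 'a assume h: "h \<noteq> 0 \<and> dist h 0 < 1"
    then have "norm (f (x + h) - f x - f' h) \<le> C * (norm h)\<^sup>2" by (intro assms(2)) simp
    with h show "norm (norm (f (x + h) - f x - f' h) / norm h) \<le> C * norm h"
      by (simp add: divide_le_eq power2_eq_square mult.assoc)
  qed simp
  have "isCont (\<lambda>h::'a. C * norm h) 0" by (intro continuous_intros)
  then have "(\<lambda>h::'a. C * norm h) \<midarrow>0\<rightarrow> C * norm (0::'a)" by (simp only: isCont_def)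
  then show "(\<lambda>h. norm (f (x + h) - f x - f' h) / norm h) \<midarrow>0\<rightarrow> 0"
    by (intro Lim_null_comparison[OF C]) simp
qed

text \<open>Differentiation under the integral sign: the integral of a quadratic remainder is a quadratic
  remainder.\<close>

lemma has_derivative_integral_quadratic:
  fixes F :: "'a::euclidean_space \<Rightarrow> 'c \<Rightarrow> 'b::{banach, second_countable_topology}"
  assumes F: "\<And>y. integrable M (F y)" and G: "\<And>b. b \<in> Basis \<Longrightarrow> integrable M (G b)"
    and C: "integrable M C"
    and le: "\<And>h t. norm h \<le> 1 \<Longrightarrow> t \<in> space M \<Longrightarrow>
      norm (F (x + h) t - F x t - (\<Sum>b\<in>Basis. (h \<bullet> b) *\<^sub>R G b t)) \<le> C t * (norm h)\<^sup>2"
  shows "((\<lambda>y. \<integral>t. F y t \<partial>M) has_derivative (\<lambda>v. \<Sum>b\<in>Basis. (v \<bullet> b) *\<^sub>R (\<integral>t. G b t \<partial>M))) (at x)"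
proof (rule has_derivative_quadratic)
  show "bounded_linear (\<lambda>v. \<Sum>b\<in>Basis. (v \<bullet> b) *\<^sub>R (\<integral>t. G b t \<partial>M))"
    by (intro bounded_linear_sum bounded_linear_compose[OF bounded_linear_scaleR_left]
        bounded_linear_inner_left)
  fix h :: 'a assume h: "norm h \<le> 1"
  have i: "integrable M (\<lambda>t. F (x + h) t - F x t - (\<Sum>b\<in>Basis. (h \<bullet> b) *\<^sub>R G b t))"
    by (intro Bochner_Integration.integrable_diff Bochner_Integration.integrable_sum
        integrable_scaleR_right F G) auto
  have "(\<integral>t. F (x + h) t \<partial>M) - (\<integral>t. F x t \<partial>M) - (\<Sum>b\<in>Basis. (h \<bullet> b) *\<^sub>R (\<integral>t. G b t \<partial>M))
      = (\<integral>t. F (x + h) t - F x t - (\<Sum>b\<in>Basis. (h \<bullet> b) *\<^sub>R G b t) \<partial>M)"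
    by (simp add: F G)
  also have "norm \<dots> \<le> (\<integral>t. norm (F (x + h) t - F x t - (\<Sum>b\<in>Basis. (h \<bullet> b) *\<^sub>R G b t)) \<partial>M)"
    by (rule integral_norm_bound)
  also have "\<dots> \<le> (\<integral>t. C t * (norm h)\<^sup>2 \<partial>M)"
    using h by (intro integral_mono integrable_norm i integrable_mult_left C le)
  also have "\<dots> = (\<integral>t. C t \<partial>M) * (norm h)\<^sup>2" by simp
  finally show "norm ((\<integral>t. F (x + h) t \<partial>M) - (\<integral>t. F x t \<partial>M) - (\<Sum>b\<in>Basis. (h \<bullet> b) *\<^sub>R (\<integral>t. G b t \<partial>M)))
    \<le> (\<integral>t. C t \<partial>M) * (norm h)\<^sup>2" .
qed

lemma cis_quadratic: "norm (cis (a + h) - cis a - \<i> * h * cis a) \<le> h\<^sup>2"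
proof -
  have "cis (a + h) - cis a - \<i> * h * cis a = cis a * (cis h - (1 + \<i> * h))"
    by (simp add: cis_mult[symmetric] algebra_simps)
  then have "norm (cis (a + h) - cis a - \<i> * h * cis a) = norm (cis h - (1 + \<i> * h))"
    by (simp add: norm_mult)
  also have "\<dots> \<le> h\<^sup>2 / 2"
    using iexp_approx1[of h 1] by (simp add: cis_conv_exp numeral_2_eq_2)
  finally show ?thesis using zero_le_power2[of h] by linarith
qed

text \<open>The operator that the Fourier transform turns into the derivative in direction \<open>b\<close>.\<close>

definition mult_coord :: "'a::euclidean_space \<Rightarrow> ('a \<Rightarrow> complex) \<Rightarrow> 'a \<Rightarrow> complex" where
  "mult_coord b f = (\<lambda>x. (- (2 * pi * \<i>) * of_real (x \<bullet> b)) * f x)"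

lemma moments_mult_coord:
  assumes "moments f" "b \<in> Basis"
  shows "moments (mult_coord b f)"
  unfolding mult_coord_def
proof (rule moments_mult_bound[OF assms(1), where C="2 * pi" and N=1])
  show "norm (- (2 * pi * \<i>) * of_real (x \<bullet> b)) \<le> 2 * pi * (1 + norm x) ^ 1" for x
    using Basis_le_norm[OF assms(2), of x] by (simp add: norm_mult)
qed simp

lemma fourier_has_derivative:
  assumes f: "moments f"
  shows "(fourier f has_derivative (\<lambda>v. \<Sum>b\<in>Basis. (v \<bullet> b) *\<^sub>R fourier (mult_coord b f) \<xi>)) (at \<xi>)"
  unfolding fourier_cis
proof (rule has_derivative_integral_quadratic[where C="\<lambda>x. (2 * pi)\<^sup>2 * ((1 + norm x) ^ 2 * norm (f x))"])
  let ?e = "\<lambda>x. - 2 * pi * (x \<bullet> \<xi>)"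
  let ?l = "\<lambda>x h. \<Sum>b\<in>Basis. (h \<bullet> b) *\<^sub>R (cis (?e x) * mult_coord b f x)"
  have [measurable]: "f \<in> borel_measurable borel" using f by (rule moments_measurable)
  show "integrable lborel (\<lambda>x. cis (- 2 * pi * (x \<bullet> y)) * f x)" for y
    by (intro integrable_cis_mult moments_integrable f) simp
  show "integrable lborel (\<lambda>x. cis (?e x) * mult_coord b f x)" if "b \<in> Basis" for b
    using that by (intro integrable_cis_mult moments_integrable moments_mult_coord f) simp_all
  show "integrable lborel (\<lambda>x. (2 * pi)\<^sup>2 * ((1 + norm x) ^ 2 * norm (f x)))"
    by (intro integrable_mult_right moments_integrable_power f)
  fix h x :: 'a
  have "?l x h
      = \<i> * (- 2 * pi * (x \<bullet> h)) * cis (?e x) * f x"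
    unfolding mult_coord_def euclidean_inner[of x h]
    by (simp add: scaleR_conv_of_real sum_distrib_left sum_distrib_right mult_ac)
  then have "cis (- 2 * pi * (x \<bullet> (\<xi> + h))) * f x - cis (?e x) * f x
        - ?l x h
      = (cis (?e x + (- 2 * pi * (x \<bullet> h))) - cis (?e x)
        - \<i> * (- 2 * pi * (x \<bullet> h)) * cis (?e x)) * f x"
    by (simp add: inner_add_right algebra_simps)
  also have "norm \<dots> \<le> (- 2 * pi * (x \<bullet> h))\<^sup>2 * norm (f x)"
    unfolding norm_mult[of _ "f x"] by (intro mult_right_mono cis_quadratic norm_ge_zero)
  also have "\<dots> \<le> ((2 * pi)\<^sup>2 * ((1 + norm x)\<^sup>2 * (norm h)\<^sup>2)) * norm (f x)"
  proof (intro mult_right_mono)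
    have "(x \<bullet> h)\<^sup>2 \<le> (norm x * norm h)\<^sup>2"
      using Cauchy_Schwarz_ineq2[of x h] by (rule power2_le_iff_abs_le[THEN iffD2, rotated]) auto
    also have "\<dots> \<le> ((1 + norm x) * norm h)\<^sup>2" by (intro power_mono mult_right_mono) auto
    finally show "(- 2 * pi * (x \<bullet> h))\<^sup>2 \<le> (2 * pi)\<^sup>2 * ((1 + norm x)\<^sup>2 * (norm h)\<^sup>2)"
      by (simp add: power_mult_distrib)
  qed simp
  finally show "norm (cis (- 2 * pi * (x \<bullet> (\<xi> + h))) * f x - cis (?e x) * f x
        - ?l x h)
      \<le> (2 * pi)\<^sup>2 * ((1 + norm x) ^ 2 * norm (f x)) * (norm h)\<^sup>2"
    by (simp add: mult_ac)
qed

lemma dir_deriv_fourier: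
  assumes "moments f" "b \<in> Basis"
  shows "dir_deriv b (fourier f) = fourier (mult_coord b f)"
proof
  fix \<xi>
  have "dir_deriv b (fourier f) \<xi> = (\<Sum>c\<in>Basis. (b \<bullet> c) *\<^sub>R fourier (mult_coord c f) \<xi>)"
    by (rule dir_deriv_eqI[OF fourier_has_derivative[OF assms(1)]])
  also have "\<dots> = (\<Sum>c\<in>Basis. if c = b then fourier (mult_coord c f) \<xi> else 0)"
    using assms(2) by (intro sum.cong) (auto simp: inner_Basis)
  finally show "dir_deriv b (fourier f) \<xi> = fourier (mult_coord b f) \<xi>" using assms(2) by simp
qed

lemma smooth_fourier:
  assumes "moments f"
  shows "smooth (fourier f)"
proof (rule smooth_coinduct[where P="\<lambda>g. \<exists>f. moments f \<and> g = fourier f"])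
  show "\<exists>g. moments g \<and> fourier f = fourier g" using assms by blast
next
  fix g :: "'a \<Rightarrow> complex" and x :: 'a assume "\<exists>f. moments f \<and> g = fourier f"
  then show "g differentiable (at x)" using fourier_has_derivative by (auto intro: differentiableI)
next
  fix g :: "'a \<Rightarrow> complex" and b :: 'a assume "\<exists>f. moments f \<and> g = fourier f" "b \<in> Basis"
  then show "\<exists>f. moments f \<and> dir_deriv b g = fourier f"
    using dir_deriv_fourier moments_mult_coord by blast
qed

lemma moments_mult_coords: "moments f \<Longrightarrow> set bs \<subseteq> Basis \<Longrightarrow> moments (foldr mult_coord bs f)"
  by (induction bs) (auto intro: moments_mult_coord)

lemma iter_deriv_fourier:
  "moments f \<Longrightarrow> set bs \<subseteq> Basis \<Longrightarrow> iter_deriv bs (fourier f) = fourier (foldr mult_coord bs f)"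
  by (induction bs) (auto simp: iter_deriv_Cons dir_deriv_fourier moments_mult_coords)

lemma slow_fourier:
  assumes "moments f"
  shows "slow (fourier f)"
  unfolding slow_def
proof (intro conjI allI impI smooth_fourier assms)
  fix bs :: "'a list" assume "set bs \<subseteq> Basis"
  then have "\<forall>x. norm (iter_deriv bs (fourier f) x) \<le> (\<integral>x. norm (foldr mult_coord bs f x) \<partial>lborel) * (1 + norm x) ^ 0"
    by (auto simp: iter_deriv_fourier assms intro: norm_fourier_le)
  then show "\<exists>C N. \<forall>x. norm (iter_deriv bs (fourier f) x) \<le> C * (1 + norm x) ^ N" by (intro exI)
qed

lemma norm_iter_deriv_coord_le:
  fixes c :: complex and b :: "'a::euclidean_space"
  assumes "b \<in> Basis" "set cs \<subseteq> Basis"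
  shows "norm (iter_deriv cs (\<lambda>x. c * of_real (x \<bullet> b)) x) \<le> norm c * (1 + norm x) ^ 1"
proof (cases cs rule: rev_cases)
  case Nil
  then show ?thesis using Basis_le_norm[OF assms(1), of x]
    by (simp add: norm_mult mult_left_mono)
next
  case (snoc ds d)
  have D: "dir_deriv d (\<lambda>x. c * of_real (x \<bullet> b)) = (\<lambda>x. c * of_real (d \<bullet> b))"
    by (rule ext, rule dir_deriv_eqI) (auto intro!: derivative_eq_intros)
  have const: "norm (iter_deriv ds (\<lambda>x::'a. e) x) \<le> norm e" for e :: complex
  proof (cases ds rule: rev_cases)
    case (snoc zs z)
    have "iter_deriv ys (\<lambda>x::'a. 0::complex) = (\<lambda>x. 0)" for ys
      by (induction ys) (auto simp: iter_deriv_Cons)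
    with snoc show ?thesis by (simp add: iter_deriv_snoc)
  qed simp
  have "norm (iter_deriv cs (\<lambda>x. c * of_real (x \<bullet> b)) x) \<le> norm (c * complex_of_real (d \<bullet> b))"
    using const unfolding snoc iter_deriv_snoc D .
  also have "\<dots> = norm c * \<bar>d \<bullet> b\<bar>" by (simp add: norm_mult)
  also have "\<bar>d \<bullet> b\<bar> \<le> 1 + norm x" using assms snoc by (auto simp: inner_Basis)
  then have "norm c * \<bar>d \<bullet> b\<bar> \<le> norm c * (1 + norm x)" by (rule mult_left_mono) simp
  finally show ?thesis by simp
qed

lemma smooth_coord: "smooth (\<lambda>x. c * complex_of_real (x \<bullet> b))"
  by (intro smooth_mult smooth_const smooth_of_real smooth_inner)

lemma slow_coord:
  assumes "b \<in> Basis"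
  shows "slow (\<lambda>x. c * complex_of_real (x \<bullet> b))"
  unfolding slow_def using norm_iter_deriv_coord_le[OF assms, of _ c] by (blast intro: smooth_coord)

lemma schwartz_mult_coord: "f \<in> schwartz \<Longrightarrow> b \<in> Basis \<Longrightarrow> mult_coord b f \<in> schwartz"
  unfolding mult_coord_def by (intro schwartz_mult_slow slow_coord)

lemma schwartz_seminorm_mult_coord:
  assumes "f \<in> schwartz" "b \<in> Basis"
  shows "schwartz_seminorm N (mult_coord b f) \<le> 2 ^ N * (2 * pi) * schwartz_seminorm (N + 1) f"
  unfolding mult_coord_def
proof (rule schwartz_seminorm_le)
  fix bs :: "'a list" and x assume bs: "set bs \<subseteq> Basis" "length bs \<le> N"
  show "(1 + norm x) ^ N * norm (iter_deriv bs (\<lambda>x. (- (2 * pi * \<i>) * of_real (x \<bullet> b)) * f x) x)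
    \<le> 2 ^ N * (2 * pi) * schwartz_seminorm (N + 1) f"
    using norm_iter_deriv_coord_le[OF assms(2), of _ "- (2 * pi * \<i>)"]
    by (intro schwartz_seminorm_mult[OF assms(1) smooth_coord _ bs]) (simp add: norm_mult)
qed

lemma schwartz_mult_coords: "f \<in> schwartz \<Longrightarrow> set bs \<subseteq> Basis \<Longrightarrow> foldr mult_coord bs f \<in> schwartz"
  by (induction bs) (auto intro: schwartz_mult_coord)

lemma schwartz_seminorm_mult_coords:
  "set bs \<subseteq> Basis \<Longrightarrow> \<exists>K\<ge>0. \<forall>f\<in>schwartz.
    schwartz_seminorm N (foldr mult_coord bs f) \<le> K * schwartz_seminorm (N + length bs) f"
proof (induction bs arbitrary: N)
  case Nil
  then show ?case by (intro exI[of _ 1]) simp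
next
  case (Cons b bs)
  then obtain K where K: "K \<ge> 0" "\<And>f. f \<in> schwartz \<Longrightarrow>
    schwartz_seminorm (N + 1) (foldr mult_coord bs f) \<le> K * schwartz_seminorm (N + 1 + length bs) f"
    by (metis list.set_intros(2) subset_code(1))
  have "schwartz_seminorm N (foldr mult_coord (b # bs) f)
      \<le> (2 ^ N * (2 * pi) * K) * schwartz_seminorm (N + length (b # bs)) f" if f: "f \<in> schwartz" for f
  proof -
    have "schwartz_seminorm N (foldr mult_coord (b # bs) f)
        \<le> 2 ^ N * (2 * pi) * schwartz_seminorm (N + 1) (foldr mult_coord bs f)"
      unfolding foldr_Cons o_apply using Cons.prems f
      by (intro schwartz_seminorm_mult_coord schwartz_mult_coords) auto
    also have "\<dots> \<le> 2 ^ N * (2 * pi) * (K * schwartz_seminorm (N + 1 + length bs) f)"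
      by (intro mult_left_mono K f) auto
    finally show ?thesis by (simp add: mult_ac)
  qed
  then show ?case using K(1) by (intro exI[of _ "2 ^ N * (2 * pi) * K"]) auto
qed

definition wave :: "'a::euclidean_space \<Rightarrow> 'a \<Rightarrow> complex" where
  "wave \<xi> x = cis (- 2 * pi * (x \<bullet> \<xi>))"

lemma wave_has_derivative:
  "((\<lambda>x. c * wave \<xi> x) has_derivative (\<lambda>v. c * (- (2 * pi * \<i>) * of_real (v \<bullet> \<xi>)) * wave \<xi> x)) (at x)"
proof (rule has_derivative_quadratic)
  have "bounded_linear (\<lambda>v. (c * (- (2 * pi * \<i>)) * wave \<xi> x) * complex_of_real (v \<bullet> \<xi>))"
    by (intro bounded_linear_compose[OF bounded_linear_mult_right]
        bounded_linear_compose[OF bounded_linear_of_real] bounded_linear_inner_left)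
  then show "bounded_linear (\<lambda>v. c * (- (2 * pi * \<i>) * of_real (v \<bullet> \<xi>)) * wave \<xi> x)"
    by (simp add: mult_ac)
  fix h :: 'a
  have "c * wave \<xi> (x + h) - c * wave \<xi> x - c * (- (2 * pi * \<i>) * of_real (h \<bullet> \<xi>)) * wave \<xi> x
    = c * (cis (- 2 * pi * (x \<bullet> \<xi>) + (- 2 * pi * (h \<bullet> \<xi>))) - cis (- 2 * pi * (x \<bullet> \<xi>))
      - \<i> * (- 2 * pi * (h \<bullet> \<xi>)) * cis (- 2 * pi * (x \<bullet> \<xi>)))"
    by (simp add: wave_def inner_add_left algebra_simps)
  also have "norm \<dots> \<le> norm c * (- 2 * pi * (h \<bullet> \<xi>))\<^sup>2"
    unfolding norm_mult[of c] by (intro mult_left_mono cis_quadratic norm_ge_zero)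
  also have "\<dots> \<le> norm c * ((2 * pi)\<^sup>2 * ((norm h)\<^sup>2 * (norm \<xi>)\<^sup>2))"
  proof (intro mult_left_mono)
    have "(h \<bullet> \<xi>)\<^sup>2 \<le> (norm h * norm \<xi>)\<^sup>2"
      using Cauchy_Schwarz_ineq2[of h \<xi>] by (rule power2_le_iff_abs_le[THEN iffD2, rotated]) auto
    then show "(- 2 * pi * (h \<bullet> \<xi>))\<^sup>2 \<le> (2 * pi)\<^sup>2 * ((norm h)\<^sup>2 * (norm \<xi>)\<^sup>2)"
      by (simp add: power_mult_distrib)
  qed simp
  finally show "norm (c * wave \<xi> (x + h) - c * wave \<xi> x - c * (- (2 * pi * \<i>) * of_real (h \<bullet> \<xi>)) * wave \<xi> x)
    \<le> (norm c * ((2 * pi)\<^sup>2 * (norm \<xi>)\<^sup>2)) * (norm h)\<^sup>2"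
    by (simp add: mult_ac)
qed

lemma dir_deriv_wave:
  "dir_deriv b (\<lambda>x. c * wave \<xi> x) = (\<lambda>x. (c * (- (2 * pi * \<i>) * of_real (b \<bullet> \<xi>))) * wave \<xi> x)"
  by (rule ext, rule dir_deriv_eqI[OF wave_has_derivative])

lemma slow_wave: "slow (wave \<xi>)"
proof -
  have sm: "smooth (wave \<xi>)"
  proof (rule smooth_coinduct[where P="\<lambda>f. \<exists>c. f = (\<lambda>x. c * wave \<xi> x)"])
    show "\<exists>c. wave \<xi> = (\<lambda>x. c * wave \<xi> x)" by (intro exI[of _ 1]) simp
  next
    fix f and x :: 'a assume "\<exists>c. f = (\<lambda>x. c * wave \<xi> x)"
    then show "f differentiable (at x)" using wave_has_derivative by (auto intro: differentiableI)
  next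
    fix f and b :: 'a assume "\<exists>c. f = (\<lambda>x. c * wave \<xi> x)"
    then show "\<exists>c. dir_deriv b f = (\<lambda>x. c * wave \<xi> x)" using dir_deriv_wave by blast
  qed
  have it: "\<exists>d. iter_deriv bs (wave \<xi>) = (\<lambda>x. d * wave \<xi> x)" for bs :: "'a list"
  proof (induction bs)
    case Nil
    show ?case by (intro exI[of _ 1]) simp
  next
    case (Cons b bs)
    then show ?case unfolding iter_deriv_Cons by (metis dir_deriv_wave)
  qed
  have "\<exists>C N. \<forall>x. norm (iter_deriv bs (wave \<xi>) x) \<le> C * (1 + norm x) ^ N" for bs :: "'a list"
  proof -
    obtain d where "iter_deriv bs (wave \<xi>) = (\<lambda>x. d * wave \<xi> x)" using it by blast
    then have "norm (iter_deriv bs (wave \<xi>) x) \<le> norm d * (1 + norm x) ^ 0" for x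
      by (simp add: norm_mult) (simp add: wave_def)
    then show ?thesis by (intro exI allI)
  qed
  with sm show ?thesis by (auto simp: slow_def)
qed

text \<open>Integration by parts: the integral of \<open>f (x + t b) - f x\<close> vanishes by
  translation invariance, and it equals \<open>t \<integral> dir_deriv b f\<close> up to \<open>O(t\<^sup>2)\<close>.\<close>

lemma integral_dir_deriv_schwartz:
  fixes f :: "'a::euclidean_space \<Rightarrow> complex"
  assumes f: "f \<in> schwartz" and b: "b \<in> Basis"
  shows "(\<integral>x. dir_deriv b f x \<partial>lborel) = 0"
proof -
  let ?W = "2 * DIM('a)" and ?I = "\<integral>x. dir_deriv b f x \<partial>lborel"
  let ?S = "schwartz_seminorm (?W + 2) f"
  define K where "K = (DIM('a))\<^sup>2 * (?S * 2 ^ ?W)"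
  define J where "J = (\<integral>x. weight ?W (x::'a) \<partial>lborel)"
  have S0: "0 \<le> ?S" by (rule schwartz_seminorm_nonneg[OF f])
  have db: "dir_deriv b f \<in> schwartz" by (rule schwartz_dir_deriv[OF f b])
  have [measurable]: "f \<in> borel_measurable borel" using f by (rule schwartz_measurable)
  have rem: "norm (f (x + t *\<^sub>R b) - f x - t *\<^sub>R dir_deriv b f x) \<le> K * t\<^sup>2 * weight ?W x"
    if t: "0 < t" "t \<le> 1" for t x
  proof -
    have "norm (f (x + t *\<^sub>R b) - f x - (\<Sum>c\<in>Basis. ((x + t *\<^sub>R b - x) \<bullet> c) *\<^sub>R dir_deriv c f x))
      \<le> (DIM('a))\<^sup>2 * (?S * 2 ^ ?W * weight ?W x) * (norm (x + t *\<^sub>R b - x))\<^sup>2"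
    proof (rule taylor_quadratic_remainder[OF schwartz_smooth[OF f]])
      fix z c d :: 'a assume z: "z \<in> closed_segment x (x + t *\<^sub>R b)" and cd: "c \<in> Basis" "d \<in> Basis"
      have "norm (z - x) \<le> norm (x + t *\<^sub>R b - x)" by (rule segment_bound1[OF z])
      then have zx: "norm (x - z) \<le> 1" using t b by (simp add: norm_minus_commute)
      have "norm (iter_deriv [d, c] f z) \<le> ?S * weight (?W + 2) z"
        using cd by (intro schwartz_seminorm_ge_weight f) auto
      also have "\<dots> \<le> ?S * (2 ^ ?W * weight ?W x)"
      proof (intro mult_left_mono S0)
        have "weight (?W + 2) z \<le> weight ?W z" by (rule weight_antimono) simp
        also have "\<dots> \<le> (1 + norm (x - z)) ^ ?W * weight ?W (z + (x - z))" by (rule weight_shift_le)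
        also have "\<dots> \<le> 2 ^ ?W * weight ?W x"
          using zx by (intro mult_mono power_mono) auto
        finally show "weight (?W + 2) z \<le> 2 ^ ?W * weight ?W x" .
      qed
      finally show "norm (dir_deriv d (dir_deriv c f) z) \<le> ?S * 2 ^ ?W * weight ?W x"
        by (simp add: iter_deriv_Cons mult.assoc)
    qed
    moreover have "(\<Sum>c\<in>Basis. ((x + t *\<^sub>R b - x) \<bullet> c) *\<^sub>R dir_deriv c f x)
        = (\<Sum>c\<in>Basis. if c = b then t *\<^sub>R dir_deriv c f x else 0)"
      using b by (intro sum.cong) (auto simp: inner_Basis)
    ultimately show ?thesis using b t by (simp add: K_def mult_ac)
  qed
  have le: "norm ?I \<le> K * J * t" if t: "0 < t" "t \<le> 1" for t
  proof -
    have i: "integrable lborel (\<lambda>x. f (x + t *\<^sub>R b))" "integrable lborel f" "integrable lborel (dir_deriv b f)"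
      by (rule lborel_integrable_translate[OF schwartz_integrable[OF f]] schwartz_integrable[OF f]
          schwartz_integrable[OF db])+
    have "t *\<^sub>R ?I = - (\<integral>x. f (x + t *\<^sub>R b) - f x - t *\<^sub>R dir_deriv b f x \<partial>lborel)"
      using i by (simp add: lborel_integral_translate)
    then have "t * norm ?I = norm (\<integral>x. f (x + t *\<^sub>R b) - f x - t *\<^sub>R dir_deriv b f x \<partial>lborel)"
      using t by (metis abs_of_pos norm_minus_cancel norm_scaleR)
    also have "\<dots> \<le> (\<integral>x. norm (f (x + t *\<^sub>R b) - f x - t *\<^sub>R dir_deriv b f x) \<partial>lborel)"
      by (rule integral_norm_bound)
    also have "\<dots> \<le> (\<integral>x. K * t\<^sup>2 * weight ?W (x::'a) \<partial>lborel)"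
    proof (rule integral_mono)
      show "integrable lborel (\<lambda>x. norm (f (x + t *\<^sub>R b) - f x - t *\<^sub>R dir_deriv b f x))"
        by (intro integrable_norm Bochner_Integration.integrable_diff integrable_scaleR_right i)
      show "integrable lborel (\<lambda>x. K * t\<^sup>2 * weight ?W (x::'a))"
        by (intro integrable_mult_right integrable_weight order_refl)
    qed (rule rem[OF t])
    also have "\<dots> = t * (K * J * t)" by (simp add: J_def power2_eq_square mult_ac)
    finally show ?thesis using t by simp
  qed
  have "norm ?I \<le> 0"
  proof (rule tendsto_lowerbound[of "\<lambda>n. K * J * (1 / real (Suc n))" _ sequentially])
    have "(\<lambda>n. K * J * (1 / real (Suc n))) \<longlonglongrightarrow> K * J * 0"
      by (intro tendsto_mult tendsto_const LIMSEQ_inverse_real_of_nat[unfolded inverse_eq_divide])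
    then show "(\<lambda>n. K * J * (1 / real (Suc n))) \<longlonglongrightarrow> 0" by simp
    show "\<forall>\<^sub>F n in sequentially. norm ?I \<le> K * J * (1 / real (Suc n))"
      by (intro always_eventually allI le) auto
  qed simp
  then show ?thesis by simp
qed

lemma fourier_dir_deriv:
  assumes f: "f \<in> schwartz" and b: "b \<in> Basis"
  shows "fourier (dir_deriv b f) \<xi> = 2 * pi * \<i> * of_real (\<xi> \<bullet> b) * fourier f \<xi>"
proof -
  have w: "smooth (\<lambda>x. 1 * wave \<xi> x)" using slow_wave[of \<xi>] by (simp add: slow_def)
  have wf: "(\<lambda>x. wave \<xi> x * f x) \<in> schwartz" by (intro schwartz_mult_slow slow_wave f)
  have "dir_deriv b (\<lambda>x. (1 * wave \<xi> x) * f x)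
      = (\<lambda>x. wave \<xi> x * dir_deriv b f x + (- (2 * pi * \<i>) * of_real (b \<bullet> \<xi>)) * (wave \<xi> x * f x))"
    by (subst dir_deriv_mult[OF smoothD[OF w] smoothD[OF schwartz_smooth[OF f]]])
      (simp add: dir_deriv_wave[of b 1 \<xi>, simplified] mult_ac)
  then have "0 = (\<integral>x. wave \<xi> x * dir_deriv b f x + (- (2 * pi * \<i>) * of_real (b \<bullet> \<xi>)) * (wave \<xi> x * f x) \<partial>lborel)"
    using integral_dir_deriv_schwartz[OF wf b] by simp
  also have "\<dots> = fourier (dir_deriv b f) \<xi> + (- (2 * pi * \<i>) * of_real (b \<bullet> \<xi>)) * fourier f \<xi>"
    unfolding fourier_cis wave_def[symmetric]
    by (subst Bochner_Integration.integral_add)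
      (auto intro!: schwartz_integrable schwartz_mult_slow slow_wave schwartz_dir_deriv schwartz_cmult f b)
  finally show ?thesis by (simp add: inner_commute)
qed

text \<open>Multiplying the transform by a coordinate amounts to differentiating \<open>f\<close>, so that \<open>N\<close> derivatives give
  \<open>N\<close> powers of decay; the other \<open>2 * DIM('a)\<close> powers make the derivatives integrable.\<close>

lemma fourier_decay:
  "\<exists>C\<ge>0. \<forall>f\<in>schwartz. \<forall>\<xi>::'a::euclidean_space.
     (1 + norm \<xi>) ^ N * norm (fourier f \<xi>) \<le> C * schwartz_seminorm (2 * DIM('a) + N) f"
proof (induction N)
  case 0
  have "norm (fourier f \<xi>) \<le> (\<integral>x. weight (2 * DIM('a)) (x::'a) \<partial>lborel) * schwartz_seminorm (2 * DIM('a)) f"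
    if "f \<in> schwartz" for f and \<xi> :: 'a
    using order_trans[OF norm_fourier_le schwartz_integral_norm_le[OF that]] by (simp add: mult.commute)
  then show ?case by (intro exI[of _ "\<integral>x. weight (2 * DIM('a)) (x::'a) \<partial>lborel"]) simp
next
  case (Suc N)
  let ?W = "2 * DIM('a)"
  obtain C where C: "C \<ge> 0" "\<And>f (\<xi>::'a). f \<in> schwartz \<Longrightarrow>
    (1 + norm \<xi>) ^ N * norm (fourier f \<xi>) \<le> C * schwartz_seminorm (?W + N) f" using Suc.IH by blast
  have "(1 + norm \<xi>) ^ Suc N * norm (fourier f \<xi>) \<le> (C * (1 + DIM('a))) * schwartz_seminorm (?W + Suc N) f"
    if f: "f \<in> schwartz" for f and \<xi> :: 'a
  proof -
    have "(1 + norm \<xi>) * norm (fourier f \<xi>) \<le> norm (fourier f \<xi>) + (\<Sum>b\<in>Basis. norm (fourier (dir_deriv b f) \<xi>))"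
    proof -
      have "norm \<xi> * norm (fourier f \<xi>) \<le> (\<Sum>b\<in>Basis. \<bar>\<xi> \<bullet> b\<bar>) * norm (fourier f \<xi>)"
        by (intro mult_right_mono norm_le_l1) auto
      also have "\<dots> = (\<Sum>b\<in>Basis. \<bar>\<xi> \<bullet> b\<bar> * norm (fourier f \<xi>))" by (rule sum_distrib_right)
      also have "\<dots> \<le> (\<Sum>b\<in>Basis. norm (fourier (dir_deriv b f) \<xi>))"
      proof (intro sum_mono)
        fix b :: 'a assume b: "b \<in> Basis"
        have "1 * (\<bar>\<xi> \<bullet> b\<bar> * norm (fourier f \<xi>)) \<le> (2 * pi) * (\<bar>\<xi> \<bullet> b\<bar> * norm (fourier f \<xi>))"
          using pi_gt3 by (intro mult_right_mono) auto
        then show "\<bar>\<xi> \<bullet> b\<bar> * norm (fourier f \<xi>) \<le> norm (fourier (dir_deriv b f) \<xi>)"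
          by (simp add: fourier_dir_deriv[OF f b] norm_mult mult_ac)
      qed
      finally show ?thesis by (simp add: algebra_simps)
    qed
    then have "(1 + norm \<xi>) ^ N * ((1 + norm \<xi>) * norm (fourier f \<xi>))
        \<le> (1 + norm \<xi>) ^ N * (norm (fourier f \<xi>) + (\<Sum>b\<in>Basis. norm (fourier (dir_deriv b f) \<xi>)))"
      by (intro mult_left_mono) auto
    also have "\<dots> = (1 + norm \<xi>) ^ N * norm (fourier f \<xi>)
        + (\<Sum>b\<in>Basis. (1 + norm \<xi>) ^ N * norm (fourier (dir_deriv b f) \<xi>))"
      by (simp add: distrib_left sum_distrib_left)
    also have "\<dots> \<le> C * schwartz_seminorm (?W + Suc N) f
        + (\<Sum>b\<in>(Basis::'a set). C * schwartz_seminorm (?W + Suc N) f)"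
    proof (intro add_mono sum_mono)
      show "(1 + norm \<xi>) ^ N * norm (fourier f \<xi>) \<le> C * schwartz_seminorm (?W + Suc N) f"
        by (rule order_trans[OF C(2)[OF f] mult_left_mono[OF schwartz_seminorm_mono[OF f] C(1)]]) simp
      show "(1 + norm \<xi>) ^ N * norm (fourier (dir_deriv b f) \<xi>) \<le> C * schwartz_seminorm (?W + Suc N) f"
        if b: "b \<in> Basis" for b
        using order_trans[OF C(2)[OF schwartz_dir_deriv[OF f b]]
            mult_left_mono[OF schwartz_seminorm_dir_deriv[OF f b] C(1)]] by simp
    qed
    finally show ?thesis by (simp add: algebra_simps)
  qed
  then show ?case using C(1) by (intro exI[of _ "C * (1 + DIM('a))"]) auto
qed

lemma fourier_schwartz:
  fixes f :: "'a::euclidean_space \<Rightarrow> complex"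
  assumes "f \<in> schwartz"
  shows "fourier f \<in> schwartz"
proof (rule schwartzI)
  have m: "moments f" by (rule schwartz_moments[OF assms])
  show "smooth (fourier f)" by (rule smooth_fourier[OF m])
  fix bs :: "'a list" and N assume bs: "set bs \<subseteq> Basis"
  obtain C where "\<And>f (\<xi>::'a). f \<in> schwartz \<Longrightarrow>
    (1 + norm \<xi>) ^ N * norm (fourier f \<xi>) \<le> C * schwartz_seminorm (2 * DIM('a) + N) f"
    using fourier_decay[where 'a='a] by blast
  from this[OF schwartz_mult_coords[OF assms bs]]
  show "\<exists>C. \<forall>x. (1 + norm x) ^ N * norm (iter_deriv bs (fourier f) x) \<le> C"
    unfolding iter_deriv_fourier[OF m bs] by (intro exI allI)
qed

lemma fourier_seminorm_bound:
  "\<exists>C\<ge>0. \<exists>M. \<forall>f::'a::euclidean_space \<Rightarrow> complex. f \<in> schwartz \<longrightarrow>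
     schwartz_seminorm N (fourier f) \<le> C * schwartz_seminorm M f"
proof -
  let ?L = "{bs. set bs \<subseteq> (Basis :: 'a set) \<and> length bs \<le> N}" and ?W = "2 * DIM('a) + N"
  have fin: "finite ?L" by (rule finite_lists_length_le) simp
  obtain C where C: "C \<ge> 0" "\<And>f (\<xi>::'a). f \<in> schwartz \<Longrightarrow>
    (1 + norm \<xi>) ^ N * norm (fourier f \<xi>) \<le> C * schwartz_seminorm ?W f"
    using fourier_decay[where 'a='a] by blast
  have "\<forall>bs\<in>?L. \<exists>K\<ge>0. \<forall>f::'a \<Rightarrow> complex\<in>schwartz.
    schwartz_seminorm ?W (foldr mult_coord bs f) \<le> K * schwartz_seminorm (?W + length bs) f"
  proof
    fix bs assume "bs \<in> ?L"
    then have "set bs \<subseteq> Basis" by simp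
    then show "\<exists>K\<ge>0. \<forall>f\<in>schwartz.
        schwartz_seminorm ?W (foldr mult_coord bs f) \<le> K * schwartz_seminorm (?W + length bs) f"
      by (rule schwartz_seminorm_mult_coords)
  qed
  from bchoice[OF this] obtain K where Kall: "\<forall>bs\<in>?L. K bs \<ge> 0 \<and> (\<forall>f\<in>schwartz.
    schwartz_seminorm ?W (foldr mult_coord bs f) \<le> K bs * schwartz_seminorm (?W + length bs) f)"
    by (elim exE)
  have K: "bs \<in> ?L \<Longrightarrow> K bs \<ge> 0" "bs \<in> ?L \<Longrightarrow> f \<in> schwartz \<Longrightarrow>
    schwartz_seminorm ?W (foldr mult_coord bs f) \<le> K bs * schwartz_seminorm (?W + length bs) f" for bs f
    using Kall[rule_format, of bs] by blast+
  have Kle: "K bs \<le> Max (K ` ?L)" if "bs \<in> ?L" for bs using that fin by auto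
  have "[] \<in> ?L" by simp
  then have K0: "0 \<le> Max (K ` ?L)" using K(1) Kle order_trans by blast
  have "schwartz_seminorm N (fourier f) \<le> (C * Max (K ` ?L)) * schwartz_seminorm (?W + N) f"
    if f: "f \<in> schwartz" for f :: "'a \<Rightarrow> complex"
  proof (rule schwartz_seminorm_le)
    fix bs :: "'a list" and x :: 'a assume bs: "set bs \<subseteq> Basis" "length bs \<le> N"
    then have L: "bs \<in> ?L" by simp
    have "(1 + norm x) ^ N * norm (iter_deriv bs (fourier f) x) \<le> C * schwartz_seminorm ?W (foldr mult_coord bs f)"
      unfolding iter_deriv_fourier[OF schwartz_moments[OF f] bs(1)]
      by (intro C schwartz_mult_coords f bs)
    also have "\<dots> \<le> C * (K bs * schwartz_seminorm (?W + length bs) f)"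
      by (intro mult_left_mono C K L f)
    also have "\<dots> \<le> C * (Max (K ` ?L) * schwartz_seminorm (?W + N) f)"
      by (intro mult_left_mono mult_mono C Kle[OF L] schwartz_seminorm_mono f K0 schwartz_seminorm_nonneg)
        (use bs in auto)
    finally show "(1 + norm x) ^ N * norm (iter_deriv bs (fourier f) x)
      \<le> C * Max (K ` ?L) * schwartz_seminorm (?W + N) f" by (simp add: mult.assoc)
  qed
  then show ?thesis using C(1) K0 by (intro exI[of _ "C * Max (K ` ?L)"] conjI exI[of _ "?W + N"]) auto
qed

lemma inv_fourier_schwartz: "f \<in> schwartz \<Longrightarrow> inv_fourier f \<in> schwartz"
  using schwartz_reflect[OF fourier_schwartz] by (simp add: inv_fourier_eq[abs_def])

lemma inv_fourier_seminorm_bound: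
  "\<exists>C\<ge>0. \<exists>M. \<forall>f::'a::euclidean_space \<Rightarrow> complex. f \<in> schwartz \<longrightarrow>
     schwartz_seminorm N (inv_fourier f) \<le> C * schwartz_seminorm M f"
proof -
  obtain C M where C: "C \<ge> 0" "\<And>f::'a \<Rightarrow> complex. f \<in> schwartz \<Longrightarrow>
      schwartz_seminorm N (fourier f) \<le> C * schwartz_seminorm M f"
    using fourier_seminorm_bound[where 'a='a and N=N] by blast
  have "schwartz_seminorm N (inv_fourier f) \<le> C * schwartz_seminorm M f"
    if "f \<in> schwartz" for f :: "'a \<Rightarrow> complex"
    using order_trans[OF schwartz_seminorm_reflect[OF fourier_schwartz[OF that]] C(2)[OF that]]
    by (simp add: inv_fourier_eq[abs_def])
  with C(1) show ?thesis by blast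
qed

section \<open>Fourier inversion\<close>

lemma integral_lborel_prod_Basis:
  fixes f :: "'a::euclidean_space \<Rightarrow> real \<Rightarrow> complex"
  assumes f: "\<And>b. b \<in> Basis \<Longrightarrow> integrable lborel (f b)"
  shows "(\<integral>x. (\<Prod>b\<in>Basis. f b (x \<bullet> b)) \<partial>(lborel :: 'a measure)) = (\<Prod>b\<in>Basis. \<integral>t. f b t \<partial>lborel)"
    and "integrable (lborel :: 'a measure) (\<lambda>x. \<Prod>b\<in>Basis. f b (x \<bullet> b))"
proof -
  interpret product_sigma_finite "\<lambda>_::'a. lborel :: real measure" ..
  have m: "f b \<in> borel_measurable borel" if "b \<in> Basis" for b
    using borel_measurable_integrable[OF f[OF that]] by simp
  have mp: "(\<lambda>x::'a. \<Prod>b\<in>Basis. f b (x \<bullet> b)) \<in> borel_measurable borel"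
    by (intro borel_measurable_prod measurable_compose[OF _ m]) auto
  have T: "(\<lambda>f. \<Sum>b\<in>Basis. f b *\<^sub>R b) \<in> (\<Pi>\<^sub>M b\<in>(Basis::'a set). lborel) \<rightarrow>\<^sub>M (borel :: 'a measure)"
    by measurable
  have eq: "(\<Prod>b\<in>Basis. f b ((\<Sum>c\<in>Basis. g c *\<^sub>R c) \<bullet> b)) = (\<Prod>b\<in>Basis. f b (g b))" for g :: "'a \<Rightarrow> real"
    by (intro prod.cong) auto
  show "(\<integral>x. (\<Prod>b\<in>Basis. f b (x \<bullet> b)) \<partial>(lborel :: 'a measure)) = (\<Prod>b\<in>Basis. \<integral>t. f b t \<partial>lborel)"
    unfolding lborel_eq[where 'a='a] integral_distr[OF T mp] eq
    using f by (intro product_integral_prod) auto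
  show "integrable (lborel :: 'a measure) (\<lambda>x. \<Prod>b\<in>Basis. f b (x \<bullet> b))"
    unfolding lborel_eq[where 'a='a] integrable_distr_eq[OF T mp] eq
    using f by (intro product_integrable_prod) auto
qed

definition gaussian :: "'a::euclidean_space \<Rightarrow> complex" where
  "gaussian x = of_real (exp (- pi * (norm x)\<^sup>2))"

text \<open>The characteristic function of the standard normal distribution, rescaled.\<close>

lemma gaussian_real_fourier:
  "integrable lborel (\<lambda>t::real. complex_of_real (exp (- pi * t\<^sup>2)))"
  "(\<integral>t. cis (- 2 * pi * (t * \<xi>)) * of_real (exp (- pi * t\<^sup>2)) \<partial>lborel) = of_real (exp (- pi * \<xi>\<^sup>2))"
proof -
  let ?c = "sqrt (2 * pi)"
  have c: "?c \<noteq> 0" "?c * ?c = 2 * pi" by auto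
  have dens: "std_normal_density (?c * t) = exp (- pi * t\<^sup>2) / ?c" for t
    by (simp add: std_normal_density_def power_mult_distrib)
  have "integrable lborel (\<lambda>t. std_normal_density (0 + ?c *\<^sub>R t))"
    by (rule lborel_integrable_affine) auto
  then have "integrable lborel (\<lambda>t. ?c * (exp (- pi * t\<^sup>2) / ?c))"
    unfolding add_0 real_scaleR_def dens by (rule integrable_mult_right)
  then have i: "integrable lborel (\<lambda>t::real. exp (- pi * t\<^sup>2))" by simp
  then show "integrable lborel (\<lambda>t::real. complex_of_real (exp (- pi * t\<^sup>2)))" by (rule integrable_of_real)
  let ?s = "- (?c * \<xi>)"
  let ?g = "\<lambda>x. std_normal_density x *\<^sub>R iexp (?s * x)"
  have "of_real (exp (- pi * \<xi>\<^sup>2)) = char std_normal_distribution ?s"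
    by (simp add: char_std_normal_distribution power_mult_distrib)
  also have "\<dots> = (\<integral>x. ?g x \<partial>lborel)"
    unfolding char_def by (subst integral_density) (auto simp: normal_density_nonneg)
  also have "\<dots> = \<bar>?c\<bar> ^ DIM(real) *\<^sub>R (\<integral>t. ?g (0 + ?c *\<^sub>R t) \<partial>lborel)"
    by (rule lborel_integral_affine) auto
  also have "\<bar>?c\<bar> ^ DIM(real) = ?c" by simp
  also have "?c *\<^sub>R (\<integral>t. ?g (0 + ?c *\<^sub>R t) \<partial>lborel) = (\<integral>t. ?c *\<^sub>R ?g (0 + ?c *\<^sub>R t) \<partial>lborel)"
    by (rule integral_scaleR_right[symmetric])
  also have "\<dots> = (\<integral>t. cis (- 2 * pi * (t * \<xi>)) * of_real (exp (- pi * t\<^sup>2)) \<partial>lborel)"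
  proof (rule Bochner_Integration.integral_cong[OF refl])
    fix t
    have "?s * (?c * t) = - (?c * ?c) * (t * \<xi>)" by algebra
    then have "?s * (?c * t) = - 2 * pi * (t * \<xi>)" unfolding c(2) by simp
    then have e: "iexp (?s * (?c * t)) = cis (- 2 * pi * (t * \<xi>))" by (simp only: cis_conv_exp)
    show "?c *\<^sub>R ?g (0 + ?c *\<^sub>R t) = cis (- 2 * pi * (t * \<xi>)) * of_real (exp (- pi * t\<^sup>2))"
      unfolding add_0 real_scaleR_def dens e using c(1) by (simp add: scaleR_conv_of_real)
  qed
  finally show "(\<integral>t. cis (- 2 * pi * (t * \<xi>)) * of_real (exp (- pi * t\<^sup>2)) \<partial>lborel) = of_real (exp (- pi * \<xi>\<^sup>2))"
    by simp
qed

lemma gaussian_prod: "gaussian x = (\<Prod>b\<in>Basis. of_real (exp (- pi * (x \<bullet> b)\<^sup>2)))"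
proof -
  have "(norm x)\<^sup>2 = x \<bullet> x" by (rule power2_norm_eq_inner)
  also have "\<dots> = (\<Sum>b\<in>Basis. (x \<bullet> b)\<^sup>2)"
    by (subst euclidean_inner) (simp add: power2_eq_square)
  finally have "exp (- pi * (norm x)\<^sup>2) = (\<Prod>b\<in>Basis. exp (- pi * (x \<bullet> b)\<^sup>2))"
    by (simp only: sum_distrib_left exp_sum[OF finite_Basis])
  then show ?thesis by (simp only: gaussian_def of_real_prod)
qed

lemma integrable_gaussian: "integrable lborel gaussian"
  unfolding gaussian_prod[abs_def]
  by (rule integral_lborel_prod_Basis(2)[where f="\<lambda>b t. of_real (exp (- pi * t\<^sup>2))"]) (rule gaussian_real_fourier)

lemma gaussian_measurable [measurable]: "gaussian \<in> borel_measurable borel"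
  unfolding gaussian_def by measurable

lemma fourier_gaussian: "fourier gaussian = (gaussian :: 'a::euclidean_space \<Rightarrow> complex)"
proof
  fix \<xi> :: 'a
  have "cis (- 2 * pi * (x \<bullet> \<xi>)) * gaussian x
      = (\<Prod>b\<in>Basis. cis (- 2 * pi * ((x \<bullet> b) * (\<xi> \<bullet> b))) * of_real (exp (- pi * (x \<bullet> b)\<^sup>2)))" for x :: 'a
  proof -
    have "cis (- 2 * pi * (x \<bullet> \<xi>)) = (\<Prod>b\<in>Basis. cis (- 2 * pi * ((x \<bullet> b) * (\<xi> \<bullet> b))))"
      unfolding cis_conv_exp euclidean_inner[of x \<xi>]
      by (simp add: exp_sum[symmetric] sum_distrib_left sum_negf)
    then show ?thesis by (simp add: prod.distrib gaussian_prod)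
  qed
  then have "fourier gaussian \<xi> = (\<integral>x. (\<Prod>b\<in>Basis. cis (- 2 * pi * ((x \<bullet> b) * (\<xi> \<bullet> b))) * of_real (exp (- pi * (x \<bullet> b)\<^sup>2))) \<partial>lborel)"
    unfolding fourier_cis by simp
  also have "\<dots> = (\<Prod>b\<in>Basis. \<integral>t. cis (- 2 * pi * (t * (\<xi> \<bullet> b))) * of_real (exp (- pi * t\<^sup>2)) \<partial>lborel)"
    by (rule integral_lborel_prod_Basis(1)[where f="\<lambda>b t. cis (- 2 * pi * (t * (\<xi> \<bullet> b))) * of_real (exp (- pi * t\<^sup>2))"])
      (intro integrable_cis_mult gaussian_real_fourier; simp)
  also have "\<dots> = gaussian \<xi>" by (simp only: gaussian_real_fourier gaussian_prod)
  finally show "fourier gaussian \<xi> = gaussian \<xi>" .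
qed

lemma Fubini_bounded_kernel:
  fixes f :: "'a::euclidean_space \<Rightarrow> complex" and g :: "'b::euclidean_space \<Rightarrow> complex"
  assumes f: "integrable lborel f" and g: "integrable lborel g"
    and k: "(\<lambda>(x, y). k x y) \<in> borel_measurable (lborel \<Otimes>\<^sub>M lborel)" and k1: "\<And>x y. norm (k x y) \<le> 1"
  shows "(\<integral>x. f x * (\<integral>y. k x y * g y \<partial>lborel) \<partial>lborel) = (\<integral>y. (\<integral>x. k x y * f x \<partial>lborel) * g y \<partial>lborel)"
    and "integrable (lborel \<Otimes>\<^sub>M lborel) (\<lambda>(x, y). k x y * f x * g y)"
proof -
  have [measurable]: "f \<in> borel_measurable borel" "g \<in> borel_measurable borel"
    using f g by (auto dest: borel_measurable_integrable)
  have m: "(\<lambda>(x, y). k x y * f x * g y) \<in> borel_measurable (lborel \<Otimes>\<^sub>M lborel)"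
    using k unfolding split_beta by measurable
  have mx: "(\<lambda>y. k x y) \<in> borel_measurable lborel" for x
    using measurable_Pair2[OF k, of x] by simp
  have gi: "integrable lborel (\<lambda>y. k x y * g y)" for x
    by (rule Bochner_Integration.integrable_bound[OF g])
      (use mx[of x] k1[of x] in \<open>auto simp: norm_mult intro!: mult_left_le_one_le\<close>)
  have i: "integrable lborel (\<lambda>y. k x y * f x * g y)" for x
    using integrable_mult_right[OF gi[of x], of "f x"] by (simp add: mult_ac)
  have nm: "integrable lborel (\<lambda>x. norm (f x) * (\<integral>y. norm (g y) \<partial>lborel))"
    by (intro integrable_mult_left integrable_norm f)
  show P: "integrable (lborel \<Otimes>\<^sub>M lborel) (\<lambda>(x, y). k x y * f x * g y)"
  proof (rule lborel_pair.Fubini_integrable[OF m])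
    show "AE x in lborel. integrable lborel (\<lambda>y. case (x, y) of (x, y) \<Rightarrow> k x y * f x * g y)"
      using i by simp
    show "integrable lborel (\<lambda>x. \<integral>y. norm (case (x, y) of (x, y) \<Rightarrow> k x y * f x * g y) \<partial>lborel)"
    proof (rule Bochner_Integration.integrable_bound[OF nm])
      have [measurable]: "(\<lambda>(x, y). k x y * f x * g y) \<in> borel_measurable (lborel \<Otimes>\<^sub>M lborel)" by (rule m)
      show "(\<lambda>x. \<integral>y. norm (case (x, y) of (x, y) \<Rightarrow> k x y * f x * g y) \<partial>lborel) \<in> borel_measurable lborel"
        by measurable
      have "norm (\<integral>y. norm (k x y * f x * g y) \<partial>lborel) \<le> norm (f x) * (\<integral>y. norm (g y) \<partial>lborel)" for x
      proof -
        have "(\<integral>y. norm (k x y * f x * g y) \<partial>lborel) \<le> (\<integral>y. norm (f x) * norm (g y) \<partial>lborel)"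
          using k1[of x] by (intro integral_mono integrable_norm i integrable_mult_right g)
            (auto simp: norm_mult intro!: mult_right_mono mult_left_le_one_le)
        then show ?thesis by simp
      qed
      then show "AE x in lborel. norm (\<integral>y. norm (case (x, y) of (x, y) \<Rightarrow> k x y * f x * g y) \<partial>lborel)
          \<le> norm (norm (f x) * (\<integral>y. norm (g y) \<partial>lborel))" by (auto intro: order_trans)
    qed
  qed
  have "(\<integral>x. f x * (\<integral>y. k x y * g y \<partial>lborel) \<partial>lborel) = (\<integral>x. (\<integral>y. k x y * f x * g y \<partial>lborel) \<partial>lborel)"
    by (simp add: integral_mult_right_zero[symmetric] mult_ac del: integral_mult_right_zero)
  also have "\<dots> = (\<integral>y. (\<integral>x. k x y * f x * g y \<partial>lborel) \<partial>lborel)"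
    using lborel_pair.Fubini_integral[OF P] by simp
  also have "\<dots> = (\<integral>y. (\<integral>x. k x y * f x \<partial>lborel) * g y \<partial>lborel)" by simp
  finally show "(\<integral>x. f x * (\<integral>y. k x y * g y \<partial>lborel) \<partial>lborel) = (\<integral>y. (\<integral>x. k x y * f x \<partial>lborel) * g y \<partial>lborel)" .
qed

lemma measurable_cis_inner [measurable]:
  "(\<lambda>(x::'a::euclidean_space, y::'a). cis (c * (x \<bullet> y))) \<in> borel_measurable (lborel \<Otimes>\<^sub>M lborel)"
  by measurable

lemma integral_fourier_mult:
  fixes f g :: "'a::euclidean_space \<Rightarrow> complex"
  assumes "integrable lborel f" "integrable lborel g"
  shows "(\<integral>\<xi>. fourier f \<xi> * g \<xi> \<partial>lborel) = (\<integral>x. f x * fourier g x \<partial>lborel)"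
  using Fubini_bounded_kernel(1)[OF assms measurable_cis_inner[of "- 2 * pi"]]
  by (simp add: fourier_cis inner_commute)

text \<open>Inversion at the origin, from which the general case follows by translation. By Parseval's formula
  the integral of \<open>fourier f\<close> against the dilated Gaussian \<open>gaussian (e *\<^sub>R \<xi>)\<close> is the integral of
  \<open>f (e *\<^sub>R y)\<close> against \<open>gaussian y\<close>; let \<open>e\<close> tend to \<open>0\<close>.\<close>

lemma integral_fourier_schwartz:
  fixes f :: "'a::euclidean_space \<Rightarrow> complex"
  assumes f: "f \<in> schwartz"
  shows "(\<integral>\<xi>. fourier f \<xi> \<partial>lborel) = f 0"
proof -
  define e where "e n = 1 / real (Suc n)" for n
  have e0: "e n \<noteq> 0" "e n > 0" for n by (auto simp: e_def)
  have elim: "e \<longlonglongrightarrow> 0" unfolding e_def by (rule LIMSEQ_inverse_real_of_nat[unfolded inverse_eq_divide])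
  have [measurable]: "f \<in> borel_measurable borel" "fourier f \<in> borel_measurable borel"
    using f by (auto intro: schwartz_measurable fourier_schwartz)
  have lim_scale: "(\<lambda>n. e n *\<^sub>R x) \<longlonglongrightarrow> 0" for x :: 'a
    using tendsto_scaleR[OF elim tendsto_const, of x] by simp
  have step: "(\<integral>\<xi>. fourier f \<xi> * gaussian (e n *\<^sub>R \<xi>) \<partial>lborel) = (\<integral>y. f (e n *\<^sub>R y) * gaussian y \<partial>lborel)" for n
  proof -
    have ig: "integrable lborel (\<lambda>\<xi>::'a. gaussian (e n *\<^sub>R \<xi>))"
      using lborel_integrable_affine[OF integrable_gaussian e0(1), of 0 n] by simp
    have F: "fourier (\<lambda>\<xi>. gaussian (e n *\<^sub>R \<xi>)) x = (1 / e n) ^ DIM('a) *\<^sub>R gaussian ((1 / e n) *\<^sub>R x)" for x :: 'a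
    proof -
      have "gaussian ((1 / e n) *\<^sub>R x) = (\<integral>\<eta>. cis (- 2 * pi * (\<eta> \<bullet> ((1 / e n) *\<^sub>R x))) * gaussian \<eta> \<partial>lborel)"
        unfolding fourier_cis[symmetric] fourier_gaussian by simp
      also have "\<dots> = \<bar>e n\<bar> ^ DIM('a) *\<^sub>R (\<integral>\<xi>. cis (- 2 * pi * ((0 + e n *\<^sub>R \<xi>) \<bullet> ((1 / e n) *\<^sub>R x))) * gaussian (0 + e n *\<^sub>R \<xi>) \<partial>lborel)"
        by (rule lborel_integral_affine[OF _ e0(1)]) simp
      also have "\<dots> = e n ^ DIM('a) *\<^sub>R fourier (\<lambda>\<xi>. gaussian (e n *\<^sub>R \<xi>)) x"
        using e0[of n] by (simp add: fourier_cis)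
      finally show ?thesis using e0[of n] by (simp add: power_one_over)
    qed
    have "(\<integral>\<xi>. fourier f \<xi> * gaussian (e n *\<^sub>R \<xi>) \<partial>lborel) = (\<integral>x. f x * ((1 / e n) ^ DIM('a) *\<^sub>R gaussian ((1 / e n) *\<^sub>R x)) \<partial>lborel)"
      unfolding integral_fourier_mult[OF schwartz_integrable[OF f] ig] F ..
    also have "\<dots> = \<bar>e n\<bar> ^ DIM('a) *\<^sub>R (\<integral>y. f (0 + e n *\<^sub>R y) * ((1 / e n) ^ DIM('a) *\<^sub>R gaussian ((1 / e n) *\<^sub>R (0 + e n *\<^sub>R y))) \<partial>lborel)"
      by (rule lborel_integral_affine[OF _ e0(1)]) simp
    also have "\<dots> = (\<integral>y. f (e n *\<^sub>R y) * gaussian y \<partial>lborel)"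
      using e0[of n] by (simp add: power_one_over)
    finally show ?thesis .
  qed
  have cont: "isCont f 0" using schwartz_continuous[OF f] by (simp add: continuous_on_eq_continuous_at)
  have contG: "isCont (gaussian :: 'a \<Rightarrow> complex) 0"
    unfolding gaussian_def by (intro continuous_intros)
  have G0: "gaussian (0::'a) = 1" by (simp add: gaussian_def)
  have L: "(\<lambda>n. \<integral>\<xi>. fourier f \<xi> * gaussian (e n *\<^sub>R \<xi>) \<partial>lborel) \<longlonglongrightarrow> (\<integral>\<xi>. fourier f \<xi> \<partial>lborel)"
  proof (rule integral_dominated_convergence[where w="\<lambda>\<xi>. norm (fourier f \<xi>)"])
    show "AE \<xi> in lborel. (\<lambda>n. fourier f \<xi> * gaussian (e n *\<^sub>R \<xi>)) \<longlonglongrightarrow> fourier f \<xi>"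
    proof (rule AE_I2)
      fix \<xi> :: 'a
      have "(\<lambda>n. fourier f \<xi> * gaussian (e n *\<^sub>R \<xi>)) \<longlonglongrightarrow> fourier f \<xi> * gaussian (0::'a)"
        by (intro tendsto_mult tendsto_const isCont_tendsto_compose[OF contG] lim_scale)
      then show "(\<lambda>n. fourier f \<xi> * gaussian (e n *\<^sub>R \<xi>)) \<longlonglongrightarrow> fourier f \<xi>" by (simp add: G0)
    qed
    show "AE \<xi> in lborel. norm (fourier f \<xi> * gaussian (e n *\<^sub>R \<xi>)) \<le> norm (fourier f \<xi>)" for n
      by (auto simp: norm_mult gaussian_def intro!: mult_left_le)
    show "integrable lborel (\<lambda>\<xi>. norm (fourier f \<xi>))"
      by (intro integrable_norm schwartz_integrable fourier_schwartz f)
  qed simp_all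
  have R: "(\<lambda>n. \<integral>y. f (e n *\<^sub>R y) * gaussian y \<partial>lborel) \<longlonglongrightarrow> (\<integral>y. f 0 * gaussian (y::'a) \<partial>lborel)"
  proof (rule integral_dominated_convergence[where w="\<lambda>y::'a. schwartz_seminorm 0 f * norm (gaussian y :: complex)"])
    show "AE y in lborel. (\<lambda>n. f (e n *\<^sub>R y) * gaussian y) \<longlonglongrightarrow> f 0 * gaussian y"
      by (intro AE_I2 tendsto_mult tendsto_const isCont_tendsto_compose[OF cont] lim_scale)
    show "AE y in lborel. norm (f (e n *\<^sub>R y) * gaussian y) \<le> schwartz_seminorm 0 f * norm (gaussian y :: complex)" for n
      using schwartz_norm_le[OF f, of _ 0] by (auto simp: norm_mult weight_def intro!: mult_right_mono)
    show "integrable lborel (\<lambda>y::'a. schwartz_seminorm 0 f * norm (gaussian y :: complex))"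
      by (intro integrable_mult_right integrable_norm integrable_gaussian)
  qed simp_all
  have "(\<integral>y. gaussian (y::'a) \<partial>lborel) = fourier gaussian (0::'a)" by (simp add: fourier_cis)
  then have "(\<integral>y. f 0 * gaussian (y::'a) \<partial>lborel) = f 0" by (simp add: fourier_gaussian G0)
  with LIMSEQ_unique[OF L R[folded step]] show ?thesis by simp
qed

lemma fourier_translate:
  assumes [measurable]: "f \<in> borel_measurable borel"
  shows "fourier (\<lambda>y. f (y - a)) \<xi> = cis (- 2 * pi * (a \<bullet> \<xi>)) * fourier f \<xi>"
proof -
  have "fourier (\<lambda>y. f (y - a)) \<xi> = (\<integral>y. cis (- 2 * pi * ((y + a) \<bullet> \<xi>)) * f (y + a - a) \<partial>lborel)"
    unfolding fourier_cis by (rule lborel_integral_translate[symmetric]) simp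
  also have "\<dots> = (\<integral>y. cis (- 2 * pi * (a \<bullet> \<xi>)) * (cis (- 2 * pi * (y \<bullet> \<xi>)) * f y) \<partial>lborel)"
  proof (intro Bochner_Integration.integral_cong refl)
    fix y
    have "cis (- 2 * pi * ((y + a) \<bullet> \<xi>)) = cis (- 2 * pi * (a \<bullet> \<xi>)) * cis (- 2 * pi * (y \<bullet> \<xi>))"
      unfolding cis_mult by (simp add: inner_add_left algebra_simps)
    then show "cis (- 2 * pi * ((y + a) \<bullet> \<xi>)) * f (y + a - a)
        = cis (- 2 * pi * (a \<bullet> \<xi>)) * (cis (- 2 * pi * (y \<bullet> \<xi>)) * f y)" by simp
  qed
  finally show ?thesis by (simp add: fourier_cis)
qed

theorem inv_fourier_fourier:
  assumes "f \<in> schwartz"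
  shows "inv_fourier (fourier f) = f"
proof
  fix x
  have "f x = (\<lambda>y. f (y - (- x))) 0" by simp
  also have "\<dots> = (\<integral>\<xi>. fourier (\<lambda>y. f (y - (- x))) \<xi> \<partial>lborel)"
    by (rule integral_fourier_schwartz[symmetric, OF schwartz_translate[OF assms]])
  also have "\<dots> = inv_fourier (fourier f) x"
    by (simp only: fourier_translate[OF schwartz_measurable[OF assms]] inv_fourier_cis) simp
  finally show "inv_fourier (fourier f) x = f x" by simp
qed

theorem fourier_inv_fourier:
  assumes "f \<in> schwartz"
  shows "fourier (inv_fourier f) = f"
proof
  fix x
  have "fourier (inv_fourier f) x = (\<integral>\<xi>. cis (- 2 * pi * ((0 - \<xi>) \<bullet> x)) * fourier f (- (0 - \<xi>)) \<partial>lborel)"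
    unfolding fourier_cis[of "inv_fourier f"] inv_fourier_eq
    by (rule lborel_integral_reflect[symmetric])
      (use schwartz_measurable[OF fourier_schwartz[OF assms]] in measurable)
  also have "\<dots> = inv_fourier (fourier f) x" by (simp add: inv_fourier_cis inner_commute)
  finally show "fourier (inv_fourier f) x = f x" by (simp add: inv_fourier_fourier assms)
qed

text \<open>The convolution theorem in the form needed for Fourier multipliers; it is just Fubini.\<close>

lemma fourier_mult_inv_fourier:
  fixes a \<phi> :: "'a::euclidean_space \<Rightarrow> complex"
  assumes a: "integrable lborel a" and \<phi>: "integrable lborel \<phi>"
  shows "fourier (\<lambda>\<xi>. a \<xi> * inv_fourier \<phi> \<xi>) y = (\<integral>x. fourier a (y - x) * \<phi> x \<partial>lborel)"
proof -
  let ?b = "\<lambda>\<xi>. cis (- 2 * pi * (\<xi> \<bullet> y)) * a \<xi>"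
  have b: "integrable lborel ?b" by (intro integrable_cis_mult a) simp
  have "fourier (\<lambda>\<xi>. a \<xi> * inv_fourier \<phi> \<xi>) y = (\<integral>\<xi>. ?b \<xi> * (\<integral>x. cis (2 * pi * (\<xi> \<bullet> x)) * \<phi> x \<partial>lborel) \<partial>lborel)"
    by (simp add: fourier_cis inv_fourier_cis mult_ac)
  also have "\<dots> = (\<integral>x. (\<integral>\<xi>. cis (2 * pi * (\<xi> \<bullet> x)) * ?b \<xi> \<partial>lborel) * \<phi> x \<partial>lborel)"
    by (rule Fubini_bounded_kernel(1)[OF b \<phi> measurable_cis_inner]) simp
  also have "\<dots> = (\<integral>x. fourier a (y - x) * \<phi> x \<partial>lborel)"
  proof -
    have "cis (2 * pi * (\<xi> \<bullet> x)) * ?b \<xi> = cis (- 2 * pi * (\<xi> \<bullet> (y - x))) * a \<xi>" for \<xi> x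
    proof -
      have "cis (2 * pi * (\<xi> \<bullet> x)) * cis (- 2 * pi * (\<xi> \<bullet> y)) = cis (- 2 * pi * (\<xi> \<bullet> (y - x)))"
        unfolding cis_mult by (simp add: inner_diff_right algebra_simps)
      then show ?thesis by (simp only: mult.assoc[symmetric])
    qed
    then show ?thesis by (simp only: fourier_cis)
  qed
  finally show ?thesis .
qed

section \<open>Tensor products and partial integration\<close>

definition tensor :: "('a \<Rightarrow> complex) \<Rightarrow> ('b \<Rightarrow> complex) \<Rightarrow> 'a \<times> 'b \<Rightarrow> complex" where
  "tensor \<phi> \<psi> = (\<lambda>z. \<phi> (fst z) * \<psi> (snd z))"

lemma dir_deriv_zero: "f differentiable at x \<Longrightarrow> dir_deriv 0 f x = 0"
  using dir_deriv_scaleR[of f x 0 0] by simp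

lemma tensor_differentiable:
  fixes \<phi> :: "'a::euclidean_space \<Rightarrow> complex" and \<psi> :: "'b::euclidean_space \<Rightarrow> complex"
  assumes "\<And>x. \<phi> differentiable at x" "\<And>x. \<psi> differentiable at x"
  shows "(\<lambda>z::'a\<times>'b. \<phi> (fst z)) differentiable at z" "(\<lambda>z::'a\<times>'b. \<psi> (snd z)) differentiable at z"
    "tensor \<phi> \<psi> differentiable at z"
proof -
  show 1: "(\<lambda>z::'a\<times>'b. \<phi> (fst z)) differentiable at z" for z
    using differentiable_compose_affine[OF bounded_linear_fst assms(1), of 0] by simp
  show 2: "(\<lambda>z::'a\<times>'b. \<psi> (snd z)) differentiable at z" for z
    using differentiable_compose_affine[OF bounded_linear_snd assms(2), of 0] by simp
  show "tensor \<phi> \<psi> differentiable at z"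
    unfolding tensor_def by (rule differentiable_mult[OF 1 2])
qed

lemma dir_deriv_tensor:
  fixes \<phi> :: "'a::euclidean_space \<Rightarrow> complex" and \<psi> :: "'b::euclidean_space \<Rightarrow> complex"
  assumes \<phi>: "\<And>x. \<phi> differentiable at x" and \<psi>: "\<And>x. \<psi> differentiable at x"
  shows "dir_deriv (u, 0) (tensor \<phi> \<psi>) = tensor (dir_deriv u \<phi>) \<psi>"
    "dir_deriv (0, v) (tensor \<phi> \<psi>) = tensor \<phi> (dir_deriv v \<psi>)"
proof -
  have d1: "dir_deriv w (\<lambda>z::'a\<times>'b. \<phi> (fst z)) = (\<lambda>z. dir_deriv (fst w) \<phi> (fst z))" for w
    using dir_deriv_compose_affine[OF bounded_linear_fst \<phi>, of w 0] by simp
  have d2: "dir_deriv w (\<lambda>z::'a\<times>'b. \<psi> (snd z)) = (\<lambda>z. dir_deriv (snd w) \<psi> (snd z))" for w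
    using dir_deriv_compose_affine[OF bounded_linear_snd \<psi>, of w 0] by simp
  have "dir_deriv w (tensor \<phi> \<psi>)
      = (\<lambda>z. \<phi> (fst z) * dir_deriv (snd w) \<psi> (snd z) + dir_deriv (fst w) \<phi> (fst z) * \<psi> (snd z))" for w
    unfolding tensor_def
    by (subst dir_deriv_mult[OF tensor_differentiable(1)[OF \<phi> \<psi>] tensor_differentiable(2)[OF \<phi> \<psi>]])
      (simp add: d1 d2)
  then show "dir_deriv (u, 0) (tensor \<phi> \<psi>) = tensor (dir_deriv u \<phi>) \<psi>"
    "dir_deriv (0, v) (tensor \<phi> \<psi>) = tensor \<phi> (dir_deriv v \<psi>)"
    using dir_deriv_zero[OF \<phi>] dir_deriv_zero[OF \<psi>] by (simp_all add: tensor_def)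
qed

lemma iter_deriv_tensor:
  fixes \<phi> :: "'a::euclidean_space \<Rightarrow> complex" and \<psi> :: "'b::euclidean_space \<Rightarrow> complex"
  assumes \<phi>: "smooth \<phi>" and \<psi>: "smooth \<psi>"
  shows "set bs \<subseteq> Basis \<Longrightarrow> \<exists>cs ds. set cs \<subseteq> Basis \<and> set ds \<subseteq> Basis \<and> length cs \<le> length bs \<and>
    length ds \<le> length bs \<and> iter_deriv bs (tensor \<phi> \<psi>) = tensor (iter_deriv cs \<phi>) (iter_deriv ds \<psi>)"
proof (induction bs)
  case Nil
  show ?case by (intro exI[of _ "[]"]) simp
next
  case (Cons b bs)
  then obtain cs ds where IH: "set cs \<subseteq> Basis" "set ds \<subseteq> Basis" "length cs \<le> length bs" "length ds \<le> length bs"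
    "iter_deriv bs (tensor \<phi> \<psi>) = tensor (iter_deriv cs \<phi>) (iter_deriv ds \<psi>)" by auto
  have d: "\<And>x. iter_deriv cs \<phi> differentiable at x" "\<And>x. iter_deriv ds \<psi> differentiable at x"
    using IH \<phi> \<psi> by (auto intro!: smoothD smooth_iter_deriv)
  have "b \<in> Basis" using Cons.prems by simp
  then consider u where "b = (u, 0)" "u \<in> Basis" | v where "b = (0, v)" "v \<in> Basis"
    by (auto simp: Basis_prod_def)
  then show ?case
  proof cases
    case 1
    then show ?thesis using IH
      by (intro exI[of _ "u # cs"] exI[of _ ds]) (simp add: iter_deriv_Cons dir_deriv_tensor d)
  next
    case 2
    then show ?thesis using IH
      by (intro exI[of _ cs] exI[of _ "v # ds"]) (simp add: iter_deriv_Cons dir_deriv_tensor d)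
  qed
qed

lemma smooth_tensor:
  fixes \<phi> :: "'a::euclidean_space \<Rightarrow> complex" and \<psi> :: "'b::euclidean_space \<Rightarrow> complex"
  assumes "smooth \<phi>" "smooth \<psi>"
  shows "smooth (tensor \<phi> \<psi>)"
  unfolding smooth_def
proof (intro allI impI)
  fix bs :: "('a \<times> 'b) list" and x assume "set bs \<subseteq> Basis"
  from iter_deriv_tensor[OF assms this] obtain cs ds where "set cs \<subseteq> Basis" "set ds \<subseteq> Basis"
    and eq: "iter_deriv bs (tensor \<phi> \<psi>) = tensor (iter_deriv cs \<phi>) (iter_deriv ds \<psi>)" by blast
  then show "iter_deriv bs (tensor \<phi> \<psi>) differentiable at x"
    unfolding eq by (intro tensor_differentiable(3) smoothD smooth_iter_deriv assms)
qed

lemma one_plus_norm_Pair_le: "1 + norm (x, t) \<le> (1 + norm x) * (1 + norm t)"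
  using norm_Pair_le[of x t] by (simp add: algebra_simps) (smt (verit) mult_nonneg_nonneg norm_ge_zero)

lemma one_plus_norm_Pair_power_le: "(1 + norm (x, t)) ^ N \<le> (1 + norm x) ^ N * (1 + norm t) ^ N"
  unfolding power_mult_distrib[symmetric] by (intro power_mono one_plus_norm_Pair_le) auto

lemma schwartz_tensor:
  fixes \<phi> :: "'a::euclidean_space \<Rightarrow> complex" and \<psi> :: "'b::euclidean_space \<Rightarrow> complex"
  assumes \<phi>: "\<phi> \<in> schwartz" and \<psi>: "\<psi> \<in> schwartz"
  shows "tensor \<phi> \<psi> \<in> schwartz"
    and "schwartz_seminorm N (tensor \<phi> \<psi>) \<le> schwartz_seminorm N \<phi> * schwartz_seminorm N \<psi>"
proof -
  let ?T = "tensor \<phi> \<psi>" and ?K = "\<lambda>M. schwartz_seminorm M \<phi> * schwartz_seminorm M \<psi>"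
  have le: "(1 + norm z) ^ M * norm (iter_deriv bs ?T z) \<le> ?K M"
    if bs: "set bs \<subseteq> Basis" "length bs \<le> M" for M bs z
  proof -
    from iter_deriv_tensor[OF schwartz_smooth[OF \<phi>] schwartz_smooth[OF \<psi>] bs(1)] obtain cs ds
      where cd: "set cs \<subseteq> Basis" "set ds \<subseteq> Basis" "length cs \<le> length bs" "length ds \<le> length bs"
      and eq: "iter_deriv bs ?T = tensor (iter_deriv cs \<phi>) (iter_deriv ds \<psi>)" by blast
    obtain x t where z: "z = (x, t)" by (cases z)
    have "(1 + norm z) ^ M * norm (iter_deriv bs ?T z)
        \<le> ((1 + norm x) ^ M * (1 + norm t) ^ M) * (norm (iter_deriv cs \<phi> x) * norm (iter_deriv ds \<psi> t))"
    proof -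
      have n: "norm (iter_deriv bs ?T z) = norm (iter_deriv cs \<phi> x) * norm (iter_deriv ds \<psi> t)"
        unfolding eq by (simp add: tensor_def z norm_mult)
      show ?thesis unfolding n unfolding z
        by (intro mult_right_mono one_plus_norm_Pair_power_le mult_nonneg_nonneg norm_ge_zero)
    qed
    also have "\<dots> = ((1 + norm x) ^ M * norm (iter_deriv cs \<phi> x)) * ((1 + norm t) ^ M * norm (iter_deriv ds \<psi> t))"
      by (simp add: mult_ac)
    also have "\<dots> \<le> ?K M"
      using cd bs by (intro mult_mono schwartz_seminorm_ge schwartz_seminorm_nonneg \<phi> \<psi>) auto
    finally show ?thesis .
  qed
  show "?T \<in> schwartz"
  proof (rule schwartzI)
    show "smooth ?T" by (intro smooth_tensor schwartz_smooth \<phi> \<psi>)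
    fix bs :: "('a \<times> 'b) list" and N assume bs: "set bs \<subseteq> Basis"
    let ?M = "max N (length bs)"
    have "(1 + norm z) ^ N * norm (iter_deriv bs ?T z) \<le> (1 + norm z) ^ ?M * norm (iter_deriv bs ?T z)" for z
      by (intro mult_right_mono power_increasing) auto
    also have "(1 + norm z) ^ ?M * norm (iter_deriv bs ?T z) \<le> ?K ?M" for z
      by (intro le bs) simp
    finally show "\<exists>C. \<forall>x. (1 + norm x) ^ N * norm (iter_deriv bs ?T x) \<le> C" by blast
  qed
  show "schwartz_seminorm N ?T \<le> ?K N"
    by (intro schwartz_seminorm_le le)
qed

lemma integrable_tensor:
  fixes \<phi> :: "'a::euclidean_space \<Rightarrow> complex" and \<psi> :: "'b::euclidean_space \<Rightarrow> complex"
  assumes \<phi>: "integrable lborel \<phi>" and \<psi>: "integrable lborel \<psi>"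
  shows "integrable lborel (tensor \<phi> \<psi>)"
    and "(\<integral>z. tensor \<phi> \<psi> z \<partial>lborel) = (\<integral>x. \<phi> x \<partial>lborel) * (\<integral>t. \<psi> t \<partial>lborel)"
proof -
  have i: "integrable (lborel \<Otimes>\<^sub>M lborel) (\<lambda>(x, y). 1 * \<phi> x * \<psi> y)"
    by (rule Fubini_bounded_kernel(2)[OF \<phi> \<psi>]) auto
  then show "integrable lborel (tensor \<phi> \<psi>)"
    by (simp add: lborel_prod tensor_def case_prod_beta')
  have "(\<integral>z. tensor \<phi> \<psi> z \<partial>lborel) = (\<integral>z. (\<lambda>(x, y). 1 * \<phi> x * \<psi> y) z \<partial>(lborel \<Otimes>\<^sub>M lborel))"
    by (simp add: lborel_prod tensor_def case_prod_beta')
  also have "\<dots> = (\<integral>x. (\<integral>t. \<phi> x * \<psi> t \<partial>lborel) \<partial>lborel)"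
    using lborel_pair.integral_fst'[OF i] by simp
  finally show "(\<integral>z. tensor \<phi> \<psi> z \<partial>lborel) = (\<integral>x. \<phi> x \<partial>lborel) * (\<integral>t. \<psi> t \<partial>lborel)" by simp
qed

lemma fourier_tensor:
  fixes a :: "'a::euclidean_space \<Rightarrow> complex" and b :: "'b::euclidean_space \<Rightarrow> complex"
  assumes "integrable lborel a" "integrable lborel b"
  shows "fourier (tensor a b) = tensor (fourier a) (fourier b)"
proof
  fix z :: "'a \<times> 'b"
  obtain \<xi> \<tau> where z: "z = (\<xi>, \<tau>)" by (cases z)
  have "fourier (tensor a b) z = (\<integral>w. tensor (\<lambda>x. cis (- 2 * pi * (x \<bullet> \<xi>)) * a x) (\<lambda>t. cis (- 2 * pi * (t \<bullet> \<tau>)) * b t) w \<partial>lborel)"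
    unfolding fourier_cis z tensor_def
  proof (intro Bochner_Integration.integral_cong refl)
    fix w :: "'a \<times> 'b"
    have "cis (- 2 * pi * (w \<bullet> (\<xi>, \<tau>))) = cis (- 2 * pi * (fst w \<bullet> \<xi>)) * cis (- 2 * pi * (snd w \<bullet> \<tau>))"
      unfolding cis_mult by (simp add: inner_prod_def algebra_simps)
    then show "cis (- 2 * pi * (w \<bullet> (\<xi>, \<tau>))) * (a (fst w) * b (snd w))
        = cis (- 2 * pi * (fst w \<bullet> \<xi>)) * a (fst w) * (cis (- 2 * pi * (snd w \<bullet> \<tau>)) * b (snd w))"
      by simp
  qed
  also have "\<dots> = fourier a \<xi> * fourier b \<tau>"
    unfolding fourier_cis by (intro integrable_tensor(2) integrable_cis_mult assms) auto
  finally show "fourier (tensor a b) z = tensor (fourier a) (fourier b) z" by (simp add: z tensor_def)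
qed

text \<open>The transpose of tensoring a distribution with the function \<open>\<psi>\<close>.\<close>

definition partial_integral :: "('b::euclidean_space \<Rightarrow> complex) \<Rightarrow> ('a::euclidean_space \<times> 'b \<Rightarrow> complex) \<Rightarrow> 'a \<Rightarrow> complex" where
  "partial_integral \<psi> \<phi> x = (\<integral>t. \<phi> (x, t) * \<psi> t \<partial>lborel)"

lemma schwartz_bounded: "f \<in> schwartz \<Longrightarrow> set bs \<subseteq> Basis \<Longrightarrow> length bs \<le> N \<Longrightarrow>
    norm (iter_deriv bs f x) \<le> schwartz_seminorm N f"
  using order_trans[OF schwartz_seminorm_ge_weight[of f bs N x] mult_left_mono[OF weight_le_1 schwartz_seminorm_nonneg]]
  by simp

lemma partial_integral_integrable:
  fixes \<phi> :: "'a::euclidean_space \<times> 'b::euclidean_space \<Rightarrow> complex"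
  assumes \<phi>: "\<phi> \<in> schwartz" and \<psi>: "\<psi> \<in> schwartz"
  shows "integrable lborel (\<lambda>t. \<phi> (x, t) * \<psi> t)"
proof (rule Bochner_Integration.integrable_bound)
  show "integrable lborel (\<lambda>t. schwartz_seminorm 0 \<phi> * norm (\<psi> t))"
    by (intro integrable_mult_right integrable_norm schwartz_integrable \<psi>)
  have [measurable]: "\<phi> \<in> borel_measurable borel" "\<psi> \<in> borel_measurable borel"
    using \<phi> \<psi> by (auto intro: schwartz_measurable)
  show "(\<lambda>t. \<phi> (x, t) * \<psi> t) \<in> borel_measurable lborel" by measurable
  show "AE t in lborel. norm (\<phi> (x, t) * \<psi> t) \<le> norm (schwartz_seminorm 0 \<phi> * norm (\<psi> t))"
    using schwartz_bounded[OF \<phi>, of "[]" 0] schwartz_seminorm_nonneg[OF \<phi>, of 0]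
    by (auto simp: norm_mult intro!: mult_right_mono)
qed

lemma sum_Basis_prod:
  "(\<Sum>c\<in>(Basis :: ('a::euclidean_space \<times> 'b::euclidean_space) set). f c)
    = (\<Sum>u\<in>Basis. f (u, 0)) + (\<Sum>v\<in>Basis. f (0, v))"
proof -
  have "(\<Sum>c\<in>(\<lambda>u::'a. (u, 0::'b)) ` Basis \<union> (\<lambda>v::'b. (0::'a, v)) ` Basis. f c)
      = (\<Sum>c\<in>(\<lambda>u. (u, 0)) ` Basis. f c) + (\<Sum>c\<in>(\<lambda>v. (0, v)) ` Basis. f c)"
    by (rule sum.union_disjoint) auto
  then show ?thesis by (simp add: Basis_prod_def sum.reindex inj_on_def)
qed

lemma partial_integral_has_derivative:
  fixes \<phi> :: "'a::euclidean_space \<times> 'b::euclidean_space \<Rightarrow> complex"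
  assumes \<phi>: "\<phi> \<in> schwartz" and \<psi>: "\<psi> \<in> schwartz"
  shows "(partial_integral \<psi> \<phi> has_derivative
    (\<lambda>v. \<Sum>b\<in>Basis. (v \<bullet> b) *\<^sub>R partial_integral \<psi> (dir_deriv (b, 0) \<phi>) x)) (at x)"
  unfolding partial_integral_def
proof (rule has_derivative_integral_quadratic[where
      C="\<lambda>t. (DIM('a \<times> 'b))\<^sup>2 * schwartz_seminorm 2 \<phi> * norm (\<psi> t)"])
  show "integrable lborel (\<lambda>t. \<phi> (y, t) * \<psi> t)" for y by (rule partial_integral_integrable[OF \<phi> \<psi>])
  show "integrable lborel (\<lambda>t. dir_deriv (b, 0) \<phi> (x, t) * \<psi> t)" if "b \<in> Basis" for b
    using that by (intro partial_integral_integrable schwartz_dir_deriv \<phi> \<psi>) (simp add: Basis_prod_def)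
  show "integrable lborel (\<lambda>t. (DIM('a \<times> 'b))\<^sup>2 * schwartz_seminorm 2 \<phi> * norm (\<psi> t))"
    by (intro integrable_mult_right integrable_norm schwartz_integrable \<psi>)
  fix h :: 'a and t :: 'b
  have "norm (\<phi> (x + h, t) - \<phi> (x, t) - (\<Sum>c\<in>Basis. (((x + h, t) - (x, t)) \<bullet> c) *\<^sub>R dir_deriv c \<phi> (x, t)))
      \<le> (DIM('a \<times> 'b))\<^sup>2 * schwartz_seminorm 2 \<phi> * (norm ((x + h, t) - (x, t)))\<^sup>2"
  proof (rule taylor_quadratic_remainder[OF schwartz_smooth[OF \<phi>]])
    fix z b c :: "'a \<times> 'b" assume "b \<in> Basis" "c \<in> Basis"
    then show "norm (dir_deriv c (dir_deriv b \<phi>) z) \<le> schwartz_seminorm 2 \<phi>"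
      using schwartz_bounded[OF \<phi>, of "[c, b]" 2 z] by (simp add: iter_deriv_Cons)
  qed
  also have "(\<Sum>c\<in>Basis. (((x + h, t) - (x, t)) \<bullet> c) *\<^sub>R dir_deriv c \<phi> (x, t))
      = (\<Sum>b\<in>Basis. (h \<bullet> b) *\<^sub>R dir_deriv (b, 0) \<phi> (x, t))"
    by (simp add: sum_Basis_prod inner_prod_def)
  finally have *: "norm (\<phi> (x + h, t) - \<phi> (x, t) - (\<Sum>b\<in>Basis. (h \<bullet> b) *\<^sub>R dir_deriv (b, 0) \<phi> (x, t))) * norm (\<psi> t)
      \<le> ((DIM('a \<times> 'b))\<^sup>2 * schwartz_seminorm 2 \<phi> * (norm h)\<^sup>2) * norm (\<psi> t)"
    by (intro mult_right_mono) (auto simp: norm_Pair)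
  have "\<phi> (x + h, t) * \<psi> t - \<phi> (x, t) * \<psi> t - (\<Sum>b\<in>Basis. (h \<bullet> b) *\<^sub>R (dir_deriv (b, 0) \<phi> (x, t) * \<psi> t))
    = (\<phi> (x + h, t) - \<phi> (x, t) - (\<Sum>b\<in>Basis. (h \<bullet> b) *\<^sub>R dir_deriv (b, 0) \<phi> (x, t))) * \<psi> t"
    by (simp add: left_diff_distrib sum_distrib_right)
  with * show "norm (\<phi> (x + h, t) * \<psi> t - \<phi> (x, t) * \<psi> t - (\<Sum>b\<in>Basis. (h \<bullet> b) *\<^sub>R (dir_deriv (b, 0) \<phi> (x, t) * \<psi> t)))
      \<le> (DIM('a \<times> 'b))\<^sup>2 * schwartz_seminorm 2 \<phi> * norm (\<psi> t) * (norm h)\<^sup>2"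
    by (simp add: norm_mult mult_ac)
qed

lemma dir_deriv_partial_integral:
  fixes \<phi> :: "'a::euclidean_space \<times> 'b::euclidean_space \<Rightarrow> complex"
  assumes \<phi>: "\<phi> \<in> schwartz" and \<psi>: "\<psi> \<in> schwartz" and b: "b \<in> Basis"
  shows "dir_deriv b (partial_integral \<psi> \<phi>) = partial_integral \<psi> (dir_deriv (b, 0) \<phi>)"
proof
  fix x
  have "dir_deriv b (partial_integral \<psi> \<phi>) x = (\<Sum>c\<in>Basis. (b \<bullet> c) *\<^sub>R partial_integral \<psi> (dir_deriv (c, 0) \<phi>) x)"
    by (rule dir_deriv_eqI[OF partial_integral_has_derivative[OF \<phi> \<psi>]])
  also have "\<dots> = (\<Sum>c\<in>Basis. if c = b then partial_integral \<psi> (dir_deriv (c, 0) \<phi>) x else 0)"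
    using b by (intro sum.cong) (auto simp: inner_Basis)
  finally show "dir_deriv b (partial_integral \<psi> \<phi>) x = partial_integral \<psi> (dir_deriv (b, 0) \<phi>) x"
    using b by simp
qed

lemma Basis_Pair_left: "b \<in> Basis \<Longrightarrow> (b, 0) \<in> Basis"
  by (simp add: Basis_prod_def)

lemma set_map_Pair_left: "set bs \<subseteq> Basis \<Longrightarrow> set (map (\<lambda>b. (b, 0)) bs) \<subseteq> Basis"
  by (auto simp: Basis_Pair_left)

lemma iter_deriv_partial_integral:
  fixes \<phi> :: "'a::euclidean_space \<times> 'b::euclidean_space \<Rightarrow> complex"
  assumes \<phi>: "\<phi> \<in> schwartz" and \<psi>: "\<psi> \<in> schwartz"
  shows "set bs \<subseteq> Basis \<Longrightarrow> iter_deriv bs (partial_integral \<psi> \<phi>) = partial_integral \<psi> (iter_deriv (map (\<lambda>b. (b, 0)) bs) \<phi>)"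
proof (induction bs)
  case (Cons b bs)
  then have "iter_deriv (map (\<lambda>b. (b, 0)) bs) \<phi> \<in> schwartz"
    by (intro schwartz_iter_deriv \<phi> set_map_Pair_left) simp
  with Cons show ?case by (simp add: iter_deriv_Cons dir_deriv_partial_integral \<psi>)
qed simp

lemma schwartz_partial_integral:
  fixes \<phi> :: "'a::euclidean_space \<times> 'b::euclidean_space \<Rightarrow> complex"
  assumes \<phi>: "\<phi> \<in> schwartz" and \<psi>: "\<psi> \<in> schwartz"
  shows "partial_integral \<psi> \<phi> \<in> schwartz"
    and "schwartz_seminorm N (partial_integral \<psi> \<phi>) \<le> schwartz_seminorm N \<phi> * (\<integral>t. norm (\<psi> t) \<partial>lborel)"
proof -
  let ?P = "partial_integral \<psi> \<phi>" and ?I = "\<integral>t. norm (\<psi> t) \<partial>lborel"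
  have le: "(1 + norm x) ^ M * norm (iter_deriv bs (?P) x)
      \<le> schwartz_seminorm M \<phi> * ?I"
    if bs: "set bs \<subseteq> Basis" "length bs \<le> M" for M bs x
  proof -
    let ?bs = "map (\<lambda>b. (b, 0::'b)) bs"
    have bs': "set ?bs \<subseteq> Basis" by (rule set_map_Pair_left[OF bs(1)])
    have s: "iter_deriv ?bs \<phi> \<in> schwartz" by (rule schwartz_iter_deriv[OF \<phi> bs'])
    have "(1 + norm x) ^ M * norm (iter_deriv bs (?P) x)
        \<le> (1 + norm x) ^ M * (\<integral>t. norm (iter_deriv ?bs \<phi> (x, t) * \<psi> t) \<partial>lborel)"
      unfolding iter_deriv_partial_integral[OF \<phi> \<psi> bs(1)] partial_integral_def
      by (intro mult_left_mono integral_norm_bound) auto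
    also have "\<dots> = (\<integral>t. (1 + norm x) ^ M * norm (iter_deriv ?bs \<phi> (x, t) * \<psi> t) \<partial>lborel)" by simp
    also have "\<dots> \<le> (\<integral>t. schwartz_seminorm M \<phi> * norm (\<psi> t) \<partial>lborel)"
    proof (rule integral_mono)
      show "integrable lborel (\<lambda>t. (1 + norm x) ^ M * norm (iter_deriv ?bs \<phi> (x, t) * \<psi> t))"
        by (intro integrable_mult_right integrable_norm partial_integral_integrable s \<psi>)
      show "integrable lborel (\<lambda>t. schwartz_seminorm M \<phi> * norm (\<psi> t))"
        by (intro integrable_mult_right integrable_norm schwartz_integrable \<psi>)
      fix t
      have "(1 + norm x) ^ M * norm (iter_deriv ?bs \<phi> (x, t)) \<le> (1 + norm (x, t)) ^ M * norm (iter_deriv ?bs \<phi> (x, t))"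
        using norm_fst_le[of "x" t] by (intro mult_right_mono power_mono) auto
      also have "\<dots> \<le> schwartz_seminorm M \<phi>" using bs by (intro schwartz_seminorm_ge \<phi> bs') simp
      finally have "(1 + norm x) ^ M * norm (iter_deriv ?bs \<phi> (x, t)) * norm (\<psi> t) \<le> schwartz_seminorm M \<phi> * norm (\<psi> t)"
        by (rule mult_right_mono) simp
      then show "(1 + norm x) ^ M * norm (iter_deriv ?bs \<phi> (x, t) * \<psi> t) \<le> schwartz_seminorm M \<phi> * norm (\<psi> t)"
        by (simp add: norm_mult mult.assoc)
    qed
    finally show ?thesis by simp
  qed
  show "?P \<in> schwartz"
  proof (rule schwartzI)
    show "smooth (?P)"
    proof (rule smooth_coinduct[where P="\<lambda>g. \<exists>\<phi>\<in>schwartz. g = partial_integral \<psi> \<phi>"])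
      show "\<exists>\<phi>'\<in>schwartz. ?P = partial_integral \<psi> \<phi>'" using \<phi> by blast
    next
      fix g :: "'a \<Rightarrow> complex" and x :: 'a assume "\<exists>\<phi>\<in>schwartz. g = partial_integral \<psi> \<phi>"
      then show "g differentiable (at x)" using partial_integral_has_derivative[OF _ \<psi>] by (auto intro: differentiableI)
    next
      fix g :: "'a \<Rightarrow> complex" and b :: 'a assume "\<exists>\<phi>\<in>schwartz. g = partial_integral \<psi> \<phi>" "b \<in> Basis"
      then show "\<exists>\<phi>\<in>schwartz. dir_deriv b g = partial_integral \<psi> \<phi>"
        using dir_deriv_partial_integral[OF _ \<psi>] schwartz_dir_deriv Basis_Pair_left by metis
    qed
    fix bs :: "'a list" and N assume bs: "set bs \<subseteq> Basis"
    let ?M = "max N (length bs)"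
    have "(1 + norm z) ^ N * norm (iter_deriv bs (?P) z)
        \<le> (1 + norm z) ^ ?M * norm (iter_deriv bs (?P) z)" for z
      by (intro mult_right_mono power_increasing) auto
    also have "(1 + norm z) ^ ?M * norm (iter_deriv bs (?P) z)
        \<le> schwartz_seminorm ?M \<phi> * ?I" for z
      by (intro le bs) simp
    finally show "\<exists>C. \<forall>x. (1 + norm x) ^ N * norm (iter_deriv bs (?P) x) \<le> C" by blast
  qed
  show "schwartz_seminorm N (?P) \<le> schwartz_seminorm N \<phi> * ?I"
    by (intro schwartz_seminorm_le le)
qed

lemma schwartz_swap:
  fixes f :: "'a::euclidean_space \<times> 'b::euclidean_space \<Rightarrow> complex"
  assumes "f \<in> schwartz"
  shows "(\<lambda>(t, x). f (x, t)) \<in> schwartz"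
proof -
  have A: "bounded_linear (\<lambda>z::'b\<times>'a. (snd z, fst z))"
    by (intro bounded_linear_Pair bounded_linear_fst bounded_linear_snd)
  have "(\<lambda>z::'b\<times>'a. f (snd z, fst z)) \<in> schwartz"
    by (rule schwartz_compose_isometry[OF A _ _ assms])
      (auto simp: Basis_prod_def norm_prod_def add.commute)
  then show ?thesis by (simp add: case_prod_beta')
qed

section \<open>Tempered distributions and convolution\<close>

lemma tempered_linear:
  "L \<in> tempered \<Longrightarrow> \<phi> \<in> schwartz \<Longrightarrow> \<psi> \<in> schwartz \<Longrightarrow> L (\<lambda>x. a * \<phi> x + b * \<psi> x) = a * L \<phi> + b * L \<psi>"
  by (simp add: tempered_def)

lemma tempered_cmult: "L \<in> tempered \<Longrightarrow> \<phi> \<in> schwartz \<Longrightarrow> L (\<lambda>x. a * \<phi> x) = a * L \<phi>"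
  using tempered_linear[of L \<phi> "\<phi>" a 0] by simp

lemma tempered_add:
  "L \<in> tempered \<Longrightarrow> \<phi> \<in> schwartz \<Longrightarrow> \<psi> \<in> schwartz \<Longrightarrow> L (\<lambda>x. \<phi> x + \<psi> x) = L \<phi> + L \<psi>"
  using tempered_linear[of L \<phi> \<psi> 1 1] by simp

lemma tempered_diff:
  "L \<in> tempered \<Longrightarrow> \<phi> \<in> schwartz \<Longrightarrow> \<psi> \<in> schwartz \<Longrightarrow> L (\<lambda>x. \<phi> x - \<psi> x) = L \<phi> - L \<psi>"
  using tempered_linear[of L \<phi> \<psi> 1 "-1"] by simp

lemma tempered_outside: "L \<in> tempered \<Longrightarrow> \<phi> \<notin> schwartz \<Longrightarrow> L \<phi> = 0"
  by (simp add: tempered_def)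

lemma tempered_bound:
  assumes "L \<in> tempered"
  obtains C N where "C \<ge> 0" "\<And>\<phi>. \<phi> \<in> schwartz \<Longrightarrow> norm (L \<phi>) \<le> C * schwartz_seminorm N \<phi>"
proof -
  obtain C N where C: "\<And>\<phi>. \<phi> \<in> schwartz \<Longrightarrow> norm (L \<phi>) \<le> C * schwartz_seminorm N \<phi>"
    using assms unfolding tempered_def by blast
  have "norm (L \<phi>) \<le> max 0 C * schwartz_seminorm N \<phi>" if "\<phi> \<in> schwartz" for \<phi>
    using C[OF that] mult_right_mono[of C "max 0 C" "schwartz_seminorm N \<phi>"] schwartz_seminorm_nonneg[OF that, of N]
    by linarith
  then show ?thesis using that[of "max 0 C" N] by simp
qed

lemma temperedI:
  assumes "\<And>\<phi> \<psi> a b. \<phi> \<in> schwartz \<Longrightarrow> \<psi> \<in> schwartz \<Longrightarrow> L (\<lambda>x. a * \<phi> x + b * \<psi> x) = a * L \<phi> + b * L \<psi>"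
    and "\<And>\<phi>. \<phi> \<in> schwartz \<Longrightarrow> norm (L \<phi>) \<le> C * schwartz_seminorm N \<phi>"
    and "\<And>\<phi>. \<phi> \<notin> schwartz \<Longrightarrow> L \<phi> = 0"
  shows "L \<in> tempered"
  using assms unfolding tempered_def by blast

lemma tempered_sum:
  assumes L: "L \<in> tempered" and "finite I" and f: "\<And>i. i \<in> I \<Longrightarrow> f i \<in> schwartz"
  shows "L (\<lambda>x. \<Sum>i\<in>I. c i * f i x) = (\<Sum>i\<in>I. c i * L (f i))"
  using assms(2) f
proof (induction I)
  case empty
  show ?case using tempered_cmult[OF L schwartz_zero, of 0] by simp
next
  case (insert i I)
  have "(\<lambda>x. \<Sum>i\<in>I. c i * f i x) \<in> schwartz"
    using insert.prems by (intro schwartz_sum schwartz_cmult) simp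
  from tempered_add[OF L schwartz_cmult this, of "f i" "c i"] insert show ?case
    by (simp add: tempered_cmult[OF L])
qed

lemma tempered_distr_comb:
  assumes f: "f \<in> tempered" and g: "g \<in> tempered"
  shows "distr_comb a f b g \<in> tempered"
proof -
  obtain C N where C: "C \<ge> 0" "\<And>\<phi>. \<phi> \<in> schwartz \<Longrightarrow> norm (f \<phi>) \<le> C * schwartz_seminorm N \<phi>"
    using tempered_bound[OF f] by blast
  obtain D M where D: "D \<ge> 0" "\<And>\<phi>. \<phi> \<in> schwartz \<Longrightarrow> norm (g \<phi>) \<le> D * schwartz_seminorm M \<phi>"
    using tempered_bound[OF g] by blast
  show ?thesis
  proof (rule temperedI[where C="norm a * C + norm b * D" and N="max N M"])
    fix \<phi> :: "'a \<Rightarrow> complex" assume p: "\<phi> \<in> schwartz"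
    have "norm (distr_comb a f b g \<phi>) \<le> norm a * norm (f \<phi>) + norm b * norm (g \<phi>)"
      unfolding distr_comb_def using norm_triangle_ineq[of "a * f \<phi>" "b * g \<phi>"] by (simp add: norm_mult)
    also have "\<dots> \<le> norm a * (C * schwartz_seminorm (max N M) \<phi>) + norm b * (D * schwartz_seminorm (max N M) \<phi>)"
      by (intro add_mono mult_left_mono order_trans[OF C(2)[OF p]] order_trans[OF D(2)[OF p]]
          schwartz_seminorm_mono p C(1) D(1)) auto
    finally show "norm (distr_comb a f b g \<phi>) \<le> (norm a * C + norm b * D) * schwartz_seminorm (max N M) \<phi>"
      by (simp add: algebra_simps)
  qed (simp_all add: distr_comb_def tempered_linear f g tempered_outside algebra_simps)
qed

lemma distr_diff_eq_comb: "distr_diff f g = distr_comb 1 f (-1) g"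
  by (simp add: distr_diff_def distr_comb_def fun_eq_iff)

lemma tempered_distr_diff: "f \<in> tempered \<Longrightarrow> g \<in> tempered \<Longrightarrow> distr_diff f g \<in> tempered"
  unfolding distr_diff_eq_comb by (rule tempered_distr_comb)

lemma distr_of_apply: "\<phi> \<in> schwartz \<Longrightarrow> distr_of f \<phi> = (\<integral>x. f x * \<phi> x \<partial>lborel)"
  by (simp add: distr_of_def on_schwartz_def)

lemma schwartz_mult_integrable:
  assumes "f \<in> schwartz" "g \<in> schwartz"
  shows "integrable lborel (\<lambda>x. f x * g x)"
  by (intro schwartz_integrable schwartz_mult_slow slow_schwartz assms)

lemma tempered_distr_of:
  fixes f :: "'a::euclidean_space \<Rightarrow> complex"
  assumes f: "f \<in> schwartz"
  shows "distr_of f \<in> tempered"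
proof (rule temperedI[where C="\<integral>x. norm (f x) \<partial>lborel" and N=0])
  fix \<phi> \<psi> :: "'a \<Rightarrow> complex" and a b assume "\<phi> \<in> schwartz" "\<psi> \<in> schwartz"
  then have i: "integrable lborel (\<lambda>x. a * (f x * \<phi> x))" "integrable lborel (\<lambda>x. b * (f x * \<psi> x))"
    and s: "(\<lambda>x. a * \<phi> x + b * \<psi> x) \<in> schwartz"
    using f by (auto intro!: integrable_mult_right schwartz_mult_integrable schwartz_add schwartz_cmult)
  have "(\<integral>x. f x * (a * \<phi> x + b * \<psi> x) \<partial>lborel) = (\<integral>x. a * (f x * \<phi> x) + b * (f x * \<psi> x) \<partial>lborel)"
    by (simp add: algebra_simps)
  also have "\<dots> = a * (\<integral>x. f x * \<phi> x \<partial>lborel) + b * (\<integral>x. f x * \<psi> x \<partial>lborel)"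
    by (subst Bochner_Integration.integral_add[OF i]) simp
  finally show "distr_of f (\<lambda>x. a * \<phi> x + b * \<psi> x) = a * distr_of f \<phi> + b * distr_of f \<psi>"
    using \<open>\<phi> \<in> schwartz\<close> \<open>\<psi> \<in> schwartz\<close> s by (simp add: distr_of_apply)
next
  fix \<phi> :: "'a \<Rightarrow> complex" assume p: "\<phi> \<in> schwartz"
  have "norm (\<integral>x. f x * \<phi> x \<partial>lborel) \<le> (\<integral>x. norm (f x * \<phi> x) \<partial>lborel)" by (rule integral_norm_bound)
  also have "\<dots> \<le> (\<integral>x. norm (f x) * schwartz_seminorm 0 \<phi> \<partial>lborel)"
  proof (rule integral_mono)
    show "integrable lborel (\<lambda>x. norm (f x * \<phi> x))" by (intro integrable_norm schwartz_mult_integrable f p)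
    show "integrable lborel (\<lambda>x. norm (f x) * schwartz_seminorm 0 \<phi>)"
      by (intro integrable_mult_left integrable_norm schwartz_integrable f)
    show "norm (f x * \<phi> x) \<le> norm (f x) * schwartz_seminorm 0 \<phi>" for x
      using schwartz_bounded[OF p, of "[]" 0 x] by (simp add: norm_mult mult_left_mono)
  qed
  finally show "norm (distr_of f \<phi>) \<le> (\<integral>x. norm (f x) \<partial>lborel) * schwartz_seminorm 0 \<phi>"
    using p by (simp add: distr_of_apply)
qed (simp add: distr_of_def on_schwartz_def)

text \<open>The Lipschitz dependence on the translation makes \<open>x \<mapsto> L (\<lambda>y. K (y - x))\<close> continuous and of
  polynomial growth.\<close>

lemma schwartz_seminorm_translate_diff:
  fixes K :: "'a::euclidean_space \<Rightarrow> complex"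
  assumes K: "K \<in> schwartz" and bs: "set bs \<subseteq> Basis" "length bs \<le> N"
  shows "(1 + norm y) ^ N * norm (iter_deriv bs K (y - x) - iter_deriv bs K (y - x'))
    \<le> DIM('a) * schwartz_seminorm (Suc N) K * ((1 + norm x) * (1 + norm (x' - x))) ^ N * norm (x' - x)"
proof -
  let ?F = "iter_deriv bs K" and ?S = "schwartz_seminorm (Suc N) K"
  let ?B = "?S * (((1 + norm x) * (1 + norm (x' - x))) ^ N * weight N y)"
  have S0: "0 \<le> ?S" by (rule schwartz_seminorm_nonneg[OF K])
  have F: "?F \<in> schwartz" by (rule schwartz_iter_deriv[OF K bs(1)])
  have "norm (?F (y - x) - ?F (y - x')) \<le> DIM('a) * ?B * norm ((y - x) - (y - x'))"
  proof (rule norm_diff_le_dir_deriv_bound)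
    show "?F differentiable at z" for z by (rule smoothD[OF schwartz_smooth[OF F]])
    fix z b assume z: "z \<in> closed_segment (y - x') (y - x)" and b: "(b::'a) \<in> Basis"
    have "norm (z - (y - x)) \<le> norm (x' - x)" using segment_bound(2)[OF z] by (simp add: norm_minus_commute)
    moreover have "norm (y - z) \<le> norm x + norm (z - (y - x))"
      using norm_triangle_ineq4[of x "z - (y - x)"] by simp
    ultimately have "1 + norm (y - z) \<le> (1 + norm x) * (1 + norm (x' - x))"
      by (simp add: algebra_simps) (smt (verit) mult_nonneg_nonneg norm_ge_zero)
    then have w: "(1 + norm (y - z)) ^ N \<le> ((1 + norm x) * (1 + norm (x' - x))) ^ N"
      by (intro power_mono) auto
    have "norm (iter_deriv (b # bs) K z) \<le> ?S * weight (Suc N) z"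
      using b bs by (intro schwartz_seminorm_ge_weight K) auto
    also have "\<dots> \<le> ?S * ((1 + norm (y - z)) ^ N * weight N (z + (y - z)))"
      by (intro mult_left_mono S0 order_trans[OF weight_antimono weight_shift_le]) simp
    also have "\<dots> \<le> ?B" using w by (intro mult_left_mono mult_right_mono S0) auto
    finally show "norm (dir_deriv b ?F z) \<le> ?B" by (simp add: iter_deriv_Cons)
  qed
  then have "(1 + norm y) ^ N * norm (?F (y - x) - ?F (y - x'))
      \<le> (1 + norm y) ^ N * (DIM('a) * ?B * norm ((y - x) - (y - x')))"
    by (rule mult_left_mono) auto
  also have "\<dots> = ((1 + norm y) ^ N * weight N y) * (DIM('a) * ?S * ((1 + norm x) * (1 + norm (x' - x))) ^ N * norm (x' - x))"
    by (simp add: mult_ac)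
  also have "(1 + norm y) ^ N * weight N y = 1" by (simp add: weight_def)
  finally show ?thesis by simp
qed

lemma slow_inv_fourier:
  assumes "moments f"
  shows "slow (inv_fourier f)"
proof -
  have [measurable]: "f \<in> borel_measurable borel" using assms by (rule moments_measurable)
  have "moments (\<lambda>x. f (- x))"
    unfolding moments_def
  proof (intro conjI allI)
    show "integrable lborel (\<lambda>x. (1 + norm x) ^ N * norm (f (- x)))" for N
      using lborel_integrable_reflect[OF moments_integrable_power[OF assms, of N], of 0] by simp
  qed measurable
  moreover have "inv_fourier f = fourier (\<lambda>x. f (- x))"
  proof
    fix x
    have "inv_fourier f x = (\<integral>\<xi>. cis (2 * pi * (x \<bullet> (0 - \<xi>))) * f (0 - \<xi>) \<partial>lborel)"
      unfolding inv_fourier_cis by (rule lborel_integral_reflect[symmetric]) simp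
    then show "inv_fourier f x = fourier (\<lambda>x. f (- x)) x" by (simp add: fourier_cis inner_commute)
  qed
  ultimately show ?thesis using slow_fourier by metis
qed

lemma foldr_mult_coord_mult: "foldr mult_coord bs (\<lambda>x. h x * \<sigma> x) = (\<lambda>x. h x * foldr mult_coord bs \<sigma> x)"
  by (induction bs) (auto simp: mult_coord_def mult_ac)

text \<open>The convolution is the Fourier transform of \<open>\<sigma>\<close> times the slowly increasing function \<open>inv_fourier \<phi>\<close>;
  differentiating it multiplies \<open>\<sigma>\<close> by coordinates.\<close>

lemma
  fixes \<sigma> \<phi> :: "'a::euclidean_space \<Rightarrow> complex"
  assumes \<sigma>: "\<sigma> \<in> schwartz" and \<phi>: "moments \<phi>"
  shows schwartz_conv_fourier: "(\<lambda>y. \<integral>x. fourier \<sigma> (y - x) * \<phi> x \<partial>lborel) \<in> schwartz"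
    and iter_deriv_conv_fourier: "set bs \<subseteq> Basis \<Longrightarrow>
      iter_deriv bs (\<lambda>y. \<integral>x. fourier \<sigma> (y - x) * \<phi> x \<partial>lborel) y = (\<integral>x. iter_deriv bs (fourier \<sigma>) (y - x) * \<phi> x \<partial>lborel)"
proof -
  let ?h = "inv_fourier \<phi>"
  have eq: "(\<lambda>y. \<integral>x. fourier \<sigma> (y - x) * \<phi> x \<partial>lborel) = fourier (\<lambda>\<xi>. ?h \<xi> * \<sigma> \<xi>)"
    using fourier_mult_inv_fourier[OF schwartz_integrable[OF \<sigma>] moments_integrable[OF \<phi>]]
    by (simp add: fun_eq_iff mult.commute)
  have s: "(\<lambda>\<xi>. ?h \<xi> * \<sigma> \<xi>) \<in> schwartz" by (intro schwartz_mult_slow slow_inv_fourier \<phi> \<sigma>)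
  then show "(\<lambda>y. \<integral>x. fourier \<sigma> (y - x) * \<phi> x \<partial>lborel) \<in> schwartz"
    unfolding eq by (rule fourier_schwartz)
  assume bs: "set bs \<subseteq> Basis"
  have "iter_deriv bs (fourier (\<lambda>\<xi>. ?h \<xi> * \<sigma> \<xi>)) y = fourier (\<lambda>\<xi>. foldr mult_coord bs \<sigma> \<xi> * ?h \<xi>) y"
    unfolding iter_deriv_fourier[OF schwartz_moments[OF s] bs] foldr_mult_coord_mult
    by (simp add: mult.commute)
  also have "\<dots> = (\<integral>x. fourier (foldr mult_coord bs \<sigma>) (y - x) * \<phi> x \<partial>lborel)"
    by (intro fourier_mult_inv_fourier schwartz_integrable schwartz_mult_coords \<sigma> bs moments_integrable \<phi>)
  finally show "iter_deriv bs (\<lambda>y. \<integral>x. fourier \<sigma> (y - x) * \<phi> x \<partial>lborel) y = (\<integral>x. iter_deriv bs (fourier \<sigma>) (y - x) * \<phi> x \<partial>lborel)"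
    unfolding eq by (simp add: iter_deriv_fourier schwartz_moments \<sigma> bs)
qed

lemma integral_simple_function_compose:
  fixes s :: "'a::euclidean_space \<Rightarrow> 'c" and G :: "'c \<Rightarrow> complex"
  assumes s: "simple_function lborel s" and \<phi>: "integrable lborel \<phi>"
  shows "(\<integral>x. G (s x) * \<phi> x \<partial>lborel) = (\<Sum>v\<in>range s. G v * (\<integral>x. indicator (s -` {v}) x * \<phi> x \<partial>lborel))"
    and "integrable lborel (\<lambda>x. G (s x) * \<phi> x)"
proof -
  have fin: "finite (range s)" using s by (simp add: simple_function_def)
  have meas: "s -` {v} \<in> sets lborel" for v
  proof (cases "v \<in> range s")
    case True
    then have "s -` {v} \<inter> space lborel \<in> sets lborel" using s by (auto simp: simple_function_def)
    then show ?thesis by simp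
  next
    case False
    then have "s -` {v} = {}" by auto
    then show ?thesis by simp
  qed
  have i: "integrable lborel (\<lambda>x. G v * (indicator (s -` {v}) x * \<phi> x))" for v
  proof (intro integrable_mult_right Bochner_Integration.integrable_bound[OF \<phi>])
    have [measurable]: "\<phi> \<in> borel_measurable borel" "s -` {v} \<in> sets borel"
      using \<phi> meas by (auto dest: borel_measurable_integrable)
    show "(\<lambda>x. indicator (s -` {v}) x * \<phi> x) \<in> borel_measurable lborel" by measurable
  qed (auto simp: indicator_def)
  have eq: "G (s x) * \<phi> x = (\<Sum>v\<in>range s. G v * (indicator (s -` {v}) x * \<phi> x))" for x
  proof -
    have "(\<Sum>v\<in>range s. G v * (indicator (s -` {v}) x * \<phi> x)) = (\<Sum>v\<in>range s. if v = s x then G (s x) * \<phi> x else 0)"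
      by (intro sum.cong) (auto simp: indicator_def)
    then show ?thesis using fin by simp
  qed
  show "(\<integral>x. G (s x) * \<phi> x \<partial>lborel) = (\<Sum>v\<in>range s. G v * (\<integral>x. indicator (s -` {v}) x * \<phi> x \<partial>lborel))"
    unfolding eq by (subst Bochner_Integration.integral_sum) (use i in auto)
  show "integrable lborel (\<lambda>x. G (s x) * \<phi> x)" unfolding eq by (intro Bochner_Integration.integrable_sum i)
qed

lemma tempered_translates:
  fixes K :: "'a::euclidean_space \<Rightarrow> complex"
  assumes L: "L \<in> tempered" and K: "K \<in> schwartz"
  shows "\<exists>C N. \<forall>x. norm (L (\<lambda>y. K (y - x))) \<le> C * (1 + norm x) ^ N"
    and "continuous_on UNIV (\<lambda>x. L (\<lambda>y. K (y - x)))"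
proof -
  obtain C N where C: "C \<ge> 0" "\<And>\<phi>. \<phi> \<in> schwartz \<Longrightarrow> norm (L \<phi>) \<le> C * schwartz_seminorm N \<phi>"
    using tempered_bound[OF L] by blast
  have "norm (L (\<lambda>y. K (y - x))) \<le> (C * schwartz_seminorm N K) * (1 + norm x) ^ N" for x
    using order_trans[OF C(2)[OF schwartz_translate[OF K]]
        mult_left_mono[OF schwartz_seminorm_translate[OF K] C(1)]] by (simp add: mult_ac)
  then show "\<exists>C N. \<forall>x. norm (L (\<lambda>y. K (y - x))) \<le> C * (1 + norm x) ^ N" by (intro exI allI)
  let ?b = "\<lambda>x x'. DIM('a) * schwartz_seminorm (Suc N) K * ((1 + norm x) * (1 + norm (x' - x))) ^ N * norm (x' - x)"
  have le: "norm (L (\<lambda>y. K (y - x)) - L (\<lambda>y. K (y - x'))) \<le> C * ?b x x'" for x x'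
  proof -
    have "norm (L (\<lambda>y. K (y - x)) - L (\<lambda>y. K (y - x'))) = norm (L (\<lambda>y. K (y - x) - K (y - x')))"
      by (simp add: tempered_diff[OF L] schwartz_translate[OF K])
    also have "\<dots> \<le> C * schwartz_seminorm N (\<lambda>y. K (y - x) - K (y - x'))"
      by (intro C schwartz_diff schwartz_translate K)
    also have "\<dots> \<le> C * ?b x x'"
    proof (intro mult_left_mono C(1) schwartz_seminorm_le)
      fix bs :: "'a list" and y assume bs: "set bs \<subseteq> Basis" "length bs \<le> N"
      show "(1 + norm y) ^ N * norm (iter_deriv bs (\<lambda>y. K (y - x) - K (y - x')) y) \<le> ?b x x'"
        using schwartz_seminorm_translate_diff[OF K bs, of y x x']
        by (simp add: schwartz_iter_deriv_diff[OF schwartz_translate[OF K] schwartz_translate[OF K] bs(1)]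
            iter_deriv_translate[OF schwartz_smooth[OF K] bs(1)])
    qed
    finally show ?thesis .
  qed
  have "isCont (\<lambda>x. L (\<lambda>y. K (y - x))) x" for x
  proof -
    have "isCont (\<lambda>x'. C * ?b x x') x" by (intro continuous_intros)
    then have "((\<lambda>x'. C * ?b x x') \<longlongrightarrow> 0) (at x)" unfolding isCont_def by simp
    then have "((\<lambda>x'. L (\<lambda>y. K (y - x)) - L (\<lambda>y. K (y - x'))) \<longlongrightarrow> 0) (at x)"
      by (rule Lim_null_comparison[OF always_eventually[OF allI[OF le]]])
    from tendsto_diff[OF tendsto_const[of "L (\<lambda>y. K (y - x))"] this]
    show ?thesis unfolding isCont_def by simp
  qed
  then show "continuous_on UNIV (\<lambda>x. L (\<lambda>y. K (y - x)))" by (simp add: continuous_on_eq_continuous_at)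
qed

lemma tempered_translates_integrable:
  fixes K :: "'a::euclidean_space \<Rightarrow> complex"
  assumes L: "L \<in> tempered" and K: "K \<in> schwartz" and \<phi>: "moments \<phi>"
  shows "integrable lborel (\<lambda>x. L (\<lambda>y. K (y - x)) * \<phi> x)"
proof -
  obtain C N where C: "\<And>x. norm (L (\<lambda>y. K (y - x))) \<le> C * (1 + norm x) ^ N"
    using tempered_translates(1)[OF L K] by blast
  have [measurable]: "(\<lambda>x. L (\<lambda>y. K (y - x))) \<in> borel_measurable borel"
    by (intro borel_measurable_continuous_onI tempered_translates L K)
  show ?thesis
    by (intro moments_integrable moments_mult_bound[OF \<phi> _ C]) measurable
qed

text \<open>The convolution integral is approximated by replacing the translation \<open>x\<close> with a simple function of
  \<open>x\<close>. This gives a finite sum of translates, on which \<open>L\<close> acts termwise, and the approximations converge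
  in every seminorm.\<close>

theorem tempered_convolution:
  fixes \<sigma> \<phi> :: "'a::euclidean_space \<Rightarrow> complex"
  assumes L: "L \<in> tempered" and \<sigma>: "\<sigma> \<in> schwartz" and \<phi>: "moments \<phi>"
  shows "L (\<lambda>y. \<integral>x. fourier \<sigma> (y - x) * \<phi> x \<partial>lborel) = (\<integral>x. L (\<lambda>y. fourier \<sigma> (y - x)) * \<phi> x \<partial>lborel)"
proof -
  let ?K = "fourier \<sigma>"
  let ?G = "\<lambda>y. \<integral>x. ?K (y - x) * \<phi> x \<partial>lborel" and ?u = "\<lambda>x. L (\<lambda>y. ?K (y - x))"
  have K: "?K \<in> schwartz" by (rule fourier_schwartz[OF \<sigma>])
  have [measurable]: "\<phi> \<in> borel_measurable borel" by (rule moments_measurable[OF \<phi>])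
  have Km [measurable]: "iter_deriv bs ?K \<in> borel_measurable borel" if "set bs \<subseteq> Basis" for bs
    by (intro schwartz_measurable schwartz_iter_deriv K that)
  have um [measurable]: "?u \<in> borel_measurable borel"
    by (intro borel_measurable_continuous_onI tempered_translates L K)
  \<comment> \<open>Simple functions approximating the identity; \<open>?A i\<close> is the convolution with \<open>x\<close> replaced by \<open>s i x\<close>.\<close>
  obtain s :: "nat \<Rightarrow> 'a \<Rightarrow> 'a" where s: "\<And>i. simple_function lborel (s i)"
    and slim: "\<And>x. (\<lambda>i. s i x) \<longlonglongrightarrow> x" and sle: "\<And>i x. norm (s i x) \<le> 2 * norm x"
    using borel_measurable_implies_sequence_metric[of "\<lambda>x::'a. x" lborel 0] by auto
  have sm [measurable]: "s i \<in> borel_measurable borel" for i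
    using borel_measurable_simple_function[OF s[of i]] by simp
  define c where "c i v = (\<integral>x. indicator (s i -` {v}) x * \<phi> x \<partial>lborel)" for i v
  let ?A = "\<lambda>i y. \<Sum>v\<in>range (s i). c i v * ?K (y - v)"
  have fin: "finite (range (s i))" for i using s[of i] by (simp add: simple_function_def)
  have A: "?A i \<in> schwartz" for i by (intro schwartz_sum schwartz_cmult schwartz_translate K)
  have derA: "iter_deriv bs (?A i) y = (\<integral>x. iter_deriv bs ?K (y - s i x) * \<phi> x \<partial>lborel)"
    if bs: "set bs \<subseteq> Basis" for bs i y
  proof -
    have "iter_deriv bs (?A i) y = (\<Sum>v\<in>range (s i). iter_deriv bs (\<lambda>y. c i v * ?K (y - v)) y)"
      by (subst smooth_iter_deriv_sum[OF _ bs])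
        (auto intro!: schwartz_smooth schwartz_cmult schwartz_translate K)
    also have "\<dots> = (\<Sum>v\<in>range (s i). iter_deriv bs ?K (y - v) * c i v)"
      by (intro sum.cong refl)
        (simp add: smooth_iter_deriv_cmult[OF schwartz_smooth[OF schwartz_translate[OF K]] bs]
          iter_deriv_translate[OF schwartz_smooth[OF K] bs])
    also have "\<dots> = (\<integral>x. iter_deriv bs ?K (y - s i x) * \<phi> x \<partial>lborel)"
      unfolding c_def by (rule integral_simple_function_compose(1)[symmetric, OF s moments_integrable[OF \<phi>]])
    finally show ?thesis .
  qed
  have G: "?G \<in> schwartz" by (rule schwartz_conv_fourier[OF \<sigma> \<phi>])
  obtain C N where C: "C \<ge> 0" "\<And>\<phi>. \<phi> \<in> schwartz \<Longrightarrow> norm (L \<phi>) \<le> C * schwartz_seminorm N \<phi>"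
    using tempered_bound[OF L] by blast
  define B where "B = DIM('a) * schwartz_seminorm (Suc N) ?K"
  have B0: "0 \<le> B" unfolding B_def by (intro mult_nonneg_nonneg schwartz_seminorm_nonneg K) simp
  \<comment> \<open>An integrand that bounds all weighted derivatives of the error; it is dominated uniformly in \<open>i\<close>.\<close>
  let ?d = "\<lambda>i x. B * ((1 + norm x) * (1 + norm (s i x - x))) ^ N * norm (s i x - x) * norm (\<phi> x)"
  have dom: "?d i x \<le> B * 3 ^ Suc N * ((1 + norm x) ^ (2 * N + 1) * norm (\<phi> x))" for i x
  proof -
    have "norm (s i x - x) \<le> 3 * norm x" using norm_triangle_ineq4[of "s i x" x] sle[of i x] by linarith
    then have "1 + norm (s i x - x) \<le> 1 + 3 * norm x" by (rule add_left_mono)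
    also have "\<dots> \<le> 3 * (1 + norm x)" by simp
    finally have n2: "1 + norm (s i x - x) \<le> 3 * (1 + norm x)" .
    then have n1: "norm (s i x - x) \<le> 3 * (1 + norm x)" by linarith
    note n = n1 n2
    have "B * ((1 + norm x) * (1 + norm (s i x - x))) ^ N * norm (s i x - x)
        \<le> B * ((1 + norm x) * (3 * (1 + norm x))) ^ N * (3 * (1 + norm x))"
      by (intro mult_mono power_mono n B0 order_refl zero_le_power mult_nonneg_nonneg) auto
    also have "\<dots> = B * 3 ^ Suc N * (1 + norm x) ^ (2 * N + 1)"
    proof -
      have "B * (t * (3 * t)) ^ N * (3 * t) = B * 3 ^ Suc N * t ^ (2 * N + 1)" for t :: real
        by (simp add: power_mult_distrib power_mult power2_eq_square)
      then show ?thesis .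
    qed
    finally have "?d i x \<le> B * 3 ^ Suc N * (1 + norm x) ^ (2 * N + 1) * norm (\<phi> x)"
      by (rule mult_right_mono) simp
    then show ?thesis by (simp add: mult.assoc)
  qed
  have domi: "integrable lborel (\<lambda>x. B * 3 ^ Suc N * ((1 + norm x) ^ (2 * N + 1) * norm (\<phi> x)))"
    by (intro integrable_mult_right moments_integrable_power \<phi>)
  have d0: "0 \<le> ?d i x" for i x using B0 by (intro mult_nonneg_nonneg zero_le_power) auto
  have di: "integrable lborel (?d i)" for i
  proof (rule Bochner_Integration.integrable_bound[OF domi])
    show "AE x in lborel. norm (?d i x) \<le> norm (B * 3 ^ Suc N * ((1 + norm x) ^ (2 * N + 1) * norm (\<phi> x)))"
      using dom d0 by (intro AE_I2) (smt (verit) real_norm_def)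
  qed measurable
  have dlim: "(\<lambda>i. \<integral>x. ?d i x \<partial>lborel) \<longlonglongrightarrow> (\<integral>x. 0 \<partial>(lborel :: 'a measure))"
  proof (rule integral_dominated_convergence[OF _ _ domi])
    show "AE x in lborel. (\<lambda>i. ?d i x) \<longlonglongrightarrow> 0"
    proof (rule AE_I2)
      fix x
      have "(\<lambda>i. norm (s i x - x)) \<longlonglongrightarrow> 0"
        using tendsto_norm[OF tendsto_diff[OF slim[of x] tendsto_const[of x]]] by simp
      then have "(\<lambda>i. ?d i x) \<longlonglongrightarrow> B * ((1 + norm x) * (1 + 0)) ^ N * 0 * norm (\<phi> x)"
        by (intro tendsto_mult tendsto_power tendsto_add tendsto_const)
      then show "(\<lambda>i. ?d i x) \<longlonglongrightarrow> 0" by simp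
    qed
    show "AE x in lborel. norm (?d i x) \<le> B * 3 ^ Suc N * ((1 + norm x) ^ (2 * N + 1) * norm (\<phi> x))" for i
      using dom d0 by (intro AE_I2) (smt (verit) real_norm_def)
  qed measurable
  have le: "norm (L ?G - L (?A i)) \<le> C * (\<integral>x. ?d i x \<partial>lborel)" for i
  proof -
    have "norm (L ?G - L (?A i)) = norm (L (\<lambda>y. ?G y - ?A i y))" by (simp add: tempered_diff[OF L G A])
    also have "\<dots> \<le> C * schwartz_seminorm N (\<lambda>y. ?G y - ?A i y)" by (intro C schwartz_diff G A)
    also have "\<dots> \<le> C * (\<integral>x. ?d i x \<partial>lborel)"
    proof (intro mult_left_mono C(1) schwartz_seminorm_le)
      fix bs :: "'a list" and y assume bs: "set bs \<subseteq> Basis" "length bs \<le> N"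
      let ?D = "iter_deriv bs ?K"
      have i1: "integrable lborel (\<lambda>x. ?D (y - x) * \<phi> x)"
      proof (rule integrable_moments_bound[OF \<phi>, where N=0])
        show "norm (?D (y - x) * \<phi> x) \<le> schwartz_seminorm N ?K * (1 + norm x) ^ 0 * norm (\<phi> x)" for x
          using schwartz_bounded[OF K bs] by (simp add: norm_mult mult_right_mono)
        show "(\<lambda>x. ?D (y - x) * \<phi> x) \<in> borel_measurable borel" using Km[OF bs(1)] by measurable
      qed
      have i2: "integrable lborel (\<lambda>x. ?D (y - s i x) * \<phi> x)"
        by (rule integral_simple_function_compose(2)[OF s moments_integrable[OF \<phi>]])
      have "(1 + norm y) ^ N * norm (iter_deriv bs (\<lambda>y. ?G y - ?A i y) y)
          = (1 + norm y) ^ N * norm (\<integral>x. ?D (y - x) * \<phi> x - ?D (y - s i x) * \<phi> x \<partial>lborel)"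
        unfolding schwartz_iter_deriv_diff[OF G A bs(1)] iter_deriv_conv_fourier[OF \<sigma> \<phi> bs(1)] derA[OF bs(1)]
        using i1 i2 by simp
      also have "\<dots> \<le> (1 + norm y) ^ N * (\<integral>x. norm (?D (y - x) * \<phi> x - ?D (y - s i x) * \<phi> x) \<partial>lborel)"
        by (intro mult_left_mono integral_norm_bound) auto
      also have "\<dots> = (\<integral>x. (1 + norm y) ^ N * norm (?D (y - x) * \<phi> x - ?D (y - s i x) * \<phi> x) \<partial>lborel)" by simp
      also have "\<dots> \<le> (\<integral>x. ?d i x \<partial>lborel)"
      proof (rule integral_mono)
        show "integrable lborel (\<lambda>x. (1 + norm y) ^ N * norm (?D (y - x) * \<phi> x - ?D (y - s i x) * \<phi> x))"
          using i1 i2 by (intro integrable_mult_right integrable_norm Bochner_Integration.integrable_diff)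
        fix x
        have "(1 + norm y) ^ N * norm (?D (y - x) - ?D (y - s i x)) * norm (\<phi> x) \<le> ?d i x"
          using schwartz_seminorm_translate_diff[OF K bs, of y x "s i x"] unfolding B_def by (intro mult_right_mono) auto
        moreover have "?D (y - x) * \<phi> x - ?D (y - s i x) * \<phi> x = (?D (y - x) - ?D (y - s i x)) * \<phi> x"
          by (simp add: left_diff_distrib)
        ultimately show "(1 + norm y) ^ N * norm (?D (y - x) * \<phi> x - ?D (y - s i x) * \<phi> x) \<le> ?d i x"
          by (simp add: norm_mult mult.assoc)
      qed (rule di)
      finally show "(1 + norm y) ^ N * norm (iter_deriv bs (\<lambda>y. ?G y - ?A i y) y) \<le> (\<integral>x. ?d i x \<partial>lborel)" .
    qed
    finally show ?thesis .
  qed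
  have "(\<lambda>i. C * (\<integral>x. ?d i x \<partial>lborel)) \<longlonglongrightarrow> 0"
    using tendsto_mult[OF tendsto_const[of C] dlim] by simp
  then have "(\<lambda>i. L ?G - L (?A i)) \<longlonglongrightarrow> 0"
    by (rule Lim_null_comparison[OF always_eventually[OF allI[OF le]]])
  from tendsto_diff[OF tendsto_const[of "L ?G"] this]
  have lim1: "(\<lambda>i. L (?A i)) \<longlonglongrightarrow> L ?G" by simp
  have LA: "L (?A i) = (\<integral>x. ?u (s i x) * \<phi> x \<partial>lborel)" for i
  proof -
    have "L (?A i) = (\<Sum>v\<in>range (s i). c i v * ?u v)"
      by (rule tempered_sum[OF L fin]) (rule schwartz_translate[OF K])
    also have "\<dots> = (\<Sum>v\<in>range (s i). ?u v * c i v)" by (simp only: mult.commute)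
    also have "\<dots> = (\<integral>x. ?u (s i x) * \<phi> x \<partial>lborel)"
      unfolding c_def
      by (rule integral_simple_function_compose(1)[where G="?u", symmetric, OF s moments_integrable[OF \<phi>]])
    finally show ?thesis .
  qed
  obtain D M where D: "\<And>x. norm (?u x) \<le> D * (1 + norm x) ^ M"
    using tempered_translates(1)[OF L K] by blast
  have D0: "0 \<le> D" using order_trans[OF norm_ge_zero D[of 0]] by simp
  have "(\<lambda>i. \<integral>x. ?u (s i x) * \<phi> x \<partial>lborel) \<longlonglongrightarrow> (\<integral>x. ?u x * \<phi> x \<partial>lborel)"
  proof (rule integral_dominated_convergence[where w="\<lambda>x. D * 2 ^ M * ((1 + norm x) ^ M * norm (\<phi> x))"])
    show "integrable lborel (\<lambda>x. D * 2 ^ M * ((1 + norm x) ^ M * norm (\<phi> x)))"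
      by (intro integrable_mult_right moments_integrable_power \<phi>)
    show "AE x in lborel. (\<lambda>i. ?u (s i x) * \<phi> x) \<longlonglongrightarrow> ?u x * \<phi> x"
    proof (rule AE_I2)
      fix x
      have "isCont ?u x" using tempered_translates(2)[OF L K] by (simp add: continuous_on_eq_continuous_at)
      from isCont_tendsto_compose[OF this slim[of x]]
      show "(\<lambda>i. ?u (s i x) * \<phi> x) \<longlonglongrightarrow> ?u x * \<phi> x" by (intro tendsto_mult tendsto_const)
    qed
    fix i
    have "norm (?u (s i x) * \<phi> x) \<le> D * 2 ^ M * ((1 + norm x) ^ M * norm (\<phi> x))" for x
    proof -
      have "norm (?u (s i x)) \<le> D * (1 + norm (s i x)) ^ M" by (rule D)
      also have "\<dots> \<le> D * (2 * (1 + norm x)) ^ M"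
        using sle[of i x] by (intro mult_left_mono power_mono D0) auto
      finally have "norm (?u (s i x)) * norm (\<phi> x) \<le> D * (2 * (1 + norm x)) ^ M * norm (\<phi> x)"
        by (rule mult_right_mono) simp
      then show ?thesis unfolding power_mult_distrib norm_mult by (simp only: mult.assoc)
    qed
    then show "AE x in lborel. norm (?u (s i x) * \<phi> x) \<le> D * 2 ^ M * ((1 + norm x) ^ M * norm (\<phi> x))" by simp
    show "(\<lambda>x. ?u (s i x) * \<phi> x) \<in> borel_measurable lborel"
      using measurable_compose[OF sm um] by measurable
  qed measurable
  with lim1 show ?thesis unfolding LA using LIMSEQ_unique by blast
qed

section \<open>Recovering the function from its distribution\<close>

lemma smooth_compose_inner:
  fixes \<eta> :: "real \<Rightarrow> real" and w :: "'a::euclidean_space"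
  assumes "smooth \<eta>"
  shows "smooth (\<lambda>x. \<eta> (x \<bullet> w + d))"
proof (rule smooth_coinduct[where P="\<lambda>g. \<exists>\<theta> c. smooth \<theta> \<and> g = (\<lambda>x. c * \<theta> (x \<bullet> w + d))"])
  show "\<exists>\<theta> c. smooth \<theta> \<and> (\<lambda>x. \<eta> (x \<bullet> w + d)) = (\<lambda>x. c * \<theta> (x \<bullet> w + d))"
    using assms by (intro exI[of _ \<eta>] exI[of _ 1]) simp
next
  fix g :: "'a \<Rightarrow> real" and x :: 'a assume "\<exists>\<theta> c. smooth \<theta> \<and> g = (\<lambda>x. c * \<theta> (x \<bullet> w + d))"
  then obtain \<theta> :: "real \<Rightarrow> real" and c where t: "smooth \<theta>" "g = (\<lambda>x. c * \<theta> (x \<bullet> w + d))" by blast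
  show "g differentiable (at x)"
    unfolding t(2)
    by (rule bounded_linear_differentiable[OF bounded_linear_mult_right])
      (rule differentiable_compose_affine[OF bounded_linear_inner_left smoothD[OF t(1)]])
next
  fix g :: "'a \<Rightarrow> real" and b :: 'a
  assume "\<exists>\<theta> c. smooth \<theta> \<and> g = (\<lambda>x. c * \<theta> (x \<bullet> w + d))"
  then obtain \<theta> :: "real \<Rightarrow> real" and c where t: "smooth \<theta>" "g = (\<lambda>x. c * \<theta> (x \<bullet> w + d))" by blast
  have "dir_deriv b g = (\<lambda>x. c * dir_deriv b (\<lambda>x. \<theta> (x \<bullet> w + d)) x)"
    unfolding t(2) by (rule dir_deriv_bounded_linear[OF bounded_linear_mult_right])
      (rule differentiable_compose_affine[OF bounded_linear_inner_left smoothD[OF t(1)]])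
  also have "\<dots> = (\<lambda>x. c * dir_deriv ((b \<bullet> w) *\<^sub>R 1) \<theta> (x \<bullet> w + d))"
    unfolding dir_deriv_compose_affine[OF bounded_linear_inner_left smoothD[OF t(1)]] by simp
  also have "\<dots> = (\<lambda>x. (c * (b \<bullet> w)) * dir_deriv 1 \<theta> (x \<bullet> w + d))"
    unfolding dir_deriv_scaleR[OF smoothD[OF t(1)]] by (simp add: mult.assoc)
  finally show "\<exists>\<theta> c. smooth \<theta> \<and> dir_deriv b g = (\<lambda>x. c * \<theta> (x \<bullet> w + d))"
    using smooth_dir_deriv[OF t(1), of 1] by auto
qed

lemma schwartz_compact_support:
  fixes f :: "'a::euclidean_space \<Rightarrow> complex"
  assumes f: "smooth f" and R: "\<And>x. norm x > R \<Longrightarrow> f x = 0"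
  shows "f \<in> schwartz"
proof (rule schwartzI[OF f])
  fix bs :: "'a list" and N assume bs: "set bs \<subseteq> Basis"
  let ?g = "\<lambda>x. (1 + norm x) ^ N * norm (iter_deriv bs f x)"
  have "continuous_on UNIV (iter_deriv bs f)"
    by (meson differentiable_imp_continuous_on differentiable_on_def differentiable_at_withinI
        smoothD smooth_iter_deriv f bs)
  then have "continuous_on (cball 0 R) ?g"
    by (intro continuous_intros) (auto intro: continuous_on_subset)
  from compact_imp_bounded[OF compact_continuous_image[OF this compact_cball]]
  obtain B where B': "\<forall>y\<in>?g ` cball 0 R. norm y \<le> B"
    unfolding bounded_iff by blast
  have B: "?g x \<le> B" if "x \<in> cball 0 R" for x
    using bspec[OF B' imageI[OF that]] unfolding real_norm_def by linarith
  have z: "iter_deriv bs (\<lambda>x::'a. 0::complex) = (\<lambda>x. 0)" for bs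
    by (induction bs) (auto simp: iter_deriv_Cons)
  have op: "open {x::'a. R < norm x}" by (intro open_Collect_less continuous_intros)
  have out: "iter_deriv bs f x = 0" if x: "norm x > R" for x
    using iter_deriv_cong_open[OF op _ smooth_const bs, of f 0 x] R x by (simp add: z)
  have "?g x \<le> max 0 B" for x
  proof (cases "norm x > R")
    case True
    then show ?thesis by (simp add: out)
  next
    case False
    then have "x \<in> cball 0 R" by simp
    from B[OF this] show ?thesis by simp
  qed
  then show "\<exists>C. \<forall>x. ?g x \<le> C" by blast
qed

locale cutoff_function =
  fixes \<eta> :: "real \<Rightarrow> real"
  assumes smooth_eta: "smooth \<eta>"
    and eta_bounds: "\<And>\<xi>. 0 \<le> \<eta> \<xi> \<and> \<eta> \<xi> \<le> 1"
    and eta_eq_1: "\<And>\<xi>. \<bar>\<xi>\<bar> \<le> 1 \<Longrightarrow> \<eta> \<xi> = 1"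
    and eta_eq_0: "\<And>\<xi>. \<bar>\<xi>\<bar> \<ge> 2 \<Longrightarrow> \<eta> \<xi> = 0"
begin

definition chi :: "'a::euclidean_space \<Rightarrow> complex" where
  "chi \<xi> = of_real (\<Prod>b\<in>Basis. \<eta> (\<xi> \<bullet> b))"

lemma smooth_chi: "smooth chi"
proof -
  have "smooth (\<lambda>x::'a. \<eta> (x \<bullet> b))" for b
    using smooth_compose_inner[OF smooth_eta, of b 0] by simp
  then show ?thesis unfolding chi_def by (intro smooth_of_real smooth_prod)
qed

lemma chi_eq_0: "b \<in> Basis \<Longrightarrow> \<bar>\<xi> \<bullet> b\<bar> \<ge> 2 \<Longrightarrow> chi \<xi> = 0"
  by (auto simp: chi_def intro!: prod_zero bexI[of _ b] eta_eq_0)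

lemma chi_eq_1: "(\<And>b. b \<in> Basis \<Longrightarrow> \<bar>\<xi> \<bullet> b\<bar> \<le> 1) \<Longrightarrow> chi \<xi> = 1"
  by (simp add: chi_def eta_eq_1)

lemma chi_eq_0_norm:
  assumes "norm (\<xi>::'a::euclidean_space) > 2 * DIM('a)"
  shows "chi \<xi> = 0"
proof (rule ccontr)
  assume "chi \<xi> \<noteq> 0"
  then have "\<bar>\<xi> \<bullet> b\<bar> \<le> 2" if "b \<in> Basis" for b using chi_eq_0[OF that, of \<xi>] by force
  then have "norm \<xi> \<le> (\<Sum>b\<in>(Basis::'a set). 2)"
    by (intro order_trans[OF norm_le_l1] sum_mono) auto
  with assms show False by simp
qed

lemma schwartz_chi: "(chi :: 'a::euclidean_space \<Rightarrow> complex) \<in> schwartz"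
  by (rule schwartz_compact_support[OF smooth_chi]) (rule chi_eq_0_norm)

lemma chi_real: "chi \<xi> = of_real (Re (chi \<xi>))" "0 \<le> Re (chi \<xi>)" "Re (chi \<xi>) \<le> 1"
  using eta_bounds by (auto simp: chi_def prod_nonneg simp del: of_real_prod intro!: prod_le_1)

text \<open>Test with a bump supported near a point where the functions differ.\<close>

lemma distribution_determines_continuous_function:
  fixes g g' :: "'a::euclidean_space \<Rightarrow> complex"
  assumes g: "continuous_on UNIV g" "\<And>\<phi>. \<phi> \<in> schwartz \<Longrightarrow> integrable lborel (\<lambda>x. g x * \<phi> x)"
    and g': "continuous_on UNIV g'" "\<And>\<phi>. \<phi> \<in> schwartz \<Longrightarrow> integrable lborel (\<lambda>x. g' x * \<phi> x)"
    and eq: "\<And>\<phi>. \<phi> \<in> schwartz \<Longrightarrow> (\<integral>x. g x * \<phi> x \<partial>lborel) = (\<integral>x. g' x * \<phi> x \<partial>lborel)"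
  shows "g = g'"
proof (rule ccontr)
  assume "g \<noteq> g'"
  then obtain a where a: "g a \<noteq> g' a" by blast
  define h where "h x = (g x - g' x) / (g a - g' a)" for x
  have "continuous_on UNIV h" unfolding h_def using a by (intro continuous_intros g g') auto
  then have "isCont h a" by (simp add: continuous_on_eq_continuous_at)
  then obtain d where d: "d > 0" "\<And>x. dist x a < d \<Longrightarrow> dist (h x) (h a) < 1 / 2"
    unfolding continuous_at_eps_delta by (elim allE[of _ "1 / 2"]) auto
  have ha: "h a = 1" using a by (simp add: h_def)
  have Re_h: "Re (h x) \<ge> 1 / 2" if "dist x a < d" for x
  proof -
    have "\<bar>Re (h x - 1)\<bar> \<le> norm (h x - 1)" by (rule abs_Re_le_cmod)
    then show ?thesis using d(2)[OF that] by (simp add: ha dist_norm)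
  qed
  \<comment> \<open>\<open>chi\<close> vanishes outside the ball of radius \<open>2 * DIM('a)\<close>, so \<open>\<phi>\<close> below vanishes outside the ball of radius \<open>d\<close>.\<close>
  define e where "e = d / (4 * DIM('a))"
  have e: "e > 0" using d by (simp add: e_def)
  define \<phi> where "\<phi> x = chi ((1 / e) *\<^sub>R x + (- (1 / e)) *\<^sub>R a)" for x :: 'a
  have \<phi>: "\<phi> \<in> schwartz" unfolding \<phi>_def using e by (intro schwartz_dilate_translate schwartz_chi) auto
  have arg: "(1 / e) *\<^sub>R x + (- (1 / e)) *\<^sub>R a = (1 / e) *\<^sub>R (x - a)" for x by (simp add: scaleR_diff_right)
  have \<phi>out: "\<phi> x = 0" if "dist x a \<ge> d" for x
    unfolding \<phi>_def arg
  proof (rule chi_eq_0_norm)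
    have "2 * DIM('a) < 4 * real DIM('a)" by simp
    also have "\<dots> = d / e" using d by (simp add: e_def)
    also have "\<dots> \<le> norm (x - a) / e" using that e by (intro divide_right_mono) (auto simp: dist_norm)
    finally show "real (2 * DIM('a)) < norm ((1 / e) *\<^sub>R (x - a))" using e by simp
  qed
  have \<phi>in: "\<phi> x = 1" if "dist x a \<le> e" for x
    unfolding \<phi>_def arg
  proof (rule chi_eq_1)
    fix b :: 'a assume b: "b \<in> Basis"
    have "\<bar>(x - a) \<bullet> b\<bar> \<le> e" using Basis_le_norm[OF b, of "x - a"] that by (simp add: dist_norm)
    then show "\<bar>((1 / e) *\<^sub>R (x - a)) \<bullet> b\<bar> \<le> 1" using e by (simp add: abs_mult)
  qed
  have \<phi>re: "\<phi> x = of_real (Re (\<phi> x))" "0 \<le> Re (\<phi> x)" for x unfolding \<phi>_def using chi_real by auto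
  have ih: "integrable lborel (\<lambda>x. h x * \<phi> x)"
  proof -
    have "integrable lborel (\<lambda>x. (1 / (g a - g' a)) * (g x * \<phi> x - g' x * \<phi> x))"
      by (intro integrable_mult_right Bochner_Integration.integrable_diff g g' \<phi>)
    then show ?thesis by (simp add: h_def left_diff_distrib)
  qed
  have "(\<integral>x. h x * \<phi> x \<partial>lborel) = (\<integral>x. (1 / (g a - g' a)) * (g x * \<phi> x - g' x * \<phi> x) \<partial>lborel)"
    by (simp add: h_def left_diff_distrib)
  also have "\<dots> = 0" using eq[OF \<phi>] g(2)[OF \<phi>] g'(2)[OF \<phi>] by simp
  finally have "0 = Re (\<integral>x. h x * \<phi> x \<partial>lborel)" by simp
  also have "\<dots> = (\<integral>x. Re (h x * \<phi> x) \<partial>lborel)" by (rule integral_Re[symmetric, OF ih])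
  also have "\<dots> \<ge> (\<integral>x. 1 / 2 * indicator (ball a (min d e)) x \<partial>lborel)"
  proof (rule integral_mono)
    show "integrable lborel (\<lambda>x. 1 / 2 * indicator (ball a (min d e)) x :: real)"
      using emeasure_bounded_finite[OF bounded_ball, of a "min d e"]
      by (intro integrable_mult_right integrable_real_indicator) auto
    show "integrable lborel (\<lambda>x. Re (h x * \<phi> x))" using ih by (rule integrable_Re)
    fix x
    have R: "Re (h x * \<phi> x) = Re (h x) * Re (\<phi> x)"
      by (subst \<phi>re(1)) (simp add: Re_complex_of_real)
    show "1 / 2 * indicator (ball a (min d e)) x \<le> Re (h x * \<phi> x)"
    proof (cases "x \<in> ball a (min d e)")
      case True
      then have "dist x a < d" "dist x a \<le> e" by (auto simp: dist_commute)
      then have "\<phi> x = 1" "Re (h x) \<ge> 1 / 2" using \<phi>in Re_h by blast+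
      with True show ?thesis by simp
    next
      case False
      have "0 \<le> Re (h x) * Re (\<phi> x)"
      proof (cases "dist x a < d")
        case True
        then show ?thesis using Re_h[OF True] \<phi>re(2)[of x] by (intro mult_nonneg_nonneg) auto
      next
        case False
        then show ?thesis by (simp add: \<phi>out)
      qed
      with False show ?thesis unfolding R by simp
    qed
  qed
  finally have "measure lborel (ball a (min d e)) \<le> 0" by simp
  moreover have "0 < measure lborel (ball a (min d e))"
    using d e by (simp add: content_ball_pos)
  ultimately show False by simp
qed

lemma fun_of_distr_eqI:
  fixes g :: "'a::euclidean_space \<Rightarrow> complex"
  assumes "continuous_on UNIV g" "\<And>\<phi>. \<phi> \<in> schwartz \<Longrightarrow> integrable lborel (\<lambda>x. g x * \<phi> x)"
    and "\<And>\<phi>. \<phi> \<in> schwartz \<Longrightarrow> L \<phi> = (\<integral>x. g x * \<phi> x \<partial>lborel)"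
  shows "fun_of_distr L = g"
  unfolding fun_of_distr_def
proof (rule the_equality)
  show "continuous_on UNIV g \<and> (\<forall>\<phi>\<in>schwartz. integrable lborel (\<lambda>x. g x * \<phi> x) \<and> L \<phi> = (\<integral>x. g x * \<phi> x \<partial>lborel))"
    using assms by blast
  fix h assume "continuous_on UNIV h \<and> (\<forall>\<phi>\<in>schwartz. integrable lborel (\<lambda>x. h x * \<phi> x) \<and> L \<phi> = (\<integral>x. h x * \<phi> x \<partial>lborel))"
  then have h: "continuous_on UNIV h" "\<And>\<phi>. \<phi> \<in> schwartz \<Longrightarrow> integrable lborel (\<lambda>x. h x * \<phi> x)"
    "\<And>\<phi>. \<phi> \<in> schwartz \<Longrightarrow> L \<phi> = (\<integral>x. h x * \<phi> x \<partial>lborel)" by simp_all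
  show "h = g"
    by (rule distribution_determines_continuous_function[OF h(1,2) assms(1,2)])
      (simp_all only: h(3)[symmetric] assms(3)[symmetric])
qed

text \<open>On the test function \<open>\<phi>\<close> the multiplier acts as the convolution with its Fourier transform, and \<open>L\<close> is
  moved inside the convolution integral.\<close>

theorem fourier_multiplier_eq:
  fixes L :: "'a::euclidean_space distr"
  assumes L: "L \<in> tempered" and m: "(\<lambda>\<xi>. complex_of_real (m \<xi>)) \<in> schwartz"
  shows "fun_of_distr (inv_fourier_distr (mult_distr m (fourier_distr L)))
    = (\<lambda>x. L (\<lambda>y. fourier (\<lambda>\<xi>. of_real (m \<xi>)) (y - x)))"
proof (rule fun_of_distr_eqI)
  let ?\<sigma> = "\<lambda>\<xi>. complex_of_real (m \<xi>)"
  have K: "fourier ?\<sigma> \<in> schwartz" by (rule fourier_schwartz[OF m])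
  show "continuous_on UNIV (\<lambda>x. L (\<lambda>y. fourier ?\<sigma> (y - x)))" by (rule tempered_translates(2)[OF L K])
  fix \<phi> :: "'a \<Rightarrow> complex" assume p: "\<phi> \<in> schwartz"
  show "integrable lborel (\<lambda>x. L (\<lambda>y. fourier ?\<sigma> (y - x)) * \<phi> x)"
    by (rule tempered_translates_integrable[OF L K schwartz_moments[OF p]])
  have h: "inv_fourier \<phi> \<in> schwartz" by (rule inv_fourier_schwartz[OF p])
  then have "(\<lambda>\<xi>. ?\<sigma> \<xi> * inv_fourier \<phi> \<xi>) \<in> schwartz" by (intro schwartz_mult_slow slow_schwartz m)
  then have "inv_fourier_distr (mult_distr m (fourier_distr L)) \<phi> = L (fourier (\<lambda>\<xi>. ?\<sigma> \<xi> * inv_fourier \<phi> \<xi>))"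
    using p h by (simp add: inv_fourier_distr_def mult_distr_def fourier_distr_def on_schwartz_def)
  also have "fourier (\<lambda>\<xi>. ?\<sigma> \<xi> * inv_fourier \<phi> \<xi>) = (\<lambda>y. \<integral>x. fourier ?\<sigma> (y - x) * \<phi> x \<partial>lborel)"
    by (rule ext) (rule fourier_mult_inv_fourier[OF schwartz_integrable[OF m] schwartz_integrable[OF p]])
  also have "L \<dots> = (\<integral>x. L (\<lambda>y. fourier ?\<sigma> (y - x)) * \<phi> x \<partial>lborel)"
    by (rule tempered_convolution[OF L m schwartz_moments[OF p]])
  finally show "inv_fourier_distr (mult_distr m (fourier_distr L)) \<phi> = (\<integral>x. L (\<lambda>y. fourier ?\<sigma> (y - x)) * \<phi> x \<partial>lborel)" .
qed

end

lemma weight_compose_measurable [measurable]: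
  "f \<in> borel_measurable M \<Longrightarrow> (\<lambda>x. weight N (f x)) \<in> borel_measurable M"
  by (rule measurable_compose[OF _ weight_measurable])

section \<open>The lattice and the frequency-uniform partition of unity\<close>

lemma int_lattice_add: "k \<in> int_lattice \<Longrightarrow> l \<in> int_lattice \<Longrightarrow> k + l \<in> int_lattice"
  by (simp add: int_lattice_def inner_add_left)

lemma int_lattice_diff: "k \<in> int_lattice \<Longrightarrow> l \<in> int_lattice \<Longrightarrow> k - l \<in> int_lattice"
  by (simp add: int_lattice_def inner_diff_left)

lemma int_lattice_0 [simp]: "0 \<in> int_lattice"
  by (simp add: int_lattice_def)

lemma int_lattice_real: "(int_lattice :: real set) = \<int>"
  by (auto simp: int_lattice_def)

lemma int_lattice_prod:
  "(int_lattice :: ('a::euclidean_space \<times> 'b::euclidean_space) set) = int_lattice \<times> int_lattice"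
  by (simp add: set_eq_iff int_lattice_def Basis_prod_def ball_Un)

lemma finite_int_lattice_ball: "finite {k \<in> int_lattice. norm (k :: 'a::euclidean_space) \<le> R}"
proof -
  let ?F = "PiE (Basis :: 'a set) (\<lambda>_. {x \<in> \<int>. - R \<le> x \<and> x \<le> R})"
  have "k \<in> (\<lambda>f. \<Sum>b\<in>Basis. f b *\<^sub>R b) ` ?F" if k: "k \<in> int_lattice" "norm k \<le> R" for k :: 'a
  proof
    let ?f = "restrict (\<lambda>b. k \<bullet> b) Basis"
    show "k = (\<Sum>b\<in>Basis. ?f b *\<^sub>R b)" by (simp add: euclidean_representation cong: sum.cong)
    have "k \<bullet> b \<in> \<int> \<and> - R \<le> k \<bullet> b \<and> k \<bullet> b \<le> R" if "b \<in> Basis" for b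
      using k that Basis_le_norm[OF that, of k] by (auto simp: int_lattice_def)
    then show "?f \<in> ?F" by (auto simp: PiE_iff)
  qed
  then have "{k \<in> int_lattice. norm (k :: 'a) \<le> R} \<subseteq> (\<lambda>f. \<Sum>b\<in>Basis. f b *\<^sub>R b) ` ?F" by blast
  moreover have "finite ?F" by (intro finite_PiE finite_Basis finite_int_segment)
  ultimately show ?thesis by (rule finite_subset[OF _ finite_imageI])
qed

lemma countable_int_lattice: "countable (int_lattice :: 'a::euclidean_space set)"
proof -
  have eq: "(int_lattice :: 'a set) = (\<Union>n. {k \<in> int_lattice. norm k \<le> real n})"
    using real_arch_simple by blast
  have "countable (\<Union>n. {k \<in> int_lattice. norm (k :: 'a) \<le> real n})"
    by (intro countable_UN countableI_type countable_finite finite_int_lattice_ball)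
  then show ?thesis by (simp only: eq[symmetric])
qed

context cutoff_function
begin

lemma bump_bounds: "0 \<le> bump \<eta> k \<xi>" "bump \<eta> k \<xi> \<le> 1"
  using eta_bounds by (auto simp: bump_def intro!: prod_nonneg prod_le_1)

lemma bump_nonzero: "bump \<eta> k \<xi> \<noteq> 0 \<Longrightarrow> b \<in> Basis \<Longrightarrow> \<bar>\<xi> \<bullet> b - k \<bullet> b\<bar> < 1"
proof (rule ccontr)
  assume "bump \<eta> k \<xi> \<noteq> 0" "b \<in> Basis" "\<not> \<bar>\<xi> \<bullet> b - k \<bullet> b\<bar> < 1"
  then have "\<eta> (2 * (\<xi> \<bullet> b - k \<bullet> b)) = 0" by (intro eta_eq_0) auto
  with \<open>b \<in> Basis\<close> have "bump \<eta> k \<xi> = 0" unfolding bump_def by (auto intro!: prod_zero)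
  with \<open>bump \<eta> k \<xi> \<noteq> 0\<close> show False by simp
qed

lemma norm_le_of_coords: "(\<And>b. b \<in> Basis \<Longrightarrow> \<bar>x \<bullet> b\<bar> \<le> c) \<Longrightarrow> norm (x::'a::euclidean_space) \<le> DIM('a) * c"
  using order_trans[OF norm_le_l1 sum_mono[of Basis "\<lambda>b. \<bar>x \<bullet> b\<bar>" "\<lambda>_. c"]] by simp

lemma bump_nonzero_norm:
  assumes "bump \<eta> k (\<xi>::'a::euclidean_space) \<noteq> 0"
  shows "norm (\<xi> - k) \<le> DIM('a)" "norm k \<le> norm \<xi> + DIM('a)"
proof -
  have "norm (\<xi> - k) \<le> DIM('a) * 1"
    using bump_nonzero[OF assms] by (intro norm_le_of_coords) (auto simp: inner_diff_left less_imp_le)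
  then show "norm (\<xi> - k) \<le> DIM('a)" by simp
  then show "norm k \<le> norm \<xi> + DIM('a)" using norm_triangle_sub[of k \<xi>] by (simp add: norm_minus_commute)
qed

definition bump_sum :: "'a::euclidean_space \<Rightarrow> real" where
  "bump_sum \<xi> = (\<Sum>\<^sub>\<infinity>m\<in>int_lattice. bump \<eta> m \<xi>)"

lemma bump_sum_eq:
  assumes "finite S" "S \<subseteq> int_lattice" "\<And>m. m \<in> int_lattice \<Longrightarrow> bump \<eta> m \<xi> \<noteq> 0 \<Longrightarrow> m \<in> S"
  shows "bump_sum \<xi> = (\<Sum>m\<in>S. bump \<eta> m \<xi>)"
proof -
  have "bump_sum \<xi> = (\<Sum>\<^sub>\<infinity>m\<in>S. bump \<eta> m \<xi>)"
    unfolding bump_sum_def by (rule infsum_cong_neutral) (use assms in auto)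
  then show ?thesis using assms(1) by simp
qed

definition near :: "real \<Rightarrow> 'a::euclidean_space set" where
  "near R = {k \<in> int_lattice. norm k \<le> R}"

lemma finite_near: "finite (near R)" and near_subset: "near R \<subseteq> int_lattice"
  by (auto simp: near_def finite_int_lattice_ball)

lemma bump_nonzero_near:
  "m \<in> int_lattice \<Longrightarrow> bump \<eta> m (\<xi>::'a::euclidean_space) \<noteq> 0 \<Longrightarrow> norm \<xi> + DIM('a) \<le> R \<Longrightarrow> m \<in> near R"
  using bump_nonzero_norm(2)[of m \<xi>] by (auto simp: near_def)

lemma bump_sum_near:
  "norm (\<xi>::'a::euclidean_space) + DIM('a) \<le> R \<Longrightarrow> bump_sum \<xi> = (\<Sum>m\<in>near R. bump \<eta> m \<xi>)"
  by (rule bump_sum_eq[OF finite_near near_subset]) (rule bump_nonzero_near)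

text \<open>Rounding the coordinates of \<open>\<xi>\<close> gives a lattice point whose bump equals \<open>1\<close> at \<open>\<xi>\<close>.\<close>

lemma bump_sum_ge_1: "1 \<le> bump_sum (\<xi>::'a::euclidean_space)"
proof -
  define k :: 'a where "k = (\<Sum>b\<in>Basis. of_int (round (\<xi> \<bullet> b)) *\<^sub>R b)"
  have kb: "k \<bullet> b = of_int (round (\<xi> \<bullet> b))" if "b \<in> Basis" for b using that by (simp add: k_def)
  have kl: "k \<in> int_lattice" by (simp add: int_lattice_def kb)
  have "\<eta> (2 * (\<xi> \<bullet> b - k \<bullet> b)) = 1" if "b \<in> Basis" for b
  proof (rule eta_eq_1)
    have "\<bar>k \<bullet> b - \<xi> \<bullet> b\<bar> \<le> 1 / 2" unfolding kb[OF that] by (rule of_int_round_abs_le)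
    then show "\<bar>2 * (\<xi> \<bullet> b - k \<bullet> b)\<bar> \<le> 1"
      unfolding abs_mult by (simp add: abs_minus_commute)
  qed
  then have b1: "bump \<eta> k \<xi> = 1" by (simp add: bump_def)
  let ?R = "norm \<xi> + DIM('a)"
  have "k \<in> near ?R" using bump_nonzero_near[OF kl, of \<xi> ?R] b1 by simp
  then have "bump \<eta> k \<xi> \<le> (\<Sum>m\<in>near ?R. bump \<eta> m \<xi>)"
    by (intro member_le_sum finite_near) (auto simp: bump_bounds)
  then show ?thesis by (simp add: b1 bump_sum_near[of \<xi> ?R])
qed

lemma smooth_bump: "smooth (bump \<eta> (k::'a::euclidean_space))"
proof -
  have "smooth (\<lambda>\<xi>::'a. \<eta> (2 * (\<xi> \<bullet> b - k \<bullet> b)))" for b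
    using smooth_compose_inner[OF smooth_eta, of "2 *\<^sub>R b" "- 2 * (k \<bullet> b)"]
    by (simp add: algebra_simps)
  then show ?thesis unfolding bump_def[abs_def] by (intro smooth_prod)
qed

lemma smooth_bump_sum: "smooth (bump_sum :: 'a::euclidean_space \<Rightarrow> real)"
proof (rule smooth_local)
  fix x :: 'a
  let ?R = "norm x + 1 + DIM('a)"
  show "\<exists>U g. open U \<and> x \<in> U \<and> smooth g \<and> (\<forall>y\<in>U. bump_sum y = g y)"
  proof (intro exI conjI ballI)
    show "open (ball x 1)" "x \<in> ball x 1" by auto
    show "smooth (\<lambda>\<xi>. \<Sum>m\<in>near ?R. bump \<eta> m \<xi>)" by (intro smooth_sum smooth_bump)
    fix y assume "y \<in> ball x 1"
    then have "norm y \<le> norm x + 1" using norm_triangle_ineq2[of y x] by (simp add: dist_norm norm_minus_commute)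
    then show "bump_sum y = (\<Sum>m\<in>near ?R. bump \<eta> m y)" by (intro bump_sum_near) simp
  qed
qed

lemma unif_part_eq: "unif_part \<eta> k \<xi> = bump \<eta> k \<xi> * inverse (bump_sum \<xi>)"
  by (simp add: unif_part_def bump_sum_def divide_inverse)

lemma bump_sum_neq_0: "bump_sum \<xi> \<noteq> 0"
  using bump_sum_ge_1[of \<xi>] by auto

lemma unif_part_nonneg: "0 \<le> unif_part \<eta> k \<xi>"
  using bump_bounds(1)[of k \<xi>] bump_sum_ge_1[of \<xi>] by (simp add: unif_part_eq)

lemma sum_unif_part:
  assumes "finite S" "S \<subseteq> int_lattice" "\<And>m. m \<in> int_lattice \<Longrightarrow> bump \<eta> m \<xi> \<noteq> 0 \<Longrightarrow> m \<in> S"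
  shows "(\<Sum>k\<in>S. unif_part \<eta> k \<xi>) = 1"
proof -
  have "(\<Sum>k\<in>S. unif_part \<eta> k \<xi>) = (\<Sum>k\<in>S. bump \<eta> k \<xi>) * inverse (bump_sum \<xi>)"
    by (simp add: unif_part_eq sum_distrib_right)
  also have "(\<Sum>k\<in>S. bump \<eta> k \<xi>) = bump_sum \<xi>" by (rule bump_sum_eq[OF assms, symmetric])
  finally show ?thesis using bump_sum_neq_0[of \<xi>] by simp
qed

lemma unif_part_nonzero: "unif_part \<eta> k \<xi> \<noteq> 0 \<Longrightarrow> bump \<eta> k \<xi> \<noteq> 0"
  by (auto simp: unif_part_eq)

lemma bump_translate: "bump \<eta> k (\<xi> - l) = bump \<eta> (k + l) \<xi>"
  by (simp add: bump_def inner_diff_left inner_add_left algebra_simps)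

lemma bump_sum_translate:
  assumes "l \<in> int_lattice"
  shows "bump_sum (\<xi> - l) = bump_sum \<xi>"
proof -
  have "bij_betw (\<lambda>m. m + l) int_lattice int_lattice"
    by (rule bij_betwI[where g="\<lambda>m. m - l"]) (auto simp: int_lattice_add int_lattice_diff assms)
  from infsum_reindex_bij_betw[OF this, of "\<lambda>m. bump \<eta> m \<xi>"] show ?thesis
    by (simp add: bump_sum_def bump_translate)
qed

lemma unif_part_translate: "k \<in> int_lattice \<Longrightarrow> unif_part \<eta> k \<xi> = unif_part \<eta> 0 (\<xi> - k)"
  by (simp add: unif_part_eq bump_sum_translate bump_translate)

lemma bump_Pair: "bump \<eta> (k, l) (x, t) = bump \<eta> k x * bump \<eta> l t"
proof -
  let ?f = "\<lambda>b. \<eta> (2 * ((x, t) \<bullet> b - (k, l) \<bullet> b))"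
  have "(\<Prod>c\<in>(\<lambda>u. (u, 0)) ` Basis \<union> (\<lambda>v. (0, v)) ` Basis. ?f c)
      = (\<Prod>c\<in>(\<lambda>u. (u, 0)) ` Basis. ?f c) * (\<Prod>c\<in>(\<lambda>v. (0, v)) ` Basis. ?f c)"
    by (rule prod.union_disjoint) auto
  then show ?thesis by (simp add: bump_def Basis_prod_def prod.reindex inj_on_def inner_prod_def)
qed

text \<open>Only finitely many bumps are nonzero at a given point, so the sum is a finite double sum of products.\<close>

lemma bump_sum_Pair:
  "bump_sum (x::'a::euclidean_space, t::'b::euclidean_space) = bump_sum x * bump_sum t"
proof -
  let ?R = "norm x + DIM('a)" and ?T = "norm t + DIM('b)"
  have "bump_sum (x, t) = (\<Sum>m\<in>near ?R \<times> near ?T. bump \<eta> m (x, t))"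
  proof (rule bump_sum_eq)
    show "finite (near ?R \<times> near ?T)" by (intro finite_cartesian_product finite_near)
    show "near ?R \<times> near ?T \<subseteq> int_lattice" by (auto simp: int_lattice_prod near_def)
    fix m :: "'a \<times> 'b" assume "m \<in> int_lattice" "bump \<eta> m (x, t) \<noteq> 0"
    then show "m \<in> near ?R \<times> near ?T"
      by (cases m) (auto simp: int_lattice_prod bump_Pair intro: bump_nonzero_near)
  qed
  also have "\<dots> = (\<Sum>(k, l)\<in>near ?R \<times> near ?T. bump \<eta> k x * bump \<eta> l t)"
    by (intro sum.cong) (auto simp: bump_Pair)
  also have "\<dots> = bump_sum x * bump_sum t"
    unfolding sum.cartesian_product[symmetric] sum_product[symmetric]
    by (simp add: bump_sum_near[of x ?R] bump_sum_near[of t ?T])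
  finally show ?thesis .
qed

lemma unif_part_Pair: "unif_part \<eta> (k, l) (x, t) = unif_part \<eta> k x * unif_part \<eta> l t"
  by (simp add: unif_part_eq bump_Pair bump_sum_Pair)

text \<open>From here on the multipliers are complex-valued: \<open>sig k\<close> is the multiplier of the \<open>k\<close>-th
  block, \<open>ker k\<close> its Fourier transform, so that the block of \<open>L\<close> at \<open>x\<close> is \<open>L\<close> applied to the
  translate of \<open>ker k\<close> by \<open>x\<close>.\<close>

definition sig :: "'a::euclidean_space \<Rightarrow> 'a \<Rightarrow> complex" where
  "sig k \<xi> = of_real (unif_part \<eta> k \<xi>)"

definition ker :: "'a::euclidean_space \<Rightarrow> 'a \<Rightarrow> complex" where
  "ker k = fourier (sig k)"

lemma schwartz_sig: "sig (k::'a::euclidean_space) \<in> schwartz"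
proof (rule schwartz_compact_support)
  have "smooth (unif_part \<eta> k)"
    unfolding unif_part_eq[abs_def] by (intro smooth_mult smooth_bump smooth_inverse smooth_bump_sum bump_sum_neq_0)
  then show "smooth (sig k)" unfolding sig_def[abs_def] by (rule smooth_of_real)
  fix \<xi> :: 'a assume "norm \<xi> > norm k + DIM('a)"
  then have "\<not> norm (\<xi> - k) \<le> DIM('a)" using norm_triangle_sub[of \<xi> k] by linarith
  then show "sig k \<xi> = 0" unfolding sig_def using bump_nonzero_norm(1) unif_part_nonzero by auto
qed

lemma schwartz_ker: "ker k \<in> schwartz"
  unfolding ker_def by (intro fourier_schwartz schwartz_sig)

theorem box_op_eq:
  assumes "L \<in> tempered"
  shows "box_op \<eta> k L x = L (\<lambda>y. ker k (y - x))"
  unfolding box_op_def ker_def sig_def[abs_def]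
  using fourier_multiplier_eq[OF assms schwartz_sig[of k, unfolded sig_def[abs_def]]] by simp

lemma box_op_eq_fun: "L \<in> tempered \<Longrightarrow> box_op \<eta> k L = (\<lambda>x. L (\<lambda>y. ker k (y - x)))"
  by (rule ext) (rule box_op_eq)

lemma sig_translate: "k \<in> int_lattice \<Longrightarrow> sig k = (\<lambda>\<xi>. sig 0 (\<xi> - k))"
  by (simp add: sig_def[abs_def] unif_part_translate[of k])

lemma norm_fourier_translate:
  assumes "a \<in> schwartz"
  shows "norm (fourier (\<lambda>\<xi>. a (\<xi> - k)) w) = norm (fourier a w)"
  by (simp add: fourier_translate schwartz_measurable assms norm_mult)

lemma ker_Pair: "ker (k, l) = tensor (ker k) (ker l)"
proof -
  have "sig (k, l) = tensor (sig k) (sig l)"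
    by (rule ext) (auto simp: sig_def tensor_def unif_part_Pair)
  then show ?thesis unfolding ker_def by (simp add: fourier_tensor schwartz_integrable schwartz_sig)
qed

lemma sig_mult_chi: "sig k \<xi> * chi (\<xi> - k) = sig k \<xi>"
proof (cases "bump \<eta> k \<xi> = 0")
  case True
  then show ?thesis by (simp add: sig_def unif_part_eq)
next
  case False
  have "chi (\<xi> - k) = 1"
    using bump_nonzero[OF False] by (intro chi_eq_1) (auto simp: inner_diff_left less_imp_le)
  then show ?thesis by simp
qed

lemma box_op_continuous: "L \<in> tempered \<Longrightarrow> continuous_on UNIV (box_op \<eta> k L)"
  using tempered_translates(2)[OF _ schwartz_ker] by (simp add: box_op_eq_fun)

lemma box_op_measurable: "L \<in> tempered \<Longrightarrow> box_op \<eta> k L \<in> borel_measurable borel"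
  by (intro borel_measurable_continuous_onI box_op_continuous)

lemma box_op_growth: "L \<in> tempered \<Longrightarrow> \<exists>C N. \<forall>x. norm (box_op \<eta> k L x) \<le> C * (1 + norm x) ^ N"
  using tempered_translates(1)[OF _ schwartz_ker] by (simp add: box_op_eq_fun)

text \<open>The test function is the convolution of \<open>fourier a\<close> with \<open>ker k\<close>, and \<open>L\<close> passes through the convolution
  integral. Thus the part of \<open>L\<close> at the frequencies seen by \<open>sig k\<close> is determined by its \<open>k\<close>-th block.\<close>

lemma tempered_fourier_mult_sig:
  fixes a :: "'a::euclidean_space \<Rightarrow> complex"
  assumes L: "L \<in> tempered" and a: "a \<in> schwartz"
  shows "L (\<lambda>y. fourier (\<lambda>\<xi>. a \<xi> * sig k \<xi>) (y - x)) = (\<integral>z. box_op \<eta> k L z * fourier a (z - x) \<partial>lborel)"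
proof -
  have A: "fourier a \<in> schwartz" by (rule fourier_schwartz[OF a])
  have [measurable]: "ker k \<in> borel_measurable borel" "fourier a \<in> borel_measurable borel"
    by (intro schwartz_measurable schwartz_ker A)+
  have "fourier (\<lambda>\<xi>. a \<xi> * sig k \<xi>) (y - x) = (\<integral>z. ker k (y - z) * fourier a (z - x) \<partial>lborel)" for y
  proof -
    have "fourier (\<lambda>\<xi>. a \<xi> * sig k \<xi>) (y - x) = fourier (\<lambda>\<xi>. sig k \<xi> * inv_fourier (fourier a) \<xi>) (y - x)"
      by (simp add: inv_fourier_fourier a mult.commute)
    also have "\<dots> = (\<integral>z. ker k (y - x - z) * fourier a z \<partial>lborel)"
      unfolding ker_def by (intro fourier_mult_inv_fourier schwartz_integrable schwartz_sig A)
    also have "\<dots> = (\<integral>z. ker k (y - x - (z + (- x))) * fourier a (z + (- x)) \<partial>lborel)"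
      by (rule lborel_integral_translate[symmetric]) measurable
    finally show ?thesis by simp
  qed
  then have "L (\<lambda>y. fourier (\<lambda>\<xi>. a \<xi> * sig k \<xi>) (y - x)) = L (\<lambda>y. \<integral>z. ker k (y - z) * fourier a (z - x) \<partial>lborel)"
    by simp
  also have "\<dots> = (\<integral>z. L (\<lambda>y. ker k (y - z)) * fourier a (z - x) \<partial>lborel)"
    unfolding ker_def
    by (rule tempered_convolution[OF L schwartz_sig schwartz_moments[OF schwartz_translate[OF A]]])
  finally show ?thesis by (simp add: box_op_eq[OF L])
qed

lemma box_op_integrable:
  assumes "L \<in> tempered" "a \<in> schwartz"
  shows "integrable lborel (\<lambda>z. box_op \<eta> k L z * fourier a (z - x))"
  unfolding box_op_eq[OF assms(1)]
  by (intro tempered_translates_integrable assms schwartz_ker schwartz_moments schwartz_translate fourier_schwartz)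

lemma chi_kernel_bound: "\<exists>c>0. \<forall>w::'a::euclidean_space. norm (fourier chi w) \<le> c * weight N w"
proof -
  have "norm (fourier chi w) \<le> (schwartz_seminorm N (fourier (chi :: 'a \<Rightarrow> complex)) + 1) * weight N w" for w :: 'a
  proof -
    have "norm (fourier chi w) \<le> schwartz_seminorm N (fourier (chi :: 'a \<Rightarrow> complex)) * weight N w"
      by (intro schwartz_norm_le fourier_schwartz schwartz_chi)
    also have "\<dots> \<le> (schwartz_seminorm N (fourier (chi :: 'a \<Rightarrow> complex)) + 1) * weight N w"
      by (intro mult_right_mono) auto
    finally show ?thesis .
  qed
  moreover have "0 < schwartz_seminorm N (fourier (chi :: 'a \<Rightarrow> complex)) + 1"
    by (rule add_nonneg_pos[OF schwartz_seminorm_nonneg[OF fourier_schwartz[OF schwartz_chi]] zero_less_one])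
  ultimately show ?thesis by blast
qed

lemma norm_integral_kernel_le:
  fixes u F :: "'a::euclidean_space \<Rightarrow> complex"
  assumes "\<And>w. norm (F w) \<le> c * weight N w" "c \<ge> 0" "u \<in> borel_measurable borel"
  shows "ennreal (norm (\<integral>z. u z * F (z - x) \<partial>lborel)) \<le> ennreal c * (\<integral>\<^sup>+z. ennreal (norm (u z) * weight N (x - z)) \<partial>lborel)"
proof (cases "integrable lborel (\<lambda>z. u z * F (z - x))")
  case True
  have "ennreal (norm (\<integral>z. u z * F (z - x) \<partial>lborel)) \<le> (\<integral>\<^sup>+z. ennreal (norm (u z * F (z - x))) \<partial>lborel)"
    by (rule integral_norm_bound_ennreal[OF True])
  also have "\<dots> \<le> (\<integral>\<^sup>+z. ennreal c * ennreal (norm (u z) * weight N (x - z)) \<partial>lborel)"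
  proof (intro nn_integral_mono)
    fix z
    have "norm (F (z - x)) \<le> c * weight N (x - z)"
      using assms(1)[of "z - x"] weight_minus[of N "z - x"] by simp
    then have "norm (u z) * norm (F (z - x)) \<le> norm (u z) * (c * weight N (x - z))"
      by (rule mult_left_mono) simp
    then have "norm (u z * F (z - x)) \<le> c * (norm (u z) * weight N (x - z))"
      by (simp add: norm_mult mult_ac)
    then show "ennreal (norm (u z * F (z - x))) \<le> ennreal c * ennreal (norm (u z) * weight N (x - z))"
      using assms(2) by (simp add: ennreal_mult'[symmetric])
  qed
  also have "\<dots> = ennreal c * (\<integral>\<^sup>+z. ennreal (norm (u z) * weight N (x - z)) \<partial>lborel)"
    using assms(3) by (subst nn_integral_cmult) auto
  finally show ?thesis .
qed (simp add: not_integrable_integral_eq)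

text \<open>The function \<open>chi\<close> centred at \<open>k\<close> equals \<open>1\<close> on the support of \<open>sig k\<close>, so that the block is
  reproduced by a convolution; its kernel is a modulation of \<open>fourier chi\<close>, whose modulus is independent
  of \<open>k\<close>.\<close>

lemma box_op_reproducing_bound:
  fixes L :: "'a::euclidean_space distr"
  assumes L: "L \<in> tempered" and c: "c > 0" "\<And>w::'a. norm (fourier chi w) \<le> c * weight N w"
  shows "ennreal (norm (box_op \<eta> k L x)) \<le> ennreal c * (\<integral>\<^sup>+z. ennreal (norm (box_op \<eta> k L z) * weight N (x - z)) \<partial>lborel)"
proof -
  have chik: "(\<lambda>\<xi>. chi (\<xi> - k)) \<in> schwartz" by (intro schwartz_translate schwartz_chi)
  have "box_op \<eta> k L x = L (\<lambda>y. fourier (\<lambda>\<xi>. chi (\<xi> - k) * sig k \<xi>) (y - x))"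
    by (simp add: box_op_eq[OF L] ker_def mult.commute[of "chi _"] sig_mult_chi)
  also have "\<dots> = (\<integral>z. box_op \<eta> k L z * fourier (\<lambda>\<xi>. chi (\<xi> - k)) (z - x) \<partial>lborel)"
    by (rule tempered_fourier_mult_sig[OF L chik])
  finally have eq: "box_op \<eta> k L x = (\<integral>z. box_op \<eta> k L z * fourier (\<lambda>\<xi>. chi (\<xi> - k)) (z - x) \<partial>lborel)" .
  show ?thesis
    by (subst eq) (rule norm_integral_kernel_le; use c box_op_measurable[OF L] in
      \<open>simp add: norm_fourier_translate[OF schwartz_chi] less_imp_le\<close>)
qed

end

section \<open>A sub-mean-value inequality for band-limited functions\<close>

lemma weight_power: "weight N x ^ m = weight (N * m) x"
  by (simp add: weight_def power_mult power_one_over)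

lemma weight_powr: "0 < m \<Longrightarrow> weight (N * m) x powr (1 / real m) = weight N x"
  unfolding weight_power[symmetric]
  by (subst powr_realpow[symmetric]) (simp_all add: powr_powr)

text \<open>With \<open>r = 1 / m\<close>, the supremum \<open>S\<close> of \<open>norm (u y) * weight (N * m) (x - y)\<close> satisfies
  \<open>S \<le> c * S powr (1 - r) * ?E\<close>: one factor \<open>powr (1 - r)\<close> of the integrand is estimated by \<open>S\<close>. Since \<open>S\<close> is
  finite, it may be cancelled.\<close>

lemma sub_mean_value_aux:
  fixes u :: "'a::euclidean_space \<Rightarrow> complex" and m N :: nat
  assumes [measurable]: "u \<in> borel_measurable borel" and m: "0 < m" and c: "0 < c"
    and rep: "\<And>x. ennreal (norm (u x)) \<le> ennreal c * (\<integral>\<^sup>+z. ennreal (norm (u z) * weight (N * m) (x - z)) \<partial>lborel)"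
    and B: "\<And>y. norm (u y) * weight (N * m) (x - y) \<le> B"
  shows "ennreal (norm (u y) powr (1 / m) * weight N (x - y))
    \<le> ennreal c * (\<integral>\<^sup>+z. ennreal (norm (u z) powr (1 / m) * weight N (x - z)) \<partial>lborel)"
    (is "_ \<le> _ * ?E")
proof (cases "?E = \<infinity>")
  case True
  then show ?thesis using c by (simp add: ennreal_mult_top)
next
  case False
  let ?r = "1 / real m" and ?v = "\<lambda>y. norm (u y) * weight (N * m) (x - y)"
  define e where "e = enn2real ?E"
  have e: "?E = ennreal e" "e \<ge> 0" using False by (auto simp: e_def less_top)
  define S where "S = (SUP y. ?v y)"
  have bdd: "bdd_above (range ?v)" by (rule bdd_aboveI2[OF B])
  have vS: "?v y \<le> S" for y unfolding S_def by (rule cSUP_upper[OF _ bdd]) simp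
  have v0: "0 \<le> ?v y" for y by simp
  have S0: "0 \<le> S" using order_trans[OF v0 vS] .
  have r: "0 < ?r" "?r \<le> 1" using m by auto
  have vr: "?v z powr ?r = norm (u z) powr ?r * weight N (x - z)" for z
    by (simp add: powr_mult weight_powr[OF m])
  have "?v y \<le> c * (S powr (1 - ?r) * e)" for y
  proof -
    have "ennreal (?v y) = ennreal (norm (u y)) * ennreal (weight (N * m) (x - y))"
      by (simp add: ennreal_mult')
    also have "\<dots> \<le> (ennreal c * (\<integral>\<^sup>+z. ennreal (norm (u z) * weight (N * m) (y - z)) \<partial>lborel)) * ennreal (weight (N * m) (x - y))"
      by (intro mult_right_mono rep) simp
    also have "\<dots> = ennreal c * (\<integral>\<^sup>+z. ennreal (norm (u z) * weight (N * m) (y - z)) * ennreal (weight (N * m) (x - y)) \<partial>lborel)"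
      by (simp add: nn_integral_multc mult.assoc)
    also have "\<dots> \<le> ennreal c * (\<integral>\<^sup>+z. ennreal (S powr (1 - ?r)) * ennreal (norm (u z) powr ?r * weight N (x - z)) \<partial>lborel)"
    proof (intro mult_left_mono nn_integral_mono)
      fix z
      have "norm (u z) * weight (N * m) (y - z) * weight (N * m) (x - y) \<le> ?v z"
        using weight_submult[of "N * m" "x - y" "y - z"] by (simp add: mult.assoc mult_left_mono mult.commute[of "weight _ (y - z)"])
      also have "?v z = ?v z powr (1 - ?r) * ?v z powr ?r"
        using v0[of z] by (simp add: powr_add[symmetric] del: zero_less_mult_iff)
      also have "\<dots> \<le> S powr (1 - ?r) * ?v z powr ?r"
        using r by (intro mult_right_mono powr_mono2 vS v0) auto
      finally have "norm (u z) * weight (N * m) (y - z) * weight (N * m) (x - y)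
          \<le> S powr (1 - ?r) * (norm (u z) powr ?r * weight N (x - z))" by (simp only: vr)
      then show "ennreal (norm (u z) * weight (N * m) (y - z)) * ennreal (weight (N * m) (x - y))
          \<le> ennreal (S powr (1 - ?r)) * ennreal (norm (u z) powr ?r * weight N (x - z))"
        by (simp add: ennreal_mult'[symmetric] ennreal_mult''[symmetric] ennreal_leI)
    qed simp
    also have "\<dots> = ennreal c * (ennreal (S powr (1 - ?r)) * ?E)"
      by (subst nn_integral_cmult) auto
    also have "\<dots> = ennreal (c * (S powr (1 - ?r) * e))"
      using c e by (simp add: ennreal_mult')
    finally have *: "ennreal (?v y) \<le> ennreal (c * (S powr (1 - ?r) * e))" .
    have "0 \<le> c * (S powr (1 - ?r) * e)" using c e(2) by simp
    from ennreal_le_iff[OF this] * show ?thesis by blast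
  qed
  then have S1: "S \<le> c * (S powr (1 - ?r) * e)" unfolding S_def by (intro cSUP_least) auto
  have Sr: "S powr ?r \<le> c * e"
  proof (cases "S = 0")
    case True
    then show ?thesis using c e by simp
  next
    case False
    then have "S > 0" using S0 by simp
    then have "S powr ?r * S powr (1 - ?r) = S" by (simp add: powr_add[symmetric])
    then have "S powr ?r * S powr (1 - ?r) \<le> (c * e) * S powr (1 - ?r)" using S1 by (simp add: mult_ac)
    then show ?thesis using \<open>S > 0\<close> by (simp add: mult_le_cancel_right)
  qed
  have "?v y powr ?r \<le> S powr ?r" using r by (intro powr_mono2 vS v0) auto
  then have "norm (u y) powr ?r * weight N (x - y) \<le> c * e" using Sr vr[of y] by simp
  then show ?thesis using c e by (simp add: ennreal_mult'[symmetric] ennreal_leI)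
qed

text \<open>The maximal function is absorbed as in \<open>sub_mean_value_aux\<close>, which requires it to be finite. Polynomial
  growth of \<open>u\<close> makes it finite for a large exponent, and the resulting inequality then shows that it is
  finite for the given exponent \<open>M\<close>. In this way the constant does not depend on the growth of \<open>u\<close>.\<close>

theorem sub_mean_value_inequality:
  fixes u :: "'a::euclidean_space \<Rightarrow> complex" and m M n :: nat
  assumes u: "u \<in> borel_measurable borel" and m: "0 < m" and c: "\<And>N. 0 < c N"
    and rep: "\<And>N x. ennreal (norm (u x)) \<le> ennreal (c N) * (\<integral>\<^sup>+z. ennreal (norm (u z) * weight N (x - z)) \<partial>lborel)"
    and growth: "\<And>x. norm (u x) \<le> A * (1 + norm x) ^ n"
  shows "ennreal (norm (u y) powr (1 / m) * weight M (x - y))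
    \<le> ennreal (c (M * m)) * (\<integral>\<^sup>+z. ennreal (norm (u z) powr (1 / m) * weight M (x - z)) \<partial>lborel)"
    (is "_ \<le> _ * ?E x")
proof (cases "?E x = \<infinity>")
  case True
  then show ?thesis using c[of "M * m"] by (simp add: ennreal_mult_top)
next
  case False
  let ?r = "1 / real m"
  define N where "N = max M n"
  have A0: "0 \<le> A" using order_trans[OF norm_ge_zero growth[of 0]] by simp
  have nN: "n \<le> N * m" using m by (auto simp: N_def intro: order_trans[OF _ mult_le_mono2[of 1 m]])
  have big: "norm (u z) * weight (N * m) (y - z) \<le> A * (1 + norm y) ^ (N * m)" for y z
  proof -
    have "norm (u z) \<le> A * (1 + norm z) ^ (N * m)"
      by (rule order_trans[OF growth]) (intro mult_left_mono power_increasing nN A0; simp)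
    then have "norm (u z) * weight (N * m) (y - z) \<le> A * (1 + norm z) ^ (N * m) * weight (N * m) (y - z)"
      by (rule mult_right_mono) simp
    also have "\<dots> \<le> A * (1 + norm y) ^ (N * m)"
    proof -
      have "weight (N * m) (z - y) \<le> (1 + norm y) ^ (N * m) * weight (N * m) (z - y + y)" by (rule weight_shift_le)
      then have "(1 + norm z) ^ (N * m) * weight (N * m) (y - z) \<le> (1 + norm z) ^ (N * m) * ((1 + norm y) ^ (N * m) * weight (N * m) z)"
        using weight_minus[of "N * m" "z - y"] by (intro mult_left_mono) auto
      also have "\<dots> = (1 + norm y) ^ (N * m)" by (simp add: weight_def)
      finally show ?thesis using A0 by (simp add: mult.assoc mult_left_mono)
    qed
    finally show ?thesis .
  qed
  define e where "e = enn2real (?E x)"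
  have e: "?E x = ennreal e" "e \<ge> 0" using False by (auto simp: e_def less_top)
  have "norm (u y) * weight (M * m) (x - y) \<le> (c (N * m) * e) ^ m" for y
  proof -
    have "ennreal (norm (u y) powr ?r) = ennreal (norm (u y) powr ?r * weight N (y - y))" by (simp add: weight_def)
    also have "\<dots> \<le> ennreal (c (N * m)) * (\<integral>\<^sup>+z. ennreal (norm (u z) powr ?r * weight N (y - z)) \<partial>lborel)"
      by (rule sub_mean_value_aux[OF u m c rep big])
    finally have "ennreal (norm (u y) powr ?r) * ennreal (weight M (x - y))
        \<le> ennreal (c (N * m)) * (\<integral>\<^sup>+z. ennreal (norm (u z) powr ?r * weight N (y - z)) \<partial>lborel) * ennreal (weight M (x - y))"
      by (rule mult_right_mono) simp
    also have "\<dots> = ennreal (c (N * m)) * (\<integral>\<^sup>+z. ennreal (norm (u z) powr ?r * weight N (y - z)) * ennreal (weight M (x - y)) \<partial>lborel)"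
      using u by (simp add: nn_integral_multc mult.assoc)
    also have "\<dots> \<le> ennreal (c (N * m)) * ?E x"
    proof (intro mult_left_mono nn_integral_mono)
      fix z
      have "weight N (y - z) * weight M (x - y) \<le> weight M (y - z) * weight M (x - y)"
        by (intro mult_right_mono weight_antimono) (auto simp: N_def)
      also have "\<dots> \<le> weight M (x - z)" using weight_submult[of M "y - z" "x - y"] by simp
      finally have "norm (u z) powr ?r * (weight N (y - z) * weight M (x - y)) \<le> norm (u z) powr ?r * weight M (x - z)"
        by (rule mult_left_mono) simp
      then show "ennreal (norm (u z) powr ?r * weight N (y - z)) * ennreal (weight M (x - y))
          \<le> ennreal (norm (u z) powr ?r * weight M (x - z))"
        by (simp add: ennreal_mult''[symmetric] mult.assoc ennreal_leI)
    qed simp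
    also have "\<dots> = ennreal (c (N * m) * e)" using c e by (simp add: ennreal_mult' less_imp_le)
    finally have le: "norm (u y) powr ?r * weight M (x - y) \<le> c (N * m) * e"
      using c[of "N * m"] e(2) by (simp add: ennreal_mult''[symmetric] less_imp_le)
    have "(norm (u y) powr ?r) ^ m = norm (u y)"
      using m by (cases "u y = 0") (auto simp: powr_power)
    then have "norm (u y) * weight (M * m) (x - y) = (norm (u y) powr ?r * weight M (x - y)) ^ m"
      by (simp add: power_mult_distrib weight_power)
    also have "\<dots> \<le> (c (N * m) * e) ^ m" by (intro power_mono le) simp
    finally show ?thesis .
  qed
  then show ?thesis by (rule sub_mean_value_aux[OF u m c rep])
qed

section \<open>Quasi-norms with values in the extended nonnegative reals\<close>

lemma epowr_ennreal: "0 \<le> r \<Longrightarrow> epowr (ennreal r) a = ennreal (r powr a)"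
  by (simp add: epowr_def)

lemma epowr_top [simp]: "epowr top a = top" and epowr_0 [simp]: "epowr 0 a = 0"
  by (auto simp: epowr_def)

lemma epowr_1 [simp]: "epowr x 1 = x"
  by (cases x) (auto simp: epowr_ennreal)

lemma epowr_eq_0_iff [simp]: "epowr x a = 0 \<longleftrightarrow> x = 0"
  by (cases x) (auto simp: epowr_ennreal)

lemma epowr_eq_top_iff [simp]: "epowr x a = top \<longleftrightarrow> x = top"
  by (cases x) (auto simp: epowr_ennreal)

lemma epowr_less_top_iff [simp]: "epowr x a < top \<longleftrightarrow> x < top"
  by (simp add: less_top[symmetric])

lemma epowr_mono: "x \<le> y \<Longrightarrow> 0 < a \<Longrightarrow> epowr x a \<le> epowr y a"
  by (cases x; cases y) (auto simp: epowr_ennreal top_unique intro!: ennreal_leI powr_mono2)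

lemma epowr_epowr: "epowr (epowr x a) b = epowr x (a * b)"
  by (cases x) (auto simp: epowr_ennreal powr_powr)

lemma epowr_inverse: "0 < a \<Longrightarrow> epowr (epowr x a) (1 / a) = x" "0 < a \<Longrightarrow> epowr (epowr x (1 / a)) a = x"
  by (auto simp: epowr_epowr)

lemma epowr_less_iff: "0 < a \<Longrightarrow> epowr x a < epowr y a \<longleftrightarrow> x < y"
  using epowr_mono[of y x a] epowr_mono[of x y a] epowr_inverse(1)[of a] by (metis leD leI order_less_le)

lemma epowr_mult: "epowr (x * y) a = epowr x a * epowr y a"
proof (cases "x = 0 \<or> y = 0")
  case False
  show ?thesis
  proof (cases "x = top \<or> y = top")
    case True
    with False show ?thesis by (auto simp: ennreal_top_mult ennreal_mult_top)
  next
    case F: False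
    then obtain r s where "x = ennreal r" "y = ennreal s" "0 \<le> r" "0 \<le> s" by (cases x; cases y) auto
    then show ?thesis by (simp add: epowr_ennreal powr_mult ennreal_mult[symmetric])
  qed
qed auto

lemma epowr_measurable [measurable (raw)]:
  assumes [measurable]: "f \<in> borel_measurable M"
  shows "(\<lambda>x. epowr (f x) a) \<in> borel_measurable M"
proof -
  have "(\<lambda>x. enn2real (f x) powr a) \<in> borel_measurable M"
    by measurable
  then have [measurable]: "(\<lambda>x. ennreal (enn2real (f x) powr a)) \<in> borel_measurable M" by measurable
  have "f -` {top} \<inter> space M \<in> sets M" by (rule measurable_sets[OF assms]) simp
  then have "{x \<in> space M. f x = top} \<in> sets M" by (simp add: vimage_def Collect_conj_eq Int_commute)
  then show ?thesis unfolding epowr_def by (intro measurable_If) auto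
qed

lemma epowr_tendsto_0:
  assumes "(f \<longlongrightarrow> 0) F" "0 < a"
  shows "((\<lambda>x. epowr (f x) a) \<longlongrightarrow> 0) F"
proof (rule order_tendstoI)
  fix y :: ennreal assume "0 < y"
  then have "0 < epowr y (1 / a)" by (simp add: zero_less_iff_neq_zero)
  from order_tendstoD(2)[OF assms(1) this] show "\<forall>\<^sub>F x in F. epowr (f x) a < y"
  proof eventually_elim
    case (elim x)
    then have "epowr (f x) a < epowr (epowr y (1 / a)) a" using epowr_less_iff[OF assms(2)] by blast
    then show ?case using epowr_inverse(2)[OF assms(2)] by simp
  qed
qed simp

lemma epowr_add_le:
  assumes "0 < a"
  shows "epowr (x + y) a \<le> ennreal (2 powr a) * (epowr x a + epowr y a)"
proof -
  have "x + y \<le> ennreal 2 * max x y"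
    by (cases "x \<le> y") (auto simp: max_def mult_2 intro: add_mono)
  then have "epowr (x + y) a \<le> epowr (ennreal 2 * max x y) a" by (rule epowr_mono[OF _ assms])
  also have "\<dots> = ennreal (2 powr a) * epowr (max x y) a" by (simp add: epowr_mult epowr_ennreal del: ennreal_numeral)
  also have "\<dots> \<le> ennreal (2 powr a) * (epowr x a + epowr y a)"
    by (intro mult_left_mono) (auto simp: max_def)
  finally show ?thesis .
qed

lemma Lp_norm_mono:
  assumes "0 < p" "\<And>x. x \<in> space M \<Longrightarrow> F x \<le> G x"
  shows "Lp_norm p M F \<le> Lp_norm p M G"
  unfolding Lp_norm_def using assms by (intro epowr_mono nn_integral_mono) auto

lemma epowr_Lp_norm: "0 < p \<Longrightarrow> epowr (Lp_norm p M F) p = (\<integral>\<^sup>+x. epowr (F x) p \<partial>M)"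
  by (simp add: Lp_norm_def epowr_inverse)

lemma Lp_norm_cmult:
  assumes "0 < p" "F \<in> borel_measurable M"
  shows "Lp_norm p M (\<lambda>x. c * F x) = c * Lp_norm p M F"
proof -
  have "(\<integral>\<^sup>+x. epowr (c * F x) p \<partial>M) = epowr c p * (\<integral>\<^sup>+x. epowr (F x) p \<partial>M)"
    unfolding epowr_mult by (intro nn_integral_cmult epowr_measurable assms)
  then show ?thesis using assms(1) by (simp add: Lp_norm_def epowr_mult epowr_inverse)
qed

lemma Lp_norm_epowr:
  assumes "0 < p" "0 < a"
  shows "Lp_norm p M (\<lambda>x. epowr (F x) a) = epowr (Lp_norm (p * a) M F) a"
  using assms by (simp add: Lp_norm_def epowr_epowr mult.commute)

lemma Lp_norm_add_le:
  assumes p: "0 < p" and [measurable]: "F \<in> borel_measurable M" "G \<in> borel_measurable M"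
  shows "Lp_norm p M (\<lambda>x. F x + G x) \<le> ennreal (2 * 2 powr (1 / p)) * (Lp_norm p M F + Lp_norm p M G)"
proof -
  let ?S = "(\<integral>\<^sup>+x. epowr (F x) p \<partial>M) + (\<integral>\<^sup>+x. epowr (G x) p \<partial>M)"
  have "(\<integral>\<^sup>+x. epowr (F x + G x) p \<partial>M) \<le> (\<integral>\<^sup>+x. ennreal (2 powr p) * (epowr (F x) p + epowr (G x) p) \<partial>M)"
    by (intro nn_integral_mono epowr_add_le p)
  also have "\<dots> = ennreal (2 powr p) * ?S"
    by (simp add: nn_integral_cmult nn_integral_add)
  finally have "Lp_norm p M (\<lambda>x. F x + G x)
      \<le> epowr (ennreal (2 powr p) * ?S) (1 / p)"
    unfolding Lp_norm_def using p by (intro epowr_mono) auto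
  also have "\<dots> = ennreal 2 * epowr ?S (1 / p)"
    using p by (simp add: epowr_mult epowr_ennreal powr_powr del: ennreal_numeral)
  also have "\<dots> \<le> ennreal 2 * (ennreal (2 powr (1 / p)) * (Lp_norm p M F + Lp_norm p M G))"
    unfolding Lp_norm_def using p by (intro mult_left_mono epowr_add_le) auto
  finally show ?thesis by (simp add: ennreal_mult' mult.assoc del: ennreal_numeral)
qed

lemma Lp_norm_measurable:
  assumes "sigma_finite_measure N" "(\<lambda>(z, x). F z x) \<in> borel_measurable (M \<Otimes>\<^sub>M N)"
  shows "(\<lambda>z. Lp_norm p N (F z)) \<in> borel_measurable M"
proof -
  interpret sigma_finite_measure N by fact
  have [measurable]: "case_prod F \<in> borel_measurable (M \<Otimes>\<^sub>M N)" using assms(2) by simp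
  show ?thesis unfolding Lp_norm_def by measurable
qed

lemma Lp_norm_AE_finite:
  assumes "Lp_norm p M F < top" "F \<in> borel_measurable M"
  shows "AE x in M. F x < top"
proof -
  have "(\<integral>\<^sup>+x. epowr (F x) p \<partial>M) \<noteq> top" using assms(1) by (simp add: Lp_norm_def less_top[symmetric])
  then have "AE x in M. epowr (F x) p \<noteq> \<infinity>"
    using assms(2) by (intro nn_integral_noteq_infinite) auto
  then show ?thesis by (simp add: less_top[symmetric])
qed

lemma Lp_norm_tendsto_0:
  assumes p: "0 < p" and [measurable]: "\<And>j. B j \<in> borel_measurable M" "A \<in> borel_measurable M"
    and le: "\<And>j x. x \<in> space M \<Longrightarrow> B j x \<le> A x" and A: "Lp_norm p M A < top"
    and lim: "AE x in M. (\<lambda>j. B j x) \<longlonglongrightarrow> 0"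
  shows "(\<lambda>j. Lp_norm p M (B j)) \<longlonglongrightarrow> 0"
proof -
  have "(\<lambda>j. \<integral>\<^sup>+x. epowr (B j x) p \<partial>M) \<longlonglongrightarrow> (\<integral>\<^sup>+x. 0 \<partial>M)"
  proof (rule nn_integral_dominated_convergence[where w="\<lambda>x. epowr (A x) p"])
    show "AE x in M. epowr (B j x) p \<le> epowr (A x) p" for j
      using le p by (intro AE_I2 epowr_mono) auto
    show "(\<integral>\<^sup>+x. epowr (A x) p \<partial>M) < \<infinity>" using A by (simp add: Lp_norm_def)
    show "AE x in M. (\<lambda>j. epowr (B j x) p) \<longlonglongrightarrow> 0"
      using lim by eventually_elim (rule epowr_tendsto_0[OF _ p])
  qed measurable
  then have "(\<lambda>j. \<integral>\<^sup>+x. epowr (B j x) p \<partial>M) \<longlonglongrightarrow> 0" by simp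
  then show ?thesis unfolding Lp_norm_def using p by (intro epowr_tendsto_0) auto
qed

lemma Lp_norm_count_ge:
  assumes "0 < p" "a \<in> A"
  shows "F a \<le> Lp_norm p (count_space A) F"
proof -
  have "epowr (F a) p \<le> (\<integral>\<^sup>+x. epowr (F x) p \<partial>count_space A)"
    by (rule nn_integral_ge_point[OF assms(2)])
  then have "epowr (epowr (F a) p) (1 / p) \<le> Lp_norm p (count_space A) F"
    unfolding Lp_norm_def using assms(1) by (intro epowr_mono) auto
  then show ?thesis by (simp add: epowr_inverse assms(1))
qed

text \<open>For a sequence with \<open>\<ell>\<^sup>p\<close> norm \<open>1\<close> all terms are at most \<open>1\<close>, hence at most their \<open>p\<close>-th powers.\<close>

lemma nn_integral_count_le_Lp_norm:
  assumes p: "0 < p" "p \<le> 1"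
  shows "(\<integral>\<^sup>+x. F x \<partial>count_space A) \<le> Lp_norm p (count_space A) F"
proof (cases "p = 1")
  case True
  then show ?thesis by (simp add: Lp_norm_def)
next
  case False
  then have p1: "p < 1" using p by simp
  let ?m = "Lp_norm p (count_space A) F"
  have "F x \<le> epowr ?m (1 - p) * epowr (F x) p" if "x \<in> A" for x
  proof (cases "F x = top")
    case True
    then have "?m = top" using Lp_norm_count_ge[OF p(1) that, of F] by (simp add: top_unique)
    then show ?thesis using True by (simp add: ennreal_top_mult)
  next
    case False
    have "F x = epowr (F x) (1 - p) * epowr (F x) p"
      using False by (cases "F x") (auto simp: epowr_ennreal ennreal_mult[symmetric] powr_add[symmetric])
    also have "\<dots> \<le> epowr ?m (1 - p) * epowr (F x) p"
      using p1 by (intro mult_right_mono epowr_mono Lp_norm_count_ge p that) auto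
    finally show ?thesis .
  qed
  then have "(\<integral>\<^sup>+x. F x \<partial>count_space A) \<le> (\<integral>\<^sup>+x. epowr ?m (1 - p) * epowr (F x) p \<partial>count_space A)"
    by (intro nn_integral_mono) simp
  also have "\<dots> = epowr ?m (1 - p) * epowr ?m p"
    by (simp add: nn_integral_cmult epowr_Lp_norm[OF p(1)])
  also have "\<dots> = ?m"
    by (cases ?m) (auto simp: epowr_ennreal ennreal_mult[symmetric] powr_add[symmetric] ennreal_top_mult)
  finally show ?thesis .
qed

lemma Lp_norm_count_reindex:
  assumes "bij_betw g A B"
  shows "Lp_norm p (count_space A) (\<lambda>x. F (g x)) = Lp_norm p (count_space B) F"
  unfolding Lp_norm_def using nn_integral_bij_count_space[OF assms, of "\<lambda>x. epowr (F x) p"] by simp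

text \<open>A convex function lies above its tangent line at \<open>t\<close>.\<close>

lemma powr_tangent_le:
  fixes b t P :: real
  assumes "1 \<le> P" "0 \<le> b" "0 \<le> t"
  shows "P * t powr (P - 1) * b \<le> b powr P + (P - 1) * t powr P"
proof (cases "P = 1")
  case True
  then show ?thesis using assms by simp
next
  case False
  then have P: "1 < P" using assms by simp
  have q: "1 / P + 1 / (P / (P - 1)) = 1" "P / (P - 1) > 1" using P by (auto simp: field_simps)
  have "b * t powr (P - 1) \<le> b powr P / P + (t powr (P - 1)) powr (P / (P - 1)) / (P / (P - 1))"
    using P q assms by (intro Youngs_inequality) auto
  also have "(t powr (P - 1)) powr (P / (P - 1)) = t powr P" using P by (simp add: powr_powr)
  finally have "P * (b * t powr (P - 1)) \<le> P * (b powr P / P + t powr P / (P / (P - 1)))"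
    using P by (intro mult_left_mono) auto
  also have "\<dots> = b powr P + (P - 1) * t powr P" using P by (simp add: field_simps)
  finally show ?thesis by (simp add: mult_ac)
qed

text \<open>Minkowski's integral inequality. With \<open>c z = Lp_norm P N (F z)\<close> and \<open>J = \<integral> c\<close>, Jensen's
  inequality for the probability measure \<open>c / J\<close> gives
  \<open>(\<integral> F z x dz) ^ P \<le> J ^ (P - 1) * \<integral> F z x ^ P * c z ^ (1 - P) dz\<close>, and integrating in \<open>x\<close> the right-hand
  side becomes \<open>J ^ P\<close>. Jensen's inequality is used through the tangent lines of \<open>t ^ P\<close>;
  \<open>G z x\<close> below is \<open>F z x ^ P * c z ^ (1 - P)\<close> with values at \<open>c z = 0\<close> and \<open>c z = \<infinity>\<close> chosen so that
  the tangent inequality holds everywhere.\<close>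

theorem Minkowski_integral_inequality:
  fixes F :: "'z \<Rightarrow> 'x \<Rightarrow> ennreal"
  assumes M: "sigma_finite_measure M" and N: "sigma_finite_measure N" and P: "1 \<le> P"
    and F [measurable]: "(\<lambda>(z, x). F z x) \<in> borel_measurable (M \<Otimes>\<^sub>M N)"
  shows "Lp_norm P N (\<lambda>x. \<integral>\<^sup>+z. F z x \<partial>M) \<le> (\<integral>\<^sup>+z. Lp_norm P N (F z) \<partial>M)"
proof -
  interpret M: sigma_finite_measure M by fact
  interpret N: sigma_finite_measure N by fact
  interpret pair_sigma_finite M N ..
  have P0: "0 < P" using P by simp
  define c where "c z = Lp_norm P N (F z)" for z
  have c [measurable]: "c \<in> borel_measurable M"
    unfolding c_def[abs_def] by (rule Lp_norm_measurable[OF N F])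
  define G where "G z x = (if c z = 0 then (if F z x = 0 then 0 else top) else if c z = top then top
      else epowr (F z x) P * ennreal (enn2real (c z) powr (1 - P)))" for z x
  have G [measurable]: "(\<lambda>(z, x). G z x) \<in> borel_measurable (M \<Otimes>\<^sub>M N)"
    unfolding G_def by measurable
  have Fz: "F z \<in> borel_measurable N" if "z \<in> space M" for z
    using measurable_Pair2[OF F that] by simp
  have Fx: "(\<lambda>z. F z x) \<in> borel_measurable M" if "x \<in> space N" for x
    using measurable_Pair1[OF F that] by simp
  have Gx: "(\<lambda>z. G z x) \<in> borel_measurable M" if "x \<in> space N" for x
    using measurable_Pair1[OF G that] by simp
  have tangent: "ennreal (P * t powr (P - 1)) * F z x \<le> G z x + ennreal ((P - 1) * t powr P) * c z"
    if t: "0 \<le> t" for t z x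
  proof (cases "c z = top \<or> c z = 0 \<or> F z x = top")
    case True
    then show ?thesis by (auto simp: G_def ennreal_top_mult enn2real_eq_0_iff)
  next
    case False
    then obtain g a where ga: "c z = ennreal g" "F z x = ennreal a" "0 < g" "0 \<le> a"
      by (cases "c z"; cases "F z x") (auto simp: less_le)
    have "g * (P * t powr (P - 1) * (a / g)) \<le> g * ((a / g) powr P + (P - 1) * t powr P)"
      using ga t P by (intro mult_left_mono powr_tangent_le) auto
    also have "g * (P * t powr (P - 1) * (a / g)) = P * t powr (P - 1) * a" using ga by simp
    also have "g * ((a / g) powr P + (P - 1) * t powr P) = a powr P * g powr (1 - P) + (P - 1) * t powr P * g"
      using ga by (simp add: powr_divide powr_diff field_simps)
    finally have "ennreal (P * t powr (P - 1) * a) \<le> ennreal (a powr P * g powr (1 - P) + (P - 1) * t powr P * g)"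
      by (rule ennreal_leI)
    then show ?thesis
      using ga P by (simp add: G_def epowr_ennreal ennreal_mult'[symmetric] ennreal_mult''[symmetric] ennreal_plus)
  qed
  define J where "J = (\<integral>\<^sup>+z. c z \<partial>M)"
  define H where "H x = (\<integral>\<^sup>+z. F z x \<partial>M)" for x
  define Gam where "Gam x = (\<integral>\<^sup>+z. G z x \<partial>M)" for x
  have HG: "ennreal (P * t powr (P - 1)) * H x \<le> Gam x + ennreal ((P - 1) * t powr P) * J"
    if "0 \<le> t" and x: "x \<in> space N" for t x
  proof -
    have "ennreal (P * t powr (P - 1)) * H x = (\<integral>\<^sup>+z. ennreal (P * t powr (P - 1)) * F z x \<partial>M)"
      unfolding H_def by (rule nn_integral_cmult[symmetric, OF Fx[OF x]])
    also have "\<dots> \<le> (\<integral>\<^sup>+z. G z x + ennreal ((P - 1) * t powr P) * c z \<partial>M)"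
      by (intro nn_integral_mono tangent that)
    also have "\<dots> = Gam x + ennreal ((P - 1) * t powr P) * J"
      unfolding Gam_def J_def using Gx[OF x] by (subst nn_integral_add) (auto simp: nn_integral_cmult)
    finally show ?thesis .
  qed
  have "Lp_norm P N H \<le> J"
  proof (cases "J = top")
    case True
    then show ?thesis by simp
  next
    case False
    then obtain j where j: "J = ennreal j" "0 \<le> j" by (cases J) auto
    have "AE z in M. c z \<noteq> \<infinity>" using False by (intro nn_integral_noteq_infinite) (auto simp: J_def)
    then have "AE z in M. (\<integral>\<^sup>+x. G z x \<partial>N) = c z"
    proof (rule AE_mp, intro AE_I2 impI)
      fix z assume z: "z \<in> space M" and fin: "c z \<noteq> \<infinity>"
      note [measurable] = Fz[OF z]
      have pc: "(\<integral>\<^sup>+x. epowr (F z x) P \<partial>N) = epowr (c z) P"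
        unfolding c_def by (rule epowr_Lp_norm[OF P0, symmetric])
      show "(\<integral>\<^sup>+x. G z x \<partial>N) = c z"
      proof (cases "c z = 0")
        case True
        then have "AE x in N. epowr (F z x) P = 0"
          using pc by (subst (asm) True) (simp add: nn_integral_0_iff_AE)
        then have "AE x in N. G z x = 0" using True by (auto simp: G_def)
        then have "(\<integral>\<^sup>+x. G z x \<partial>N) = (\<integral>\<^sup>+x. 0 \<partial>N)" by (rule nn_integral_cong_AE)
        then show ?thesis using True by simp
      next
        case c0: False
        then obtain g where g: "c z = ennreal g" "0 < g" using fin by (cases "c z") (auto simp: less_le)
        have "(\<integral>\<^sup>+x. G z x \<partial>N) = (\<integral>\<^sup>+x. epowr (F z x) P * ennreal (g powr (1 - P)) \<partial>N)"
          using c0 g by (simp add: G_def)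
        also have "\<dots> = epowr (c z) P * ennreal (g powr (1 - P))"
          by (subst nn_integral_multc) (auto simp: pc)
        also have "\<dots> = c z" using g
          by (simp add: epowr_ennreal ennreal_mult'[symmetric] powr_add[symmetric])
        finally show ?thesis .
      qed
    qed
    then have "(\<integral>\<^sup>+z. (\<integral>\<^sup>+x. G z x \<partial>N) \<partial>M) = J" unfolding J_def by (rule nn_integral_cong_AE)
    then have GJ: "(\<integral>\<^sup>+x. Gam x \<partial>N) = J" unfolding Gam_def using Fubini'[OF G] by simp
    have Gm: "Gam \<in> borel_measurable N" unfolding Gam_def by measurable
    show ?thesis
    proof (cases "j = 0")
      case True
      then have "AE x in N. Gam x = 0" using GJ j Gm by (simp add: nn_integral_0_iff_AE)
      then have "AE x in N. epowr (H x) P = 0"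
      proof (rule AE_mp, intro AE_I2 impI)
        fix x assume "x \<in> space N" "Gam x = 0"
        then show "epowr (H x) P = 0" using HG[of 1 x] P True j by auto
      qed
      then have "(\<integral>\<^sup>+x. epowr (H x) P \<partial>N) = (\<integral>\<^sup>+x. 0 \<partial>N)" by (rule nn_integral_cong_AE)
      then show ?thesis by (simp add: Lp_norm_def)
    next
      case False
      then have j0: "0 < j" using j by simp
      have "epowr (H x) P \<le> ennreal (j powr (P - 1)) * Gam x" if x: "x \<in> space N" for x
      proof (cases "H x = 0 \<or> Gam x = top")
        case True
        then show ?thesis using j0 by (auto simp: ennreal_mult_top)
      next
        case F: False
        then obtain g where g: "Gam x = ennreal g" "0 \<le> g" by (cases "Gam x") auto
        have "H x \<noteq> top"
        proof
          assume "H x = top"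
          then have "top \<le> ennreal g + ennreal (P - 1) * ennreal j"
            using HG[of 1 x] x g j P by (simp add: ennreal_mult_top)
          then show False by (simp add: top_unique ennreal_mult_eq_top_iff)
        qed
        then obtain h where h: "H x = ennreal h" "0 < h" using F by (cases "H x") (auto simp: less_le)
        have "ennreal (P * (h / j) powr (P - 1)) * ennreal h \<le> ennreal g + ennreal ((P - 1) * (h / j) powr P) * ennreal j"
          using HG[of "h / j" x] x g j h j0 by simp
        then have "P * (h / j) powr (P - 1) * h \<le> g + (P - 1) * (h / j) powr P * j"
          using P h j0 g by (simp add: ennreal_mult'[symmetric] ennreal_mult''[symmetric] ennreal_plus[symmetric] del: ennreal_plus)
        moreover have "(h / j) powr P * j = (h / j) powr (P - 1) * h"
          using h j0 by (simp add: powr_diff)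
        ultimately have "P * ((h / j) powr (P - 1) * h) \<le> g + (P - 1) * ((h / j) powr (P - 1) * h)"
          by (simp add: mult.assoc)
        then have "(h / j) powr (P - 1) * h \<le> g" by (simp add: algebra_simps)
        then have "j powr (P - 1) * ((h / j) powr (P - 1) * h) \<le> j powr (P - 1) * g" by (intro mult_left_mono) auto
        also have "j powr (P - 1) * ((h / j) powr (P - 1) * h) = h powr P"
          using h j0 by (simp add: powr_divide powr_diff)
        finally show ?thesis using h g by (simp add: epowr_ennreal ennreal_mult'[symmetric] ennreal_leI)
      qed
      then have "(\<integral>\<^sup>+x. epowr (H x) P \<partial>N) \<le> (\<integral>\<^sup>+x. ennreal (j powr (P - 1)) * Gam x \<partial>N)"
        by (intro nn_integral_mono)
      also have "\<dots> = ennreal (j powr (P - 1)) * ennreal j"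
        using GJ j by (simp add: nn_integral_cmult Gm)
      also have "\<dots> = epowr J P"
        using j0 j by (simp add: epowr_ennreal ennreal_mult'[symmetric] powr_diff)
      finally have "Lp_norm P N H \<le> epowr (epowr J P) (1 / P)"
        unfolding Lp_norm_def using P0 by (intro epowr_mono) auto
      then show ?thesis by (simp add: epowr_inverse P0)
    qed
  qed
  then show ?thesis unfolding J_def c_def H_def .
qed

section \<open>Mixed norms over the lattice\<close>

text \<open>The two inner quasi-norms of the anisotropic norm; the outer one is added in \<open>mixed_norm\<close> below.\<close>

definition seq_norm :: "real \<Rightarrow> real \<Rightarrow> ('a::euclidean_space \<times> real \<Rightarrow> ennreal) \<Rightarrow> ennreal" where
  "seq_norm r q A = Lp_norm r (count_space \<int>) (\<lambda>kn. Lp_norm q (count_space int_lattice) (\<lambda>kb. A (kb, kn)))"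

lemma countable_Ints: "countable (\<int> :: real set)"
  unfolding int_lattice_real[symmetric] by (rule countable_int_lattice)

lemma sigma_finite_Ints: "sigma_finite_measure (count_space (\<int> :: real set))"
  by (rule sigma_finite_measure_count_space_countable[OF countable_Ints])

lemma sigma_finite_int_lattice: "sigma_finite_measure (count_space (int_lattice :: 'a::euclidean_space set))"
  by (rule sigma_finite_measure_count_space_countable[OF countable_int_lattice])

lemma measurable_pair_count_space:
  assumes "countable A" "\<And>k. k \<in> A \<Longrightarrow> (\<lambda>z. F z k) \<in> borel_measurable M"
  shows "(\<lambda>(z, k). F z k) \<in> borel_measurable (M \<Otimes>\<^sub>M count_space A)"
proof -
  have "(\<lambda>(k, z). F z k) \<in> borel_measurable (count_space A \<Otimes>\<^sub>M M)"
    by (rule measurable_pair_measure_countable1[OF assms(1)]) (simp add: assms(2))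
  from measurable_pair_swap[OF this] show ?thesis by (simp add: split_beta')
qed

lemma Lp_norm_count_measurable:
  assumes "countable A" "\<And>k. k \<in> A \<Longrightarrow> (\<lambda>z. F z k) \<in> borel_measurable M"
  shows "(\<lambda>z. Lp_norm p (count_space A) (F z)) \<in> borel_measurable M"
  by (rule Lp_norm_measurable[OF sigma_finite_measure_count_space_countable[OF assms(1)]
        measurable_pair_count_space[OF assms]])

lemma seq_norm_mono:
  assumes "0 < r" "0 < q" "\<And>k. k \<in> int_lattice \<Longrightarrow> A k \<le> B k"
  shows "seq_norm r q A \<le> seq_norm r q B"
  unfolding seq_norm_def
  by (intro Lp_norm_mono assms) (auto simp: int_lattice_prod int_lattice_real)

lemma seq_norm_cmult: "0 < r \<Longrightarrow> 0 < q \<Longrightarrow> seq_norm r q (\<lambda>k. c * A k) = c * seq_norm r q A"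
  unfolding seq_norm_def by (simp add: Lp_norm_cmult)

lemma seq_norm_epowr:
  "0 < r \<Longrightarrow> 0 < q \<Longrightarrow> 0 < a \<Longrightarrow> seq_norm r q (\<lambda>k. epowr (A k) a) = epowr (seq_norm (r * a) (q * a) A) a"
  unfolding seq_norm_def by (simp add: Lp_norm_epowr)

lemma seq_norm_add_le:
  assumes "0 < r" "0 < q"
  shows "seq_norm r q (\<lambda>k. A k + B k)
    \<le> ennreal (2 * 2 powr (1 / q)) * ennreal (2 * 2 powr (1 / r)) * (seq_norm r q A + seq_norm r q B)"
proof -
  have "seq_norm r q (\<lambda>k. A k + B k) \<le> Lp_norm r (count_space \<int>) (\<lambda>kn. ennreal (2 * 2 powr (1 / q)) *
     (Lp_norm q (count_space int_lattice) (\<lambda>kb. A (kb, kn)) + Lp_norm q (count_space int_lattice) (\<lambda>kb. B (kb, kn))))"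
    unfolding seq_norm_def by (intro Lp_norm_mono assms Lp_norm_add_le) auto
  also have "\<dots> = ennreal (2 * 2 powr (1 / q)) * Lp_norm r (count_space \<int>) (\<lambda>kn.
     Lp_norm q (count_space int_lattice) (\<lambda>kb. A (kb, kn)) + Lp_norm q (count_space int_lattice) (\<lambda>kb. B (kb, kn)))"
    by (rule Lp_norm_cmult[OF assms(1)]) simp
  also have "\<dots> \<le> ennreal (2 * 2 powr (1 / q)) * (ennreal (2 * 2 powr (1 / r)) * (seq_norm r q A + seq_norm r q B))"
    unfolding seq_norm_def by (intro mult_left_mono Lp_norm_add_le assms) auto
  finally show ?thesis by (simp add: mult.assoc)
qed

lemma seq_norm_ge:
  assumes "0 < r" "0 < q" "k \<in> int_lattice"
  shows "A k \<le> seq_norm r q A"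
proof -
  obtain kb kn where k: "k = (kb, kn)" "kb \<in> int_lattice" "kn \<in> \<int>"
    using assms(3) by (cases k) (auto simp: int_lattice_prod int_lattice_real)
  have "A (kb, kn) \<le> Lp_norm q (count_space int_lattice) (\<lambda>kb. A (kb, kn))"
    using Lp_norm_count_ge[OF assms(2) k(2), of "\<lambda>kb. A (kb, kn)"] .
  also have "\<dots> \<le> seq_norm r q A"
    unfolding seq_norm_def using Lp_norm_count_ge[OF assms(1) k(3)] .
  finally show ?thesis by (simp add: k)
qed

lemma seq_norm_shift:
  assumes "(j::'a::euclidean_space \<times> real) \<in> int_lattice"
  shows "seq_norm r q (\<lambda>k. A (k + j)) = seq_norm r q A"
proof -
  obtain jb jn where j: "j = (jb, jn)" "jb \<in> int_lattice" "jn \<in> \<int>"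
    using assms by (cases j) (auto simp: int_lattice_prod int_lattice_real)
  have b1: "bij_betw (\<lambda>k. k + jb) int_lattice int_lattice"
    by (rule bij_betwI[where g="\<lambda>m. m - jb"]) (auto simp: int_lattice_add int_lattice_diff j)
  have b2: "bij_betw (\<lambda>k. k + jn) \<int> \<int>"
    by (rule bij_betwI[where g="\<lambda>m. m - jn"]) (auto simp: j)
  show ?thesis
    unfolding seq_norm_def j
    using Lp_norm_count_reindex[OF b1, of q "\<lambda>kb. A (kb, _)"]
      Lp_norm_count_reindex[OF b2, of r "\<lambda>kn. Lp_norm q (count_space int_lattice) (\<lambda>kb. A (kb, kn))"]
    by simp
qed

lemma seq_norm_measurable:
  assumes "\<And>k. k \<in> int_lattice \<Longrightarrow> (\<lambda>z. A z k) \<in> borel_measurable M"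
  shows "(\<lambda>z. seq_norm r q (A z)) \<in> borel_measurable M"
  unfolding seq_norm_def using assms
  by (intro Lp_norm_count_measurable countable_Ints countable_int_lattice)
    (auto simp: int_lattice_prod int_lattice_real)

lemma seq_norm_Minkowski:
  assumes M: "sigma_finite_measure M" and r: "1 \<le> r" and q: "1 \<le> q"
    and A: "\<And>k. k \<in> int_lattice \<Longrightarrow> (\<lambda>z. A z k) \<in> borel_measurable M"
  shows "seq_norm r q (\<lambda>k. \<integral>\<^sup>+z. A z k \<partial>M) \<le> (\<integral>\<^sup>+z. seq_norm r q (A z) \<partial>M)"
proof -
  have Ak: "(\<lambda>z. A z (kb, kn)) \<in> borel_measurable M" if "kb \<in> int_lattice" "kn \<in> \<int>" for kb kn
    using that by (intro A) (auto simp: int_lattice_prod int_lattice_real)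
  have "seq_norm r q (\<lambda>k. \<integral>\<^sup>+z. A z k \<partial>M)
      \<le> Lp_norm r (count_space \<int>) (\<lambda>kn. \<integral>\<^sup>+z. Lp_norm q (count_space int_lattice) (\<lambda>kb. A z (kb, kn)) \<partial>M)"
    unfolding seq_norm_def
    by (intro Lp_norm_mono Minkowski_integral_inequality M sigma_finite_int_lattice q
        measurable_pair_count_space countable_int_lattice Ak) (use r in auto)
  also have "\<dots> \<le> (\<integral>\<^sup>+z. seq_norm r q (A z) \<partial>M)"
    unfolding seq_norm_def
    by (intro Minkowski_integral_inequality M sigma_finite_Ints r measurable_pair_count_space countable_Ints
        Lp_norm_count_measurable countable_int_lattice Ak)
  finally show ?thesis .
qed

lemma seq_norm_tendsto_0:
  assumes r: "0 < r" and q: "0 < q" and le: "\<And>j k. k \<in> int_lattice \<Longrightarrow> B j k \<le> A k"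
    and A: "seq_norm r q A < top" and lim: "\<And>k. k \<in> int_lattice \<Longrightarrow> (\<lambda>j. B j k) \<longlonglongrightarrow> 0"
  shows "(\<lambda>j. seq_norm r q (B j)) \<longlonglongrightarrow> 0"
  unfolding seq_norm_def
proof (rule Lp_norm_tendsto_0[OF r])
  let ?A = "\<lambda>kn. Lp_norm q (count_space int_lattice) (\<lambda>kb. A (kb, kn))"
  have m: "(kb, kn) \<in> int_lattice" if "kb \<in> int_lattice" "kn \<in> \<int>" for kb :: 'a and kn :: real
    using that by (simp add: int_lattice_prod int_lattice_real)
  show "Lp_norm q (count_space int_lattice) (\<lambda>kb. B j (kb, kn)) \<le> ?A kn" if "kn \<in> space (count_space \<int>)" for j kn
    using that by (intro Lp_norm_mono q le m) auto
  show "Lp_norm r (count_space \<int>) ?A < top" using A by (simp add: seq_norm_def)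
  show "AE kn in count_space \<int>. (\<lambda>j. Lp_norm q (count_space int_lattice) (\<lambda>kb. B j (kb, kn))) \<longlonglongrightarrow> 0"
  proof (rule AE_I2)
    fix kn :: real assume "kn \<in> space (count_space \<int>)"
    then have kn: "kn \<in> \<int>" by simp
    show "(\<lambda>j. Lp_norm q (count_space int_lattice) (\<lambda>kb. B j (kb, kn))) \<longlonglongrightarrow> 0"
    proof (rule Lp_norm_tendsto_0[OF q])
      have "?A kn \<le> seq_norm r q A" unfolding seq_norm_def using Lp_norm_count_ge[OF r kn] .
      then show "?A kn < top" using A by (rule le_less_trans)
      show "AE kb in count_space int_lattice. (\<lambda>j. B j (kb, kn)) \<longlonglongrightarrow> 0"
        using lim m kn by (intro AE_I2) simp
    qed (use le m kn in auto)
  qed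
qed auto

definition mixed_norm :: "real \<Rightarrow> real \<Rightarrow> real \<Rightarrow> ('a::euclidean_space \<times> real \<Rightarrow> 'a \<times> real \<Rightarrow> ennreal) \<Rightarrow> ennreal" where
  "mixed_norm p r q A = Lp_norm p lborel (\<lambda>x. seq_norm r q (\<lambda>k. A k x))"

lemma mixed_norm_mono:
  "0 < p \<Longrightarrow> 0 < r \<Longrightarrow> 0 < q \<Longrightarrow> (\<And>k x. k \<in> int_lattice \<Longrightarrow> A k x \<le> B k x) \<Longrightarrow> mixed_norm p r q A \<le> mixed_norm p r q B"
  unfolding mixed_norm_def by (intro Lp_norm_mono seq_norm_mono) auto

lemma mixed_norm_cmult:
  assumes "0 < p" "0 < r" "0 < q" "\<And>k. k \<in> int_lattice \<Longrightarrow> A k \<in> borel_measurable borel"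
  shows "mixed_norm p r q (\<lambda>k x. c * A k x) = c * mixed_norm p r q A"
  unfolding mixed_norm_def using assms
  by (simp add: seq_norm_cmult Lp_norm_cmult seq_norm_measurable)

lemma mixed_norm_shift: "j \<in> int_lattice \<Longrightarrow> mixed_norm p r q (\<lambda>k. A (k + j)) = mixed_norm p r q A"
  unfolding mixed_norm_def using seq_norm_shift[of j r q "\<lambda>k. A k _"] by simp

lemma mixed_norm_tendsto_0:
  assumes p: "0 < p" and r: "0 < r" and q: "0 < q"
    and mB: "\<And>j k. k \<in> int_lattice \<Longrightarrow> B j k \<in> borel_measurable borel"
    and mA: "\<And>k. k \<in> int_lattice \<Longrightarrow> A k \<in> borel_measurable borel"
    and le: "\<And>j k x. k \<in> int_lattice \<Longrightarrow> B j k x \<le> A k x"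
    and A: "mixed_norm p r q A < top"
    and lim: "\<And>k x. k \<in> int_lattice \<Longrightarrow> A k x < top \<Longrightarrow> (\<lambda>j. B j k x) \<longlonglongrightarrow> 0"
  shows "(\<lambda>j. mixed_norm p r q (B j)) \<longlonglongrightarrow> 0"
  unfolding mixed_norm_def
proof (rule Lp_norm_tendsto_0[OF p])
  show "(\<lambda>x. seq_norm r q (\<lambda>k. B j k x)) \<in> borel_measurable lborel" for j
    using mB by (intro seq_norm_measurable) simp
  show Am: "(\<lambda>x. seq_norm r q (\<lambda>k. A k x)) \<in> borel_measurable lborel"
    using mA by (intro seq_norm_measurable) simp
  show "seq_norm r q (\<lambda>k. B j k x) \<le> seq_norm r q (\<lambda>k. A k x)" for j x
    by (intro seq_norm_mono r q le)
  show fin: "Lp_norm p lborel (\<lambda>x. seq_norm r q (\<lambda>k. A k x)) < top"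
    using A by (simp add: mixed_norm_def)
  show "AE x in lborel. (\<lambda>j. seq_norm r q (\<lambda>k. B j k x)) \<longlonglongrightarrow> 0"
    using Lp_norm_AE_finite[OF fin Am]
  proof eventually_elim
    case (elim x)
    have "A k x < top" if "k \<in> int_lattice" for k
      using seq_norm_ge[OF r q that, of "\<lambda>k. A k x"] elim by (rule le_less_trans)
    then show ?case by (intro seq_norm_tendsto_0[OF r q le elim] lim)
  qed
qed

lemma mixed_norm_sum_tendsto_0:
  fixes B :: "'i \<Rightarrow> nat \<Rightarrow> 'a::euclidean_space \<times> real \<Rightarrow> 'a \<times> real \<Rightarrow> ennreal"
  assumes p: "0 < p" and r: "0 < r" and q: "0 < q" and "finite I"
    and m: "\<And>i j k. i \<in> I \<Longrightarrow> k \<in> int_lattice \<Longrightarrow> B i j k \<in> borel_measurable borel"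
    and lim: "\<And>i. i \<in> I \<Longrightarrow> (\<lambda>j. mixed_norm p r q (B i j)) \<longlonglongrightarrow> 0"
  shows "(\<lambda>j::nat. mixed_norm p r q (\<lambda>k x. \<Sum>i\<in>I. B i j k x)) \<longlonglongrightarrow> 0"
  using assms(4) m lim
proof (induction I)
  case empty
  have "mixed_norm p r q (\<lambda>(k::'a \<times> real) x. 0) = 0"
    using mixed_norm_cmult[OF p r q, of "\<lambda>(k::'a \<times> real) x. 0" 0] by simp
  then show ?case by simp
next
  case (insert i I)
  let ?K = "ennreal (2 * 2 powr (1 / q)) * ennreal (2 * 2 powr (1 / r))" and ?C = "ennreal (2 * 2 powr (1 / p))"
  let ?S = "\<lambda>j k x. \<Sum>i\<in>I. B i j k x"
  have le: "mixed_norm p r q (\<lambda>k x. \<Sum>i\<in>insert i I. B i j k x)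
      \<le> ?K * ?C * (mixed_norm p r q (B i j) + mixed_norm p r q (?S j))" for j
  proof -
    have [measurable]: "B i j k \<in> borel_measurable borel" "?S j k \<in> borel_measurable borel" if "k \<in> int_lattice" for k
      using insert.prems(1) that by (auto intro!: borel_measurable_sum)
    have mb: "(\<lambda>x. seq_norm r q (\<lambda>k. B i j k x)) \<in> borel_measurable lborel"
      "(\<lambda>x. seq_norm r q (\<lambda>k. ?S j k x)) \<in> borel_measurable lborel"
      by (intro seq_norm_measurable; simp)+
    have "mixed_norm p r q (\<lambda>k x. \<Sum>i\<in>insert i I. B i j k x) = mixed_norm p r q (\<lambda>k x. B i j k x + ?S j k x)"
      using insert.hyps by simp
    also have "\<dots> \<le> Lp_norm p lborel (\<lambda>x. ?K * (seq_norm r q (\<lambda>k. B i j k x) + seq_norm r q (\<lambda>k. ?S j k x)))"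
      unfolding mixed_norm_def by (intro Lp_norm_mono p seq_norm_add_le r q)
    also have "\<dots> = ?K * Lp_norm p lborel (\<lambda>x. seq_norm r q (\<lambda>k. B i j k x) + seq_norm r q (\<lambda>k. ?S j k x))"
      using mb by (intro Lp_norm_cmult p) simp
    also have "\<dots> \<le> ?K * (?C * (mixed_norm p r q (B i j) + mixed_norm p r q (?S j)))"
      unfolding mixed_norm_def by (intro mult_left_mono Lp_norm_add_le p mb) simp
    finally show ?thesis by (simp add: mult.assoc)
  qed
  have "(\<lambda>j. mixed_norm p r q (B i j) + mixed_norm p r q (?S j)) \<longlonglongrightarrow> 0 + 0"
    using insert.prems by (intro tendsto_add insert.IH) auto
  then have "(\<lambda>j. ?K * ?C * (mixed_norm p r q (B i j) + mixed_norm p r q (?S j))) \<longlonglongrightarrow> ?K * ?C * (0 + 0)"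
    by (intro ennreal_tendsto_cmult) (simp_all add: ennreal_mult_less_top)
  then have "(\<lambda>j. ?K * ?C * (mixed_norm p r q (B i j) + mixed_norm p r q (?S j))) \<longlonglongrightarrow> 0" by simp
  from tendsto_sandwich[OF _ _ tendsto_const this] show ?case using le by simp
qed

definition average :: "real \<Rightarrow> nat \<Rightarrow> ('a::euclidean_space \<Rightarrow> ennreal) \<Rightarrow> 'a \<Rightarrow> ennreal" where
  "average a M f x = (\<integral>\<^sup>+z. epowr (f (x - z)) a * ennreal (weight M z) \<partial>lborel)"

lemma average_measurable [measurable]:
  fixes f :: "'a::euclidean_space \<Rightarrow> ennreal"
  assumes [measurable]: "f \<in> borel_measurable borel"
  shows "average a M f \<in> borel_measurable borel"
proof -
  have "(\<lambda>x. \<integral>\<^sup>+z. epowr (f (x - z)) a * ennreal (weight M z) \<partial>lborel) \<in> borel_measurable borel"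
    by measurable
  then show ?thesis by (simp add: average_def[abs_def])
qed

lemma seq_norm_average:
  fixes U :: "'a::euclidean_space \<times> real \<Rightarrow> 'a \<times> real \<Rightarrow> ennreal"
  assumes a: "0 < a" and r: "a \<le> r" and q: "a \<le> q"
    and U: "\<And>k. k \<in> int_lattice \<Longrightarrow> U k \<in> borel_measurable borel"
  shows "seq_norm r q (\<lambda>k. epowr (average a M (U k) x) (1 / a))
    \<le> epowr (\<integral>\<^sup>+z. epowr (seq_norm r q (\<lambda>k. U k (x - z))) a * ennreal (weight M z) \<partial>lborel) (1 / a)"
proof -
  let ?f = "\<lambda>z k. epowr (U k (x - z)) a * ennreal (weight M z)"
  have r0: "0 < r" "0 < q" using assms by auto
  have "seq_norm r q (\<lambda>k. epowr (average a M (U k) x) (1 / a))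
      = epowr (seq_norm (r * (1 / a)) (q * (1 / a)) (\<lambda>k. average a M (U k) x)) (1 / a)"
    using a r0 by (intro seq_norm_epowr) auto
  also have "\<dots> \<le> epowr (\<integral>\<^sup>+z. seq_norm (r * (1 / a)) (q * (1 / a)) (?f z) \<partial>lborel) (1 / a)"
    unfolding average_def using a r q U
    by (intro epowr_mono seq_norm_Minkowski sigma_finite_lborel) (auto simp: pos_le_divide_eq)
  also have "(\<lambda>z. seq_norm (r * (1 / a)) (q * (1 / a)) (?f z))
     = (\<lambda>z. epowr (seq_norm r q (\<lambda>k. U k (x - z))) a * ennreal (weight M z))"
  proof
    fix z
    have "seq_norm (r * (1 / a)) (q * (1 / a)) (?f z)
        = ennreal (weight M z) * seq_norm (r * (1 / a)) (q * (1 / a)) (\<lambda>k. epowr (U k (x - z)) a)"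
      using a r0 by (simp add: seq_norm_cmult[symmetric] mult.commute)
    also have "seq_norm (r * (1 / a)) (q * (1 / a)) (\<lambda>k. epowr (U k (x - z)) a) = epowr (seq_norm r q (\<lambda>k. U k (x - z))) a"
      using a r0 by (subst seq_norm_epowr) auto
    finally show "seq_norm (r * (1 / a)) (q * (1 / a)) (?f z)
        = epowr (seq_norm r q (\<lambda>k. U k (x - z))) a * ennreal (weight M z)" by (simp add: mult.commute)
  qed
  finally show ?thesis .
qed

text \<open>After taking powers \<open>a\<close> all exponents are at least \<open>1\<close> and Minkowski's inequality applies, in the outer
  variable together with translation invariance.\<close>

lemma mixed_norm_average:
  fixes U :: "'a::euclidean_space \<times> real \<Rightarrow> 'a \<times> real \<Rightarrow> ennreal"
  assumes a: "0 < a" and p: "a \<le> p" and r: "a \<le> r" and q: "a \<le> q"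
    and U: "\<And>k. k \<in> int_lattice \<Longrightarrow> U k \<in> borel_measurable borel"
  shows "mixed_norm p r q (\<lambda>k x. epowr (average a M (U k) x) (1 / a))
    \<le> epowr (\<integral>\<^sup>+z. ennreal (weight M (z::'a \<times> real)) \<partial>lborel) (1 / a) * mixed_norm p r q U"
proof -
  have p0: "0 < p" using a p by simp
  let ?G = "\<lambda>x. seq_norm r q (\<lambda>k. U k x)"
  let ?f = "\<lambda>z x. epowr (?G (x - z)) a * ennreal (weight M z)"
  have G [measurable]: "?G \<in> borel_measurable borel" by (intro seq_norm_measurable U)
  have Gz: "(\<lambda>x. ?G (x - z)) \<in> borel_measurable lborel" for z
    using measurable_compose[OF _ G, of "\<lambda>x. x - z" lborel] by simp
  have "mixed_norm p r q (\<lambda>k x. epowr (average a M (U k) x) (1 / a))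
      \<le> Lp_norm p lborel (\<lambda>x. epowr (\<integral>\<^sup>+z. epowr (?G (x - z)) a * ennreal (weight M z) \<partial>lborel) (1 / a))"
    unfolding mixed_norm_def by (intro Lp_norm_mono p0 seq_norm_average a r q U)
  also have "\<dots> = epowr (Lp_norm (p * (1 / a)) lborel (\<lambda>x. \<integral>\<^sup>+z. ?f z x \<partial>lborel)) (1 / a)"
    using a p0 by (intro Lp_norm_epowr) auto
  also have "\<dots> \<le> epowr (\<integral>\<^sup>+z. Lp_norm (p * (1 / a)) lborel (?f z) \<partial>lborel) (1 / a)"
  proof (intro epowr_mono Minkowski_integral_inequality sigma_finite_lborel)
    show "(\<lambda>(z, x). epowr (?G (x - z)) a * ennreal (weight M z)) \<in> borel_measurable (lborel \<Otimes>\<^sub>M lborel)"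
    proof -
      have "(\<lambda>w. ?G (snd w - fst w)) \<in> borel_measurable (lborel \<Otimes>\<^sub>M lborel)"
        by (rule measurable_compose[OF _ G]) measurable
      then show ?thesis unfolding split_beta' by measurable
    qed
  qed (use a p in \<open>auto simp: pos_le_divide_eq\<close>)
  also have "(\<lambda>z. Lp_norm (p * (1 / a)) lborel (?f z))
      = (\<lambda>z. ennreal (weight M z) * epowr (mixed_norm p r q U) a)"
  proof
    fix z
    have "Lp_norm (p * (1 / a)) lborel (?f z)
        = ennreal (weight M z) * Lp_norm (p * (1 / a)) lborel (\<lambda>x. epowr (?G (x - z)) a)"
      using a p0 Gz[of z] by (subst Lp_norm_cmult[symmetric]) (auto simp: mult.commute)
    also have "Lp_norm (p * (1 / a)) lborel (\<lambda>x. epowr (?G (x - z)) a) = epowr (Lp_norm p lborel (\<lambda>x. ?G (x - z))) a"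
      using a p0 by (subst Lp_norm_epowr) auto
    also have "Lp_norm p lborel (\<lambda>x. ?G (x - z)) = mixed_norm p r q U"
      unfolding mixed_norm_def Lp_norm_def
      using lborel_nn_integral_translate[of "\<lambda>x. epowr (?G x) p" "- z"] G by simp
    finally show "Lp_norm (p * (1 / a)) lborel (?f z)
        = ennreal (weight M z) * epowr (mixed_norm p r q U) a" .
  qed
  also have "epowr (\<integral>\<^sup>+z. ennreal (weight M (z::'a \<times> real)) * epowr (mixed_norm p r q U) a \<partial>lborel) (1 / a)
      = epowr (\<integral>\<^sup>+z. ennreal (weight M (z::'a \<times> real)) \<partial>lborel) (1 / a) * mixed_norm p r q U"
    using a by (subst nn_integral_multc) (auto simp: epowr_mult epowr_inverse)
  finally show ?thesis .
qed

section \<open>Weighted blocks\<close>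

lemma inv_fourier_mult_fourier:
  fixes a \<phi> :: "'a::euclidean_space \<Rightarrow> complex"
  assumes a: "integrable lborel a" and \<phi>: "integrable lborel \<phi>"
  shows "inv_fourier (\<lambda>\<xi>. a \<xi> * fourier \<phi> \<xi>) x = (\<integral>z. \<phi> z * fourier a (z - x) \<partial>lborel)"
proof -
  let ?b = "\<lambda>\<xi>. cis (2 * pi * (\<xi> \<bullet> x)) * a \<xi>"
  have b: "integrable lborel ?b" by (intro integrable_cis_mult a) simp
  have "inv_fourier (\<lambda>\<xi>. a \<xi> * fourier \<phi> \<xi>) x = (\<integral>\<xi>. ?b \<xi> * (\<integral>z. cis (- 2 * pi * (\<xi> \<bullet> z)) * \<phi> z \<partial>lborel) \<partial>lborel)"
    by (simp add: fourier_cis inv_fourier_cis mult_ac inner_commute)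
  also have "\<dots> = (\<integral>z. (\<integral>\<xi>. cis (- 2 * pi * (\<xi> \<bullet> z)) * ?b \<xi> \<partial>lborel) * \<phi> z \<partial>lborel)"
    by (rule Fubini_bounded_kernel(1)[OF b \<phi> measurable_cis_inner]) simp
  also have "\<dots> = (\<integral>z. \<phi> z * fourier a (z - x) \<partial>lborel)"
  proof -
    have "cis (- 2 * pi * (\<xi> \<bullet> z)) * ?b \<xi> = cis (- 2 * pi * (\<xi> \<bullet> (z - x))) * a \<xi>" for \<xi> z
    proof -
      have "cis (- 2 * pi * (\<xi> \<bullet> z)) * cis (2 * pi * (\<xi> \<bullet> x)) = cis (- 2 * pi * (\<xi> \<bullet> (z - x)))"
        unfolding cis_mult by (simp add: inner_diff_right algebra_simps)
      then show ?thesis by (simp only: mult.assoc[symmetric])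
    qed
    then show ?thesis by (simp only: fourier_cis mult.commute)
  qed
  finally show ?thesis .
qed

lemma exists_small_reciprocal:
  assumes "0 < (e::real)"
  obtains m where "0 < m" "1 / real m \<le> e"
proof -
  obtain m where m: "1 / e \<le> real m" using real_arch_simple by blast
  have "0 < 1 / e" using assms by simp
  then have "0 < real m" using m by linarith
  moreover from this have "1 / real m \<le> e" using m assms by (simp add: field_simps)
  ultimately show ?thesis using that[of m] by simp
qed

lemma weight_cancel: "(1 + norm x) ^ a * weight (a + b) x = weight b x"
  by (simp add: weight_mult) (simp add: weight_def)

lemma jbracket_pos: "0 < jbracket k"
  by (simp add: jbracket_def add_pos_nonneg)

lemma jbracket_bounds: "jbracket k \<le> 1 + norm k" "1 + norm k \<le> 2 * jbracket k"
proof -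
  have "1 + (norm k)\<^sup>2 \<le> (1 + norm k)\<^sup>2" by (simp add: power2_sum)
  then show "jbracket k \<le> 1 + norm k" unfolding jbracket_def by (intro real_le_lsqrt) auto
  have "1 \<le> jbracket k" unfolding jbracket_def by simp
  moreover have "norm k \<le> jbracket k" unfolding jbracket_def by (intro real_le_rsqrt) simp
  ultimately show "1 + norm k \<le> 2 * jbracket k" by linarith
qed

lemma jbracket_ratio: "jbracket k \<le> 2 * (1 + norm j) * jbracket (k + j)"
proof -
  have "jbracket k \<le> 1 + norm (k + j + (- j))" using jbracket_bounds(1)[of k] by simp
  also have "\<dots> \<le> (1 + norm (k + j)) * (1 + norm (- j))" by (rule one_plus_norm_add_le)
  also have "\<dots> \<le> (2 * jbracket (k + j)) * (1 + norm (- j))"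
    by (intro mult_right_mono jbracket_bounds) auto
  finally show ?thesis by (simp only: norm_minus_cancel mult_ac)
qed

text \<open>Peetre's inequality.\<close>

lemma jbracket_powr_ratio:
  "jbracket k powr s \<le> (2 * (1 + norm j)) powr \<bar>s\<bar> * jbracket (k + j) powr s"
proof -
  let ?K = "2 * (1 + norm j)"
  have K: "?K > 0" by (intro mult_pos_pos) auto
  show ?thesis
  proof (cases "0 \<le> s")
    case True
    have "jbracket k powr s \<le> (?K * jbracket (k + j)) powr s"
      using True jbracket_pos[of k] jbracket_ratio[of k j] by (intro powr_mono2) auto
    then show ?thesis using True K jbracket_pos[of "k + j"] by (simp add: powr_mult)
  next
    case False
    have "jbracket (k + j) \<le> ?K * jbracket k" using jbracket_ratio[of "k + j" "- j"] by simp
    then have "(?K * jbracket k) powr s \<le> jbracket (k + j) powr s"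
      using False jbracket_pos[of "k + j"] by (intro powr_mono2') auto
    then have "?K powr (- s) * (?K powr s * jbracket k powr s) \<le> ?K powr (- s) * jbracket (k + j) powr s"
      using K jbracket_pos[of k] by (intro mult_left_mono) (auto simp: powr_mult)
    moreover have "?K powr (- s) * ?K powr s = 1" using K by (simp add: powr_add[symmetric])
    ultimately show ?thesis using False by (simp add: mult.assoc[symmetric])
  qed
qed

lemma jbracket_powr_weight: "\<exists>n. \<forall>k. jbracket k powr s \<le> (1 + norm k) ^ n"
proof -
  obtain n where n: "\<bar>s\<bar> \<le> real n" using real_arch_simple by blast
  have "jbracket k powr s \<le> (1 + norm k) ^ n" for k :: 'a
  proof -
    have j1: "1 \<le> jbracket k" unfolding jbracket_def by simp
    have "jbracket k powr s \<le> jbracket k powr real n" using n j1 by (intro powr_mono) auto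
    also have "\<dots> = jbracket k ^ n" using jbracket_pos[of k] by (simp add: powr_realpow)
    also have "\<dots> \<le> (1 + norm k) ^ n"
      by (intro power_mono jbracket_bounds(1) less_imp_le jbracket_pos)
    finally show ?thesis .
  qed
  then show ?thesis by blast
qed

context cutoff_function
begin

definition wblock :: "real \<Rightarrow> ('a::euclidean_space \<times> real) distr \<Rightarrow> 'a \<times> real \<Rightarrow> 'a \<times> real \<Rightarrow> ennreal" where
  "wblock s f k x = ennreal (jbracket (fst k) powr s * norm (box_op \<eta> k f x))"

lemma aniso_wiener_norm_eq: "aniso_wiener_norm \<eta> p q r s f = mixed_norm p r q (wblock s f)"
  by (simp add: aniso_wiener_norm_def mixed_norm_def seq_norm_def wblock_def[abs_def])

lemma wblock_measurable: "f \<in> tempered \<Longrightarrow> wblock s f k \<in> borel_measurable borel"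
  unfolding wblock_def[abs_def] using box_op_measurable[of f k] by measurable

text \<open>A substitute for the Peetre maximal function of a block. The exponent \<open>m\<close> is written \<open>1 / (1 / real m)\<close> to
  match \<open>average\<close> with power \<open>1 / real m\<close>.\<close>

definition maxblock :: "real \<Rightarrow> nat \<Rightarrow> ('a::euclidean_space \<times> real) distr \<Rightarrow> 'a \<times> real \<Rightarrow> 'a \<times> real \<Rightarrow> ennreal" where
  "maxblock s m f k x = epowr (average (1 / real m) (2 * DIM('a \<times> real)) (wblock s f k) x) (1 / (1 / real m))"

lemma maxblock_measurable: "f \<in> tempered \<Longrightarrow> maxblock s m f k \<in> borel_measurable borel"
  unfolding maxblock_def[abs_def] by (intro epowr_measurable average_measurable wblock_measurable)

text \<open>The sub-mean-value inequality for a block, multiplied by its weight. The constant depends neither on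
  \<open>f\<close> nor on \<open>k\<close> because the reproducing kernels are bounded independently of them.\<close>

lemma wblock_le_maxblock:
  assumes m: "0 < m"
  shows "\<exists>C>0. \<forall>f\<in>tempered. \<forall>k x y. wblock s f k y
    \<le> ennreal (C * (1 + norm (x - y)) ^ (2 * DIM('a::euclidean_space \<times> real) * m)) * maxblock s m f k (x :: 'a \<times> real)"
proof -
  let ?M = "2 * DIM('a \<times> real)" and ?a = "1 / real m"
  have "\<forall>N. \<exists>c. 0 < c \<and> (\<forall>w::'a \<times> real. norm (fourier chi w) \<le> c * weight N w)"
    using chi_kernel_bound[where 'a="'a \<times> real"] by simp
  from choice[OF this] obtain c where c: "\<forall>N. 0 < c N \<and> (\<forall>w::'a \<times> real. norm (fourier chi w) \<le> c N * weight N w)"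
    by (elim exE)
  have c0: "0 < c N" for N using c by simp
  define C where "C = c (?M * m) ^ m"
  have "wblock s f k y \<le> ennreal (C * (1 + norm (x - y)) ^ (?M * m)) * maxblock s m f k x"
    if f: "f \<in> tempered" for f :: "('a \<times> real) distr" and k x y
  proof -
    let ?u = "box_op \<eta> k f" and ?b = "jbracket (fst k) powr s"
    have um [measurable]: "?u \<in> borel_measurable borel" by (rule box_op_measurable[OF f])
    obtain A n where growth: "\<And>x. norm (?u x) \<le> A * (1 + norm x) ^ n" using box_op_growth[OF f] by blast
    let ?A = "average ?a ?M (wblock s f k) x" and ?J = "\<integral>\<^sup>+z. ennreal (norm (?u z) powr ?a * weight ?M (x - z)) \<partial>lborel"
    let ?c = "c (?M * m)" and ?e = "(1 + norm (x - y)) ^ ?M" and ?y = "norm (?u y) powr ?a * weight ?M (x - y)"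
    have rep: "ennreal (norm (?u x)) \<le> ennreal (c N) * (\<integral>\<^sup>+z. ennreal (norm (?u z) * weight N (x - z)) \<partial>lborel)" for N x
      using c by (intro box_op_reproducing_bound f) auto
    have ep: "epowr (wblock s f k z) ?a = ennreal (?b powr ?a * norm (?u z) powr ?a)" for z
      unfolding wblock_def by (simp add: epowr_ennreal powr_mult)
    have "?A = (\<integral>\<^sup>+z. epowr (wblock s f k (x - z)) ?a * ennreal (weight ?M (x - (x - z))) \<partial>lborel)"
      by (simp add: average_def)
    also have "\<dots> = (\<integral>\<^sup>+z. epowr (wblock s f k z) ?a * ennreal (weight ?M (x - z)) \<partial>lborel)"
      using wblock_measurable[OF f, of s k]
      by (intro lborel_nn_integral_reflect[where f="\<lambda>z. epowr (wblock s f k z) ?a * ennreal (weight ?M (x - z))"]) auto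
    also have "\<dots> = (\<integral>\<^sup>+z. ennreal (?b powr ?a) * ennreal (norm (?u z) powr ?a * weight ?M (x - z)) \<partial>lborel)"
      by (intro nn_integral_cong) (simp add: ep ennreal_mult'[symmetric] ennreal_mult''[symmetric] mult.assoc)
    also have "\<dots> = ennreal (?b powr ?a) * ?J"
      by (rule nn_integral_cmult) measurable
    finally have av: "?A = ennreal (?b powr ?a) * ?J" .
    have "ennreal ?y
        \<le> ennreal (?c) * ?J"
      by (rule sub_mean_value_inequality[OF um m c0 rep growth])
    then have "ennreal (?b powr ?a) * ennreal ?y
        \<le> ennreal (?b powr ?a) * (ennreal (?c) * ?J)"
      by (rule mult_left_mono) simp
    also have "\<dots> = ennreal (?c) * ?A" unfolding av by (simp add: mult_ac)
    finally have "ennreal (?b powr ?a) * ennreal ?y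
        \<le> ennreal (?c) * ?A" .
    then have "ennreal ?e * (ennreal (?b powr ?a) * ennreal ?y)
        \<le> ennreal ?e * (ennreal (?c) * ?A)"
      by (rule mult_left_mono) simp
    moreover have "ennreal ?e * (ennreal (?b powr ?a) * ennreal ?y) = epowr (wblock s f k y) ?a"
    proof -
      have "?e * (?b powr ?a * (norm (?u y) powr ?a * weight ?M (x - y))) = ?b powr ?a * norm (?u y) powr ?a"
        by (simp add: weight_def)
      then show ?thesis by (simp add: ep ennreal_mult'[symmetric] ennreal_mult''[symmetric])
    qed
    moreover have "ennreal ?e * (ennreal (?c) * ?A)
        = ennreal (?c * ?e) * ?A"
      using c0[of "?M * m"] by (simp add: ennreal_mult mult_ac)
    ultimately have "epowr (wblock s f k y) ?a \<le> ennreal (?c * ?e) * ?A" by simp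
    then have "epowr (epowr (wblock s f k y) ?a) (1 / ?a) \<le> epowr (ennreal (?c * ?e) * ?A) (1 / ?a)"
      using m by (intro epowr_mono) auto
    also have "\<dots> = ennreal ((?c * ?e) powr real m) * maxblock s m f k x"
      using c0[of "?M * m"] by (simp add: epowr_mult maxblock_def epowr_ennreal less_imp_le)
    also have "(?c * ?e) powr real m = C * (1 + norm (x - y)) ^ (?M * m)"
    proof -
      have "0 < ?c * (1 + norm (x - y)) ^ ?M" by (intro mult_pos_pos zero_less_power c0 one_plus_norm_pos)
      then show ?thesis by (simp only: powr_realpow C_def power_mult_distrib power_mult)
    qed
    finally show ?thesis using m by (simp add: epowr_inverse)
  qed
  moreover have "0 < C" using c0 by (simp add: C_def)
  ultimately show ?thesis by blast
qed

lemma mixed_norm_maxblock: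
  fixes f :: "('a::euclidean_space \<times> real) distr"
  assumes f: "f \<in> tempered" and m: "0 < m" and p: "1 / real m \<le> p" and r: "1 / real m \<le> r" and q: "1 / real m \<le> q"
  shows "mixed_norm p r q (maxblock s m f)
    \<le> epowr (\<integral>\<^sup>+z. ennreal (weight (2 * DIM('a \<times> real)) (z::'a \<times> real)) \<partial>lborel) (real m) * mixed_norm p r q (wblock s f)"
  using mixed_norm_average[of "1 / real m" p r q "wblock s f" "2 * DIM('a \<times> real)"] m p r q wblock_measurable[OF f]
  by (simp add: maxblock_def[abs_def])

lemma weight_integral_constant: "epowr (\<integral>\<^sup>+z. ennreal (weight (2 * DIM('a)) (z::'a::euclidean_space)) \<partial>lborel) a < top"
  using nn_integral_weight_finite[where 'a='a] by simp

lemma weighted_block_integral_le_maxblock: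
  assumes m: "0 < m"
  shows "\<exists>C>0. \<forall>f\<in>tempered. \<forall>k (x :: 'a::euclidean_space \<times> real). ennreal (jbracket (fst k) powr s) *
     (\<integral>\<^sup>+z. ennreal (norm (box_op \<eta> k f z) * weight (2 * DIM('a \<times> real) * m + 2 * DIM('a \<times> real)) (x - z)) \<partial>lborel)
    \<le> ennreal C * maxblock s m f k x"
proof -
  let ?M = "2 * DIM('a \<times> real)"
  obtain C where C: "C > 0" "\<And>f k x y. f \<in> tempered \<Longrightarrow> wblock s f k y
    \<le> ennreal (C * (1 + norm (x - y)) ^ (?M * m)) * maxblock s m f k (x :: 'a \<times> real)"
    using wblock_le_maxblock[OF m, where 'a='a and s=s] by blast
  define I where "I = (\<integral>\<^sup>+z. ennreal (weight ?M (z::'a \<times> real)) \<partial>lborel)"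
  have I: "I < top" using nn_integral_weight_finite[where 'a="'a \<times> real"] by (simp add: I_def)
  define D where "D = C * (enn2real I + 1)"
  have D: "D > 0" "ennreal C * I \<le> ennreal D"
  proof -
    show "D > 0" using C by (simp add: D_def add_nonneg_pos)
    obtain i where "I = ennreal i" "0 \<le> i" using I by (cases I) auto
    then show "ennreal C * I \<le> ennreal D" using C by (simp add: D_def ennreal_mult'[symmetric] ennreal_leI)
  qed
  have "ennreal (jbracket (fst k) powr s) * (\<integral>\<^sup>+z. ennreal (norm (box_op \<eta> k f z) * weight (?M * m + ?M) (x - z)) \<partial>lborel)
      \<le> ennreal D * maxblock s m f k x" if f: "f \<in> tempered" for f :: "('a \<times> real) distr" and k x
  proof -
    have [measurable]: "box_op \<eta> k f \<in> borel_measurable borel" by (rule box_op_measurable[OF f])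
    let ?j = "ennreal (jbracket (fst k) powr s)" and ?X = "maxblock s m f k x"
    let ?F = "\<lambda>z. ennreal (norm (box_op \<eta> k f z) * weight (?M * m + ?M) (x - z))"
    have "?j * (\<integral>\<^sup>+z. ?F z \<partial>lborel)
        = (\<integral>\<^sup>+z. ?j * ?F z \<partial>lborel)"
      by (rule nn_integral_cmult[symmetric]) measurable
    also have "\<dots> \<le> (\<integral>\<^sup>+z. ennreal C * ?X * ennreal (weight ?M (x - z)) \<partial>lborel)"
    proof (intro nn_integral_mono)
      fix z
      have "?j * ?F z
          = wblock s f k z * ennreal (weight (?M * m + ?M) (x - z))"
        unfolding wblock_def by (simp add: ennreal_mult'[symmetric] ennreal_mult''[symmetric] mult.assoc)
      also have "\<dots> \<le> ennreal (C * (1 + norm (x - z)) ^ (?M * m)) * ?X * ennreal (weight (?M * m + ?M) (x - z))"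
        by (intro mult_right_mono C f) simp
      also have "\<dots> = ?X * ennreal (C * (1 + norm (x - z)) ^ (?M * m) * weight (?M * m + ?M) (x - z))"
        using C(1) by (simp add: ennreal_mult'' mult_ac)
      also have "C * (1 + norm (x - z)) ^ (?M * m) * weight (?M * m + ?M) (x - z) = C * weight ?M (x - z)"
        unfolding mult.assoc weight_cancel ..
      also have "?X * ennreal (C * weight ?M (x - z)) = ennreal C * ?X * ennreal (weight ?M (x - z))"
        using C(1) by (simp add: ennreal_mult'' mult_ac)
      finally show "?j * ?F z
          \<le> ennreal C * ?X * ennreal (weight ?M (x - z))" .
    qed
    also have "\<dots> = ennreal C * ?X * (\<integral>\<^sup>+z. ennreal (weight ?M (x - z)) \<partial>lborel)"
      by (rule nn_integral_cmult) measurable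
    also have "(\<integral>\<^sup>+z. ennreal (weight ?M (x - z)) \<partial>lborel) = I"
      unfolding I_def by (rule lborel_nn_integral_reflect) measurable
    also have "ennreal C * ?X * I = (ennreal C * I) * ?X" by (simp add: mult_ac)
    also have "\<dots> \<le> ennreal D * ?X" by (intro mult_right_mono D) simp
    finally show ?thesis .
  qed
  with D(1) show ?thesis by blast
qed

section \<open>Neighbouring blocks\<close>

definition nbr :: "'a::euclidean_space set" where
  "nbr = {j \<in> int_lattice. \<forall>b\<in>Basis. \<bar>j \<bullet> b\<bar> \<le> 3}"

lemma nbr_subset: "nbr \<subseteq> int_lattice"
  by (auto simp: nbr_def)

lemma finite_nbr: "finite (nbr :: 'a::euclidean_space set)"
proof (rule finite_subset)
  show "nbr \<subseteq> (near (DIM('a) * 3) :: 'a set)"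
  proof
    fix x :: 'a assume "x \<in> nbr"
    then show "x \<in> near (DIM('a) * 3)" using norm_le_of_coords[of x 3] by (auto simp: nbr_def near_def)
  qed
qed (rule finite_near)

text \<open>The multiplier by which block \<open>k\<close>, smoothed with \<open>chi\<close> centred at \<open>k\<close>, contributes to block \<open>l\<close>.\<close>

definition theta :: "'a::euclidean_space \<Rightarrow> 'a \<Rightarrow> 'a \<Rightarrow> complex" where
  "theta l k \<xi> = sig l \<xi> * chi (\<xi> - k)"

lemma schwartz_theta: "theta l k \<in> schwartz"
  unfolding theta_def[abs_def] by (intro schwartz_mult_slow slow_schwartz schwartz_sig schwartz_translate schwartz_chi)

lemma sig_nonzero: "sig l \<xi> \<noteq> 0 \<Longrightarrow> b \<in> Basis \<Longrightarrow> \<bar>\<xi> \<bullet> b - l \<bullet> b\<bar> < 1"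
  using bump_nonzero[OF unif_part_nonzero, of l \<xi> b] by (simp add: sig_def)

lemma theta_outside:
  assumes "l \<in> int_lattice" "k \<in> int_lattice" "k - l \<notin> nbr"
  shows "theta l k \<xi> = 0"
proof (rule ccontr)
  assume "theta l k \<xi> \<noteq> 0"
  then have nz: "sig l \<xi> \<noteq> 0" "chi (\<xi> - k) \<noteq> 0" by (auto simp: theta_def)
  obtain b where b: "b \<in> Basis" "\<bar>(k - l) \<bullet> b\<bar> > 3"
    using assms int_lattice_diff[of k l] by (auto simp: nbr_def not_le)
  have "\<bar>\<xi> \<bullet> b - l \<bullet> b\<bar> < 1" by (rule sig_nonzero[OF nz(1) b(1)])
  moreover have "\<bar>\<xi> \<bullet> b - k \<bullet> b\<bar> < 2"
    using chi_eq_0[OF b(1), of "\<xi> - k"] nz(2) by (force simp: inner_diff_left)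
  ultimately show False using b(2) unfolding inner_diff_left by linarith
qed

lemma theta_kernel_bound:
  "\<exists>C\<ge>0. \<forall>l\<in>int_lattice. \<forall>j\<in>nbr. \<forall>w::'a::euclidean_space. norm (fourier (theta l (l + j)) w) \<le> C * weight N w"
proof -
  let ?c = "\<lambda>j::'a. schwartz_seminorm N (fourier (theta 0 j))"
  have c0: "0 \<le> ?c j" for j by (intro schwartz_seminorm_nonneg fourier_schwartz schwartz_theta)
  have "norm (fourier (theta l (l + j)) w) \<le> (\<Sum>j\<in>nbr. ?c j) * weight N w"
    if l: "l \<in> int_lattice" and j: "j \<in> nbr" for l j w :: 'a
  proof -
    have "theta l (l + j) = (\<lambda>\<xi>. theta 0 j (\<xi> - l))"
      by (rule ext) (simp add: theta_def sig_translate[OF l] diff_diff_eq)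
    then have "norm (fourier (theta l (l + j)) w) = norm (fourier (theta 0 j) w)"
      by (simp add: norm_fourier_translate[OF schwartz_theta])
    also have "\<dots> \<le> ?c j * weight N w" by (intro schwartz_norm_le fourier_schwartz schwartz_theta)
    also have "\<dots> \<le> (\<Sum>j\<in>nbr. ?c j) * weight N w"
      using j c0 by (intro mult_right_mono member_le_sum finite_nbr) auto
    finally show ?thesis .
  qed
  moreover have "0 \<le> (\<Sum>j\<in>nbr. ?c j)" using c0 by (intro sum_nonneg) auto
  ultimately show ?thesis by blast
qed

text \<open>Only neighbours of \<open>l\<close> meet the support of \<open>sig l\<close>, so their multipliers add up to \<open>1\<close> there; the
  additional factor \<open>chi\<close> equals \<open>1\<close> on the support of \<open>sig (l + j)\<close>.\<close>

lemma sig_eq_sum_theta: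
  assumes "l \<in> int_lattice"
  shows "sig l \<xi> = (\<Sum>j\<in>nbr. theta l (l + j) \<xi> * sig (l + j) \<xi>)"
proof (cases "sig l \<xi> = 0")
  case True
  then show ?thesis by (simp add: theta_def)
next
  case False
  have "(\<Sum>j\<in>nbr. unif_part \<eta> (l + j) \<xi>) = (\<Sum>k\<in>(\<lambda>j. l + j) ` nbr. unif_part \<eta> k \<xi>)"
    by (subst sum.reindex) (auto simp: inj_on_def)
  also have "\<dots> = 1"
  proof (rule sum_unif_part)
    show "finite ((\<lambda>j. l + j) ` nbr)" by (intro finite_imageI finite_nbr)
    show "(\<lambda>j. l + j) ` nbr \<subseteq> int_lattice" using nbr_subset assms by (auto intro!: int_lattice_add)
    fix k assume k: "k \<in> int_lattice" "bump \<eta> k \<xi> \<noteq> 0"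
    have "k - l \<in> nbr"
      unfolding nbr_def
    proof (intro CollectI conjI ballI int_lattice_diff k assms)
      fix b :: 'a assume b: "b \<in> Basis"
      \<comment> \<open>The supports of \<open>sig l\<close> and \<open>bump\<close> at \<open>k\<close> have coordinates within \<open>1\<close> of \<open>l\<close> and \<open>k\<close>.\<close>
      show "\<bar>(k - l) \<bullet> b\<bar> \<le> 3"
        using sig_nonzero[OF False b] bump_nonzero[OF k(2) b] unfolding inner_diff_left by linarith
    qed
    then show "k \<in> (\<lambda>j. l + j) ` nbr" by (intro image_eqI[where x="k - l"]) auto
  qed
  finally have "(\<Sum>j\<in>nbr. sig (l + j) \<xi>) = 1" by (simp add: sig_def of_real_sum[symmetric])
  then have "sig l \<xi> = (\<Sum>j\<in>nbr. sig l \<xi> * sig (l + j) \<xi>)" by (simp add: sum_distrib_left[symmetric])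
  also have "\<dots> = (\<Sum>j\<in>nbr. theta l (l + j) \<xi> * sig (l + j) \<xi>)"
  proof (intro sum.cong refl)
    fix j
    have "theta l (l + j) \<xi> * sig (l + j) \<xi> = sig l \<xi> * (sig (l + j) \<xi> * chi (\<xi> - (l + j)))"
      by (simp add: theta_def mult_ac)
    then show "sig l \<xi> * sig (l + j) \<xi> = theta l (l + j) \<xi> * sig (l + j) \<xi>" by (simp only: sig_mult_chi)
  qed
  finally show ?thesis .
qed

lemma fourier_sum:
  assumes "finite I" "\<And>i. i \<in> I \<Longrightarrow> integrable lborel (f i)"
  shows "fourier (\<lambda>\<xi>. \<Sum>i\<in>I. f i \<xi>) w = (\<Sum>i\<in>I. fourier (f i) w)"
  unfolding fourier_cis sum_distrib_left
  by (rule Bochner_Integration.integral_sum) (intro integrable_cis_mult assms; simp)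

lemma box_op_expansion:
  assumes L: "L \<in> tempered" and l: "l \<in> int_lattice"
  shows "box_op \<eta> l L x = (\<Sum>j\<in>nbr. \<integral>z. box_op \<eta> (l + j) L z * fourier (theta l (l + j)) (z - x) \<partial>lborel)"
proof -
  let ?t = "\<lambda>j \<xi>. theta l (l + j) \<xi> * sig (l + j) \<xi>"
  have s: "(?t j) \<in> schwartz" for j
    by (intro schwartz_mult_slow slow_schwartz schwartz_sig schwartz_theta)
  have k: "ker l (y - x) = (\<Sum>j\<in>nbr. 1 * fourier (?t j) (y - x))" for y
  proof -
    have "sig l = (\<lambda>\<xi>. \<Sum>j\<in>nbr. ?t j \<xi>)"
      by (rule ext) (rule sig_eq_sum_theta[OF l])
    then have "ker l (y - x) = fourier (\<lambda>\<xi>. \<Sum>j\<in>nbr. ?t j \<xi>) (y - x)"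
      by (simp add: ker_def)
    also have "\<dots> = (\<Sum>j\<in>nbr. fourier (?t j) (y - x))"
      by (intro fourier_sum finite_nbr schwartz_integrable s)
    finally show ?thesis by simp
  qed
  have "box_op \<eta> l L x = L (\<lambda>y. \<Sum>j\<in>nbr. 1 * fourier (?t j) (y - x))"
    unfolding box_op_eq[OF L] k ..
  also have "\<dots> = (\<Sum>j\<in>nbr. 1 * L (\<lambda>y. fourier (?t j) (y - x)))"
    by (intro tempered_sum L finite_nbr schwartz_translate fourier_schwartz s)
  finally show ?thesis by (simp add: tempered_fourier_mult_sig[OF L schwartz_theta])
qed

lemma box_op_diff:
  assumes "L \<in> tempered" "L' \<in> tempered"
  shows "box_op \<eta> k (distr_diff L L') x = box_op \<eta> k L x - box_op \<eta> k L' x"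
  using assms by (simp add: box_op_eq tempered_distr_diff) (simp add: distr_diff_def)

lemma box_op_distr_of:
  assumes g: "g \<in> schwartz"
  shows "box_op \<eta> k (distr_of g) x = inv_fourier (\<lambda>\<xi>. sig k \<xi> * fourier g \<xi>) x"
proof -
  have "box_op \<eta> k (distr_of g) x = (\<integral>y. g y * ker k (y - x) \<partial>lborel)"
    by (simp add: box_op_eq[OF tempered_distr_of[OF g]] distr_of_apply schwartz_translate schwartz_ker)
  then show ?thesis
    unfolding ker_def by (simp add: inv_fourier_mult_fourier schwartz_integrable schwartz_sig g)
qed

section \<open>Density of the Schwartz functions\<close>

text \<open>The approximation of \<open>L\<close>: the blocks with frequency at most \<open>n\<close>, each cut off to the ball of
  radius \<open>n\<close> and then smoothed by a kernel that reproduces the block.\<close>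

definition cut_block :: "nat \<Rightarrow> 'a::euclidean_space distr \<Rightarrow> 'a \<Rightarrow> 'a \<Rightarrow> complex" where
  "cut_block n L k z = box_op \<eta> k L z * indicator (cball 0 (real n)) z"

definition approximant :: "nat \<Rightarrow> 'a::euclidean_space distr \<Rightarrow> 'a \<Rightarrow> complex" where
  "approximant n L = inv_fourier (\<lambda>\<xi>. \<Sum>k\<in>near (real n). chi (\<xi> - k) * fourier (cut_block n L k) \<xi>)"

lemma moments_cut_block:
  fixes L :: "'a::euclidean_space distr"
  assumes L: "L \<in> tempered"
  shows "moments (cut_block n L k)"
proof (rule moments_of_decay)
  have [measurable]: "box_op \<eta> k L \<in> borel_measurable borel" by (rule box_op_measurable[OF L])
  show "cut_block n L k \<in> borel_measurable borel" unfolding cut_block_def[abs_def]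
    by (intro borel_measurable_times box_op_measurable[OF L] borel_measurable_indicator) simp
  obtain C N where C: "\<And>x. norm (box_op \<eta> k L x) \<le> C * (1 + norm x) ^ N" using box_op_growth[OF L] by blast
  have C0: "0 \<le> C" using order_trans[OF norm_ge_zero C[of 0]] by simp
  fix K
  have "norm (cut_block n L k x) \<le> (C * (1 + real n) ^ (N + K)) * weight K x" for x
  proof (cases "x \<in> cball 0 (real n)")
    case True
    then have x: "norm x \<le> real n" by simp
    have "norm (box_op \<eta> k L x) \<le> C * (1 + norm x) ^ N" by (rule C)
    also have "\<dots> = C * (1 + norm x) ^ (N + K) * weight K x" by (simp add: power_add weight_def)
    also have "\<dots> \<le> C * (1 + real n) ^ (N + K) * weight K x"
      using x C0 by (intro mult_right_mono mult_left_mono power_mono) auto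
    finally show ?thesis using True by (simp add: cut_block_def)
  next
    case False
    then show ?thesis using C0 by (simp add: cut_block_def)
  qed
  then show "\<exists>C. \<forall>x. norm (cut_block n L k x) \<le> C * weight K x" by blast
qed

lemma schwartz_chi_mult_fourier:
  "moments v \<Longrightarrow> (\<lambda>\<xi>. chi (\<xi> - k) * fourier v \<xi>) \<in> schwartz"
  using schwartz_mult_slow[OF slow_fourier schwartz_translate[OF schwartz_chi], of v k] by (simp add: mult.commute)

lemma schwartz_approximant:
  assumes L: "L \<in> tempered"
  shows "approximant n L \<in> schwartz"
  unfolding approximant_def
  by (intro inv_fourier_schwartz schwartz_sum schwartz_chi_mult_fourier moments_cut_block L)

lemma box_op_approximant:
  assumes L: "L \<in> tempered" and l: "l \<in> int_lattice"
  shows "box_op \<eta> l (distr_of (approximant n L)) x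
    = (\<Sum>j\<in>nbr. if l + j \<in> near (real n) then \<integral>z. cut_block n L (l + j) z * fourier (theta l (l + j)) (z - x) \<partial>lborel else 0)"
proof -
  let ?v = "cut_block n L"
  let ?I = "\<lambda>k. \<integral>z. ?v k z * fourier (theta l k) (z - x) \<partial>lborel"
  have s: "(\<lambda>\<xi>. \<Sum>k\<in>near (real n). chi (\<xi> - k) * fourier (?v k) \<xi>) \<in> schwartz"
    by (intro schwartz_sum schwartz_chi_mult_fourier moments_cut_block L)
  have st: "(\<lambda>\<xi>. theta l k \<xi> * fourier (?v k) \<xi>) \<in> schwartz" for k
    using schwartz_mult_slow[OF slow_fourier[OF moments_cut_block[OF L]] schwartz_theta, of n k l k] by (simp add: mult.commute)
  have "box_op \<eta> l (distr_of (approximant n L)) x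
      = inv_fourier (\<lambda>\<xi>. sig l \<xi> * (\<Sum>k\<in>near (real n). chi (\<xi> - k) * fourier (?v k) \<xi>)) x"
    unfolding box_op_distr_of[OF schwartz_approximant[OF L]] by (simp add: approximant_def fourier_inv_fourier[OF s])
  also have "(\<lambda>\<xi>. sig l \<xi> * (\<Sum>k\<in>near (real n). chi (\<xi> - k) * fourier (?v k) \<xi>))
      = (\<lambda>\<xi>. \<Sum>k\<in>near (real n). theta l k \<xi> * fourier (?v k) \<xi>)"
    by (rule ext) (simp add: sum_distrib_left theta_def mult.assoc)
  also have "inv_fourier \<dots> x = (\<Sum>k\<in>near (real n). inv_fourier (\<lambda>\<xi>. theta l k \<xi> * fourier (?v k) \<xi>) x)"
    unfolding inv_fourier_eq by (intro fourier_sum finite_near schwartz_integrable st)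
  also have "\<dots> = (\<Sum>k\<in>near (real n). ?I k)"
    by (intro sum.cong refl inv_fourier_mult_fourier schwartz_integrable schwartz_theta moments_integrable moments_cut_block L)
  also have "\<dots> = (\<Sum>k\<in>(\<lambda>j. l + j) ` nbr. if k \<in> near (real n) then ?I k else 0)"
  proof -
    have out: "?I k = 0" if "k \<in> near (real n)" "k \<notin> (\<lambda>j. l + j) ` nbr" for k
    proof -
      have "k - l \<notin> nbr" using that(2) by (metis add.commute diff_add_cancel image_eqI)
      then have "theta l k = (\<lambda>\<xi>. 0)" using theta_outside[OF l] that(1) near_subset by blast
      then show ?thesis by (simp add: fourier_cis)
    qed
    have "(\<Sum>k\<in>near (real n). ?I k) = (\<Sum>k\<in>near (real n) \<inter> (\<lambda>j. l + j) ` nbr. ?I k)"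
      by (intro sum.mono_neutral_right finite_near) (use out in auto)
    also have "\<dots> = (\<Sum>k\<in>(\<lambda>j. l + j) ` nbr. if k \<in> near (real n) then ?I k else 0)"
      by (subst sum.inter_restrict[symmetric]) (auto simp: finite_nbr Int_commute)
    finally show ?thesis .
  qed
  also have "\<dots> = (\<Sum>j\<in>nbr. if l + j \<in> near (real n) then ?I (l + j) else 0)"
    by (subst sum.reindex) (auto simp: inj_on_def)
  finally show ?thesis .
qed

text \<open>The part of an averaged block that \<open>approximant n L\<close> discards.\<close>

definition tail :: "nat \<Rightarrow> nat \<Rightarrow> 'a::euclidean_space distr \<Rightarrow> 'a \<Rightarrow> 'a \<Rightarrow> ennreal" where
  "tail N n L k x = (\<integral>\<^sup>+z. ennreal (norm (box_op \<eta> k L z) * (if k \<in> near (real n) \<and> norm z \<le> real n then 0 else 1) * weight N (x - z)) \<partial>lborel)"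

lemma box_op_diff_approximant_le:
  assumes C: "C \<ge> 0" "\<And>l j w::'a::euclidean_space. l \<in> int_lattice \<Longrightarrow> j \<in> nbr \<Longrightarrow> norm (fourier (theta l (l + j)) w) \<le> C * weight N w"
    and L: "L \<in> tempered" and l: "l \<in> int_lattice"
  shows "ennreal (norm (box_op \<eta> l (distr_diff L (distr_of (approximant n L))) x)) \<le> (\<Sum>j\<in>nbr. ennreal C * tail N n L (l + j) (x::'a))"
proof -
  let ?u = "\<lambda>k. box_op \<eta> k L" and ?F = "\<lambda>j. fourier (theta l (l + j))"
  let ?w = "\<lambda>k z. ?u k z * (if k \<in> near (real n) \<and> norm z \<le> real n then 0 else 1)"
  have um [measurable]: "?u k \<in> borel_measurable borel" for k by (rule box_op_measurable[OF L])
  let ?I = "\<lambda>j. \<integral>z. ?w (l + j) z * ?F j (z - x) \<partial>lborel"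
  have i1: "integrable lborel (\<lambda>z. ?u (l + j) z * ?F j (z - x))" for j
    by (rule box_op_integrable[OF L schwartz_theta])
  have Fm [measurable]: "?F j \<in> borel_measurable borel" for j
    by (intro schwartz_measurable fourier_schwartz schwartz_theta)
  have i2: "integrable lborel (\<lambda>z. cut_block n L (l + j) z * ?F j (z - x))" for j
  proof (rule Bochner_Integration.integrable_bound[OF i1[of j]])
    have [measurable]: "cut_block n L (l + j) \<in> borel_measurable borel"
      by (rule moments_measurable[OF moments_cut_block[OF L]])
    show "(\<lambda>z. cut_block n L (l + j) z * ?F j (z - x)) \<in> borel_measurable lborel" by measurable
  qed (auto simp: cut_block_def norm_mult split: split_indicator)
  have "box_op \<eta> l (distr_diff L (distr_of (approximant n L))) x
      = (\<Sum>j\<in>nbr. (\<integral>z. ?u (l + j) z * ?F j (z - x) \<partial>lborel)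
        - (if l + j \<in> near (real n) then \<integral>z. cut_block n L (l + j) z * ?F j (z - x) \<partial>lborel else 0))"
    unfolding box_op_diff[OF L tempered_distr_of[OF schwartz_approximant[OF L]]]
      box_op_expansion[OF L l] box_op_approximant[OF L l] sum_subtractf ..
  also have "\<dots> = (\<Sum>j\<in>nbr. \<integral>z. ?w (l + j) z * ?F j (z - x) \<partial>lborel)"
  proof (intro sum.cong refl)
    fix j
    show "(\<integral>z. ?u (l + j) z * ?F j (z - x) \<partial>lborel)
        - (if l + j \<in> near (real n) then \<integral>z. cut_block n L (l + j) z * ?F j (z - x) \<partial>lborel else 0)
        = (?I j)"
    proof (cases "l + j \<in> near (real n)")
      case True
      have "(\<integral>z. ?u (l + j) z * ?F j (z - x) \<partial>lborel) - (\<integral>z. cut_block n L (l + j) z * ?F j (z - x) \<partial>lborel)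
          = (\<integral>z. ?u (l + j) z * ?F j (z - x) - cut_block n L (l + j) z * ?F j (z - x) \<partial>lborel)"
        using i1 i2 by simp
      also have "\<dots> = (?I j)"
        using True by (intro Bochner_Integration.integral_cong refl) (auto simp: cut_block_def split: split_indicator)
      finally show ?thesis using True by simp
    qed simp
  qed
  finally have "ennreal (norm (box_op \<eta> l (distr_diff L (distr_of (approximant n L))) x))
      \<le> ennreal (\<Sum>j\<in>nbr. norm (?I j))"
    by (simp add: ennreal_leI norm_sum)
  also have "\<dots> = (\<Sum>j\<in>nbr. ennreal (norm (?I j)))"
    by (simp add: sum_ennreal)
  also have "\<dots> \<le> (\<Sum>j\<in>nbr. ennreal C * tail N n L (l + j) x)"
  proof (intro sum_mono)
    fix j assume j: "j \<in> (nbr :: 'a set)"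
    have "ennreal (norm (?I j))
        \<le> ennreal C * (\<integral>\<^sup>+z. ennreal (norm (?w (l + j) z) * weight N (x - z)) \<partial>lborel)"
      by (rule norm_integral_kernel_le[OF C(2)[OF l j] C(1)]) measurable
    also have "(\<integral>\<^sup>+z. ennreal (norm (?w (l + j) z) * weight N (x - z)) \<partial>lborel) = tail N n L (l + j) x"
      unfolding tail_def by (intro nn_integral_cong) (simp add: norm_mult)
    finally show "ennreal (norm (?I j)) \<le> ennreal C * tail N n L (l + j) x" .
  qed
  finally show ?thesis .
qed

lemma tail_measurable:
  fixes L :: "'a::euclidean_space distr"
  assumes L: "L \<in> tempered"
  shows "tail N n L k \<in> borel_measurable borel"
proof -
  have [measurable]: "box_op \<eta> k L \<in> borel_measurable borel" by (rule box_op_measurable[OF L])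
  have "(\<lambda>x. \<integral>\<^sup>+z. ennreal (norm (box_op \<eta> k L z) * (if k \<in> near (real n) \<and> norm z \<le> real n then 0 else 1) * weight N (x - z)) \<partial>lborel) \<in> borel_measurable borel"
    by measurable
  then show ?thesis by (simp add: tail_def[abs_def])
qed

text \<open>Every lattice point and every \<open>z\<close> is eventually within the truncation, so dominated convergence
  applies.\<close>

lemma tail_tendsto_0:
  fixes L :: "'a::euclidean_space distr"
  assumes L: "L \<in> tempered" and k: "k \<in> int_lattice"
    and fin: "(\<integral>\<^sup>+z. ennreal (norm (box_op \<eta> k L z) * weight N (x - z)) \<partial>lborel) < top"
  shows "(\<lambda>n. tail N n L k x) \<longlonglongrightarrow> 0"
proof -
  have [measurable]: "box_op \<eta> k L \<in> borel_measurable borel" by (rule box_op_measurable[OF L])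
  let ?t = "\<lambda>n z. ennreal (norm (box_op \<eta> k L z) * (if k \<in> near (real n) \<and> norm z \<le> real n then 0 else 1) * weight N (x - z))"
  have "(\<lambda>n. \<integral>\<^sup>+z. ?t n z \<partial>lborel) \<longlonglongrightarrow> (\<integral>\<^sup>+z. 0 \<partial>(lborel :: 'a measure))"
  proof (rule nn_integral_dominated_convergence[where w="\<lambda>z. ennreal (norm (box_op \<eta> k L z) * weight N (x - z))"])
    show "AE z in lborel. ?t n z \<le> ennreal (norm (box_op \<eta> k L z) * weight N (x - z))" for n
      by (intro AE_I2 ennreal_leI) auto
    show "AE z in lborel. (\<lambda>n. ?t n z) \<longlonglongrightarrow> 0"
    proof (rule AE_I2)
      fix z :: 'a
      obtain n0 where n0: "max (norm k) (norm z) \<le> real n0" using real_arch_simple by blast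
      have "?t n z = 0" if "n0 \<le> n" for n
      proof -
        have "real n0 \<le> real n" using that by simp
        then have "k \<in> near (real n)" "norm z \<le> real n" using n0 k by (auto simp: near_def)
        then show ?thesis by simp
      qed
      then have "\<forall>\<^sub>F n in sequentially. ?t n z = 0" unfolding eventually_sequentially by blast
      then show "(\<lambda>n. ?t n z) \<longlonglongrightarrow> 0" by (rule tendsto_eventually)
    qed
  qed (use fin in simp_all)
  then show ?thesis by (simp add: tail_def[abs_def])
qed

theorem schwartz_approximation:
  fixes L :: "('a::euclidean_space \<times> real) distr"
  assumes L: "L \<in> tempered" and p: "0 < p" and r: "0 < r" and q: "0 < q"
    and fin: "aniso_wiener_norm \<eta> p q r s L < \<infinity>"
  shows "(\<lambda>n. aniso_wiener_norm \<eta> p q r s (distr_diff L (distr_of (approximant n L)))) \<longlonglongrightarrow> 0"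
proof -
  let ?W = "2 * DIM('a \<times> real)"
  let ?d = "\<lambda>n. distr_diff L (distr_of (approximant n L))" and ?j = "\<lambda>k::'a \<times> real. jbracket (fst k) powr s"
  obtain m where m: "0 < m" "1 / real m \<le> min p (min r q)"
    using exists_small_reciprocal[of "min p (min r q)"] p r q by auto
  let ?N = "?W * m + ?W"
  let ?E = "\<lambda>k x. \<integral>\<^sup>+z. ennreal (norm (box_op \<eta> k L z) * weight ?N (x - z)) \<partial>lborel"
  obtain C where C: "C \<ge> 0" "\<And>l j w::'a \<times> real. l \<in> int_lattice \<Longrightarrow> j \<in> nbr \<Longrightarrow>
      norm (fourier (theta l (l + j)) w) \<le> C * weight ?N w"
    using theta_kernel_bound[where 'a="'a \<times> real" and N="?N"] by blast
  obtain D where D: "D > 0" "\<And>k x. ennreal (?j k) * ?E k x \<le> ennreal D * maxblock s m L k x"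
    using weighted_block_integral_le_maxblock[OF m(1), where 'a='a and s=s] L by blast
  define B where "B n k x = ennreal (?j k) * tail ?N n L k x" for n k x
  have jb: "0 < ?j k" for k :: "'a \<times> real" using jbracket_pos[of "fst k"] by simp
  have Bm: "B n k \<in> borel_measurable borel" for n k
    unfolding B_def[abs_def] using tail_measurable[OF L] by measurable
  have tail_le: "tail ?N n L k x \<le> ?E k x" for n k x
    unfolding tail_def by (intro nn_integral_mono ennreal_leI) auto
  have B0: "(\<lambda>n. mixed_norm p r q (B n)) \<longlonglongrightarrow> 0"
  proof (rule mixed_norm_tendsto_0[OF p r q Bm])
    show "(\<lambda>x. ennreal D * maxblock s m L k x) \<in> borel_measurable borel" for k
      using maxblock_measurable[OF L] by measurable
    show "B n k x \<le> ennreal D * maxblock s m L k x" for n k x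
      unfolding B_def by (rule order_trans[OF mult_left_mono[OF tail_le] D(2)]) simp
    have "mixed_norm p r q (\<lambda>k x. ennreal D * maxblock s m L k x) = ennreal D * mixed_norm p r q (maxblock s m L)"
      by (intro mixed_norm_cmult p r q maxblock_measurable L)
    also have "\<dots> \<le> ennreal D * (epowr (\<integral>\<^sup>+z. ennreal (weight ?W (z::'a \<times> real)) \<partial>lborel) (real m) * mixed_norm p r q (wblock s L))"
      using m by (intro mult_left_mono mixed_norm_maxblock L) auto
    also have "\<dots> < top"
      using fin weight_integral_constant[where 'a="'a \<times> real" and a="real m"]
      by (simp add: ennreal_mult_less_top aniso_wiener_norm_eq)
    finally show "mixed_norm p r q (\<lambda>k x. ennreal D * maxblock s m L k x) < top" .
    fix k :: "'a \<times> real" and x assume k: "k \<in> int_lattice" and f: "ennreal D * maxblock s m L k x < top"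
    have "ennreal (?j k) * ?E k x < top"
      using D(2) f by (rule le_less_trans)
    then have "?E k x < top"
      using jb[of k] by (auto simp: ennreal_mult_less_top)
    from tail_tendsto_0[OF L k this]
    have "(\<lambda>n. ennreal (?j k) * tail ?N n L k x) \<longlonglongrightarrow> ennreal (?j k) * 0"
      by (intro ennreal_tendsto_cmult) auto
    then show "(\<lambda>n. B n k x) \<longlonglongrightarrow> 0" by (simp add: B_def)
  qed
  \<comment> \<open>The weights of neighbouring lattice points are comparable.\<close>
  define K where "K j = C * (2 * (1 + norm (fst j))) powr \<bar>s\<bar>" for j :: "'a \<times> real"
  have K0: "0 \<le> K j" for j using C by (simp add: K_def)
  have le: "wblock s (?d n) l x \<le> (\<Sum>j\<in>nbr. ennreal (K j) * B n (l + j) x)"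
    if l: "l \<in> int_lattice" for n l x
  proof -
    have "wblock s (?d n) l x
        \<le> ennreal (?j l) * (\<Sum>j\<in>nbr. ennreal C * tail ?N n L (l + j) x)"
    proof -
      have "wblock s (?d n) l x = ennreal (?j l)
          * ennreal (norm (box_op \<eta> l (?d n) x))"
        by (simp add: wblock_def ennreal_mult')
      then show ?thesis by (simp only:) (intro mult_left_mono box_op_diff_approximant_le[OF C L l]; simp)
    qed
    also have "\<dots> = (\<Sum>j\<in>nbr. ennreal (C * ?j l) * tail ?N n L (l + j) x)"
      using C(1) by (simp add: sum_distrib_left ennreal_mult' mult_ac)
    also have "\<dots> \<le> (\<Sum>j\<in>nbr. ennreal (K j) * B n (l + j) x)"
    proof (intro sum_mono)
      fix j
      have "C * ?j l \<le> K j * ?j (l + j)"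
        unfolding K_def using mult_left_mono[OF jbracket_powr_ratio C(1), of "fst l" s "fst j"] by (simp add: mult_ac)
      then have "ennreal (C * ?j l) \<le> ennreal (K j) * ennreal (?j (l + j))"
        using K0 by (simp add: ennreal_mult'[symmetric] ennreal_leI)
      then show "ennreal (C * ?j l) * tail ?N n L (l + j) x \<le> ennreal (K j) * B n (l + j) x"
        unfolding B_def mult.assoc[symmetric] by (rule mult_right_mono) simp
    qed
    finally show ?thesis .
  qed
  have "(\<lambda>n. mixed_norm p r q (\<lambda>l x. \<Sum>j\<in>nbr. ennreal (K j) * B n (l + j) x)) \<longlonglongrightarrow> 0"
  proof (rule mixed_norm_sum_tendsto_0[OF p r q finite_nbr])
    show "(\<lambda>x. ennreal (K j) * B n (k + j) x) \<in> borel_measurable borel" for j n k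
      using Bm by measurable
    fix j :: "'a \<times> real" assume "j \<in> nbr"
    then have j: "j \<in> int_lattice" using nbr_subset by blast
    have "mixed_norm p r q (\<lambda>l x. ennreal (K j) * B n (l + j) x) = ennreal (K j) * mixed_norm p r q (B n)" for n
      using mixed_norm_cmult[OF p r q, of "\<lambda>l. B n (l + j)" "ennreal (K j)"] Bm mixed_norm_shift[OF j, of p r q "B n"] by simp
    moreover have "(\<lambda>n. ennreal (K j) * mixed_norm p r q (B n)) \<longlonglongrightarrow> ennreal (K j) * 0"
      by (intro ennreal_tendsto_cmult B0) simp
    ultimately show "(\<lambda>n. mixed_norm p r q (\<lambda>l x. ennreal (K j) * B n (l + j) x)) \<longlonglongrightarrow> 0" by simp
  qed
  from tendsto_sandwich[OF _ _ tendsto_const this] show ?thesis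
    unfolding aniso_wiener_norm_eq using le by (simp add: mixed_norm_mono p r q)
qed

end

section \<open>Finiteness of the norms of Schwartz functions\<close>

lemma nn_integral_count_lborel_swap:
  fixes F :: "'k \<Rightarrow> 'a::euclidean_space \<Rightarrow> ennreal"
  assumes "countable A" "\<And>k. k \<in> A \<Longrightarrow> F k \<in> borel_measurable borel"
  shows "(\<integral>\<^sup>+k. (\<integral>\<^sup>+z. F k z \<partial>lborel) \<partial>count_space A) = (\<integral>\<^sup>+z. (\<integral>\<^sup>+k. F k z \<partial>count_space A) \<partial>lborel)"
proof -
  interpret pair_sigma_finite "lborel :: 'a measure" "count_space A"
    by (intro pair_sigma_finite.intro sigma_finite_lborel sigma_finite_measure_count_space_countable assms(1))
  have "(\<lambda>(z, k). F k z) \<in> borel_measurable (lborel \<Otimes>\<^sub>M count_space A)"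
    by (rule measurable_pair_count_space[OF assms(1)]) (simp add: assms(2))
  from Fubini'[of "\<lambda>z k. F k z", OF this] show ?thesis .
qed

text \<open>Comparison with the integral: the balls of radius \<open>1 / 2\<close> around lattice points are disjoint, and on
  each of them the weight is comparable to its value at the centre.\<close>

lemma nn_integral_lattice_weight_finite:
  "(\<integral>\<^sup>+k. ennreal (weight (2 * DIM('a)) k) \<partial>count_space (int_lattice :: 'a::euclidean_space set)) < top"
proof -
  let ?W = "2 * DIM('a)" and ?B = "\<lambda>k::'a. ball k (1 / 2)"
  define v where "v = unit_ball_vol DIM('a) * (1 / 2) ^ DIM('a)"
  have V: "emeasure lborel (?B k) = ennreal v" for k unfolding v_def by (rule emeasure_ball) simp
  have v0: "v > 0" unfolding v_def by (intro mult_pos_pos unit_ball_vol_pos) auto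
  have "ennreal v * (\<integral>\<^sup>+k. ennreal (weight ?W k) \<partial>count_space (int_lattice :: 'a set))
      = (\<integral>\<^sup>+k. (\<integral>\<^sup>+z. ennreal (weight ?W k) * indicator (?B k) z \<partial>lborel) \<partial>count_space int_lattice)"
  proof -
    have "(\<integral>\<^sup>+z. ennreal (weight ?W k) * indicator (?B k) z \<partial>lborel) = ennreal (weight ?W k) * ennreal v" for k :: 'a
      by (subst nn_integral_cmult_indicator) (simp_all only: V sets_lborel borel_open open_ball)
    then show ?thesis
      by (simp only:) (subst nn_integral_multc, simp_all add: mult.commute)
  qed
  also have "\<dots> = (\<integral>\<^sup>+z. (\<integral>\<^sup>+k. ennreal (weight ?W k) * indicator (?B k) z \<partial>count_space int_lattice) \<partial>lborel)"
  proof (rule nn_integral_count_lborel_swap[OF countable_int_lattice])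
    fix k :: 'a
    have [measurable]: "?B k \<in> sets borel" by simp
    show "(\<lambda>z. ennreal (weight ?W k) * indicator (?B k) z) \<in> borel_measurable borel" by measurable
  qed
  also have "\<dots> \<le> (\<integral>\<^sup>+z. ennreal (2 ^ ?W) * ennreal (weight ?W z) \<partial>(lborel :: 'a measure))"
  proof (intro nn_integral_mono)
    fix z :: 'a
    let ?S = "{k \<in> int_lattice. z \<in> ?B k}"
    let ?I = "\<integral>\<^sup>+k. ennreal (weight ?W k) * indicator (?B k) z \<partial>count_space int_lattice"
    have eq: "k = l" if k: "k \<in> ?S" and l: "l \<in> ?S" for k l
    proof (rule euclidean_eqI)
      fix b :: 'a assume b: "b \<in> Basis"
      have "dist k l < 1" using k l dist_triangle[of k l z] by (auto simp: dist_commute)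
      then have "\<bar>k \<bullet> b - l \<bullet> b\<bar> < 1"
        using Basis_le_norm[OF b, of "k - l"] by (simp add: dist_norm inner_diff_left)
      moreover have "k \<bullet> b \<in> \<int>" "l \<bullet> b \<in> \<int>" using k l b by (auto simp: int_lattice_def)
      then have "k \<bullet> b - l \<bullet> b \<in> \<int>" by (rule Ints_diff)
      ultimately have "k \<bullet> b - l \<bullet> b = 0" by (intro Ints_nonzero_abs_less1)
      then show "k \<bullet> b = l \<bullet> b" by simp
    qed
    show "?I \<le> ennreal (2 ^ ?W) * ennreal (weight ?W z)"
    proof (cases "?S = {}")
      case True
      then have "?I = (\<integral>\<^sup>+k. 0 \<partial>count_space (int_lattice :: 'a set))"
        by (intro nn_integral_cong) (auto split: split_indicator)
      then show ?thesis by simp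
    next
      case False
      then obtain k0 where k0: "k0 \<in> ?S" by blast
      have "?I
          = (\<Sum>k\<in>{k0}. ennreal (weight ?W k) * indicator (?B k) z)"
        by (rule nn_integral_count_space') (use k0 eq in \<open>auto split: split_indicator\<close>)
      also have "\<dots> \<le> ennreal (weight ?W k0)" using k0 by (simp add: indicator_def)
      also have "\<dots> \<le> ennreal (2 ^ ?W * weight ?W z)"
      proof (rule ennreal_leI)
        have n: "norm (z - k0) \<le> 1" using k0 by (auto simp: dist_norm norm_minus_commute)
        have "weight ?W k0 \<le> (1 + norm (z - k0)) ^ ?W * weight ?W (k0 + (z - k0))" by (rule weight_shift_le)
        also have "\<dots> \<le> 2 ^ ?W * weight ?W z" using n by (intro mult_mono power_mono) auto
        finally show "weight ?W k0 \<le> 2 ^ ?W * weight ?W z" .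
      qed
      finally show ?thesis by (simp add: ennreal_mult')
    qed
  qed
  also have "\<dots> = ennreal (2 ^ ?W) * (\<integral>\<^sup>+z. ennreal (weight ?W z) \<partial>(lborel :: 'a measure))"
    by (rule nn_integral_cmult) simp
  also have "\<dots> < top" using nn_integral_weight_finite[where 'a='a] by (simp add: ennreal_mult_less_top)
  finally show ?thesis using v0 by (auto simp: ennreal_mult_less_top)
qed

lemma weight_powr_le:
  assumes "0 < p" "real n \<le> real N * p"
  shows "weight N x powr p \<le> weight n x"
proof -
  have "weight N x powr p = (1 + norm x) powr (- (real N * p))"
    by (simp add: weight_def powr_divide powr_minus_divide powr_realpow[symmetric] powr_powr)
  also have "\<dots> \<le> (1 + norm x) powr (- real n)" using assms by (intro powr_mono) auto
  also have "\<dots> = weight n x" by (simp add: weight_def powr_minus_divide powr_realpow)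
  finally show ?thesis .
qed

lemma Lp_norm_weight_finite:
  assumes "0 < p" "(\<integral>\<^sup>+x. ennreal (weight n x) \<partial>M) < top"
  shows "\<exists>N. Lp_norm p M (\<lambda>x. ennreal (weight N x)) < top"
proof -
  obtain N where "real n / p \<le> real N" using real_arch_simple by blast
  then have N: "real n \<le> real N * p" using assms(1) by (simp add: divide_le_eq)
  have "(\<integral>\<^sup>+x. epowr (ennreal (weight N x)) p \<partial>M) \<le> (\<integral>\<^sup>+x. ennreal (weight n x) \<partial>M)"
    by (intro nn_integral_mono) (simp add: epowr_ennreal ennreal_leI weight_powr_le[OF assms(1) N])
  also have "\<dots> < top" by (rule assms(2))
  finally show ?thesis unfolding Lp_norm_def by (intro exI[of _ N]) simp
qed

text \<open>The multiplier is concentrated near \<open>k\<close>, and \<open>h\<close> is small there if \<open>k\<close> is large; so every seminorm of the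
  product decays in \<open>k\<close>, and \<open>fourier\<close> is continuous with respect to the seminorms.\<close>

lemma localized_fourier_decay:
  fixes a :: "'a::euclidean_space \<Rightarrow> complex"
  assumes a: "a \<in> schwartz"
  shows "\<exists>C\<ge>0. \<exists>N'. \<forall>h\<in>schwartz. \<forall>k w. norm (fourier (\<lambda>\<xi>. a (\<xi> - k) * h \<xi>) w)
    \<le> C * schwartz_seminorm N' h * (weight M k * weight N w)"
proof -
  obtain C M1 where C: "C \<ge> 0" "\<And>f::'a \<Rightarrow> complex. f \<in> schwartz \<Longrightarrow>
      schwartz_seminorm N (fourier f) \<le> C * schwartz_seminorm M1 f"
    using fourier_seminorm_bound[where 'a='a and N=N] by blast
  define S where "S = schwartz_seminorm (max M1 M) a"
  have S0: "0 \<le> S" unfolding S_def by (rule schwartz_seminorm_nonneg[OF a])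
  have "norm (fourier (\<lambda>\<xi>. a (\<xi> - k) * h \<xi>) w) \<le> (C * (2 ^ M1 * S)) * schwartz_seminorm (M1 + M) h * (weight M k * weight N w)"
    if h: "h \<in> schwartz" for h and k w :: 'a
  proof -
    let ?g = "\<lambda>\<xi>. a (\<xi> - k) * h \<xi>"
    have ak: "smooth (\<lambda>\<xi>. a (\<xi> - k))" by (intro smooth_translate schwartz_smooth a)
    have s: "?g \<in> schwartz" by (intro schwartz_mult_slow slow_schwartz schwartz_translate a h)
    have der: "norm (iter_deriv cs (\<lambda>\<xi>. a (\<xi> - k)) x) \<le> (S * weight M k) * (1 + norm x) ^ M"
      if cs: "set cs \<subseteq> Basis" "length cs \<le> M1" for cs x
    proof -
      have "norm (iter_deriv cs (\<lambda>\<xi>. a (\<xi> - k)) x) \<le> S * weight (max M1 M) (x - k)"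
        unfolding iter_deriv_translate[OF schwartz_smooth[OF a] cs(1)] S_def
        using cs by (intro schwartz_seminorm_ge_weight a) auto
      also have "\<dots> \<le> S * weight M (x - k)" by (intro mult_left_mono S0 weight_antimono) simp
      also have "\<dots> \<le> S * ((1 + norm (- x)) ^ M * weight M (x - k + (- x)))"
        by (intro mult_left_mono S0 weight_shift_le)
      finally show ?thesis by (simp add: mult_ac)
    qed
    have "schwartz_seminorm M1 ?g \<le> 2 ^ M1 * (S * weight M k) * schwartz_seminorm (M1 + M) h"
      by (intro schwartz_seminorm_le schwartz_seminorm_mult[OF h ak der])
    then have "C * schwartz_seminorm M1 ?g \<le> C * (2 ^ M1 * (S * weight M k) * schwartz_seminorm (M1 + M) h)"
      by (rule mult_left_mono[OF _ C(1)])
    then have "schwartz_seminorm N (fourier ?g) \<le> C * (2 ^ M1 * (S * weight M k) * schwartz_seminorm (M1 + M) h)"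
      using C(2)[OF s] by linarith
    then have "schwartz_seminorm N (fourier ?g) * weight N w
        \<le> C * (2 ^ M1 * (S * weight M k) * schwartz_seminorm (M1 + M) h) * weight N w"
      by (rule mult_right_mono) simp
    from order_trans[OF schwartz_norm_le[OF fourier_schwartz[OF s]] this] show ?thesis by (simp add: mult_ac)
  qed
  moreover have "0 \<le> C * (2 ^ M1 * S)" using C(1) S0 by simp
  ultimately show ?thesis by blast
qed

lemma nn_integral_lborel_tensor:
  fixes F :: "'a::euclidean_space \<Rightarrow> ennreal" and H :: "'b::euclidean_space \<Rightarrow> ennreal"
  assumes F [measurable]: "F \<in> borel_measurable borel" and H [measurable]: "H \<in> borel_measurable borel"
  shows "(\<integral>\<^sup>+z. F (fst z) * H (snd z) \<partial>(lborel :: ('a \<times> 'b) measure)) = (\<integral>\<^sup>+x. F x \<partial>lborel) * (\<integral>\<^sup>+t. H t \<partial>lborel)"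
proof -
  have m: "(\<lambda>z. F (fst z) * H (snd z)) \<in> borel_measurable (lborel \<Otimes>\<^sub>M lborel)" by measurable
  have "(\<integral>\<^sup>+z. F (fst z) * H (snd z) \<partial>(lborel :: ('a \<times> 'b) measure)) = (\<integral>\<^sup>+x. \<integral>\<^sup>+t. F x * H t \<partial>lborel \<partial>lborel)"
    using lborel.nn_integral_fst[OF m] by (simp add: lborel_prod)
  also have "\<dots> = (\<integral>\<^sup>+x. F x * (\<integral>\<^sup>+t. H t \<partial>lborel) \<partial>lborel)" by (simp add: nn_integral_cmult)
  also have "\<dots> = (\<integral>\<^sup>+x. F x \<partial>lborel) * (\<integral>\<^sup>+t. H t \<partial>lborel)" by (simp add: nn_integral_multc)
  finally show ?thesis .
qed

lemma Lp_norm_lborel_tensor: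
  fixes F :: "'a::euclidean_space \<Rightarrow> ennreal" and H :: "'b::euclidean_space \<Rightarrow> ennreal"
  assumes "F \<in> borel_measurable borel" "H \<in> borel_measurable borel"
  shows "Lp_norm p lborel (\<lambda>z. F (fst z) * H (snd z)) = Lp_norm p lborel F * Lp_norm p lborel H"
  unfolding Lp_norm_def epowr_mult using assms
  by (subst nn_integral_lborel_tensor) (auto simp: epowr_mult)

lemma seq_norm_tensor:
  assumes "0 < r" "0 < q"
  shows "seq_norm r q (\<lambda>k. a (fst k) * b (snd k))
    = Lp_norm q (count_space int_lattice) a * Lp_norm r (count_space \<int>) b"
proof -
  have "seq_norm r q (\<lambda>k. a (fst k) * b (snd k)) = Lp_norm r (count_space \<int>) (\<lambda>kn. Lp_norm q (count_space int_lattice) (\<lambda>kb. b kn * a kb))"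
    by (simp add: seq_norm_def mult.commute)
  also have "\<dots> = Lp_norm r (count_space \<int>) (\<lambda>kn. Lp_norm q (count_space int_lattice) a * b kn)"
    by (subst Lp_norm_cmult[OF assms(2)]) (simp_all add: mult.commute)
  also have "\<dots> = Lp_norm q (count_space int_lattice) a * Lp_norm r (count_space \<int>) b"
    by (simp add: Lp_norm_cmult[OF assms(1)])
  finally show ?thesis .
qed

context cutoff_function
begin

lemma box_op_distr_of_decay:
  fixes f :: "'a::euclidean_space \<Rightarrow> complex"
  assumes f: "f \<in> schwartz"
  shows "\<exists>C\<ge>0. \<forall>k\<in>int_lattice. \<forall>x. norm (box_op \<eta> k (distr_of f) x) \<le> C * (weight M k * weight N x)"
proof -
  obtain C N' where C: "C \<ge> 0" "\<And>h (k::'a) w. h \<in> schwartz \<Longrightarrow> norm (fourier (\<lambda>\<xi>. sig 0 (\<xi> - k) * h \<xi>) w)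
    \<le> C * schwartz_seminorm N' h * (weight M k * weight N w)"
    using localized_fourier_decay[OF schwartz_sig, of "0::'a" M N] by blast
  let ?S = "schwartz_seminorm N' (fourier f)"
  have "norm (box_op \<eta> k (distr_of f) x) \<le> C * ?S * (weight M k * weight N x)" if k: "k \<in> int_lattice" for k x
    using C(2)[OF fourier_schwartz[OF f], of k "- x"]
    unfolding box_op_distr_of[OF f] inv_fourier_eq sig_translate[OF k] by simp
  moreover have "0 \<le> C * ?S" using C(1) schwartz_seminorm_nonneg[OF fourier_schwartz[OF f]] by simp
  ultimately show ?thesis by blast
qed

lemma wiener_norm_schwartz_finite:
  fixes f :: "'a::euclidean_space \<Rightarrow> complex"
  assumes f: "f \<in> schwartz" and p: "0 < p" and q: "0 < q"
  shows "wiener_norm \<eta> p q s (distr_of f) < top"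
proof -
  obtain n where n: "\<And>k::'a. jbracket k powr s \<le> (1 + norm k) ^ n" using jbracket_powr_weight[of s] by blast
  obtain Na where Na: "Lp_norm q (count_space (int_lattice :: 'a set)) (\<lambda>k. ennreal (weight Na k)) < top"
    using Lp_norm_weight_finite[OF q nn_integral_lattice_weight_finite[where 'a='a]] by blast
  obtain Nc where Nc: "Lp_norm p (lborel :: 'a measure) (\<lambda>x. ennreal (weight Nc x)) < top"
    using Lp_norm_weight_finite[OF p nn_integral_weight_finite[where 'a='a, unfolded infinity_ennreal_def]] by blast
  obtain C where C: "C \<ge> 0" "\<And>k x. k \<in> int_lattice \<Longrightarrow> norm (box_op \<eta> k (distr_of f) x) \<le> C * (weight (n + Na) k * weight Nc x)"
    using box_op_distr_of_decay[OF f, of "n + Na" Nc] by blast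
  have le: "ennreal (jbracket k powr s * norm (box_op \<eta> k (distr_of f) x)) \<le> ennreal (C * weight Nc x) * ennreal (weight Na k)"
    if k: "k \<in> int_lattice" for k x
  proof -
    have "jbracket k powr s * norm (box_op \<eta> k (distr_of f) x) \<le> (1 + norm k) ^ n * (C * (weight (n + Na) k * weight Nc x))"
      by (intro mult_mono n C(2) k) auto
    also have "\<dots> = C * weight Nc x * ((1 + norm k) ^ n * weight (n + Na) k)" by (simp only: mult_ac)
    also have "\<dots> = C * weight Nc x * weight Na k" by (simp only: weight_cancel)
    finally show ?thesis using C(1) by (simp add: ennreal_mult'[symmetric] ennreal_leI)
  qed
  have "wiener_norm \<eta> p q s (distr_of f) \<le> Lp_norm p lborel (\<lambda>x::'a. Lp_norm q (count_space (int_lattice :: 'a set)) (\<lambda>k. ennreal (C * weight Nc x) * ennreal (weight Na k)))"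
    unfolding wiener_norm_def by (intro Lp_norm_mono p q) (simp add: le)
  also have "\<dots> = Lp_norm p lborel (\<lambda>x::'a. (ennreal C * Lp_norm q (count_space (int_lattice :: 'a set)) (\<lambda>k. ennreal (weight Na k))) * ennreal (weight Nc x))"
    using C(1) by (subst Lp_norm_cmult[OF q]) (simp_all add: ennreal_mult' mult_ac)
  also have "\<dots> = (ennreal C * Lp_norm q (count_space (int_lattice :: 'a set)) (\<lambda>k. ennreal (weight Na k))) * Lp_norm p lborel (\<lambda>x::'a. ennreal (weight Nc x))"
    by (rule Lp_norm_cmult[OF p]) simp
  also have "\<dots> < top" using Na Nc by (simp add: ennreal_mult_less_top)
  finally show ?thesis .
qed

text \<open>The decay of the blocks is chosen so fast that it splits into \<open>n\<close> powers that absorb \<open>jbracket\<close>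
  and into factors that are summable in each of the three variables.\<close>

lemma aniso_wiener_norm_schwartz_finite:
  fixes f :: "'a::euclidean_space \<times> real \<Rightarrow> complex"
  assumes f: "f \<in> schwartz" and p: "0 < p" and r: "0 < r" and q: "0 < q"
  shows "aniso_wiener_norm \<eta> p q r s (distr_of f) < top"
proof -
  obtain n where n: "\<And>k::'a. jbracket k powr s \<le> (1 + norm k) ^ n" using jbracket_powr_weight[of s] by blast
  obtain Na where Na: "Lp_norm q (count_space (int_lattice :: 'a set)) (\<lambda>k. ennreal (weight Na k)) < top"
    using Lp_norm_weight_finite[OF q nn_integral_lattice_weight_finite[where 'a='a]] by blast
  obtain Nb where Nb: "Lp_norm r (count_space \<int>) (\<lambda>k::real. ennreal (weight Nb k)) < top"
    using Lp_norm_weight_finite[OF r nn_integral_lattice_weight_finite[where 'a=real]] unfolding int_lattice_real by blast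
  obtain Nc where Nc: "Lp_norm p (lborel :: ('a \<times> real) measure) (\<lambda>x. ennreal (weight Nc x)) < top"
    using Lp_norm_weight_finite[OF p nn_integral_weight_finite[where 'a="'a \<times> real", unfolded infinity_ennreal_def]] by blast
  obtain C where C: "C \<ge> 0" "\<And>k x. k \<in> int_lattice \<Longrightarrow> norm (box_op \<eta> k (distr_of f) x) \<le> C * (weight ((n + Na) + Nb) k * weight Nc x)"
    using box_op_distr_of_decay[OF f, of "(n + Na) + Nb" Nc] by blast
  have le: "wblock s (distr_of f) k x \<le> ennreal (C * weight Nc x) * (ennreal (weight Na (fst k)) * ennreal (weight Nb (snd k)))"
    if k: "k \<in> int_lattice" for k x
  proof -
    have w: "weight ((n + Na) + Nb) k \<le> weight (n + Na) (fst k) * weight Nb (snd k)"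
    proof -
      have "weight M k \<le> weight M (fst k)" "weight M k \<le> weight M (snd k)" for M
        using norm_fst_le[of "fst k" "snd k"] norm_snd_le[of "snd k" "fst k"]
        by (auto simp: weight_def intro!: divide_left_mono power_mono mult_pos_pos zero_less_power)
      then show ?thesis unfolding weight_mult[of "n + Na" Nb] by (intro mult_mono) auto
    qed
    have "jbracket (fst k) powr s * norm (box_op \<eta> k (distr_of f) x) \<le> (1 + norm (fst k)) ^ n * (C * (weight ((n + Na) + Nb) k * weight Nc x))"
      by (intro mult_mono n C(2) k) auto
    also have "\<dots> \<le> (1 + norm (fst k)) ^ n * (C * ((weight (n + Na) (fst k) * weight Nb (snd k)) * weight Nc x))"
      by (intro mult_left_mono mult_right_mono w C(1)) auto
    also have "\<dots> = C * weight Nc x * (((1 + norm (fst k)) ^ n * weight (n + Na) (fst k)) * weight Nb (snd k))" by (simp only: mult_ac)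
    also have "\<dots> = C * weight Nc x * (weight Na (fst k) * weight Nb (snd k))" by (simp only: weight_cancel)
    finally show ?thesis using C(1) unfolding wblock_def by (simp add: ennreal_mult'[symmetric] ennreal_leI)
  qed
  let ?E = "Lp_norm q (count_space (int_lattice :: 'a set)) (\<lambda>k. ennreal (weight Na k)) * Lp_norm r (count_space \<int>) (\<lambda>k::real. ennreal (weight Nb k))"
  have "aniso_wiener_norm \<eta> p q r s (distr_of f) \<le> Lp_norm p lborel (\<lambda>x::'a \<times> real. seq_norm r q (\<lambda>k::'a \<times> real. ennreal (C * weight Nc x) * (ennreal (weight Na (fst k)) * ennreal (weight Nb (snd k)))))"
    unfolding aniso_wiener_norm_eq mixed_norm_def by (intro Lp_norm_mono seq_norm_mono p r q le)
  also have "\<dots> = Lp_norm p lborel (\<lambda>x::'a \<times> real. (ennreal C * ?E) * ennreal (weight Nc x))"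
    unfolding seq_norm_cmult[OF r q] seq_norm_tensor[OF r q, of "\<lambda>k::'a. ennreal (weight Na k)" "\<lambda>k. ennreal (weight Nb k)"]
      ennreal_mult'[OF C(1)] by (simp only: mult_ac)
  also have "\<dots> = (ennreal C * ?E) * Lp_norm p lborel (\<lambda>x::'a \<times> real. ennreal (weight Nc x))"
    by (rule Lp_norm_cmult[OF p]) simp
  also have "\<dots> < top" using Na Nb Nc by (simp add: ennreal_mult_less_top)
  finally show ?thesis .
qed

section \<open>Tempered distributions are controlled by their blocks\<close>

definition dilated_chi :: "nat \<Rightarrow> 'a::euclidean_space \<Rightarrow> complex" where
  "dilated_chi n \<xi> = chi ((1 / real (Suc n)) *\<^sub>R \<xi>)"

lemma smooth_dilated_chi: "smooth (dilated_chi n)"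
  unfolding dilated_chi_def[abs_def] using smooth_dilate_translate[OF smooth_chi, of "1 / real (Suc n)" 0] by simp

lemma iter_deriv_dilated_chi_bound:
  fixes x :: "'a::euclidean_space"
  assumes "set cs \<subseteq> Basis" "length cs \<le> N"
  shows "norm (iter_deriv cs (dilated_chi n) x) \<le> (1 / real (Suc n)) ^ length cs * schwartz_seminorm N (chi :: 'a \<Rightarrow> complex)"
proof -
  let ?c = "1 / real (Suc n)"
  have "iter_deriv cs (dilated_chi n) x = ?c ^ length cs *\<^sub>R iter_deriv cs chi (?c *\<^sub>R x)"
    unfolding dilated_chi_def[abs_def] using iter_deriv_dilate_translate[OF smooth_chi assms(1), of ?c 0] by simp
  then have "norm (iter_deriv cs (dilated_chi n) x) = ?c ^ length cs * norm (iter_deriv cs (chi :: 'a \<Rightarrow> complex) (?c *\<^sub>R x))" by simp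
  also have "\<dots> \<le> ?c ^ length cs * schwartz_seminorm N (chi :: 'a \<Rightarrow> complex)"
    by (intro mult_left_mono schwartz_bounded schwartz_chi assms) simp
  finally show ?thesis .
qed

lemma schwartz_dilated_chi_mult:
  fixes h :: "'a::euclidean_space \<Rightarrow> complex"
  assumes h: "h \<in> schwartz"
  shows "(\<lambda>\<xi>. dilated_chi n \<xi> * h \<xi>) \<in> schwartz"
    and "schwartz_seminorm N (\<lambda>\<xi>. dilated_chi n \<xi> * h \<xi>) \<le> 2 ^ N * schwartz_seminorm N (chi :: 'a \<Rightarrow> complex) * schwartz_seminorm N h"
proof -
  have "(dilated_chi n :: 'a \<Rightarrow> complex) \<in> schwartz"
    unfolding dilated_chi_def[abs_def] using schwartz_dilate_translate[OF schwartz_chi, of "1 / real (Suc n)" 0] by simp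
  then show "(\<lambda>\<xi>. dilated_chi n \<xi> * h \<xi>) \<in> schwartz" by (intro schwartz_mult_slow slow_schwartz h)
  have "norm (iter_deriv cs (dilated_chi n) x) \<le> schwartz_seminorm N (chi :: 'a \<Rightarrow> complex) * (1 + norm x) ^ 0"
    if "set cs \<subseteq> Basis" "length cs \<le> N" for cs and x :: 'a
  proof -
    have "(1 / real (Suc n)) ^ length cs \<le> 1" by (intro power_le_one) auto
    from mult_right_mono[OF this schwartz_seminorm_nonneg[OF schwartz_chi]] show ?thesis
      using iter_deriv_dilated_chi_bound[OF that, of n x] by (auto intro: order_trans)
  qed
  from schwartz_seminorm_mult[OF h smooth_dilated_chi this]
  show "schwartz_seminorm N (\<lambda>\<xi>. dilated_chi n \<xi> * h \<xi>) \<le> 2 ^ N * schwartz_seminorm N (chi :: 'a \<Rightarrow> complex) * schwartz_seminorm N h"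
    by (intro schwartz_seminorm_le) simp
qed

text \<open>The function \<open>1 - dilated_chi n\<close> is at most of size \<open>norm x / Suc n\<close> because \<open>chi 0 = 1\<close>, and each of its
  derivatives gains a factor \<open>1 / Suc n\<close>.\<close>

lemma schwartz_seminorm_dilated_chi_diff:
  fixes h :: "'a::euclidean_space \<Rightarrow> complex"
  assumes h: "h \<in> schwartz"
  shows "\<exists>K\<ge>0. \<forall>n. schwartz_seminorm N (\<lambda>\<xi>. h \<xi> - dilated_chi n \<xi> * h \<xi>) \<le> K * (1 / real (Suc n))"
proof -
  let ?s = "\<lambda>N. schwartz_seminorm N (chi :: 'a \<Rightarrow> complex)"
  define K where "K = DIM('a) * ?s 1 + ?s N"
  have s0: "0 \<le> ?s N" for N by (rule schwartz_seminorm_nonneg[OF schwartz_chi])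
  have K0: "0 \<le> K" unfolding K_def by (intro add_nonneg_nonneg mult_nonneg_nonneg s0) simp
  have "schwartz_seminorm N (\<lambda>\<xi>. h \<xi> - dilated_chi n \<xi> * h \<xi>) \<le> (2 ^ N * K * schwartz_seminorm (N + 1) h) * (1 / real (Suc n))" for n
  proof -
    let ?c = "1 / real (Suc n)"
    let ?m = "\<lambda>\<xi>::'a. 1 + (- 1) * dilated_chi n \<xi>"
    have c: "0 \<le> ?c" "?c \<le> 1" by auto
    have sm: "smooth (\<lambda>\<xi>::'a. (- 1) * dilated_chi n \<xi>)" by (intro smooth_mult smooth_const smooth_dilated_chi)
    have m: "smooth ?m" by (intro smooth_add smooth_const sm)
    have der: "norm (iter_deriv cs ?m x) \<le> (K * ?c) * (1 + norm x) ^ 1" if cs: "set cs \<subseteq> Basis" "length cs \<le> N" for cs x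
    proof (cases cs rule: rev_cases)
      case Nil
      have "norm (chi (?c *\<^sub>R x) - chi (0::'a) :: complex) \<le> DIM('a) * ?s 1 * norm (?c *\<^sub>R x - 0)"
      proof (rule norm_diff_le_dir_deriv_bound)
        show "chi differentiable at z" for z :: 'a by (rule smoothD[OF smooth_chi])
        show "norm (dir_deriv b chi z) \<le> ?s 1" if "b \<in> Basis" for b z :: 'a
          using schwartz_bounded[OF schwartz_chi, of "[b]" 1 z] that by (simp add: iter_deriv_Cons)
      qed
      moreover have "chi (0::'a) = 1" by (rule chi_eq_1) simp
      ultimately have "norm (?m x) \<le> DIM('a) * ?s 1 * (?c * norm x)"
        by (simp add: dilated_chi_def norm_minus_commute)
      also have "\<dots> \<le> K * (?c * (1 + norm x))"
        unfolding K_def using s0 c by (intro mult_mono) (auto intro!: add_nonneg_nonneg mult_nonneg_nonneg divide_right_mono)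
      finally show ?thesis using Nil by (simp add: mult.assoc)
    next
      case (snoc ds d)
      have z: "iter_deriv ys (\<lambda>x::'a. 0::complex) = (\<lambda>x. 0)" for ys
        by (induction ys) (auto simp: iter_deriv_Cons)
      have "iter_deriv cs ?m x = iter_deriv cs (\<lambda>x. 1) x + (- 1) * iter_deriv cs (dilated_chi n) x"
        unfolding smooth_iter_deriv_add[OF smooth_const sm cs(1)] smooth_iter_deriv_cmult[OF smooth_dilated_chi cs(1)] ..
      also have "iter_deriv cs (\<lambda>x. 1 :: complex) x = 0" unfolding snoc iter_deriv_snoc by (simp add: z)
      finally have "norm (iter_deriv cs ?m x) \<le> ?c ^ length cs * ?s N"
        using iter_deriv_dilated_chi_bound[OF cs, of n x] by simp
      also have "\<dots> \<le> ?c * ?s N"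
        using power_decreasing[OF _ c, of 1 "length cs"] snoc by (intro mult_right_mono s0) simp
      also have "\<dots> \<le> (K * ?c) * (1 + norm x) ^ 1"
      proof -
        have "?s N * 1 \<le> K * (1 + norm x)" unfolding K_def using s0
          by (intro mult_mono) (auto intro!: add_nonneg_nonneg mult_nonneg_nonneg)
        from mult_left_mono[OF this c(1)] show ?thesis by (simp add: mult_ac)
      qed
      finally show ?thesis .
    qed
    have "schwartz_seminorm N (\<lambda>\<xi>. ?m \<xi> * h \<xi>) \<le> 2 ^ N * (K * ?c) * schwartz_seminorm (N + 1) h"
      by (intro schwartz_seminorm_le schwartz_seminorm_mult[OF h m der])
    moreover have "(\<lambda>\<xi>. ?m \<xi> * h \<xi>) = (\<lambda>\<xi>. h \<xi> - dilated_chi n \<xi> * h \<xi>)" by (rule ext) (simp add: algebra_simps)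
    ultimately show ?thesis by (simp add: mult_ac)
  qed
  moreover have "0 \<le> 2 ^ N * K * schwartz_seminorm (N + 1) h"
    using K0 schwartz_seminorm_nonneg[OF h] by simp
  ultimately show ?thesis by blast
qed

text \<open>If the Fourier transform of the test function has compact support, then the distribution is a
  finite sum over blocks, and each term is controlled by the decay of the localized test function.
  The general case follows by cutting off with a dilated \<open>chi\<close>, which is bounded uniformly in every
  seminorm.\<close>

theorem tempered_le_blocks:
  "\<exists>C\<ge>0. \<exists>N. \<forall>L\<in>tempered. \<forall>\<phi>\<in>schwartz. ennreal (norm (L \<phi>)) \<le> ennreal (C * schwartz_seminorm N \<phi>) *
     (\<integral>\<^sup>+k. (\<integral>\<^sup>+z. ennreal (norm (box_op \<eta> k L z) * (weight M k * weight M z)) \<partial>lborel)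
       \<partial>count_space (int_lattice :: 'a::euclidean_space set))"
proof -
  let ?w = "\<lambda>(k::'a) (z::'a). weight M k * weight M z"
  obtain C1 N1 where C1: "C1 \<ge> 0" "\<And>h (k::'a) w. h \<in> schwartz \<Longrightarrow> norm (fourier (\<lambda>\<xi>. chi (\<xi> - k) * h \<xi>) w)
    \<le> C1 * schwartz_seminorm N1 h * ?w k w"
    using localized_fourier_decay[OF schwartz_chi, where M=M and N=M] by blast
  obtain C2 N2 where C2: "C2 \<ge> 0" "\<And>f::'a \<Rightarrow> complex. f \<in> schwartz \<Longrightarrow>
      schwartz_seminorm N1 (inv_fourier f) \<le> C2 * schwartz_seminorm N2 f"
    using inv_fourier_seminorm_bound[where 'a='a and N=N1] by blast
  define S where "S = 2 ^ N1 * schwartz_seminorm N1 (chi :: 'a \<Rightarrow> complex)"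
  have S0: "0 \<le> S" unfolding S_def by (intro mult_nonneg_nonneg schwartz_seminorm_nonneg schwartz_chi) simp
  have "ennreal (norm (L \<phi>)) \<le> ennreal (C1 * S * C2 * schwartz_seminorm N2 \<phi>) *
     (\<integral>\<^sup>+k. (\<integral>\<^sup>+z. ennreal (norm (box_op \<eta> k L z) * ?w k z) \<partial>lborel) \<partial>count_space int_lattice)"
    (is "_ \<le> ennreal ?K * ?B") if L: "L \<in> tempered" and p: "\<phi> \<in> schwartz" for L and \<phi> :: "'a \<Rightarrow> complex"
  proof -
    define h where "h = inv_fourier \<phi>"
    have h: "h \<in> schwartz" unfolding h_def by (rule inv_fourier_schwartz[OF p])
    define d where "d n = (\<lambda>\<xi>. dilated_chi n \<xi> * h \<xi>)" for n
    have d: "d n \<in> schwartz" for n unfolding d_def by (rule schwartz_dilated_chi_mult(1)[OF h])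
    let ?r = "\<lambda>n \<xi>. h \<xi> - d n \<xi>"
    let ?b = "\<lambda>k. \<integral>\<^sup>+z. ennreal (norm (box_op \<eta> k L z) * ?w k z) \<partial>lborel"
    have dS: "C1 * schwartz_seminorm N1 (d n) \<le> ?K" for n
    proof -
      have "schwartz_seminorm N1 (d n) \<le> S * schwartz_seminorm N1 h"
        unfolding d_def S_def by (rule schwartz_dilated_chi_mult(2)[OF h])
      also have "\<dots> \<le> S * (C2 * schwartz_seminorm N2 \<phi>)"
        unfolding h_def by (intro mult_left_mono S0 C2 p)
      finally have "C1 * schwartz_seminorm N1 (d n) \<le> C1 * (S * (C2 * schwartz_seminorm N2 \<phi>))"
        by (rule mult_left_mono[OF _ C1(1)])
      then show ?thesis by (simp add: mult_ac)
    qed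
    have K0: "0 \<le> ?K" using C1(1) S0 C2(1) schwartz_seminorm_nonneg[OF p] by simp
    have le: "ennreal (norm (L (fourier (d n)))) \<le> ennreal ?K * ?B" for n
    proof -
      \<comment> \<open>The support of \<open>d n\<close> has radius at most \<open>real (Suc n) * (2 * DIM('a))\<close>; blocks beyond \<open>R\<close> do not meet it.\<close>
      define R where "R = real (Suc n) * (2 * DIM('a)) + DIM('a)"
      let ?h = "\<lambda>k \<xi>. chi (\<xi> - k) * d n \<xi>" and ?hs = "\<lambda>k \<xi>. (chi (\<xi> - k) * d n \<xi>) * sig k \<xi>"
      let ?I = "\<lambda>k. \<integral>z. box_op \<eta> k L z * fourier (?h k) z \<partial>lborel"
      have dec: "d n \<xi> = (\<Sum>k\<in>near R. ?hs k \<xi>)" for \<xi>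
      proof (cases "norm \<xi> > real (Suc n) * (2 * DIM('a))")
        case True
        then have "norm ((1 / real (Suc n)) *\<^sub>R \<xi>) > 2 * DIM('a)" by (simp add: field_simps)
        from chi_eq_0_norm[OF this] have "d n \<xi> = 0" unfolding d_def dilated_chi_def by simp
        then show ?thesis by simp
      next
        case False
        then have "norm \<xi> + DIM('a) \<le> R" by (simp add: R_def)
        then have "(\<Sum>k\<in>near R. unif_part \<eta> k \<xi>) = 1"
          by (intro sum_unif_part finite_near near_subset bump_nonzero_near)
        then have "(\<Sum>k\<in>near R. sig k \<xi>) = 1" by (simp add: sig_def of_real_sum[symmetric])
        then have "d n \<xi> = (\<Sum>k\<in>near R. d n \<xi> * sig k \<xi>)" by (simp add: sum_distrib_left[symmetric])
        also have "\<dots> = (\<Sum>k\<in>near R. ?hs k \<xi>)"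
        proof (intro sum.cong refl)
          fix k
          have "?hs k \<xi> = d n \<xi> * (sig k \<xi> * chi (\<xi> - k))" by (simp add: mult_ac)
          then show "d n \<xi> * sig k \<xi> = ?hs k \<xi>" by (simp only: sig_mult_chi)
        qed
        finally show ?thesis .
      qed
      have a: "(?h k) \<in> schwartz" for k
        by (intro schwartz_mult_slow slow_schwartz schwartz_translate schwartz_chi d)
      have as: "(?hs k) \<in> schwartz" for k
        by (rule schwartz_mult_slow[OF slow_schwartz[OF a] schwartz_sig])
      have "fourier (d n) = (\<lambda>y. \<Sum>k\<in>near R. 1 * fourier (?hs k) y)"
      proof
        fix y
        have "fourier (d n) y = fourier (\<lambda>\<xi>. \<Sum>k\<in>near R. ?hs k \<xi>) y"
          using dec by presburger
        also have "\<dots> = (\<Sum>k\<in>near R. fourier (?hs k) y)"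
          by (intro fourier_sum finite_near schwartz_integrable as)
        finally show "fourier (d n) y = (\<Sum>k\<in>near R. 1 * fourier (?hs k) y)" by simp
      qed
      then have "L (fourier (d n)) = (\<Sum>k\<in>near R. 1 * L (fourier (?hs k)))"
        by (simp only:) (intro tempered_sum L finite_near fourier_schwartz as)
      also have "\<dots> = (\<Sum>k\<in>near R. ?I k)"
        using tempered_fourier_mult_sig[OF L a, where x=0] by simp
      finally have "ennreal (norm (L (fourier (d n))))
          \<le> ennreal (\<Sum>k\<in>near R. norm (?I k))"
        by (simp add: ennreal_leI norm_sum)
      also have "\<dots> = (\<Sum>k\<in>near R. ennreal (norm (?I k)))"
        by (simp add: sum_ennreal)
      also have "\<dots> \<le> (\<Sum>k\<in>near R. ennreal ?K * ?b k)"
      proof (intro sum_mono)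
        fix k :: 'a
        have [measurable]: "box_op \<eta> k L \<in> borel_measurable borel" by (rule box_op_measurable[OF L])
        have i: "integrable lborel (\<lambda>z. box_op \<eta> k L z * fourier (?h k) z)"
          using box_op_integrable[OF L a, of k k 0] by simp
        have "ennreal (norm (?I k))
            \<le> (\<integral>\<^sup>+z. ennreal (norm (box_op \<eta> k L z * fourier (?h k) z)) \<partial>lborel)"
          by (rule integral_norm_bound_ennreal[OF i])
        also have "\<dots> \<le> (\<integral>\<^sup>+z. ennreal ?K * ennreal (norm (box_op \<eta> k L z) * ?w k z) \<partial>lborel)"
        proof (intro nn_integral_mono)
          fix z
          have "norm (fourier (?h k) z) \<le> C1 * schwartz_seminorm N1 (d n) * ?w k z"
            by (rule C1(2)[OF d])
          also have "\<dots> \<le> ?K * ?w k z" by (intro mult_right_mono dS) simp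
          finally have "norm (box_op \<eta> k L z) * norm (fourier (?h k) z)
              \<le> norm (box_op \<eta> k L z) * (?K * ?w k z)" by (rule mult_left_mono) simp
          also have "\<dots> = ?K * (norm (box_op \<eta> k L z) * ?w k z)" by (simp only: mult_ac)
          finally show "ennreal (norm (box_op \<eta> k L z * fourier (?h k) z))
              \<le> ennreal ?K * ennreal (norm (box_op \<eta> k L z) * ?w k z)"
            unfolding norm_mult ennreal_mult'[OF K0, symmetric] by (rule ennreal_leI)
        qed
        also have "\<dots> = ennreal ?K * ?b k" by (rule nn_integral_cmult) measurable
        finally show "ennreal (norm (?I k)) \<le> ennreal ?K * ?b k" .
      qed
      also have "\<dots> = ennreal ?K * (\<Sum>k\<in>near R. ?b k)" by (simp add: sum_distrib_left)
      also have "(\<Sum>k\<in>near R. ?b k) = (\<integral>\<^sup>+k. (if k \<in> near R then ?b k else 0) \<partial>count_space int_lattice)"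
        by (subst nn_integral_count_space'[OF finite_near _ near_subset]) auto
      also have "\<dots> \<le> ?B" by (intro nn_integral_mono) auto
      finally show ?thesis by (simp add: mult_left_mono)
    qed
    have lim: "(\<lambda>n. L (fourier (d n))) \<longlonglongrightarrow> L \<phi>"
    proof -
      obtain C N where C: "C \<ge> 0" "\<And>\<phi>. \<phi> \<in> schwartz \<Longrightarrow> norm (L \<phi>) \<le> C * schwartz_seminorm N \<phi>"
        using tempered_bound[OF L] by blast
      obtain D N' where D: "D \<ge> 0" "\<And>f::'a \<Rightarrow> complex. f \<in> schwartz \<Longrightarrow> schwartz_seminorm N (fourier f) \<le> D * schwartz_seminorm N' f"
        using fourier_seminorm_bound[where 'a='a and N=N] by blast
      obtain K where K: "K \<ge> 0" "\<And>n. schwartz_seminorm N' (?r n) \<le> K * (1 / real (Suc n))"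
        using schwartz_seminorm_dilated_chi_diff[OF h, of N'] unfolding d_def by blast
      have phi: "\<phi> = fourier h" unfolding h_def by (simp add: fourier_inv_fourier p)
      have nle: "norm (L \<phi> - L (fourier (d n))) \<le> C * (D * K) * (1 / real (Suc n))" for n
      proof -
        have hd: "(?r n) \<in> schwartz" by (intro schwartz_diff h d)
        have "(\<lambda>y. \<phi> y - fourier (d n) y) = fourier (?r n)"
        proof
          fix y
          have "integrable lborel (\<lambda>x. cis (- 2 * pi * (x \<bullet> y)) * h x)" "integrable lborel (\<lambda>x. cis (- 2 * pi * (x \<bullet> y)) * d n x)"
            by (intro integrable_cis_mult schwartz_integrable h d; simp)+
          then show "\<phi> y - fourier (d n) y = fourier (?r n) y"
            unfolding phi fourier_cis by (simp add: right_diff_distrib)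
        qed
        then have "norm (L \<phi> - L (fourier (d n))) = norm (L (fourier (?r n)))"
          using tempered_diff[OF L p fourier_schwartz[OF d[of n]]] by simp
        also have "\<dots> \<le> C * schwartz_seminorm N (fourier (?r n))" by (intro C fourier_schwartz hd)
        also have "\<dots> \<le> C * (D * (K * (1 / real (Suc n))))"
          by (intro mult_left_mono C(1) order_trans[OF D(2)[OF hd]] mult_left_mono[OF K(2) D(1)])
        finally show ?thesis by (simp add: mult.assoc)
      qed
      have "(\<lambda>n. C * (D * K) * (1 / real (Suc n))) \<longlonglongrightarrow> C * (D * K) * 0"
        by (intro tendsto_mult tendsto_const LIMSEQ_inverse_real_of_nat[unfolded inverse_eq_divide])
      then have "(\<lambda>n. C * (D * K) * (1 / real (Suc n))) \<longlonglongrightarrow> 0" by simp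
      then have "(\<lambda>n. L \<phi> - L (fourier (d n))) \<longlonglongrightarrow> 0"
        by (rule Lim_null_comparison[OF always_eventually[OF allI[OF nle]]])
      from tendsto_diff[OF tendsto_const[of "L \<phi>"] this] show ?thesis by simp
    qed
    have "(\<lambda>n. ennreal (norm (L (fourier (d n))))) \<longlonglongrightarrow> ennreal (norm (L \<phi>))"
      by (intro tendsto_ennrealI tendsto_norm lim)
    then show ?thesis by (rule LIMSEQ_le_const2) (use le in blast)
  qed
  moreover have "0 \<le> C1 * S * C2" using C1(1) S0 C2(1) by simp
  ultimately show ?thesis by blast
qed

section \<open>The trace operator\<close>

text \<open>The summand of the trace with last frequency \<open>kn\<close>.\<close>

definition slice :: "('a::euclidean_space \<times> real) distr \<Rightarrow> real \<Rightarrow> 'a distr" where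
  "slice f kn = on_schwartz (\<lambda>\<phi>. f (tensor \<phi> (ker kn)))"

lemma tempered_slice:
  assumes f: "f \<in> tempered"
  shows "slice f kn \<in> tempered"
proof -
  obtain C N where C: "C \<ge> 0" "\<And>\<phi>. \<phi> \<in> schwartz \<Longrightarrow> norm (f \<phi>) \<le> C * schwartz_seminorm N \<phi>"
    using tempered_bound[OF f] by blast
  show ?thesis
  proof (rule temperedI[where C="C * schwartz_seminorm N (ker kn)" and N=N])
    fix \<phi> \<psi> :: "'a \<Rightarrow> complex" and a b assume p: "\<phi> \<in> schwartz" "\<psi> \<in> schwartz"
    have "tensor (\<lambda>x. a * \<phi> x + b * \<psi> x) (ker kn) = (\<lambda>z. a * tensor \<phi> (ker kn) z + b * tensor \<psi> (ker kn) z)"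
      by (rule ext) (simp add: tensor_def algebra_simps)
    then show "slice f kn (\<lambda>x. a * \<phi> x + b * \<psi> x) = a * slice f kn \<phi> + b * slice f kn \<psi>"
      using p by (simp add: slice_def on_schwartz_def schwartz_add schwartz_cmult
          tempered_linear[OF f] schwartz_tensor schwartz_ker)
  next
    fix \<phi> :: "'a \<Rightarrow> complex" assume p: "\<phi> \<in> schwartz"
    have "norm (f (tensor \<phi> (ker kn))) \<le> C * schwartz_seminorm N (tensor \<phi> (ker kn))"
      by (intro C schwartz_tensor p schwartz_ker)
    also have "\<dots> \<le> C * (schwartz_seminorm N \<phi> * schwartz_seminorm N (ker kn))"
      by (intro mult_left_mono C(1) schwartz_tensor(2) p schwartz_ker)
    finally show "norm (slice f kn \<phi>) \<le> C * schwartz_seminorm N (ker kn) * schwartz_seminorm N \<phi>"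
      using p by (simp add: slice_def on_schwartz_def mult_ac)
  qed (simp add: slice_def on_schwartz_def)
qed

lemma ker_Pair_translate: "(\<lambda>z. ker (kb, kn) (z - (x, t))) = tensor (\<lambda>y. ker kb (y - x)) (\<lambda>\<tau>. ker kn (\<tau> - t))"
  by (rule ext) (simp add: ker_Pair tensor_def)

lemma box_op_slice:
  assumes f: "f \<in> tempered"
  shows "box_op \<eta> kb (slice f kn) x = box_op \<eta> (kb, kn) f (x, 0)"
  unfolding box_op_eq[OF tempered_slice[OF f]] box_op_eq[OF f] ker_Pair_translate
  by (simp add: slice_def on_schwartz_def schwartz_translate schwartz_ker)

lemma epowr_le_add: "0 < a \<Longrightarrow> a \<le> p \<Longrightarrow> epowr x a \<le> 1 + epowr x p"
proof (cases x)
  case (real t)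
  assume "0 < a" "a \<le> p"
  have "t powr a \<le> 1 + t powr p"
  proof (cases "t \<le> 1")
    case True
    then have "t powr a \<le> 1" using real \<open>0 < a\<close> by (intro powr_le1) auto
    then show ?thesis by (simp add: add_increasing2)
  next
    case False
    then have "t powr a \<le> t powr p" using \<open>a \<le> p\<close> by (intro powr_mono) auto
    then show ?thesis by simp
  qed
  then have "ennreal (t powr a) \<le> ennreal (1 + t powr p)" by (rule ennreal_leI)
  then show ?thesis using real by (simp add: epowr_ennreal ennreal_plus)
qed simp

text \<open>The averages in \<open>maxblock\<close> use the power \<open>1 / m \<le> p\<close>, and \<open>t\<^sup>a \<le> 1 + t\<^sup>p\<close> for \<open>a \<le> p\<close>; so they are
  bounded in terms of the norm of \<open>f\<close>, at every point.\<close>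

lemma seq_norm_wblock_bounded:
  fixes f :: "('a::euclidean_space \<times> real) distr"
  assumes f: "f \<in> tempered" and fin: "aniso_wiener_norm \<eta> p q r s f < top" and p: "0 < p" and r: "0 < r" and q: "0 < q"
  shows "\<exists>B<top. \<forall>x. seq_norm r q (\<lambda>k. wblock s f k x) \<le> B"
proof -
  obtain m where m: "0 < m" "1 / real m \<le> min p (min r q)"
    using exists_small_reciprocal[of "min p (min r q)"] p r q by auto
  let ?M = "2 * DIM('a \<times> real)" and ?a = "1 / real m"
  have a: "0 < ?a" "?a \<le> p" "?a \<le> r" "?a \<le> q" using m by auto
  obtain C where C: "C > 0" "\<And>k x y. wblock s f k y \<le> ennreal (C * (1 + norm (x - y)) ^ (?M * m)) * maxblock s m f k (x :: 'a \<times> real)"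
    using wblock_le_maxblock[OF m(1), where 'a='a and s=s] f by blast
  let ?G = "\<lambda>x. seq_norm r q (\<lambda>k. wblock s f k x)"
  have G [measurable]: "?G \<in> borel_measurable borel" by (intro seq_norm_measurable wblock_measurable f)
  define I where "I = (\<integral>\<^sup>+z. ennreal (weight ?M (z::'a \<times> real)) \<partial>lborel) + epowr (aniso_wiener_norm \<eta> p q r s f) p"
  have I: "I < top" using nn_integral_weight_finite[where 'a="'a \<times> real"] fin by (simp add: I_def)
  have "?G x \<le> ennreal C * epowr I (1 / ?a)" for x
  proof -
    have "?G x \<le> seq_norm r q (\<lambda>k. ennreal C * maxblock s m f k x)"
      using C(2)[of _ x x] by (intro seq_norm_mono r q) simp
    also have "\<dots> = ennreal C * seq_norm r q (\<lambda>k. maxblock s m f k x)" by (intro seq_norm_cmult r q)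
    also have "\<dots> \<le> ennreal C * epowr (\<integral>\<^sup>+z. epowr (?G (x - z)) ?a * ennreal (weight ?M z) \<partial>lborel) (1 / ?a)"
      unfolding maxblock_def using a by (intro mult_left_mono seq_norm_average wblock_measurable f) auto
    also have "\<dots> \<le> ennreal C * epowr I (1 / ?a)"
    proof (intro mult_left_mono epowr_mono)
      have "(\<integral>\<^sup>+z. epowr (?G (x - z)) ?a * ennreal (weight ?M z) \<partial>lborel)
          \<le> (\<integral>\<^sup>+z. ennreal (weight ?M z) + epowr (?G (x - z)) p \<partial>lborel)"
      proof (intro nn_integral_mono)
        fix z
        have "epowr (?G (x - z)) ?a * ennreal (weight ?M z) \<le> (1 + epowr (?G (x - z)) p) * ennreal (weight ?M z)"
          by (intro mult_right_mono epowr_le_add a) simp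
        also have "\<dots> = ennreal (weight ?M z) + epowr (?G (x - z)) p * ennreal (weight ?M z)" by (simp add: distrib_right)
        also have "\<dots> \<le> ennreal (weight ?M z) + epowr (?G (x - z)) p * 1"
          by (intro add_left_mono mult_left_mono) (auto simp: weight_le_1)
        finally show "epowr (?G (x - z)) ?a * ennreal (weight ?M z) \<le> ennreal (weight ?M z) + epowr (?G (x - z)) p" by simp
      qed
      also have "\<dots> = (\<integral>\<^sup>+z. ennreal (weight ?M (z :: 'a \<times> real)) \<partial>lborel) + (\<integral>\<^sup>+z. epowr (?G (x - z)) p \<partial>lborel)"
      proof (rule nn_integral_add)
        have "(\<lambda>z. ?G (x - z)) \<in> borel_measurable lborel"
          using measurable_compose[OF _ G, of "\<lambda>z. x - z" lborel] by simp
        then show "(\<lambda>z. epowr (?G (x - z)) p) \<in> borel_measurable lborel" by (rule epowr_measurable)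
      qed simp
      also have "(\<integral>\<^sup>+z. epowr (?G (x - z)) p \<partial>lborel) = (\<integral>\<^sup>+z. epowr (?G z) p \<partial>lborel)"
        by (rule lborel_nn_integral_reflect[where f="\<lambda>z. epowr (?G z) p"]) simp
      also have "\<dots> = epowr (aniso_wiener_norm \<eta> p q r s f) p"
        unfolding aniso_wiener_norm_eq mixed_norm_def by (rule epowr_Lp_norm[OF p, symmetric])
      finally show "(\<integral>\<^sup>+z. epowr (?G (x - z)) ?a * ennreal (weight ?M z) \<partial>lborel) \<le> I" by (simp add: I_def)
    qed (use m in auto)
    finally show ?thesis .
  qed
  moreover have "ennreal C * epowr I (1 / ?a) < top" using I by (simp add: ennreal_mult_less_top)
  ultimately show ?thesis by blast
qed

text \<open>The synthesis estimate is applied to every slice. As \<open>r \<le> 1\<close>, the sum over \<open>kn\<close> of the \<open>\<ell>\<^sup>q\<close> norms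
  of the blocks is bounded, uniformly in space; the weights make the remaining sum and integral finite.\<close>

lemma sum_slices_bound:
  fixes f :: "('a::euclidean_space \<times> real) distr"
  assumes f: "f \<in> tempered" and fin: "aniso_wiener_norm \<eta> p q r s f < top"
    and p: "0 < p" and r: "0 < r" "r \<le> 1" and q: "0 < q"
  shows "\<exists>C\<ge>0. \<exists>N. \<forall>\<phi>\<in>schwartz. (\<integral>\<^sup>+kn. ennreal (norm (f (tensor \<phi> (ker kn)))) \<partial>count_space \<int>) \<le> ennreal (C * schwartz_seminorm N \<phi>)"
proof -
  let ?W = "2 * DIM('a)"
  obtain n where n: "\<And>k::'a. jbracket k powr (- s) \<le> (1 + norm k) ^ n" using jbracket_powr_weight[of "- s"] by blast
  \<comment> \<open>The first \<open>n\<close> powers of the weight absorb \<open>jbracket kb powr (- s)\<close>, the others are summable.\<close>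
  let ?M = "n + ?W"
  obtain C N where C: "C \<ge> 0" "\<And>L \<phi>. L \<in> tempered \<Longrightarrow> \<phi> \<in> schwartz \<Longrightarrow> ennreal (norm (L \<phi>)) \<le> ennreal (C * schwartz_seminorm N \<phi>) *
     (\<integral>\<^sup>+k. (\<integral>\<^sup>+z. ennreal (norm (box_op \<eta> k L z) * (weight ?M k * weight ?M z)) \<partial>lborel) \<partial>count_space (int_lattice :: 'a set))"
    using tempered_le_blocks[where 'a='a and M="?M"] by blast
  obtain B where B: "B < top" "\<And>x. seq_norm r q (\<lambda>k. wblock s f k x) \<le> B"
    using seq_norm_wblock_bounded[OF f fin p r(1) q] by blast
  let ?J = "\<lambda>kn. \<integral>\<^sup>+kb. (\<integral>\<^sup>+z. ennreal (norm (box_op \<eta> (kb, kn) f (z, 0)) * (weight ?M kb * weight ?M z)) \<partial>lborel) \<partial>count_space (int_lattice :: 'a set)"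
  let ?S = "\<integral>\<^sup>+kn. ?J kn \<partial>count_space \<int>" and ?Z = "int_lattice :: 'a set"
  let ?k = "\<lambda>kn z. \<integral>\<^sup>+kb. wblock s f (kb, kn) (z, 0) * ennreal (weight ?W kb) * ennreal (weight ?W z) \<partial>count_space ?Z"
  define Sa where "Sa = (\<integral>\<^sup>+k. ennreal (weight ?W k) \<partial>count_space ?Z)"
  define Sb where "Sb = (\<integral>\<^sup>+z. ennreal (weight ?W (z::'a)) \<partial>lborel)"
  have S: "Sa < top" "Sb < top" unfolding Sa_def Sb_def
    using nn_integral_lattice_weight_finite[where 'a='a] nn_integral_weight_finite[where 'a='a] by simp_all
  have wm [measurable]: "(\<lambda>z. wblock s f (kb, kn) (z, 0)) \<in> borel_measurable borel" for kb kn
  proof -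
    have "(\<lambda>z::'a. (z, 0::real)) \<in> borel_measurable borel"
      by (intro borel_measurable_continuous_onI continuous_intros)
    then show ?thesis by (rule measurable_compose[OF _ wblock_measurable[OF f]])
  qed
  have "?S \<le> B * Sa * Sb"
  proof -
    have pt: "ennreal (norm (box_op \<eta> (kb, kn) f (z, 0)) * (weight ?M kb * weight ?M z))
        \<le> wblock s f (kb, kn) (z, 0) * ennreal (weight ?W kb) * ennreal (weight ?W z)" for kb kn z
    proof -
      let ?u = "norm (box_op \<eta> (kb, kn) f (z, 0))"
      have "jbracket kb powr s * jbracket kb powr (- s) = 1" using jbracket_pos[of kb] by (simp add: powr_add[symmetric])
      then have "?u * (weight ?M kb * weight ?M z) = (jbracket kb powr s * ?u) * ((jbracket kb powr (- s) * weight ?M kb) * weight ?M z)"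
        by (simp add: mult_ac)
      also have "\<dots> \<le> (jbracket kb powr s * ?u) * (((1 + norm kb) ^ n * weight ?M kb) * weight ?W z)"
        by (intro mult_left_mono mult_mono mult_right_mono n weight_antimono) auto
      also have "\<dots> = (jbracket kb powr s * ?u) * (weight ?W kb * weight ?W z)" by (simp only: weight_cancel)
      finally have "ennreal (?u * (weight ?M kb * weight ?M z)) \<le> ennreal ((jbracket kb powr s * ?u) * (weight ?W kb * weight ?W z))"
        by (rule ennreal_leI)
      then show ?thesis unfolding wblock_def fst_conv by (simp add: ennreal_mult'[symmetric] ennreal_mult''[symmetric] mult.assoc)
    qed
    have "?S \<le> (\<integral>\<^sup>+kn. (\<integral>\<^sup>+kb. (\<integral>\<^sup>+z. wblock s f (kb, kn) (z, 0) * ennreal (weight ?W kb) * ennreal (weight ?W z) \<partial>lborel) \<partial>count_space ?Z) \<partial>count_space \<int>)"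
      by (intro nn_integral_mono pt)
    also have "\<dots> = (\<integral>\<^sup>+kn. (\<integral>\<^sup>+z. ?k kn z \<partial>lborel) \<partial>count_space \<int>)"
      by (intro nn_integral_cong nn_integral_count_lborel_swap countable_int_lattice) simp
    also have "\<dots> = (\<integral>\<^sup>+z. (\<integral>\<^sup>+kn. ?k kn z \<partial>count_space \<int>) \<partial>lborel)"
    proof (intro nn_integral_count_lborel_swap countable_Ints)
      fix kn :: real
      interpret sigma_finite_measure "count_space ?Z" by (rule sigma_finite_int_lattice)
      have "(\<lambda>(z, kb). wblock s f (kb, kn) (z, 0) * ennreal (weight ?W kb) * ennreal (weight ?W z)) \<in> borel_measurable (borel \<Otimes>\<^sub>M count_space ?Z)"
        by (intro measurable_pair_count_space countable_int_lattice) simp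
      from borel_measurable_nn_integral[OF this]
      show "?k kn \<in> borel_measurable borel" .
    qed
    also have "\<dots> \<le> (\<integral>\<^sup>+z. (B * Sa) * ennreal (weight ?W (z::'a)) \<partial>lborel)"
    proof (intro nn_integral_mono)
      fix z :: 'a
      let ?l = "\<lambda>kn. Lp_norm q (count_space ?Z) (\<lambda>kb. wblock s f (kb, kn) (z, 0))"
      have "(\<integral>\<^sup>+kn. ?k kn z \<partial>count_space \<int>)
          \<le> (\<integral>\<^sup>+kn. (\<integral>\<^sup>+kb. ?l kn * (ennreal (weight ?W kb) * ennreal (weight ?W z)) \<partial>count_space ?Z) \<partial>count_space \<int>)"
        unfolding mult.assoc
        by (intro nn_integral_mono mult_right_mono) (auto intro: Lp_norm_count_ge[OF q])
      also have "\<dots> = (\<integral>\<^sup>+kn. ?l kn \<partial>count_space \<int>) * (Sa * ennreal (weight ?W z))"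
        unfolding Sa_def by (simp add: nn_integral_cmult nn_integral_multc)
      also have "\<dots> \<le> B * (Sa * ennreal (weight ?W z))"
      proof (intro mult_right_mono)
        have "(\<integral>\<^sup>+kn. ?l kn \<partial>count_space \<int>) \<le> seq_norm r q (\<lambda>k. wblock s f k (z, 0))"
          unfolding seq_norm_def by (rule nn_integral_count_le_Lp_norm[OF r])
        also have "\<dots> \<le> B" by (rule B)
        finally show "(\<integral>\<^sup>+kn. ?l kn \<partial>count_space \<int>) \<le> B" .
      qed simp
      finally show "(\<integral>\<^sup>+kn. ?k kn z \<partial>count_space \<int>)
          \<le> (B * Sa) * ennreal (weight ?W z)" by (simp add: mult.assoc)
    qed
    also have "\<dots> = B * Sa * Sb" unfolding Sb_def by (rule nn_integral_cmult) simp
    finally show ?thesis .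
  qed
  also have "\<dots> < top" using B(1) S by (simp add: ennreal_mult_less_top)
  finally have fin: "?S < top" .
  then obtain D where D: "?S = ennreal D" "D \<ge> 0" by (cases ?S) auto
  have "(\<integral>\<^sup>+kn. ennreal (norm (f (tensor \<phi> (ker kn)))) \<partial>count_space \<int>) \<le> ennreal ((C * D) * schwartz_seminorm N \<phi>)"
    if p: "\<phi> \<in> schwartz" for \<phi>
  proof -
    have "(\<integral>\<^sup>+kn. ennreal (norm (f (tensor \<phi> (ker kn)))) \<partial>count_space \<int>) \<le> (\<integral>\<^sup>+kn. ennreal (C * schwartz_seminorm N \<phi>) * ?J kn \<partial>count_space \<int>)"
    proof (intro nn_integral_mono)
      fix kn
      show "ennreal (norm (f (tensor \<phi> (ker kn)))) \<le> ennreal (C * schwartz_seminorm N \<phi>) * ?J kn"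
      proof -
        have "slice f kn \<phi> = f (tensor \<phi> (ker kn))" using p by (simp add: slice_def on_schwartz_def)
        then show ?thesis using C(2)[OF tempered_slice[OF f, of kn] p] unfolding box_op_slice[OF f] by (simp only:)
      qed
    qed
    also have "\<dots> = ennreal (C * schwartz_seminorm N \<phi>) * ennreal D" by (simp add: nn_integral_cmult D)
    also have "\<dots> = ennreal ((C * D) * schwartz_seminorm N \<phi>)"
      using C(1) D(2) schwartz_seminorm_nonneg[OF p, of N] by (simp add: ennreal_mult'[symmetric] mult_ac)
    finally show ?thesis .
  qed
  moreover have "0 \<le> C * D" using C(1) D(2) by simp
  ultimately show ?thesis by blast
qed

definition trace_op :: "('a::euclidean_space \<times> real) distr \<Rightarrow> 'a distr" where
  "trace_op f = on_schwartz (\<lambda>\<phi>. \<integral>kn. f (tensor \<phi> (ker kn)) \<partial>count_space \<int>)"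

lemma ennreal_norm_integral_le:
  fixes F :: "'k \<Rightarrow> complex"
  shows "ennreal (norm (\<integral>x. F x \<partial>M)) \<le> (\<integral>\<^sup>+x. ennreal (norm (F x)) \<partial>M)"
  by (cases "integrable M F") (auto simp: not_integrable_integral_eq intro: integral_norm_bound_ennreal)

lemma slices_integrable:
  fixes f :: "('a::euclidean_space \<times> real) distr"
  assumes "f \<in> tempered" "aniso_wiener_norm \<eta> p q r s f < top" "0 < p" "0 < r" "r \<le> 1" "0 < q" "\<phi> \<in> schwartz"
  shows "integrable (count_space \<int>) (\<lambda>kn. f (tensor \<phi> (ker kn)))"
proof -
  obtain C N where "(\<integral>\<^sup>+kn. ennreal (norm (f (tensor \<phi> (ker kn)))) \<partial>count_space \<int>) \<le> ennreal (C * schwartz_seminorm N \<phi>)"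
    using sum_slices_bound[OF assms(1-6)] assms(7) by blast
  then have "(\<integral>\<^sup>+kn. ennreal (norm (f (tensor \<phi> (ker kn)))) \<partial>count_space \<int>) < \<infinity>"
    by (rule le_less_trans) simp
  then show ?thesis by (simp add: integrable_iff_bounded)
qed

lemma tempered_trace_op:
  fixes f :: "('a::euclidean_space \<times> real) distr"
  assumes A: "f \<in> tempered" "aniso_wiener_norm \<eta> p q r s f < top" "0 < p" "0 < r" "r \<le> 1" "0 < q"
  shows "trace_op f \<in> tempered"
proof -
  obtain C N where C: "C \<ge> 0" "\<And>\<phi>. \<phi> \<in> schwartz \<Longrightarrow> (\<integral>\<^sup>+kn. ennreal (norm (f (tensor \<phi> (ker kn)))) \<partial>count_space \<int>) \<le> ennreal (C * schwartz_seminorm N \<phi>)"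
    using sum_slices_bound[OF A] by blast
  show ?thesis
  proof (rule temperedI[where C=C and N=N])
    fix \<phi> \<psi> :: "'a \<Rightarrow> complex" and a b assume p: "\<phi> \<in> schwartz" "\<psi> \<in> schwartz"
    have "f (tensor (\<lambda>x. a * \<phi> x + b * \<psi> x) (ker kn)) = a * f (tensor \<phi> (ker kn)) + b * f (tensor \<psi> (ker kn))" for kn
    proof -
      have "tensor (\<lambda>x. a * \<phi> x + b * \<psi> x) (ker kn) = (\<lambda>z. a * tensor \<phi> (ker kn) z + b * tensor \<psi> (ker kn) z)"
        by (rule ext) (simp add: tensor_def algebra_simps)
      then show ?thesis
        by (simp only:) (intro tempered_linear[OF A(1)] schwartz_tensor(1) p schwartz_ker)
    qed
    then show "trace_op f (\<lambda>x. a * \<phi> x + b * \<psi> x) = a * trace_op f \<phi> + b * trace_op f \<psi>"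
      using p slices_integrable[OF A p(1)] slices_integrable[OF A p(2)]
      by (simp add: trace_op_def on_schwartz_def schwartz_add schwartz_cmult)
  next
    fix \<phi> :: "'a \<Rightarrow> complex" assume p: "\<phi> \<in> schwartz"
    have "ennreal (norm (trace_op f \<phi>)) \<le> ennreal (C * schwartz_seminorm N \<phi>)"
      using order_trans[OF ennreal_norm_integral_le C(2)[OF p]] p by (simp add: trace_op_def on_schwartz_def)
    then show "norm (trace_op f \<phi>) \<le> C * schwartz_seminorm N \<phi>"
      using C(1) schwartz_seminorm_nonneg[OF p, of N] by (subst (asm) ennreal_le_iff) auto
  qed (simp add: trace_op_def on_schwartz_def)
qed

lemma box_op_trace_op:
  fixes f :: "('a::euclidean_space \<times> real) distr"
  assumes A: "f \<in> tempered" "aniso_wiener_norm \<eta> p q r s f < top" "0 < p" "0 < r" "r \<le> 1" "0 < q"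
  shows "box_op \<eta> kb (trace_op f) x = (\<integral>kn. box_op \<eta> (kb, kn) f (x, 0) \<partial>count_space \<int>)"
  unfolding box_op_eq[OF tempered_trace_op[OF A]] box_op_eq[OF A(1)] ker_Pair_translate
  by (simp add: trace_op_def on_schwartz_def schwartz_translate schwartz_ker)

text \<open>Minkowski's inequality if \<open>q \<ge> 1\<close>. Otherwise the sum is estimated by the \<open>\<ell>\<^sup>q\<close> norm in \<open>kn\<close>, and
  the two sums of \<open>q\<close>-th powers are interchanged.\<close>

lemma Lp_norm_sum_le_seq_norm:
  fixes A :: "'a::euclidean_space \<times> real \<Rightarrow> ennreal"
  assumes q: "0 < q"
  shows "Lp_norm q (count_space int_lattice) (\<lambda>kb. \<integral>\<^sup>+kn. A (kb, kn) \<partial>count_space \<int>) \<le> seq_norm (min 1 q) q A"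
proof (cases "1 \<le> q")
  case True
  have "Lp_norm q (count_space int_lattice) (\<lambda>kb. \<integral>\<^sup>+kn. A (kb, kn) \<partial>count_space \<int>)
      \<le> (\<integral>\<^sup>+kn. Lp_norm q (count_space int_lattice) (\<lambda>kb. A (kb, kn)) \<partial>count_space \<int>)"
    by (intro Minkowski_integral_inequality sigma_finite_Ints sigma_finite_int_lattice True
        measurable_pair_count_space countable_int_lattice) simp
  then show ?thesis using True by (simp add: seq_norm_def Lp_norm_def)
next
  case False
  then have q1: "q \<le> 1" "min 1 q = q" by auto
  interpret pair_sigma_finite "count_space (int_lattice :: 'a set)" "count_space (\<int> :: real set)"
    by (intro pair_sigma_finite.intro sigma_finite_Ints sigma_finite_int_lattice)
  have "Lp_norm q (count_space int_lattice) (\<lambda>kb. \<integral>\<^sup>+kn. A (kb, kn) \<partial>count_space \<int>)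
      \<le> Lp_norm q (count_space int_lattice) (\<lambda>kb. Lp_norm q (count_space \<int>) (\<lambda>kn. A (kb, kn)))"
    by (intro Lp_norm_mono q nn_integral_count_le_Lp_norm q1)
  also have "\<dots> = seq_norm q q A"
  proof -
    have "(\<lambda>(kb, kn). epowr (A (kb, kn)) q) \<in> borel_measurable (count_space (int_lattice :: 'a set) \<Otimes>\<^sub>M count_space \<int>)"
      by (intro measurable_pair_count_space countable_Ints) simp
    from Fubini'[OF this] show ?thesis
      unfolding seq_norm_def Lp_norm_def using q by (simp add: epowr_inverse)
  qed
  finally show ?thesis by (simp add: q1)
qed

theorem trace_op_bounded:
  assumes p: "0 < p" and q: "0 < q"
  shows "\<exists>C>0. \<forall>f::('a::euclidean_space \<times> real) distr. f \<in> aniso_wiener_space \<eta> p q (min 1 q) s \<longrightarrow>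
    wiener_norm \<eta> p q s (trace_op f) \<le> ennreal C * aniso_wiener_norm \<eta> p q (min 1 q) s f"
proof -
  let ?r = "min 1 q" and ?M = "2 * DIM('a \<times> real)"
  have r: "0 < ?r" "?r \<le> 1" using q by auto
  obtain m where m: "0 < m" "1 / real m \<le> min p (min ?r q)"
    using exists_small_reciprocal[of "min p (min ?r q)"] p r q by auto
  obtain C where C: "C > 0" "\<And>f k x y. f \<in> tempered \<Longrightarrow> wblock s f k y \<le> ennreal (C * (1 + norm (x - y)) ^ (?M * m)) * maxblock s m f k (x :: 'a \<times> real)"
    using wblock_le_maxblock[OF m(1), where 'a='a and s=s] by blast
  \<comment> \<open>For \<open>0 \<le> t \<le> 1\<close> the points \<open>(x, 0)\<close> and \<open>(x, t)\<close> have distance at most \<open>1\<close>.\<close>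
  define D where "D = C * 2 ^ (?M * m)"
  have D: "0 < D" using C(1) by (simp add: D_def)
  define E where "E = epowr (\<integral>\<^sup>+z. ennreal (weight ?M (z::'a \<times> real)) \<partial>lborel) (real m)"
  have "E < top" unfolding E_def by (rule weight_integral_constant)
  then obtain e where e: "E = ennreal e" "e \<ge> 0" by (cases E) auto
  have "wiener_norm \<eta> p q s (trace_op f) \<le> ennreal (D * e + 1) * aniso_wiener_norm \<eta> p q ?r s f"
    if f: "f \<in> aniso_wiener_space \<eta> p q ?r s" for f :: "('a \<times> real) distr"
  proof -
    have ft: "f \<in> tempered" and fin: "aniso_wiener_norm \<eta> p q ?r s f < top"
      using f by (auto simp: aniso_wiener_space_def)
    note A = ft fin p r q
    let ?G = "\<lambda>z. seq_norm ?r q (\<lambda>k. maxblock s m f k z)"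
    have Gm [measurable]: "?G \<in> borel_measurable borel" by (intro seq_norm_measurable maxblock_measurable ft)
    let ?H = "\<lambda>x. Lp_norm q (count_space int_lattice) (\<lambda>kb. ennreal (jbracket kb powr s * norm (box_op \<eta> kb (trace_op f) x)))"
    have H: "?H x \<le> ennreal D * ?G (x, t)" if t: "0 \<le> t" "t \<le> 1" for x t
    proof -
      have "?H x \<le> Lp_norm q (count_space int_lattice) (\<lambda>kb. \<integral>\<^sup>+kn. wblock s f (kb, kn) (x, 0) \<partial>count_space \<int>)"
      proof (intro Lp_norm_mono q)
        fix kb :: 'a
        have "ennreal (jbracket kb powr s * norm (box_op \<eta> kb (trace_op f) x))
            = ennreal (jbracket kb powr s) * ennreal (norm (\<integral>kn. box_op \<eta> (kb, kn) f (x, 0) \<partial>count_space \<int>))"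
          by (simp add: box_op_trace_op[OF A] ennreal_mult')
        also have "\<dots> \<le> ennreal (jbracket kb powr s) * (\<integral>\<^sup>+kn. ennreal (norm (box_op \<eta> (kb, kn) f (x, 0))) \<partial>count_space \<int>)"
          by (intro mult_left_mono ennreal_norm_integral_le) simp
        also have "\<dots> = (\<integral>\<^sup>+kn. wblock s f (kb, kn) (x, 0) \<partial>count_space \<int>)"
          by (simp add: nn_integral_cmult[symmetric] wblock_def ennreal_mult')
        finally show "ennreal (jbracket kb powr s * norm (box_op \<eta> kb (trace_op f) x)) \<le> (\<integral>\<^sup>+kn. wblock s f (kb, kn) (x, 0) \<partial>count_space \<int>)" .
      qed
      also have "\<dots> \<le> seq_norm ?r q (\<lambda>k. wblock s f k (x, 0))"
        by (rule Lp_norm_sum_le_seq_norm[OF q, where A="\<lambda>k. wblock s f k (x, 0)"])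
      also have "\<dots> \<le> seq_norm ?r q (\<lambda>k. ennreal D * maxblock s m f k (x, t))"
      proof (intro seq_norm_mono r q)
        fix k
        have "1 + norm ((x, t) - (x, 0)) \<le> 2" using t by (simp add: norm_Pair)
        then have "C * (1 + norm ((x, t) - (x, 0))) ^ (?M * m) \<le> D"
          unfolding D_def using C(1) by (intro mult_left_mono power_mono) auto
        then show "wblock s f k (x, 0) \<le> ennreal D * maxblock s m f k (x, t)"
          by (intro order_trans[OF C(2)[OF ft] mult_right_mono[OF ennreal_leI]]) auto
      qed
      also have "\<dots> = ennreal D * ?G (x, t)" by (intro seq_norm_cmult r q)
      finally show ?thesis .
    qed
    have m2: "(\<lambda>z. epowr (ennreal D * ?G z) p) \<in> borel_measurable (lborel \<Otimes>\<^sub>M lborel)"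
      unfolding lborel_prod by measurable
    have "(\<integral>\<^sup>+x. epowr (?H x) p \<partial>lborel) \<le> (\<integral>\<^sup>+x. (\<integral>\<^sup>+t. epowr (ennreal D * ?G (x, t)) p \<partial>lborel) \<partial>lborel)"
    proof (intro nn_integral_mono)
      fix x :: 'a
      \<comment> \<open>Averaging over \<open>t\<close> in the unit interval turns the bound at \<open>(x, t)\<close> into an integral over the product.\<close>
      have "epowr (?H x) p = epowr (?H x) p * emeasure lborel {0..1::real}" by simp
      also have "\<dots> = (\<integral>\<^sup>+t. epowr (?H x) p * indicator {0..1::real} t \<partial>lborel)"
        by (rule nn_integral_cmult_indicator[symmetric]) simp
      also have "\<dots> \<le> (\<integral>\<^sup>+t. epowr (ennreal D * ?G (x, t)) p \<partial>lborel)"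
        using H p by (intro nn_integral_mono) (auto split: split_indicator intro: epowr_mono)
      finally show "epowr (?H x) p \<le> (\<integral>\<^sup>+t. epowr (ennreal D * ?G (x, t)) p \<partial>lborel)" .
    qed
    also have "\<dots> = (\<integral>\<^sup>+z. epowr (ennreal D * ?G z) p \<partial>lborel)"
      using lborel.nn_integral_fst[OF m2] by (simp add: lborel_prod)
    finally have "wiener_norm \<eta> p q s (trace_op f) \<le> Lp_norm p lborel (\<lambda>z. ennreal D * ?G z)"
      unfolding wiener_norm_def Lp_norm_def[of p] using p by (intro epowr_mono) auto
    also have "\<dots> = ennreal D * mixed_norm p ?r q (maxblock s m f)"
      unfolding mixed_norm_def by (rule Lp_norm_cmult[OF p]) simp
    also have "\<dots> \<le> ennreal D * (E * aniso_wiener_norm \<eta> p q ?r s f)"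
      unfolding E_def aniso_wiener_norm_eq using m by (intro mult_left_mono mixed_norm_maxblock ft) auto
    also have "\<dots> = ennreal (D * e) * aniso_wiener_norm \<eta> p q ?r s f"
      using D e by (simp add: ennreal_mult' mult.assoc)
    also have "\<dots> \<le> ennreal (D * e + 1) * aniso_wiener_norm \<eta> p q ?r s f"
      by (intro mult_right_mono ennreal_leI) auto
    finally show ?thesis .
  qed
  moreover have "0 < D * e + 1" using D e by (simp add: add_nonneg_pos)
  ultimately show ?thesis by blast
qed

section \<open>The trace of a Schwartz function\<close>

lemma unif_part_count_space:
  fixes \<xi> :: "'a::euclidean_space"
  shows "integrable (count_space int_lattice) (\<lambda>k. unif_part \<eta> k \<xi>)"
    and "(\<integral>k. unif_part \<eta> k \<xi> \<partial>count_space int_lattice) = 1"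
proof -
  let ?S = "near (norm \<xi> + DIM('a)) :: 'a set"
  have z: "unif_part \<eta> k \<xi> = 0" if "k \<in> int_lattice" "k \<notin> ?S" for k
    using bump_nonzero_near[OF that(1) _ order_refl] that(2) by (auto simp: unif_part_def)
  have "(\<integral>\<^sup>+k. ennreal (norm (unif_part \<eta> k \<xi>)) \<partial>count_space int_lattice) = (\<Sum>k\<in>?S. ennreal (norm (unif_part \<eta> k \<xi>)))"
    by (rule nn_integral_count_space'[OF finite_near _ near_subset]) (simp add: z)
  also have "\<dots> = ennreal (\<Sum>k\<in>?S. norm (unif_part \<eta> k \<xi>))" by (rule sum_ennreal) simp
  finally show "integrable (count_space int_lattice) (\<lambda>k. unif_part \<eta> k \<xi>)"
    by (simp add: integrable_iff_bounded)
  have sub: "{k \<in> int_lattice. unif_part \<eta> k \<xi> \<noteq> 0} \<subseteq> ?S" using z by blast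
  then have "finite {k \<in> int_lattice. unif_part \<eta> k \<xi> \<noteq> 0}" by (rule finite_subset[OF _ finite_near])
  then have "(\<integral>k. unif_part \<eta> k \<xi> \<partial>count_space int_lattice) = (\<Sum>k | k \<in> int_lattice \<and> unif_part \<eta> k \<xi> \<noteq> 0. unif_part \<eta> k \<xi>)"
    by (rule lebesgue_integral_count_space_finite_support)
  also have "\<dots> = (\<Sum>k\<in>?S. unif_part \<eta> k \<xi>)"
    by (rule sum.mono_neutral_left[OF finite_near sub]) (use near_subset in blast)
  also have "\<dots> = 1" by (intro sum_unif_part finite_near near_subset bump_nonzero_near) auto
  finally show "(\<integral>k. unif_part \<eta> k \<xi> \<partial>count_space int_lattice) = 1" .
qed

text \<open>By Parseval the sum is the integral of \<open>fourier a\<close> against the partition of unity, that is,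
  the integral of \<open>fourier a\<close>; it remains to apply Fourier inversion at \<open>0\<close>.\<close>

lemma sum_integral_ker:
  fixes a :: "real \<Rightarrow> complex"
  assumes a: "a \<in> schwartz"
  shows "(\<integral>kn. (\<integral>t. a t * ker kn t \<partial>lborel) \<partial>count_space \<int>) = a 0"
proof -
  define h where "h = fourier a"
  have h: "h \<in> schwartz" unfolding h_def by (rule fourier_schwartz[OF a])
  note u = unif_part_count_space[where 'a=real, unfolded int_lattice_real]
  interpret pair_sigma_finite "lborel :: real measure" "count_space (\<int> :: real set)"
    by (intro pair_sigma_finite.intro sigma_finite_lborel sigma_finite_Ints)
  have int: "integrable (lborel \<Otimes>\<^sub>M count_space \<int>) (\<lambda>(\<xi>, k::real). h \<xi> * sig k \<xi>)"
  proof (rule Fubini_integrable)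
    show "(\<lambda>(\<xi>, k::real). h \<xi> * sig k \<xi>) \<in> borel_measurable (lborel \<Otimes>\<^sub>M count_space \<int>)"
      using schwartz_measurable[OF h] schwartz_measurable[OF schwartz_sig[where 'a=real]]
      by (intro measurable_pair_count_space countable_Ints) simp
    have "(\<integral>k. norm (case (\<xi>, k) of (\<xi>, k::real) \<Rightarrow> h \<xi> * sig k \<xi>) \<partial>count_space \<int>) = norm (h \<xi>)" for \<xi>
      using u(2)[of \<xi>] by (simp add: norm_mult sig_def unif_part_nonneg)
    then show "integrable lborel (\<lambda>\<xi>. \<integral>k. norm (case (\<xi>, k) of (\<xi>, k::real) \<Rightarrow> h \<xi> * sig k \<xi>) \<partial>count_space \<int>)"
      by (simp only:) (intro integrable_norm schwartz_integrable h)
    have "integrable (count_space \<int>) (\<lambda>k::real. h \<xi> * sig k \<xi>)" for \<xi>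
      unfolding sig_def by (intro integrable_mult_right integrable_of_real u)
    then show "AE \<xi> in lborel. integrable (count_space \<int>) (\<lambda>k. case (\<xi>, k) of (\<xi>, k::real) \<Rightarrow> h \<xi> * sig k \<xi>)"
      by simp
  qed
  have "(\<integral>t. a t * ker kn t \<partial>lborel) = (\<integral>\<xi>. h \<xi> * sig kn \<xi> \<partial>lborel)" for kn :: real
    unfolding ker_def h_def by (intro integral_fourier_mult[symmetric] schwartz_integrable a schwartz_sig)
  then have "(\<integral>kn. (\<integral>t. a t * ker kn t \<partial>lborel) \<partial>count_space \<int>) = (\<integral>kn. (\<integral>\<xi>. h \<xi> * sig kn \<xi> \<partial>lborel) \<partial>count_space (\<int> :: real set))"
    by (simp only:)
  also have "\<dots> = (\<integral>\<xi>. (\<integral>kn. h \<xi> * sig kn \<xi> \<partial>count_space (\<int> :: real set)) \<partial>lborel)"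
    by (rule Fubini_integral[OF int])
  also have "\<dots> = (\<integral>\<xi>. h \<xi> \<partial>lborel)"
  proof -
    have "(\<integral>kn. sig kn \<xi> \<partial>count_space (\<int> :: real set)) = 1" for \<xi>
      unfolding sig_def integral_complex_of_real u(2) by simp
    then show ?thesis by simp
  qed
  also have "\<dots> = a 0" unfolding h_def by (rule integral_fourier_schwartz[OF a])
  finally show ?thesis .
qed

lemma trace_op_distr_of:
  fixes f :: "'a::euclidean_space \<times> real \<Rightarrow> complex"
  assumes f: "f \<in> schwartz"
  shows "trace_op (distr_of f) = distr_of (trace_fun f)"
proof
  fix \<phi> :: "'a \<Rightarrow> complex"
  show "trace_op (distr_of f) \<phi> = distr_of (trace_fun f) \<phi>"
  proof (cases "\<phi> \<in> schwartz")
    case p: True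
    \<comment> \<open>The pairing of \<open>f\<close> with \<open>\<phi>\<close> in the first variable, a Schwartz function of the last variable.\<close>
    define a where "a = partial_integral \<phi> (\<lambda>(t, x). f (x, t))"
    have a: "a \<in> schwartz" unfolding a_def by (rule schwartz_partial_integral(1)[OF schwartz_swap[OF f] p])
    have "distr_of f (tensor \<phi> (ker kn)) = (\<integral>t. a t * ker kn t \<partial>lborel)" for kn
    proof -
      have t: "tensor \<phi> (ker kn) \<in> schwartz" by (rule schwartz_tensor(1)[OF p schwartz_ker])
      have i: "integrable (lborel \<Otimes>\<^sub>M lborel) (\<lambda>(x, t). f (x, t) * tensor \<phi> (ker kn) (x, t))"
        using schwartz_mult_integrable[OF f t] by (simp add: lborel_prod case_prod_beta')
      have "distr_of f (tensor \<phi> (ker kn)) = (\<integral>z. (\<lambda>(x, t). f (x, t) * tensor \<phi> (ker kn) (x, t)) z \<partial>(lborel \<Otimes>\<^sub>M lborel))"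
        by (simp add: distr_of_apply[OF t] lborel_prod case_prod_beta')
      also have "\<dots> = (\<integral>t. (\<integral>x. f (x, t) * tensor \<phi> (ker kn) (x, t) \<partial>lborel) \<partial>lborel)"
        by (rule lborel_pair.integral_snd[OF i, symmetric])
      also have "\<dots> = (\<integral>t. a t * ker kn t \<partial>lborel)"
        by (simp add: a_def partial_integral_def tensor_def mult.assoc[symmetric])
      finally show ?thesis .
    qed
    then have "trace_op (distr_of f) \<phi> = a 0"
      using p sum_integral_ker[OF a] by (simp add: trace_op_def on_schwartz_def)
    also have "\<dots> = distr_of (trace_fun f) \<phi>"
      using p by (simp add: distr_of_apply a_def partial_integral_def trace_fun_def)
    finally show ?thesis .
  qed (simp add: trace_op_def distr_of_def on_schwartz_def)
qed

lemma trace_op_distr_comb: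
  fixes f g :: "('a::euclidean_space \<times> real) distr"
  assumes "f \<in> aniso_wiener_space \<eta> p q r s" "g \<in> aniso_wiener_space \<eta> p q r s" "0 < p" "0 < r" "r \<le> 1" "0 < q"
  shows "trace_op (distr_comb a f b g) = distr_comb a (trace_op f) b (trace_op g)"
proof
  fix \<phi> :: "'a \<Rightarrow> complex"
  show "trace_op (distr_comb a f b g) \<phi> = distr_comb a (trace_op f) b (trace_op g) \<phi>"
  proof (cases "\<phi> \<in> schwartz")
    case p: True
    have "integrable (count_space \<int>) (\<lambda>kn. f (tensor \<phi> (ker kn)))" "integrable (count_space \<int>) (\<lambda>kn. g (tensor \<phi> (ker kn)))"
      using assms by (auto simp: aniso_wiener_space_def intro: slices_integrable[OF _ _ assms(3-6) p])
    then show ?thesis using p by (simp add: trace_op_def on_schwartz_def distr_comb_def)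
  qed (simp add: trace_op_def on_schwartz_def distr_comb_def)
qed

section \<open>The extension operator\<close>

text \<open>This is the tensor product of the distribution \<open>g\<close> with the function \<open>chi\<close> of the last
  variable, which equals \<open>1\<close> at \<open>0\<close>.\<close>

definition extension_op :: "'a::euclidean_space distr \<Rightarrow> ('a \<times> real) distr" where
  "extension_op g = on_schwartz (\<lambda>\<phi>. g (partial_integral chi \<phi>))"

lemma tempered_extension_op:
  fixes g :: "'a::euclidean_space distr"
  assumes g: "g \<in> tempered"
  shows "extension_op g \<in> tempered"
proof -
  obtain C N where C: "C \<ge> 0" "\<And>\<phi>. \<phi> \<in> schwartz \<Longrightarrow> norm (g \<phi>) \<le> C * schwartz_seminorm N \<phi>"
    using tempered_bound[OF g] by blast
  let ?I = "\<integral>t. norm (chi (t::real) :: complex) \<partial>lborel"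
  note pi = schwartz_partial_integral[OF _ schwartz_chi[where 'a=real], where 'a='a]
  show ?thesis
  proof (rule temperedI[where C="C * ?I" and N=N])
    fix \<phi> \<psi> :: "'a \<times> real \<Rightarrow> complex" and a b assume p: "\<phi> \<in> schwartz" "\<psi> \<in> schwartz"
    have "partial_integral chi (\<lambda>x. a * \<phi> x + b * \<psi> x) = (\<lambda>x. a * partial_integral chi \<phi> x + b * partial_integral chi \<psi> x)"
    proof
      fix x
      have "partial_integral chi (\<lambda>x. a * \<phi> x + b * \<psi> x) x = (\<integral>t. a * (\<phi> (x, t) * chi t) + b * (\<psi> (x, t) * chi t) \<partial>lborel)"
        by (simp add: partial_integral_def algebra_simps)
      also have "\<dots> = (\<integral>t. a * (\<phi> (x, t) * chi t) \<partial>lborel) + (\<integral>t. b * (\<psi> (x, t) * chi t) \<partial>lborel)"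
        by (intro Bochner_Integration.integral_add integrable_mult_right partial_integral_integrable p schwartz_chi)
      finally show "partial_integral chi (\<lambda>x. a * \<phi> x + b * \<psi> x) x = a * partial_integral chi \<phi> x + b * partial_integral chi \<psi> x"
        by (simp add: partial_integral_def)
    qed
    then show "extension_op g (\<lambda>x. a * \<phi> x + b * \<psi> x) = a * extension_op g \<phi> + b * extension_op g \<psi>"
      using p by (simp add: extension_op_def on_schwartz_def schwartz_add schwartz_cmult tempered_linear[OF g] pi(1))
  next
    fix \<phi> :: "'a \<times> real \<Rightarrow> complex" assume p: "\<phi> \<in> schwartz"
    have "norm (g (partial_integral chi \<phi>)) \<le> C * schwartz_seminorm N (partial_integral chi \<phi>)" by (intro C pi p)
    also have "\<dots> \<le> C * (schwartz_seminorm N \<phi> * ?I)" by (intro mult_left_mono C(1) pi(2) p)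
    finally show "norm (extension_op g \<phi>) \<le> C * ?I * schwartz_seminorm N \<phi>"
      using p by (simp add: extension_op_def on_schwartz_def mult_ac)
  qed (simp add: extension_op_def on_schwartz_def)
qed

lemma extension_op_tensor:
  fixes g :: "'a::euclidean_space distr"
  assumes g: "g \<in> tempered" and p: "\<phi> \<in> schwartz" "\<psi> \<in> schwartz"
  shows "extension_op g (tensor \<phi> \<psi>) = (\<integral>t. chi t * \<psi> t \<partial>lborel) * g \<phi>"
proof -
  have "partial_integral chi (tensor \<phi> \<psi>) = (\<lambda>x. (\<integral>t. chi t * \<psi> t \<partial>lborel) * \<phi> x)"
  proof
    fix x
    have "partial_integral chi (tensor \<phi> \<psi>) x = (\<integral>t. \<phi> x * (chi t * \<psi> t) \<partial>lborel)"
      unfolding partial_integral_def tensor_def by (simp add: mult_ac)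
    then show "partial_integral chi (tensor \<phi> \<psi>) x = (\<integral>t. chi t * \<psi> t \<partial>lborel) * \<phi> x" by (simp add: mult.commute)
  qed
  then show ?thesis
    using schwartz_tensor(1)[OF p] by (simp add: extension_op_def on_schwartz_def tempered_cmult[OF g p(1)])
qed

lemma box_op_extension_op:
  fixes g :: "'a::euclidean_space distr"
  assumes g: "g \<in> tempered"
  shows "box_op \<eta> (kb, kn) (extension_op g) (x, t) = box_op \<eta> kb g x * box_op \<eta> kn (distr_of chi) t"
proof -
  have s: "(\<lambda>y. ker kb (y - x)) \<in> schwartz" "(\<lambda>\<tau>. ker kn (\<tau> - t)) \<in> schwartz"
    by (intro schwartz_translate schwartz_ker)+
  show ?thesis
    unfolding box_op_eq[OF tempered_extension_op[OF g]] box_op_eq[OF g] box_op_eq[OF tempered_distr_of[OF schwartz_chi]]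
      ker_Pair_translate extension_op_tensor[OF g s] distr_of_apply[OF s(2)] by (rule mult.commute)
qed

text \<open>The norms factor because the blocks do; the second factor is a one-dimensional norm of \<open>chi\<close> with
  \<open>s = 0\<close>, as the weight \<open>jbracket kb\<close> involves the first variable only.\<close>

lemma aniso_wiener_norm_extension_op:
  fixes g :: "'a::euclidean_space distr"
  assumes g: "g \<in> tempered" and r: "0 < r" and q: "0 < q"
  shows "aniso_wiener_norm \<eta> p q r s (extension_op g)
    = wiener_norm \<eta> p q s g * wiener_norm \<eta> p r 0 (distr_of (chi :: real \<Rightarrow> complex))"
proof -
  let ?A = "\<lambda>x kb. ennreal (jbracket kb powr s * norm (box_op \<eta> kb g x))"
  let ?B = "\<lambda>t kn. ennreal (jbracket kn powr 0 * norm (box_op \<eta> kn (distr_of (chi :: real \<Rightarrow> complex)) t))"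
  let ?LA = "\<lambda>x. Lp_norm q (count_space int_lattice) (?A x)"
  let ?LB = "\<lambda>t. Lp_norm r (count_space \<int>) (?B t)"
  have wb: "wblock s (extension_op g) k z = ?A (fst z) (fst k) * ?B (snd z) (snd k)" for k z
  proof -
    have "jbracket (snd k) powr 0 = 1" using jbracket_pos[of "snd k"] by simp
    then show ?thesis
      using box_op_extension_op[OF g, of "fst k" "snd k" "fst z" "snd z"]
      by (simp add: wblock_def norm_mult ennreal_mult'[symmetric] mult.assoc)
  qed
  have sn: "seq_norm r q (\<lambda>k. wblock s (extension_op g) k z) = ?LA (fst z) * ?LB (snd z)" for z
    unfolding wb by (rule seq_norm_tensor[OF r q])
  have m: "?LA \<in> borel_measurable borel" "?LB \<in> borel_measurable borel"
    using box_op_measurable[OF g] box_op_measurable[OF tempered_distr_of[OF schwartz_chi[where 'a=real]]]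
    by (intro Lp_norm_measurable sigma_finite_int_lattice sigma_finite_Ints measurable_pair_count_space
        countable_Ints countable_int_lattice; simp)+
  have "aniso_wiener_norm \<eta> p q r s (extension_op g) = Lp_norm p lborel (\<lambda>z. ?LA (fst z) * ?LB (snd z))"
    unfolding aniso_wiener_norm_eq mixed_norm_def sn ..
  also have "\<dots> = Lp_norm p lborel ?LA * Lp_norm p lborel ?LB" by (rule Lp_norm_lborel_tensor[OF m])
  finally show ?thesis unfolding wiener_norm_def int_lattice_real .
qed

lemma extension_op_distr_comb:
  "extension_op (distr_comb a f b g) = distr_comb a (extension_op f) b (extension_op g)"
  by (simp add: extension_op_def on_schwartz_def distr_comb_def fun_eq_iff)

lemma trace_op_extension_op:
  fixes g :: "'a::euclidean_space distr"
  assumes g: "g \<in> tempered"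
  shows "trace_op (extension_op g) = g"
proof
  fix \<phi> :: "'a \<Rightarrow> complex"
  show "trace_op (extension_op g) \<phi> = g \<phi>"
  proof (cases "\<phi> \<in> schwartz")
    case p: True
    have "trace_op (extension_op g) \<phi> = (\<integral>kn. (\<integral>t. chi t * ker kn t \<partial>lborel) * g \<phi> \<partial>count_space (\<int> :: real set))"
      using p by (simp add: trace_op_def on_schwartz_def extension_op_tensor[OF g p schwartz_ker])
    also have "\<dots> = (\<integral>kn. (\<integral>t. chi t * ker kn t \<partial>lborel) \<partial>count_space (\<int> :: real set)) * g \<phi>" by simp
    also have "\<dots> = g \<phi>" unfolding sum_integral_ker[OF schwartz_chi] by (simp add: chi_eq_1)
    finally show ?thesis .
  next
    case False
    then show ?thesis using g by (simp add: trace_op_def on_schwartz_def tempered_def)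
  qed
qed

end

section \<open>The trace theorem\<close>

lemma continuous_linear_opI:
  assumes T: "\<And>f. f \<in> X \<Longrightarrow> T f \<in> Y"
    and lin: "\<And>f g a b. f \<in> X \<Longrightarrow> g \<in> X \<Longrightarrow> T (distr_comb a f b g) = distr_comb a (T f) b (T g)"
    and C: "C > 0" and bound: "\<And>f. f \<in> X \<Longrightarrow> NY (T f) \<le> ennreal C * NX f"
    and diff: "\<And>f g. f \<in> X \<Longrightarrow> g \<in> X \<Longrightarrow> NX (distr_diff f g) < top \<Longrightarrow> distr_diff f g \<in> X"
  shows "continuous_linear_op X NX Y NY T"
  unfolding continuous_linear_op_def
proof (intro conjI ballI allI impI)
  fix f and \<epsilon> :: real assume f: "f \<in> X" and e: "\<epsilon> > 0"
  show "\<exists>\<delta>>0. \<forall>g\<in>X. NX (distr_diff g f) < ennreal \<delta> \<longrightarrow> NY (distr_diff (T g) (T f)) < ennreal \<epsilon>"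
  proof (intro exI[of _ "\<epsilon> / C"] conjI ballI impI)
    show "0 < \<epsilon> / C" using e C by simp
    fix g assume g: "g \<in> X" and lt: "NX (distr_diff g f) < ennreal (\<epsilon> / C)"
    have "NX (distr_diff g f) < top" using lt ennreal_less_top by (rule order.strict_trans)
    then have d: "distr_diff g f \<in> X" by (rule diff[OF g f])
    have "distr_diff (T g) (T f) = T (distr_diff g f)" unfolding distr_diff_eq_comb lin[OF g f] ..
    then have "NY (distr_diff (T g) (T f)) \<le> ennreal C * NX (distr_diff g f)" using bound[OF d] by simp
    also have "\<dots> < ennreal C * ennreal (\<epsilon> / C)"
      using C by (intro ennreal_mult_strict_left_mono lt) auto
    also have "\<dots> = ennreal \<epsilon>" using C e by (simp add: ennreal_mult'[symmetric])
    finally show "NY (distr_diff (T g) (T f)) < ennreal \<epsilon>" .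
  qed
qed (simp_all add: T lin)

context cutoff_function
begin

lemma schwartz_dense_aniso_wiener_space:
  assumes p: "0 < p" and q: "0 < q" and r: "0 < r"
  shows "schwartz_dense (aniso_wiener_space \<eta> p q r s :: ('a::euclidean_space \<times> real) distr set) (aniso_wiener_norm \<eta> p q r s)"
  unfolding schwartz_dense_def
proof (intro conjI ballI allI impI subsetI)
  fix L :: "('a \<times> real) distr" assume "L \<in> distr_of ` schwartz"
  then show "L \<in> aniso_wiener_space \<eta> p q r s"
    using tempered_distr_of aniso_wiener_norm_schwartz_finite[OF _ p r q] by (auto simp: aniso_wiener_space_def)
next
  fix f :: "('a \<times> real) distr" and \<epsilon> :: real assume f: "f \<in> aniso_wiener_space \<eta> p q r s" and e: "\<epsilon> > 0"
  have ft: "f \<in> tempered" and fin: "aniso_wiener_norm \<eta> p q r s f < \<infinity>" using f by (auto simp: aniso_wiener_space_def)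
  have "\<forall>\<^sub>F n in sequentially. aniso_wiener_norm \<eta> p q r s (distr_diff f (distr_of (approximant n f))) < ennreal \<epsilon>"
    using e by (intro order_tendstoD(2)[OF schwartz_approximation[OF ft p r q fin]]) simp
  then obtain n where "aniso_wiener_norm \<eta> p q r s (distr_diff f (distr_of (approximant n f))) < ennreal \<epsilon>"
    using eventually_happens'[OF sequentially_bot] by blast
  then show "\<exists>g\<in>schwartz. aniso_wiener_norm \<eta> p q r s (distr_diff f (distr_of g)) < ennreal \<epsilon>"
    using schwartz_approximant[OF ft] by blast
qed

theorem trace_retraction_wiener_space:
  assumes p: "0 < p" and q: "0 < q"
  shows "trace_retraction
    (aniso_wiener_space \<eta> p q (min 1 q) s :: ('a::euclidean_space \<times> real) distr set) (aniso_wiener_norm \<eta> p q (min 1 q) s)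
    (wiener_space \<eta> p q s) (wiener_norm \<eta> p q s)"
proof -
  let ?r = "min 1 q"
  let ?X = "aniso_wiener_space \<eta> p q ?r s :: ('a \<times> real) distr set" and ?Y = "wiener_space \<eta> p q s :: 'a distr set"
  let ?NX = "aniso_wiener_norm \<eta> p q ?r s :: ('a \<times> real) distr \<Rightarrow> ennreal" and ?NY = "wiener_norm \<eta> p q s :: 'a distr \<Rightarrow> ennreal"
  have r: "0 < ?r" "?r \<le> 1" using q by auto
  note dense = schwartz_dense_aniso_wiener_space[OF p q r(1), where 'a='a and s=s]
  obtain C where C: "C > 0" "\<And>f. f \<in> ?X \<Longrightarrow> ?NY (trace_op f) \<le> ennreal C * ?NX f"
    using trace_op_bounded[OF p q, where 'a='a and s=s] by blast
  have T: "continuous_linear_op ?X ?NX ?Y ?NY trace_op"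
  proof (rule continuous_linear_opI[where C=C])
    fix f assume f: "f \<in> ?X"
    show "?NY (trace_op f) \<le> ennreal C * ?NX f" by (rule C(2)[OF f])
    also have "\<dots> < \<infinity>" using f by (simp add: aniso_wiener_space_def ennreal_mult_less_top)
    finally have "?NY (trace_op f) < \<infinity>" .
    moreover have "trace_op f \<in> tempered"
      using f by (intro tempered_trace_op[OF _ _ p r q]) (auto simp: aniso_wiener_space_def)
    ultimately show "trace_op f \<in> ?Y" by (simp add: wiener_space_def)
  next
    fix f g a b assume "f \<in> ?X" "g \<in> ?X"
    then show "trace_op (distr_comb a f b g) = distr_comb a (trace_op f) b (trace_op g)"
      by (rule trace_op_distr_comb[OF _ _ p r q])
  next
    fix f g assume "f \<in> ?X" "g \<in> ?X" "?NX (distr_diff f g) < top"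
    then show "distr_diff f g \<in> ?X" by (simp add: aniso_wiener_space_def tempered_distr_diff)
  qed (rule C(1))
  define E where "E = wiener_norm \<eta> p ?r 0 (distr_of (chi :: real \<Rightarrow> complex))"
  have "E < top" unfolding E_def by (rule wiener_norm_schwartz_finite[OF schwartz_chi p r(1)])
  then obtain e where e: "E = ennreal e" "e \<ge> 0" by (cases E) auto
  have NR: "?NX (extension_op g) = ennreal e * ?NY g" if "g \<in> ?Y" for g
    using aniso_wiener_norm_extension_op[OF _ r(1) q, of g p s] that e by (simp add: wiener_space_def E_def mult.commute)
  have R: "continuous_linear_op ?Y ?NY ?X ?NX extension_op"
  proof (rule continuous_linear_opI[where C="e + 1"])
    fix g assume g: "g \<in> ?Y"
    then show "extension_op g \<in> ?X"
      using NR[OF g] by (auto simp: aniso_wiener_space_def wiener_space_def ennreal_mult_less_top intro: tempered_extension_op)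
    show "?NX (extension_op g) \<le> ennreal (e + 1) * ?NY g"
      unfolding NR[OF g] by (intro mult_right_mono ennreal_leI) auto
  next
    fix f g assume "f \<in> ?Y" "g \<in> ?Y" "?NY (distr_diff f g) < top"
    then show "distr_diff f g \<in> ?Y" by (simp add: wiener_space_def tempered_distr_diff)
  qed (use e in \<open>simp_all add: extension_op_distr_comb\<close>)
  have TR: "\<forall>g\<in>?Y. trace_op (extension_op g) = g" by (auto simp: wiener_space_def trace_op_extension_op)
  have Ts: "\<forall>f\<in>schwartz. trace_op (distr_of f) = distr_of (trace_fun f)" by (simp add: trace_op_distr_of)
  have bound: "\<forall>f\<in>schwartz. ?NY (distr_of (trace_fun f)) \<le> ennreal C * ?NX (distr_of f)"
  proof
    fix f :: "'a \<times> real \<Rightarrow> complex" assume f: "f \<in> schwartz"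
    have "distr_of f \<in> ?X" using dense f by (auto simp: schwartz_dense_def)
    from C(2)[OF this] show "?NY (distr_of (trace_fun f)) \<le> ennreal C * ?NX (distr_of f)"
      by (simp add: trace_op_distr_of[OF f])
  qed
  show ?thesis unfolding trace_retraction_def using dense C(1) bound T Ts R TR by blast
qed

end

theorem theorem1p1:
  fixes \<eta> :: "real \<Rightarrow> real" and p q s :: real
  assumes "smooth \<eta>"
    and "\<And>\<xi>. 0 \<le> \<eta> \<xi> \<and> \<eta> \<xi> \<le> 1"
    and "\<And>\<xi>. \<bar>\<xi>\<bar> \<le> 1 \<Longrightarrow> \<eta> \<xi> = 1"
    and "\<And>\<xi>. \<bar>\<xi>\<bar> \<ge> 2 \<Longrightarrow> \<eta> \<xi> = 0"
    and "0 < p" and "0 < q"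
  shows "trace_retraction
    (aniso_wiener_space \<eta> p q (min 1 q) s :: ((real ^ 'm::finite) \<times> real) distr set)
    (aniso_wiener_norm \<eta> p q (min 1 q) s)
    (wiener_space \<eta> p q s :: (real ^ 'm) distr set)
    (wiener_norm \<eta> p q s)"
proof -
  interpret cutoff_function \<eta> by (rule cutoff_function.intro) (fact assms)+
  show ?thesis by (rule trace_retraction_wiener_space[OF assms(5,6)])
qed

end
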